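(* Let $D\subset\mathbb C^2$ be a $C^2$-smooth, strongly convex Reinhardt domain and let $\mu$ be any rotation-invariant continuous positive multiple of surface measure on $bD$. Then the operator $\mathbb A_\mu=\mathbb L_\mu^*-\mathbb L$ ($\mathbb L_\mu^*$ the adjoint of the Leray transform $\mathbb L$ in $L^2(bD,\mu)$) is compact in $L^2(bD,\mu)$ if and only if $D$ is a domain of the form $$\{(z_1,z_2): a_1|z_1|^2+a_2|z_2|^2<1\}$$ with $a_1,a_2>0$.
   Context: $D\subset\mathbb C^2$ is Reinhardt if it is invariant under all rotations $(z_1,z_2)\mapsto(e^{i\theta_1}z_1,e^{i\theta_2}z_2)$. $bD$ is the boundary. A domain $D$ as in the claim has the form $D=\{|z_1|<b_1,\ |z_2|<\phi(|z_1|)\}$ with $b_1>0$ and $\phi$ continuous on $[0,b_1]$, $\phi(b_1)=0$, $\phi$ of class $C^2$ on $(0,b_1)$ with $\phi'<0$, $\phi''<0$ there. On $bD$ write $\zeta_j=r_je^{i\theta_j}$, $r_j=|\zeta_j|$. Where $\zeta_1\zeta_2\neq0$ set $s=\frac{-r_1\phi'(r_1)}{\phi(r_1)-r_1\phi'(r_1)}$. The function $s$ is a strictly increasing function of $r_1$ with range $(0,1)$; $(s,\theta_1,\theta_2)\in(0,1)\times[0,2\pi)^2$ are coordinates on $bD\setminus\{\zeta_1\zeta_2=0\}$ and $r_1,r_2$ are functions of $s$. Leray transform: for $w\in D$, $\mathbb Lf(w)=\int_{\zeta\in bD}f(\zeta)L(\zeta,w)$, where $$L(\zeta,w)=\frac1{(2\pi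 i)^2}\frac{j^*(\partial\rho\wedge\bar\partial\partial\rho)(\zeta)}{\left[\frac{\partial\rho}{\partial\zeta_1}(\zeta)(\zeta_1-w_1)+\frac{\partial\rho}{\partial\zeta_2}(\zeta)(\zeta_2-w_2)\right]^2},$$ $\rho$ is any defining function of $bD$ (the kernel does not depend on the choice) and $j:bD\to\mathbb C^2$ is the inclusion. In coordinates, $$L(\zeta,w)=\frac{ds\wedge d\theta_1\wedge d\theta_2}{4\pi^2\left(1-e^{-i\theta_1}\frac s{r_1}w_1-e^{-i\theta_2}\frac{1-s}{r_2}w_2\right)^2},$$ with $bD$ oriented so that $ds\wedge d\theta_1\wedge d\theta_2>0$. Operator on $L^2$: an $(n,m)$-monomial ($n,m\in\mathbb Z$) is a function on $bD$ of the form $g(s)e^{i(n\theta_1+m\theta_2)}$. For $\mu$ as in the claim and an $(n,m)$-monomial $f\in L^2(bD,\mu)$, $\mathbb Lf$ is a constant multiple of $w_1^nw_2^m$ (and is $0$ if $\min\{n,m\}<0$), hence extends continuously to $\overline D$; its boundary values are denoted $\mathbb L_{n,m}f$. Writing $f\in L^2(bD,\mu)$ as the orthogonal sum $\sum_{n,m\in\mathbb Z} f_{n,m}$ of $(n,m)$-monomials, $\mathbb Lf=\sum_{n,m\ge0}\mathbb L_{n,m}f_{n,m}$; under the hypotheses of the claim this is a bounded operator on $L^2(bD,\mu)$. "$\mu$ is a rotation-invariant continuous positive multiple of surface measure" means $d\mu=h\,d\sigma$ with $d\sigma$ surface measure and $h$ a continuous positive rotation-invariant function on $bD$. *)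

theory Defs
  imports "HOL-Analysis.Analysis"
begin

section \<open>Strongly convex Reinhardt domains in complex two-space\<close>

type_synonym C2 = "complex \<times> complex"

definition rot :: "real \<Rightarrow> real \<Rightarrow> C2 \<Rightarrow> C2" where
  "rot \<alpha> \<beta> z = (cis \<alpha> * fst z, cis \<beta> * snd z)"

definition Reinhardt :: "C2 set \<Rightarrow> bool" where
  "Reinhardt D \<longleftrightarrow> (\<forall>\<alpha> \<beta>. rot \<alpha> \<beta> ` D = D)"

definition C2_smooth_on :: "C2 set \<Rightarrow> (C2 \<Rightarrow> real) \<Rightarrow> bool" where
  "C2_smooth_on U \<rho> \<longleftrightarrow>
     (\<exists>(\<rho>' :: C2 \<Rightarrow> (C2 \<Rightarrow>\<^sub>L real)) (\<rho>'' :: C2 \<Rightarrow> (C2 \<Rightarrow>\<^sub>L (C2 \<Rightarrow>\<^sub>L real))).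
        (\<forall>z\<in>U. (\<rho> has_derivative blinfun_apply (\<rho>' z)) (at z)) \<and>
        (\<forall>z\<in>U. (\<rho>' has_derivative blinfun_apply (\<rho>'' z)) (at z)) \<and>
        continuous_on U \<rho>'')"

definition C2_defining_function :: "C2 set \<Rightarrow> (C2 \<Rightarrow> real) \<Rightarrow> bool" where
  "C2_defining_function D \<rho> \<longleftrightarrow>
     (\<exists>U. open U \<and> frontier D \<subseteq> U \<and> C2_smooth_on U \<rho> \<and> D \<inter> U = {z \<in> U. \<rho> z < 0}) \<and>
     (\<forall>z\<in>frontier D. \<exists>v. frechet_derivative \<rho> (at z) v \<noteq> 0)"

text \<open>The real Hessian of a defining function is positive definite on the real tangent
  spaces of the boundary; for a given domain this does not depend on the defining function.\<close>

definition strongly_convex :: "C2 set \<Rightarrow> (C2 \<Rightarrow> real) \<Rightarrow> bool" where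
  "strongly_convex D \<rho> \<longleftrightarrow> convex D \<and>
     (\<forall>z\<in>frontier D. \<forall>v. v \<noteq> 0 \<and> frechet_derivative \<rho> (at z) v = 0 \<longrightarrow>
        frechet_derivative (\<lambda>x. frechet_derivative \<rho> (at x) v) (at z) v > 0)"

definition smooth_strongly_convex_Reinhardt_domain :: "C2 set \<Rightarrow> (C2 \<Rightarrow> real) \<Rightarrow> bool" where
  "smooth_strongly_convex_Reinhardt_domain D \<rho> \<longleftrightarrow>
     open D \<and> connected D \<and> D \<noteq> {} \<and> bounded D \<and> Reinhardt D \<and>
     C2_defining_function D \<rho> \<and> strongly_convex D \<rho>"


section \<open>Polar coordinates and surface measure on the boundary\<close>

text \<open>These recover \<open>b\<^sub>1\<close> and (on the open interval from 0 to \<open>b\<^sub>1\<close>) the function \<open>\<phi>\<close> from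
  \<open>D = {|z\<^sub>1| < b\<^sub>1, |z\<^sub>2| < \<phi>(|z\<^sub>1|)}\<close>.\<close>

definition outer_radius :: "C2 set \<Rightarrow> real" where
  "outer_radius D = Sup {cmod (fst z) |z. z \<in> D}"

definition profile :: "C2 set \<Rightarrow> real \<Rightarrow> real" where
  "profile D r = Sup {cmod (snd z) |z. z \<in> D \<and> cmod (fst z) = r}"

text \<open>The chart is a bijection from the box onto the boundary minus the two circles
  \<open>\<zeta>\<^sub>1 \<zeta>\<^sub>2 = 0\<close>, which are null sets.  The coordinate \<open>s\<close> is a strictly increasing function of
  \<open>r\<^sub>1\<close>, so \<open>(r\<^sub>1, \<theta>\<^sub>1, \<theta>\<^sub>2)\<close> and \<open>(s, \<theta>\<^sub>1, \<theta>\<^sub>2)\<close> define the same orientation.\<close>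

definition polar_box :: "C2 set \<Rightarrow> (real \<times> real \<times> real) set" where
  "polar_box D = {0<..<outer_radius D} \<times> {0..<2 * pi} \<times> {0..<2 * pi}"

definition polar_chart :: "C2 set \<Rightarrow> real \<times> real \<times> real \<Rightarrow> C2" where
  "polar_chart D = (\<lambda>(r, \<theta>\<^sub>1, \<theta>\<^sub>2).
     (complex_of_real r * cis \<theta>\<^sub>1, complex_of_real (profile D r) * cis \<theta>\<^sub>2))"

definition chart_tangent :: "C2 set \<Rightarrow> real \<times> real \<times> real \<Rightarrow> real \<times> real \<times> real \<Rightarrow> C2" where
  "chart_tangent D p = frechet_derivative (polar_chart D) (at p)"

definition gram_det :: "C2 set \<Rightarrow> real \<times> real \<times> real \<Rightarrow> real" where
  "gram_det D p =
     (let T = (vector [chart_tangent D p (1, 0, 0), chart_tangent D p (0, 1, 0),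
                       chart_tangent D p (0, 0, 1)] :: C2 ^ 3)
      in det (\<chi> i j. T $ i \<bullet> T $ j))"

definition surface_measure :: "C2 set \<Rightarrow> C2 measure" where
  "surface_measure D =
     distr (density (restrict_space lborel (polar_box D)) (\<lambda>p. ennreal (sqrt (gram_det D p))))
           (restrict_space borel (frontier D)) (polar_chart D)"

definition invariant_surface_multiple :: "C2 set \<Rightarrow> C2 measure \<Rightarrow> bool" where
  "invariant_surface_multiple D \<mu> \<longleftrightarrow>
     (\<exists>h :: C2 \<Rightarrow> real. continuous_on (frontier D) h \<and>
        (\<forall>\<zeta>\<in>frontier D. h \<zeta> > 0 \<and> (\<forall>\<alpha> \<beta>. h (rot \<alpha> \<beta> \<zeta>) = h \<zeta>)) \<and>
        \<mu> = density (surface_measure D) (\<lambda>\<zeta>. ennreal (h \<zeta>)))"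


section \<open>Operators on L2\<close>

text \<open>Elements of \<open>L\<^sup>2\<close> are represented by functions; an operator acts on representatives, and
  its values matter only up to equality almost everywhere.\<close>

definition L2 :: "'a measure \<Rightarrow> ('a \<Rightarrow> complex) set" where
  "L2 M = {f. f \<in> borel_measurable M \<and> integrable M (\<lambda>x. (cmod (f x))\<^sup>2)}"

definition L2_inner :: "'a measure \<Rightarrow> ('a \<Rightarrow> complex) \<Rightarrow> ('a \<Rightarrow> complex) \<Rightarrow> complex" where
  "L2_inner M f g = (LINT x|M. f x * cnj (g x))"

definition L2_norm :: "'a measure \<Rightarrow> ('a \<Rightarrow> complex) \<Rightarrow> real" where
  "L2_norm M f = sqrt (LINT x|M. (cmod (f x))\<^sup>2)"

definition has_L2_sum ::
  "'a measure \<Rightarrow> ('i \<Rightarrow> 'a \<Rightarrow> complex) \<Rightarrow> 'i set \<Rightarrow> ('a \<Rightarrow> complex) \<Rightarrow> bool" where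
  "has_L2_sum M F I f \<longleftrightarrow> f \<in> L2 M \<and> (\<forall>i\<in>I. F i \<in> L2 M) \<and>
     ((\<lambda>J. L2_norm M (\<lambda>x. f x - (\<Sum>i\<in>J. F i x))) \<longlongrightarrow> 0) (finite_subsets_at_top I)"

definition L2_adjoint ::
  "'a measure \<Rightarrow> (('a \<Rightarrow> complex) \<Rightarrow> ('a \<Rightarrow> complex)) \<Rightarrow> ('a \<Rightarrow> complex) \<Rightarrow> ('a \<Rightarrow> complex)" where
  "L2_adjoint M T g =
     (SOME k. k \<in> L2 M \<and> (\<forall>f\<in>L2 M. L2_inner M (T f) g = L2_inner M f k))"

definition L2_compact_operator ::
  "'a measure \<Rightarrow> (('a \<Rightarrow> complex) \<Rightarrow> ('a \<Rightarrow> complex)) \<Rightarrow> bool" where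
  "L2_compact_operator M T \<longleftrightarrow> (\<forall>f\<in>L2 M. T f \<in> L2 M) \<and>
     (\<forall>f :: nat \<Rightarrow> 'a \<Rightarrow> complex.
        (\<forall>n. f n \<in> L2 M) \<and> (\<exists>C. \<forall>n. L2_norm M (f n) \<le> C) \<longrightarrow>
        (\<exists>g\<in>L2 M. \<exists>k :: nat \<Rightarrow> nat. strict_mono k \<and>
           (\<lambda>n. L2_norm M (\<lambda>x. T (f (k n)) x - g x)) \<longlonglongrightarrow> 0))"


section \<open>The Leray transform\<close>

text \<open>\<open>del F z\<close> and \<open>delbar F z\<close> are the values at \<open>z\<close> of the one-forms
  \<open>\<partial>F = \<Sum>\<^sub>j (\<partial>F/\<partial>\<zeta>\<^sub>j) d\<zeta>\<^sub>j\<close> and of its conjugate counterpart, the complex linear and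
  antilinear parts of the real differential.\<close>

definition del :: "(C2 \<Rightarrow> complex) \<Rightarrow> C2 \<Rightarrow> C2 \<Rightarrow> complex" where
  "del F z v = (frechet_derivative F (at z) v
      - \<i> * frechet_derivative F (at z) (\<i> * fst v, \<i> * snd v)) / 2"

definition delbar :: "(C2 \<Rightarrow> complex) \<Rightarrow> C2 \<Rightarrow> C2 \<Rightarrow> complex" where
  "delbar F z v = (frechet_derivative F (at z) v
      + \<i> * frechet_derivative F (at z) (\<i> * fst v, \<i> * snd v)) / 2"

definition wirtinger1 :: "(C2 \<Rightarrow> real) \<Rightarrow> C2 \<Rightarrow> complex" where
  "wirtinger1 \<rho> z = del (\<lambda>x. complex_of_real (\<rho> x)) z (1, 0)"

definition wirtinger2 :: "(C2 \<Rightarrow> real) \<Rightarrow> C2 \<Rightarrow> complex" where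
  "wirtinger2 \<rho> z = del (\<lambda>x. complex_of_real (\<rho> x)) z (0, 1)"

text \<open>The two-form applying \<open>delbar\<close> to \<open>\<partial>\<rho> = \<rho>\<^sub>1 d\<zeta>\<^sub>1 + \<rho>\<^sub>2 d\<zeta>\<^sub>2\<close>, that is
  \<open>\<Sum>\<^sub>j (delbar \<rho>\<^sub>j) \<and> d\<zeta>\<^sub>j\<close>, with the convention
  \<open>(a \<and> b)(u, v) = a(u) b(v) - a(v) b(u)\<close>.\<close>

definition delbar_del :: "(C2 \<Rightarrow> real) \<Rightarrow> C2 \<Rightarrow> C2 \<Rightarrow> C2 \<Rightarrow> complex" where
  "delbar_del \<rho> z u v =
      (delbar (wirtinger1 \<rho>) z u * fst v - delbar (wirtinger1 \<rho>) z v * fst u)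
    + (delbar (wirtinger2 \<rho>) z u * snd v - delbar (wirtinger2 \<rho>) z v * snd u)"

text \<open>Wedge product of the one-form \<open>\<partial>\<rho>\<close> with the above two-form.\<close>

definition leray_form :: "(C2 \<Rightarrow> real) \<Rightarrow> C2 \<Rightarrow> C2 \<Rightarrow> C2 \<Rightarrow> C2 \<Rightarrow> complex" where
  "leray_form \<rho> z u v w =
     (let \<alpha> = del (\<lambda>x. complex_of_real (\<rho> x)) z
      in \<alpha> u * delbar_del \<rho> z v w - \<alpha> v * delbar_del \<rho> z u w + \<alpha> w * delbar_del \<rho> z u v)"

text \<open>The density of the pullback of \<open>L(\<zeta>, w)\<close> with respect to \<open>dr\<^sub>1 \<and> d\<theta>\<^sub>1 \<and> d\<theta>\<^sub>2\<close>.\<close>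

definition leray_kernel ::
  "C2 set \<Rightarrow> (C2 \<Rightarrow> real) \<Rightarrow> real \<times> real \<times> real \<Rightarrow> C2 \<Rightarrow> complex" where
  "leray_kernel D \<rho> p w =
     (let \<zeta> = polar_chart D p in
      1 / (2 * complex_of_real pi * \<i>)\<^sup>2 *
      (leray_form \<rho> \<zeta> (chart_tangent D p (1, 0, 0)) (chart_tangent D p (0, 1, 0))
                      (chart_tangent D p (0, 0, 1)) /
       (wirtinger1 \<rho> \<zeta> * (fst \<zeta> - fst w) + wirtinger2 \<rho> \<zeta> * (snd \<zeta> - snd w))\<^sup>2))"

definition leray_integral ::
  "C2 set \<Rightarrow> (C2 \<Rightarrow> real) \<Rightarrow> (C2 \<Rightarrow> complex) \<Rightarrow> C2 \<Rightarrow> complex" where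
  "leray_integral D \<rho> f w =
     (LINT p:polar_box D|lborel. f (polar_chart D p) * leray_kernel D \<rho> p w)"

definition leray_boundary_value ::
  "C2 set \<Rightarrow> (C2 \<Rightarrow> real) \<Rightarrow> (C2 \<Rightarrow> complex) \<Rightarrow> C2 \<Rightarrow> complex" where
  "leray_boundary_value D \<rho> f z = Lim (at z within D) (leray_integral D \<rho> f)"

text \<open>A function of \<open>s\<close> is the same thing as a function of \<open>r\<^sub>1\<close>.  The values on the null set
  \<open>\<zeta>\<^sub>1 \<zeta>\<^sub>2 = 0\<close> are immaterial.\<close>

definition monomial :: "C2 set \<Rightarrow> int \<Rightarrow> int \<Rightarrow> (C2 \<Rightarrow> complex) \<Rightarrow> bool" where
  "monomial D n m f \<longleftrightarrow>
     (\<exists>g :: real \<Rightarrow> complex. \<forall>r \<theta>\<^sub>1 \<theta>\<^sub>2. 0 < r \<and> r < outer_radius D \<longrightarrow>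
        f (polar_chart D (r, \<theta>\<^sub>1, \<theta>\<^sub>2)) = g r * cis (of_int n * \<theta>\<^sub>1 + of_int m * \<theta>\<^sub>2))"

text \<open>Monomials of different degrees are orthogonal for a rotation-invariant \<open>\<mu>\<close>, so the
  family \<open>F\<close> is determined by \<open>f\<close> almost everywhere, and hence so is the sum of the images.\<close>

definition leray_op ::
  "C2 set \<Rightarrow> (C2 \<Rightarrow> real) \<Rightarrow> C2 measure \<Rightarrow> (C2 \<Rightarrow> complex) \<Rightarrow> (C2 \<Rightarrow> complex)" where
  "leray_op D \<rho> \<mu> f =
     (SOME g. \<exists>F :: int \<times> int \<Rightarrow> C2 \<Rightarrow> complex.
        (\<forall>n m. monomial D n m (F (n, m))) \<and>
        has_L2_sum \<mu> F UNIV f \<and>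
        has_L2_sum \<mu> (\<lambda>k. leray_boundary_value D \<rho> (F k)) ({0..} \<times> {0..}) g)"

definition leray_antisymmetric_part ::
  "C2 set \<Rightarrow> (C2 \<Rightarrow> real) \<Rightarrow> C2 measure \<Rightarrow> (C2 \<Rightarrow> complex) \<Rightarrow> (C2 \<Rightarrow> complex)" where
  "leray_antisymmetric_part D \<rho> \<mu> f =
     (\<lambda>\<zeta>. L2_adjoint \<mu> (leray_op D \<rho> \<mu>) f \<zeta> - leray_op D \<rho> \<mu> f \<zeta>)"

end

theory Submission
  imports Defs "HOL-Library.Diagonal_Subsequence"
begin

text \<open>By rotation invariance the Leray transform is an orthogonal sum of the rank-one operators
  \<open>f \<mapsto> \<langle>f, e + d\<rangle> e\<close>, where \<open>e\<close> is the normalized monomial \<open>z\<^sub>1\<^sup>n z\<^sub>2\<^sup>m\<close> and \<open>d\<close> is a monomial of the same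
  degree orthogonal to it. The antisymmetric part is therefore compact if and only if the norms of the \<open>d\<close>
  tend to 0. With \<open>\<sigma>\<close> for the coordinate \<open>s\<close>, the number \<open>\<kappa> = 1 + \<parallel>d\<parallel>\<^sup>2\<close> measures the defect in the
  Cauchy--Schwarz inequality for \<open>r\<^sup>n \<phi>\<^sup>m W\<^sup>1\<^sup>/\<^sup>2\<close> and \<open>v W\<^sup>-\<^sup>1\<^sup>/\<^sup>2\<close>, two functions of \<open>r\<close> whose product is
  the beta weight \<open>\<sigma>\<^sup>n (1 - \<sigma>)\<^sup>m \<sigma>'\<close>. Along the degrees \<open>(k p, k q)\<close> both concentrate like Gaussians where
  \<open>\<sigma> = p / (p + q)\<close>, and \<open>\<kappa>\<close> tends to 1 only if their widths agree to first order, which means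
  \<open>r \<sigma>' = 2 \<sigma>\<close> at that point. By density this equation holds everywhere; it integrates to
  \<open>\<sigma> = r\<^sup>2 / b\<^sup>2\<close> and then to the equation of an ellipsoid. Conversely, on an ellipsoid the quotient of
  the two functions is a constant times a fixed continuous function of \<open>\<sigma>\<close>, and the concentration of the
  beta weights gives \<open>\<kappa> \<longlongrightarrow> 1\<close>.\<close>

subsection \<open>Square-integrable functions\<close>

text \<open>The operator and its adjoint are given by choice, so they have values even where the
  defining series diverges or no adjoint vector exists. The argument therefore never starts from
  boundedness. In the converse direction boundedness follows from the bound on the norms of the
  \<open>d\<close>; in the direct one, divergence at a single function would make the adjoint take
  the same value c at every \<open>e\<close>, and c - \<open>e\<close> has no convergent
  subsequence. The lower bound for \<open>\<kappa>\<close> rests on positivity of the defect. Two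
  intervals of length 1 / sqrt k near the concentration point suffice, if each carries a fixed share
  of the beta mass and the quotient of the two weights differs between them by a fixed factor. The
  logarithm of that quotient is essentially k times a function with a critical point there, hence
  changes by an amount of order k (1 / sqrt k)^2 = 1. The slope of \<phi> may be infinite at the
  outer radius. So the calculus takes place on the open interval, and the slope enters integrals
  through the antiderivatives - \<phi> and \<sigma> or inside bounded combinations.\<close>

lemma L2_measurable: "f \<in> L2 M \<Longrightarrow> f \<in> borel_measurable M"
  by (simp add: L2_def)

lemma L2_integrable_square: "f \<in> L2 M \<Longrightarrow> integrable M (\<lambda>x. (cmod (f x))\<^sup>2)"
  by (simp add: L2_def)

lemma L2_I:
  "f \<in> borel_measurable M \<Longrightarrow> integrable M (\<lambda>x. (cmod (f x))\<^sup>2) \<Longrightarrow> f \<in> L2 M"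
  by (simp add: L2_def)

lemma L2_cong: "(\<And>x. x \<in> space M \<Longrightarrow> f x = g x) \<Longrightarrow> f \<in> L2 M \<longleftrightarrow> g \<in> L2 M"
  unfolding L2_def using measurable_cong[of M f g borel]
  by (auto cong: Bochner_Integration.integrable_cong)

lemma L2_norm_cong: "(\<And>x. x \<in> space M \<Longrightarrow> f x = g x) \<Longrightarrow> L2_norm M f = L2_norm M g"
  unfolding L2_norm_def by (metis (mono_tags, lifting) Bochner_Integration.integral_cong)

lemma L2_mult_integrable:
  assumes "f \<in> L2 M" "g \<in> L2 M"
  shows "integrable M (\<lambda>x. f x * g x)"
proof (rule Bochner_Integration.integrable_bound)
  show "integrable M (\<lambda>x. (cmod (f x))\<^sup>2 + (cmod (g x))\<^sup>2)"
    using assms by (simp add: L2_def)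
  show "(\<lambda>x. f x * g x) \<in> borel_measurable M"
    using assms by (auto simp: L2_def)
  have "cmod (f x * g x) \<le> (cmod (f x))\<^sup>2 + (cmod (g x))\<^sup>2" for x
  proof -
    have "0 \<le> (cmod (f x) - cmod (g x))\<^sup>2 + (cmod (f x))\<^sup>2 + (cmod (g x))\<^sup>2" by simp
    then show ?thesis by (simp add: norm_mult power2_diff algebra_simps)
  qed
  then show "AE x in M. norm (f x * g x) \<le> norm ((cmod (f x))\<^sup>2 + (cmod (g x))\<^sup>2)"
    by auto
qed

lemma L2_cnj: "f \<in> L2 M \<Longrightarrow> (\<lambda>x. cnj (f x)) \<in> L2 M"
  unfolding L2_def
  by (auto intro!: borel_measurable_continuous_onI continuous_intros measurable_compose[of f M borel cnj])

lemma L2_inner_integrable: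
  "f \<in> L2 M \<Longrightarrow> g \<in> L2 M \<Longrightarrow> integrable M (\<lambda>x. f x * cnj (g x))"
  by (rule L2_mult_integrable[OF _ L2_cnj])

lemma L2_zero [simp]: "(\<lambda>x. 0) \<in> L2 M"
  by (simp add: L2_def)

lemma L2_cmult: "f \<in> L2 M \<Longrightarrow> (\<lambda>x. c * f x) \<in> L2 M"
  by (auto simp: L2_def norm_mult power_mult_distrib)

lemma L2_add:
  assumes "f \<in> L2 M" "g \<in> L2 M"
  shows "(\<lambda>x. f x + g x) \<in> L2 M"
proof (rule L2_I)
  show "(\<lambda>x. f x + g x) \<in> borel_measurable M" using assms by (auto simp: L2_def)
  show "integrable M (\<lambda>x. (cmod (f x + g x))\<^sup>2)"
  proof (rule Bochner_Integration.integrable_bound)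
    show "integrable M (\<lambda>x. 2 * (cmod (f x))\<^sup>2 + 2 * (cmod (g x))\<^sup>2)"
      using assms by (simp add: L2_def)
    show "(\<lambda>x. (cmod (f x + g x))\<^sup>2) \<in> borel_measurable M"
      using assms by (auto simp: L2_def)
    have "(cmod (f x + g x))\<^sup>2 \<le> 2 * (cmod (f x))\<^sup>2 + 2 * (cmod (g x))\<^sup>2" for x
    proof -
      have "(cmod (f x + g x))\<^sup>2 \<le> (cmod (f x) + cmod (g x))\<^sup>2"
        by (intro power_mono norm_triangle_ineq) simp
      also have "\<dots> \<le> 2 * (cmod (f x))\<^sup>2 + 2 * (cmod (g x))\<^sup>2"
        using sum_squares_bound[of "cmod (f x)" "cmod (g x)"]
        unfolding power2_sum by linarith
      finally show ?thesis .
    qed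
    then show "AE x in M. norm ((cmod (f x + g x))\<^sup>2)
        \<le> norm (2 * (cmod (f x))\<^sup>2 + 2 * (cmod (g x))\<^sup>2)"
      by auto
  qed
qed

lemma L2_uminus: "f \<in> L2 M \<Longrightarrow> (\<lambda>x. - f x) \<in> L2 M"
  by (auto simp: L2_def)

lemma L2_diff: "f \<in> L2 M \<Longrightarrow> g \<in> L2 M \<Longrightarrow> (\<lambda>x. f x - g x) \<in> L2 M"
  using L2_add[OF _ L2_uminus, of f M g] by simp

lemma L2_sum: "(\<And>i. i \<in> J \<Longrightarrow> F i \<in> L2 M) \<Longrightarrow> (\<lambda>x. \<Sum>i\<in>J. F i x) \<in> L2 M"
  by (induction J rule: infinite_finite_induct) (auto intro: L2_add)

section \<open>Inner product and norm\<close>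

lemma L2_inner_add_left:
  assumes "f \<in> L2 M" "g \<in> L2 M" "h \<in> L2 M"
  shows "L2_inner M (\<lambda>x. f x + g x) h = L2_inner M f h + L2_inner M g h"
  unfolding L2_inner_def using L2_inner_integrable[OF assms(1,3)] L2_inner_integrable[OF assms(2,3)]
  by (simp add: distrib_right)

lemma L2_inner_cmult_left: "L2_inner M (\<lambda>x. c * f x) h = c * L2_inner M f h"
  unfolding L2_inner_def by (simp add: mult.assoc)

lemma L2_inner_diff_left:
  assumes "f \<in> L2 M" "g \<in> L2 M" "h \<in> L2 M"
  shows "L2_inner M (\<lambda>x. f x - g x) h = L2_inner M f h - L2_inner M g h"
  unfolding L2_inner_def using L2_inner_integrable[OF assms(1,3)] L2_inner_integrable[OF assms(2,3)]
  by (simp add: left_diff_distrib)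

lemma L2_inner_commute: "L2_inner M g f = cnj (L2_inner M f g)"
  unfolding L2_inner_def Bochner_Integration.integral_cnj[symmetric]
  by (rule Bochner_Integration.integral_cong) (simp_all add: mult.commute)

lemma L2_inner_zero_left [simp]: "L2_inner M (\<lambda>x. 0) h = 0"
  by (simp add: L2_inner_def)

lemma L2_inner_sum_left:
  assumes "\<And>i. i \<in> J \<Longrightarrow> F i \<in> L2 M" "h \<in> L2 M"
  shows "L2_inner M (\<lambda>x. \<Sum>i\<in>J. F i x) h = (\<Sum>i\<in>J. L2_inner M (F i) h)"
  using assms(1)
  by (induction J rule: infinite_finite_induct)
    (auto simp: L2_inner_add_left[OF _ L2_sum assms(2)])

lemma L2_inner_add_right:
  assumes "f \<in> L2 M" "g \<in> L2 M" "h \<in> L2 M"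
  shows "L2_inner M h (\<lambda>x. f x + g x) = L2_inner M h f + L2_inner M h g"
  by (simp add: L2_inner_commute[of M h f] L2_inner_commute[of M h g]
      L2_inner_commute[of M h "\<lambda>x. f x + g x"] L2_inner_add_left assms)

lemma L2_inner_diff_right:
  assumes "f \<in> L2 M" "g \<in> L2 M" "h \<in> L2 M"
  shows "L2_inner M h (\<lambda>x. f x - g x) = L2_inner M h f - L2_inner M h g"
  by (simp add: L2_inner_commute[of M h f] L2_inner_commute[of M h g]
      L2_inner_commute[of M h "\<lambda>x. f x - g x"] L2_inner_diff_left assms)

lemma L2_inner_cmult_right: "L2_inner M h (\<lambda>x. c * f x) = cnj c * L2_inner M h f"
  by (simp add: L2_inner_commute[of M h f] L2_inner_commute[of M h "\<lambda>x. c * f x"] L2_inner_cmult_left)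

lemma L2_inner_sum_right:
  assumes "\<And>i. i \<in> J \<Longrightarrow> F i \<in> L2 M" "h \<in> L2 M"
  shows "L2_inner M h (\<lambda>x. \<Sum>i\<in>J. F i x) = (\<Sum>i\<in>J. L2_inner M h (F i))"
  unfolding L2_inner_commute[of M h] using assms by (simp add: L2_inner_sum_left)

lemma L2_norm_nonneg [simp]: "0 \<le> L2_norm M f"
  by (simp add: L2_norm_def)

lemma L2_norm_power2: "(L2_norm M f)\<^sup>2 = (LINT x|M. (cmod (f x))\<^sup>2)"
  by (simp add: L2_norm_def)

lemma L2_inner_self: "L2_inner M f f = complex_of_real ((L2_norm M f)\<^sup>2)"
  unfolding L2_norm_power2 L2_inner_def integral_complex_of_real[symmetric]
  by (rule Bochner_Integration.integral_cong) (simp_all only: complex_norm_square)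

lemma L2_norm_cmult: "L2_norm M (\<lambda>x. c * f x) = cmod c * L2_norm M f"
  by (simp add: L2_norm_def norm_mult power_mult_distrib real_sqrt_mult)

lemma L2_norm_uminus: "L2_norm M (\<lambda>x. - f x) = L2_norm M f"
  by (simp add: L2_norm_def)

lemma L2_norm_diff_commute: "L2_norm M (\<lambda>x. f x - g x) = L2_norm M (\<lambda>x. g x - f x)"
  by (simp add: L2_norm_def norm_minus_commute)

lemma L2_norm_zero [simp]: "L2_norm M (\<lambda>x. 0) = 0"
  by (simp add: L2_norm_def)

text \<open>The discriminant argument, applied to |f| - t |g|. The version with absolute values also
  bounds L1 norms, on which the completeness proof relies.\<close>

lemma L2_Cauchy_Schwarz_abs:
  assumes "f \<in> L2 M" "g \<in> L2 M"
  shows "(LINT x|M. cmod (f x) * cmod (g x)) \<le> L2_norm M f * L2_norm M g"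
proof -
  let ?b = "LINT x|M. cmod (f x) * cmod (g x)"
  have fg: "integrable M (\<lambda>x. cmod (f x) * cmod (g x))"
    using integrable_norm[OF L2_mult_integrable[OF assms]] by (simp add: norm_mult)
  have q: "0 \<le> (L2_norm M f)\<^sup>2 - 2 * t * ?b + t\<^sup>2 * (L2_norm M g)\<^sup>2" for t :: real
  proof -
    have "0 \<le> (LINT x|M. (cmod (f x) - t * cmod (g x))\<^sup>2)" by simp
    also have "(\<lambda>x. (cmod (f x) - t * cmod (g x))\<^sup>2)
      = (\<lambda>x. (cmod (f x))\<^sup>2 - 2 * t * (cmod (f x) * cmod (g x)) + t\<^sup>2 * (cmod (g x))\<^sup>2)"
      by (auto simp: power2_diff power_mult_distrib algebra_simps)
    finally show ?thesis
      using fg L2_integrable_square[OF assms(1)] L2_integrable_square[OF assms(2)]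
      by (simp add: L2_norm_power2)
  qed
  have b0: "0 \<le> ?b" by simp
  have "?b\<^sup>2 \<le> (L2_norm M f)\<^sup>2 * (L2_norm M g)\<^sup>2"
  proof (cases "L2_norm M g = 0")
    case True
    have "?b = 0"
    proof (rule ccontr)
      assume b: "?b \<noteq> 0"
      \<comment> \<open>With \<open>L2_norm M g = 0\<close> the polynomial is affine in
        \<open>t\<close> with slope -2 \<open>?b\<close>, and this choice of \<open>t\<close> makes
        it negative.\<close>
      have "0 \<le> (L2_norm M f)\<^sup>2 - 2 * (((L2_norm M f)\<^sup>2 + 1) / ?b * ?b)"
        using q[of "((L2_norm M f)\<^sup>2 + 1) / ?b"] True by (simp only: mult.assoc) simp
      also have "((L2_norm M f)\<^sup>2 + 1) / ?b * ?b = (L2_norm M f)\<^sup>2 + 1"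
        using b by simp
      finally have "0 \<le> (L2_norm M f)\<^sup>2 - 2 * ((L2_norm M f)\<^sup>2 + 1)" .
      moreover have "\<not> 0 \<le> A - 2 * (A + 1)" if "0 \<le> A" for A :: real using that by simp
      ultimately show False using zero_le_power2 by blast
    qed
    then show ?thesis by simp
  next
    case False
    then have "(L2_norm M g)\<^sup>2 > 0" by simp
    moreover have "b\<^sup>2 \<le> A * c" if "0 \<le> A - 2 * (b / c) * b + (b / c)\<^sup>2 * c" "c > 0" for A b c :: real
      using that by (simp add: field_simps power2_eq_square)
    ultimately show ?thesis using q by blast
  qed
  then show ?thesis
    by (metis L2_norm_nonneg power_mult_distrib mult_nonneg_nonneg power2_le_imp_le)
qed

lemma L2_Cauchy_Schwarz:
  assumes "f \<in> L2 M" "g \<in> L2 M"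
  shows "cmod (L2_inner M f g) \<le> L2_norm M f * L2_norm M g"
proof -
  have "cmod (L2_inner M f g) \<le> (LINT x|M. cmod (f x) * cmod (g x))"
    unfolding L2_inner_def using integral_norm_bound[of M "\<lambda>x. f x * cnj (g x)"]
    by (simp add: norm_mult)
  then show ?thesis using L2_Cauchy_Schwarz_abs[OF assms] by simp
qed

lemma L2_norm_add_power2:
  assumes "f \<in> L2 M" "g \<in> L2 M"
  shows "(L2_norm M (\<lambda>x. f x + g x))\<^sup>2
    = (L2_norm M f)\<^sup>2 + 2 * Re (L2_inner M f g) + (L2_norm M g)\<^sup>2"
proof -
  have "complex_of_real ((L2_norm M (\<lambda>x. f x + g x))\<^sup>2)
      = L2_inner M f f + L2_inner M f g + (L2_inner M g f + L2_inner M g g)"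
    using assms by (simp only: L2_inner_self[symmetric] L2_inner_add_left L2_inner_add_right L2_add)
  then have "Re (complex_of_real ((L2_norm M (\<lambda>x. f x + g x))\<^sup>2))
      = Re (L2_inner M f f + L2_inner M f g + (L2_inner M g f + L2_inner M g g))" by simp
  moreover have "Re (L2_inner M g f) = Re (L2_inner M f g)"
    by (subst L2_inner_commute) simp
  ultimately show ?thesis by (simp add: L2_inner_self)
qed

lemma L2_norm_triangle:
  assumes "f \<in> L2 M" "g \<in> L2 M"
  shows "L2_norm M (\<lambda>x. f x + g x) \<le> L2_norm M f + L2_norm M g"
proof (rule power2_le_imp_le)
  have "Re (L2_inner M f g) \<le> L2_norm M f * L2_norm M g"
    using L2_Cauchy_Schwarz[OF assms] complex_Re_le_cmod order_trans by blast
  then show "(L2_norm M (\<lambda>x. f x + g x))\<^sup>2 \<le> (L2_norm M f + L2_norm M g)\<^sup>2"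
    by (simp add: L2_norm_add_power2[OF assms] power2_sum)
qed simp

lemma L2_norm_triangle_diff:
  assumes "f \<in> L2 M" "g \<in> L2 M" "h \<in> L2 M"
  shows "L2_norm M (\<lambda>x. f x - h x) \<le> L2_norm M (\<lambda>x. f x - g x) + L2_norm M (\<lambda>x. g x - h x)"
  using L2_norm_triangle[OF L2_diff[OF assms(1,2)] L2_diff[OF assms(2,3)]] by simp

lemma L2_norm_triangle_sum:
  assumes "\<And>i. i \<in> J \<Longrightarrow> F i \<in> L2 M"
  shows "L2_norm M (\<lambda>x. \<Sum>i\<in>J. F i x) \<le> (\<Sum>i\<in>J. L2_norm M (F i))"
  using assms
proof (induction J rule: infinite_finite_induct)
  case (insert a J)
  have "L2_norm M (\<lambda>x. F a x + (\<Sum>i\<in>J. F i x)) \<le> L2_norm M (F a) + L2_norm M (\<lambda>x. \<Sum>i\<in>J. F i x)"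
    using insert by (intro L2_norm_triangle L2_sum) auto
  with insert show ?case by (auto intro: order_trans)
qed auto

lemma L2_inner_0_if_norm_0:
  assumes "f \<in> L2 M" "g \<in> L2 M" "L2_norm M f = 0"
  shows "L2_inner M f g = 0"
  using L2_Cauchy_Schwarz[OF assms(1,2)] assms(3) by simp

section \<open>Finite measures and completeness\<close>

lemma L2_I_bounded:
  assumes "finite_measure M" "f \<in> borel_measurable M" "\<And>x. x \<in> space M \<Longrightarrow> cmod (f x) \<le> B"
  shows "f \<in> L2 M"
proof (rule L2_I[OF assms(2)])
  interpret finite_measure M by fact
  have "(cmod (f x))\<^sup>2 \<le> B\<^sup>2" if "x \<in> space M" for x
    using assms(3)[OF that] by (intro power_mono) auto
  then show "integrable M (\<lambda>x. (cmod (f x))\<^sup>2)"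
    using assms(2) by (intro integrable_const_bound[of _ "B\<^sup>2"]) auto
qed

lemma L2_integrable:
  assumes "finite_measure M" "f \<in> L2 M"
  shows "integrable M f"
  using L2_mult_integrable[OF assms(2) L2_I_bounded[OF assms(1), of "\<lambda>x. 1" 1]] by simp

text \<open>The increments are summable in L1, by Cauchy--Schwarz against the constant 1 on a finite
  measure space, so the sequence converges almost everywhere. Fatou's lemma carries the L2 bounds
  over to the limit. The explicit rate is kept because \<open>L2_Riesz_Fischer\<close> uses
  it.\<close>

lemma L2_complete_fast:
  assumes fin: "finite_measure M"
    and f: "\<And>n. f n \<in> L2 M"
    and cau: "\<And>m n. n \<le> m \<Longrightarrow> L2_norm M (\<lambda>x. f m x - f n x) \<le> (1/2)^n"
  obtains g where "g \<in> L2 M" "\<And>n. L2_norm M (\<lambda>x. g x - f n x) \<le> (1/2)^n"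
proof -
  interpret finite_measure M by fact
  define d where "d n x = f (Suc n) x - f n x" for n x
  have d: "d n \<in> L2 M" for n
    unfolding d_def by (intro L2_diff f)
  have [measurable]: "f n \<in> borel_measurable M" for n using f by (rule L2_measurable)
  have [measurable]: "d n \<in> borel_measurable M" for n using d by (rule L2_measurable)
  define c where "c = L2_norm M (\<lambda>x. 1)"
  have dn: "(LINT x|M. cmod (d n x)) \<le> (1/2)^n * c" for n
  proof -
    have "(LINT x|M. cmod (d n x)) \<le> L2_norm M (d n) * c"
      using L2_Cauchy_Schwarz_abs[OF d L2_I_bounded[OF fin, of "\<lambda>x. 1" 1]] unfolding c_def by simp
    also have "\<dots> \<le> (1/2)^n * c"
      using cau[of n "Suc n"] by (intro mult_right_mono) (simp_all add: d_def[abs_def] c_def)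
    finally show ?thesis .
  qed
  have "(\<integral>\<^sup>+x. (\<Sum>n. ennreal (cmod (d n x))) \<partial>M) = (\<Sum>n. \<integral>\<^sup>+x. ennreal (cmod (d n x)) \<partial>M)"
    by (intro nn_integral_suminf) auto
  also have "\<dots> = (\<Sum>n. ennreal (LINT x|M. cmod (d n x)))"
    using L2_integrable[OF fin d] by (subst nn_integral_eq_integral) auto
  also have "\<dots> \<le> (\<Sum>n. ennreal ((1/2)^n * c))"
    by (intro suminf_le allI ennreal_leI dn) auto
  finally have le: "(\<integral>\<^sup>+x. (\<Sum>n. ennreal (cmod (d n x))) \<partial>M) \<le> (\<Sum>n. ennreal ((1/2)^n * c))" .
  have "summable (\<lambda>n. (1/2)^n * c)" by (intro summable_mult2 summable_geometric) auto
  then have "(\<Sum>n. ennreal ((1/2)^n * c)) \<noteq> top"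
    by (rule ennreal_suminf_neq_top) (simp add: c_def)
  with le have "(\<integral>\<^sup>+x. (\<Sum>n. ennreal (cmod (d n x))) \<partial>M) \<noteq> \<infinity>"
    unfolding infinity_ennreal_def by (rule neq_top_trans[rotated])
  then have ae1: "AE x in M. (\<Sum>n. ennreal (cmod (d n x))) \<noteq> \<infinity>"
    by (intro nn_integral_PInf_AE) auto
  define g where "g x = lim (\<lambda>n. f n x)" for x
  have [measurable]: "g \<in> borel_measurable M" unfolding g_def by measurable
  have lim: "AE x in M. (\<lambda>n. f n x) \<longlonglongrightarrow> g x"
    using ae1
  proof eventually_elim
    case (elim x)
    then have "summable (\<lambda>n. cmod (d n x))"
      by (intro summable_suminf_not_top) (auto simp: infinity_ennreal_def)
    then have "summable (\<lambda>n. d n x)" by (rule summable_norm_cancel)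
    then have "convergent (\<lambda>n. f 0 x + (\<Sum>i<n. d i x))"
      by (intro convergent_add convergent_const) (simp add: summable_iff_convergent)
    moreover have "f 0 x + (\<Sum>i<n. d i x) = f n x" for n
      unfolding d_def by (subst sum_lessThan_telescope) simp
    ultimately show ?case by (simp add: g_def convergent_LIMSEQ_iff)
  qed
  have est: "(\<integral>\<^sup>+x. ennreal ((cmod (g x - f n x))\<^sup>2) \<partial>M) \<le> ennreal (((1/2)^n)\<^sup>2)" for n
  proof -
    have "(\<integral>\<^sup>+x. ennreal ((cmod (g x - f n x))\<^sup>2) \<partial>M)
        = (\<integral>\<^sup>+x. liminf (\<lambda>m. ennreal ((cmod (f m x - f n x))\<^sup>2)) \<partial>M)"
    proof (rule nn_integral_cong_AE, use lim in eventually_elim)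
      case (elim x)
      have "(\<lambda>m. ennreal ((cmod (f m x - f n x))\<^sup>2)) \<longlonglongrightarrow> ennreal ((cmod (g x - f n x))\<^sup>2)"
        by (intro tendsto_intros elim)
      from lim_imp_Liminf[OF sequentially_bot this] show ?case by (rule sym)
    qed
    also have "\<dots> \<le> liminf (\<lambda>m. \<integral>\<^sup>+x. ennreal ((cmod (f m x - f n x))\<^sup>2) \<partial>M)"
      by (rule nn_integral_liminf) auto
    also have "\<dots> \<le> ennreal (((1/2)^n)\<^sup>2)"
    proof (rule Liminf_le)
      show "\<forall>\<^sub>F m in sequentially. (\<integral>\<^sup>+x. ennreal ((cmod (f m x - f n x))\<^sup>2) \<partial>M)
          \<le> ennreal (((1/2)^n)\<^sup>2)"
        using eventually_ge_at_top[of n]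
      proof eventually_elim
        case (elim m)
        have "(\<integral>\<^sup>+x. ennreal ((cmod (f m x - f n x))\<^sup>2) \<partial>M)
            = ennreal ((L2_norm M (\<lambda>x. f m x - f n x))\<^sup>2)"
          using L2_integrable_square[OF L2_diff[OF f f]]
          by (subst nn_integral_eq_integral) (auto simp: L2_norm_power2)
        also have "\<dots> \<le> ennreal (((1/2)^n)\<^sup>2)"
          by (intro ennreal_leI power_mono cau elim) simp
        finally show ?case .
      qed
    qed simp
    finally show ?thesis .
  qed
  have gd: "(\<lambda>x. g x - f n x) \<in> L2 M" for n
  proof (rule L2_I)
    show "integrable M (\<lambda>x. (cmod (g x - f n x))\<^sup>2)"
      using est[of n] by (intro integrableI_bounded) (auto simp: less_top intro: le_less_trans)
  qed measurable
  have "g \<in> L2 M" using L2_add[OF gd[of 0] f[of 0]] by simp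
  moreover have "L2_norm M (\<lambda>x. g x - f n x) \<le> (1/2)^n" for n
  proof (rule power2_le_imp_le)
    have "ennreal ((L2_norm M (\<lambda>x. g x - f n x))\<^sup>2) \<le> ennreal (((1/2)^n)\<^sup>2)"
      using est[of n] L2_integrable_square[OF gd]
      by (subst (asm) nn_integral_eq_integral) (auto simp: L2_norm_power2)
    then show "(L2_norm M (\<lambda>x. g x - f n x))\<^sup>2 \<le> ((1/2)^n)\<^sup>2" by simp
  qed simp
  ultimately show ?thesis by (rule that)
qed

lemma L2_complete:
  assumes fin: "finite_measure M"
    and f: "\<And>n. f n \<in> L2 M"
    and cau: "\<And>\<epsilon>. \<epsilon> > 0 \<Longrightarrow> \<exists>N. \<forall>m\<ge>N. \<forall>n\<ge>N. L2_norm M (\<lambda>x. f m x - f n x) < \<epsilon>"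
  obtains g where "g \<in> L2 M" "(\<lambda>n. L2_norm M (\<lambda>x. f n x - g x)) \<longlonglongrightarrow> 0"
proof -
  have "\<forall>k. \<exists>N. \<forall>m\<ge>N. \<forall>n\<ge>N. L2_norm M (\<lambda>x. f m x - f n x) < (1/2)^k"
    using cau by (meson half_gt_zero_iff zero_less_one zero_less_power)
  then obtain N0 where N0: "\<And>k m n. m \<ge> N0 k \<Longrightarrow> n \<ge> N0 k \<Longrightarrow> L2_norm M (\<lambda>x. f m x - f n x) < (1/2)^k"
    by metis
  \<comment> \<open>The maximum over all earlier thresholds gives \<open>N0 n \<le> N m\<close> for
    n \<le> m, as the fast criterion requires.\<close>
  define N where "N k = Max (N0 ` {..k})" for k
  have N0N: "j \<le> k \<Longrightarrow> N0 j \<le> N k" for j k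
    unfolding N_def by (intro Max_ge) auto
  obtain g where g: "g \<in> L2 M" "\<And>n. L2_norm M (\<lambda>x. g x - f (N n) x) \<le> (1/2)^n"
  proof (rule L2_complete_fast[OF fin, of "\<lambda>k. f (N k)"])
    fix m n :: nat assume "n \<le> m"
    then show "L2_norm M (\<lambda>x. f (N m) x - f (N n) x) \<le> (1/2)^n"
      by (intro less_imp_le[OF N0] N0N) auto
  qed (use f in auto)
  have "(\<lambda>n. L2_norm M (\<lambda>x. f n x - g x)) \<longlonglongrightarrow> 0"
  proof (rule LIMSEQ_I)
    fix r :: real assume "r > 0"
    then obtain k where k: "(1/2)^k < r/2"
      using real_arch_pow_inv[of "r/2" "1/2"] by auto
    have "L2_norm M (\<lambda>x. f n x - g x) < r" if "n \<ge> N k" for n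
    proof -
      have "L2_norm M (\<lambda>x. f n x - g x)
          \<le> L2_norm M (\<lambda>x. f n x - f (N k) x) + L2_norm M (\<lambda>x. f (N k) x - g x)"
        by (intro L2_norm_triangle_diff f g)
      also have "L2_norm M (\<lambda>x. f n x - f (N k) x) < (1/2)^k"
        by (intro N0) (use that N0N[of k k] in auto)
      also have "L2_norm M (\<lambda>x. f (N k) x - g x) \<le> (1/2)^k"
        using g(2)[of k] by (simp add: L2_norm_diff_commute)
      finally show ?thesis using k by simp
    qed
    then show "\<exists>no. \<forall>n\<ge>no. norm (L2_norm M (\<lambda>x. f n x - g x) - 0) < r" by auto
  qed
  with g(1) show ?thesis by (rule that)
qed

subsection \<open>Unconditional sums in L2\<close>

lemma has_L2_sum_iff:
  "has_L2_sum M F I f \<longleftrightarrow> f \<in> L2 M \<and> (\<forall>i\<in>I. F i \<in> L2 M) \<and>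
    (\<forall>\<epsilon>>0. \<exists>X. finite X \<and> X \<subseteq> I \<and>
      (\<forall>Y. finite Y \<and> X \<subseteq> Y \<and> Y \<subseteq> I \<longrightarrow> L2_norm M (\<lambda>x. f x - (\<Sum>i\<in>Y. F i x)) < \<epsilon>))"
  unfolding has_L2_sum_def tendsto_iff eventually_finite_subsets_at_top by (simp add: dist_real_def)

lemma has_L2_sum_cong:
  assumes "\<And>i x. i \<in> I \<Longrightarrow> x \<in> space M \<Longrightarrow> F i x = G i x"
  shows "has_L2_sum M F I f \<longleftrightarrow> has_L2_sum M G I f"
proof -
  have *: "L2_norm M (\<lambda>x. f x - (\<Sum>i\<in>Y. F i x)) = L2_norm M (\<lambda>x. f x - (\<Sum>i\<in>Y. G i x))"
    if "Y \<subseteq> I" for Y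
    using assms that by (intro L2_norm_cong) (auto intro!: sum.cong)
  have "F i \<in> L2 M \<longleftrightarrow> G i \<in> L2 M" if "i \<in> I" for i
    using assms that by (intro L2_cong) auto
  moreover have "((\<lambda>J. L2_norm M (\<lambda>x. f x - (\<Sum>i\<in>J. F i x))) \<longlongrightarrow> 0) (finite_subsets_at_top I) \<longleftrightarrow>
      ((\<lambda>J. L2_norm M (\<lambda>x. f x - (\<Sum>i\<in>J. G i x))) \<longlongrightarrow> 0) (finite_subsets_at_top I)"
    by (intro filterlim_cong refl eventually_finite_subsets_at_top_weakI) (rule *)
  ultimately show ?thesis unfolding has_L2_sum_def by auto
qed

text \<open>Continuity of the inner product turns an unconditional L2 sum into an unconditional sum
  of numbers. Coefficients of series are later identified in this way.\<close>

lemma has_L2_sum_inner: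
  assumes "has_L2_sum M F I f" "h \<in> L2 M"
  shows "((\<lambda>i. L2_inner M (F i) h) has_sum L2_inner M f h) I"
proof -
  have f: "f \<in> L2 M" and F: "\<And>i. i \<in> I \<Longrightarrow> F i \<in> L2 M"
    and lim: "((\<lambda>J. L2_norm M (\<lambda>x. f x - (\<Sum>i\<in>J. F i x))) \<longlongrightarrow> 0) (finite_subsets_at_top I)"
    using assms(1) by (auto simp: has_L2_sum_def)
  have "((\<lambda>J. L2_inner M f h - (\<Sum>i\<in>J. L2_inner M (F i) h)) \<longlongrightarrow> 0) (finite_subsets_at_top I)"
  proof (rule Lim_null_comparison)
    show "((\<lambda>J. L2_norm M (\<lambda>x. f x - (\<Sum>i\<in>J. F i x)) * L2_norm M h) \<longlongrightarrow> 0) (finite_subsets_at_top I)"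
      using tendsto_mult_right[OF lim, of "L2_norm M h"] by simp
    show "\<forall>\<^sub>F J in finite_subsets_at_top I. norm (L2_inner M f h - (\<Sum>i\<in>J. L2_inner M (F i) h))
        \<le> L2_norm M (\<lambda>x. f x - (\<Sum>i\<in>J. F i x)) * L2_norm M h"
    proof (rule eventually_finite_subsets_at_top_weakI)
      fix J assume J: "finite J" "J \<subseteq> I"
      then have S: "(\<lambda>x. \<Sum>i\<in>J. F i x) \<in> L2 M" by (intro L2_sum F) auto
      have "L2_inner M f h - (\<Sum>i\<in>J. L2_inner M (F i) h)
          = L2_inner M (\<lambda>x. f x - (\<Sum>i\<in>J. F i x)) h"
        using J F by (subst L2_inner_diff_left[OF f S assms(2)], subst L2_inner_sum_left[OF _ assms(2)]) auto
      then show "norm (L2_inner M f h - (\<Sum>i\<in>J. L2_inner M (F i) h))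
          \<le> L2_norm M (\<lambda>x. f x - (\<Sum>i\<in>J. F i x)) * L2_norm M h"
        using L2_Cauchy_Schwarz[OF L2_diff[OF f S] assms(2)] by simp
    qed
  qed
  from tendsto_diff[OF tendsto_const[of "L2_inner M f h"] this]
  show ?thesis unfolding has_sum_def by simp
qed

text \<open>The difference of two sums is orthogonal to everything, itself included. Limits in L2
  are determined only almost everywhere, hence a norm instead of an equation of functions.\<close>

lemma has_L2_sum_unique:
  assumes "has_L2_sum M F I f" "has_L2_sum M F I g"
  shows "L2_norm M (\<lambda>x. f x - g x) = 0"
proof -
  have f: "f \<in> L2 M" and g: "g \<in> L2 M" using assms by (auto simp: has_L2_sum_def)
  have "L2_inner M f h = L2_inner M g h" if "h \<in> L2 M" for h
    using has_L2_sum_inner[OF assms(1) that] has_L2_sum_inner[OF assms(2) that] by (rule has_sum_unique)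
  then have "L2_inner M (\<lambda>x. f x - g x) (\<lambda>x. f x - g x) = 0"
    using L2_diff[OF f g] by (subst L2_inner_diff_left) (auto simp: f g)
  then show ?thesis by (simp add: L2_inner_self)
qed

lemma has_L2_sum_add:
  assumes "has_L2_sum M F I f" "has_L2_sum M G I g"
  shows "has_L2_sum M (\<lambda>i x. F i x + G i x) I (\<lambda>x. f x + g x)"
  unfolding has_L2_sum_def
proof (intro conjI ballI)
  have f: "f \<in> L2 M" and g: "g \<in> L2 M" using assms by (auto simp: has_L2_sum_def)
  have F: "\<And>i. i \<in> I \<Longrightarrow> F i \<in> L2 M" and G: "\<And>i. i \<in> I \<Longrightarrow> G i \<in> L2 M"
    using assms by (auto simp: has_L2_sum_def)
  show "(\<lambda>x. f x + g x) \<in> L2 M" by (intro L2_add f g)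
  show "(\<lambda>x. F i x + G i x) \<in> L2 M" if "i \<in> I" for i by (intro L2_add F G that)
  show "((\<lambda>J. L2_norm M (\<lambda>x. f x + g x - (\<Sum>i\<in>J. F i x + G i x))) \<longlongrightarrow> 0) (finite_subsets_at_top I)"
  proof (rule Lim_null_comparison)
    show "((\<lambda>J. L2_norm M (\<lambda>x. f x - (\<Sum>i\<in>J. F i x)) + L2_norm M (\<lambda>x. g x - (\<Sum>i\<in>J. G i x))) \<longlongrightarrow> 0)
        (finite_subsets_at_top I)"
      using assms by (auto simp: has_L2_sum_def intro: tendsto_add_zero)
    show "\<forall>\<^sub>F J in finite_subsets_at_top I. norm (L2_norm M (\<lambda>x. f x + g x - (\<Sum>i\<in>J. F i x + G i x)))
        \<le> L2_norm M (\<lambda>x. f x - (\<Sum>i\<in>J. F i x)) + L2_norm M (\<lambda>x. g x - (\<Sum>i\<in>J. G i x))"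
    proof (rule eventually_finite_subsets_at_top_weakI)
      fix J assume J: "finite J" "J \<subseteq> I"
      have "L2_norm M (\<lambda>x. (f x - (\<Sum>i\<in>J. F i x)) + (g x - (\<Sum>i\<in>J. G i x)))
        \<le> L2_norm M (\<lambda>x. f x - (\<Sum>i\<in>J. F i x)) + L2_norm M (\<lambda>x. g x - (\<Sum>i\<in>J. G i x))"
        using J by (intro L2_norm_triangle L2_diff f g L2_sum F G) auto
      then show "norm (L2_norm M (\<lambda>x. f x + g x - (\<Sum>i\<in>J. F i x + G i x)))
        \<le> L2_norm M (\<lambda>x. f x - (\<Sum>i\<in>J. F i x)) + L2_norm M (\<lambda>x. g x - (\<Sum>i\<in>J. G i x))"
        by (simp add: sum.distrib algebra_simps)
    qed
  qed
qed

lemma has_L2_sum_cmult: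
  assumes "has_L2_sum M F I f"
  shows "has_L2_sum M (\<lambda>i x. c * F i x) I (\<lambda>x. c * f x)"
  unfolding has_L2_sum_def
proof (intro conjI ballI)
  show "(\<lambda>x. c * f x) \<in> L2 M" using assms by (intro L2_cmult) (auto simp: has_L2_sum_def)
  show "(\<lambda>x. c * F i x) \<in> L2 M" if "i \<in> I" for i
    using assms that by (intro L2_cmult) (auto simp: has_L2_sum_def)
  have "L2_norm M (\<lambda>x. c * f x - (\<Sum>i\<in>J. c * F i x))
      = cmod c * L2_norm M (\<lambda>x. f x - (\<Sum>i\<in>J. F i x))" for J
    by (subst L2_norm_cmult[symmetric]) (simp add: right_diff_distrib sum_distrib_left)
  then show "((\<lambda>J. L2_norm M (\<lambda>x. c * f x - (\<Sum>i\<in>J. c * F i x))) \<longlongrightarrow> 0) (finite_subsets_at_top I)"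
    using assms tendsto_mult_left[of _ 0 _ "cmod c"] by (auto simp: has_L2_sum_def)
qed

text \<open>A bound on large partial sums passes to the limit. The prescribed finite part
  \<open>J0\<close> allows finitely many exceptional indices to be estimated separately.\<close>

lemma has_L2_sum_norm_le:
  assumes "has_L2_sum M F I f" "finite J0" "J0 \<subseteq> I"
    and "\<And>J. finite J \<Longrightarrow> J0 \<subseteq> J \<Longrightarrow> J \<subseteq> I \<Longrightarrow> L2_norm M (\<lambda>x. \<Sum>i\<in>J. F i x) \<le> B"
  shows "L2_norm M f \<le> B"
proof (rule field_le_epsilon)
  fix \<epsilon> :: real assume "\<epsilon> > 0"
  then obtain X where X: "finite X" "X \<subseteq> I"
    "\<And>Y. finite Y \<Longrightarrow> X \<subseteq> Y \<Longrightarrow> Y \<subseteq> I \<Longrightarrow> L2_norm M (\<lambda>x. f x - (\<Sum>i\<in>Y. F i x)) < \<epsilon>"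
    using assms(1) unfolding has_L2_sum_iff by metis
  have f: "f \<in> L2 M" and F: "\<And>i. i \<in> I \<Longrightarrow> F i \<in> L2 M"
    using assms(1) by (auto simp: has_L2_sum_def)
  let ?Y = "X \<union> J0"
  have S: "(\<lambda>x. \<Sum>i\<in>?Y. F i x) \<in> L2 M" using X assms(3) by (intro L2_sum F) auto
  have "L2_norm M f \<le> L2_norm M (\<lambda>x. f x - (\<Sum>i\<in>?Y. F i x)) + L2_norm M (\<lambda>x. \<Sum>i\<in>?Y. F i x)"
    using L2_norm_triangle[OF L2_diff[OF f S] S] by simp
  also have "\<dots> \<le> \<epsilon> + B"
    using X(1,2) assms(2,3) by (intro add_mono less_imp_le[OF X(3)] assms(4)) auto
  finally show "L2_norm M f \<le> B + \<epsilon>" by simp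
qed

section \<open>Orthogonal families\<close>

definition L2_orthogonal :: "'a measure \<Rightarrow> ('i \<Rightarrow> 'a \<Rightarrow> complex) \<Rightarrow> 'i set \<Rightarrow> bool" where
  "L2_orthogonal M u I \<longleftrightarrow> (\<forall>i\<in>I. u i \<in> L2 M) \<and>
     (\<forall>i\<in>I. \<forall>j\<in>I. i \<noteq> j \<longrightarrow> L2_inner M (u i) (u j) = 0)"

lemma L2_orthogonal_subset: "L2_orthogonal M u I \<Longrightarrow> J \<subseteq> I \<Longrightarrow> L2_orthogonal M u J"
  unfolding L2_orthogonal_def by (auto simp: subset_iff)

lemma L2_norm_orthogonal_sum:
  assumes "L2_orthogonal M u J" "finite J"
  shows "(L2_norm M (\<lambda>x. \<Sum>i\<in>J. a i * u i x))\<^sup>2 = (\<Sum>i\<in>J. (cmod (a i))\<^sup>2 * (L2_norm M (u i))\<^sup>2)"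
proof -
  have u: "\<And>i. i \<in> J \<Longrightarrow> (\<lambda>x. a i * u i x) \<in> L2 M"
    using assms(1) by (intro L2_cmult) (simp add: L2_orthogonal_def)
  have "complex_of_real ((L2_norm M (\<lambda>x. \<Sum>i\<in>J. a i * u i x))\<^sup>2)
      = (\<Sum>i\<in>J. L2_inner M (\<lambda>x. a i * u i x) (\<lambda>x. \<Sum>i\<in>J. a i * u i x))"
    unfolding L2_inner_self[symmetric]
    by (rule L2_inner_sum_left[where F = "\<lambda>i x. a i * u i x", OF u L2_sum[OF u]])
  also have "\<dots> = (\<Sum>i\<in>J. \<Sum>j\<in>J. a i * (cnj (a j) * L2_inner M (u i) (u j)))"
  proof (intro sum.cong refl)
    fix i assume "i \<in> J"
    have "L2_inner M (\<lambda>x. a i * u i x) (\<lambda>x. \<Sum>i\<in>J. a i * u i x)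
        = (\<Sum>j\<in>J. L2_inner M (\<lambda>x. a i * u i x) (\<lambda>x. a j * u j x))"
      by (rule L2_inner_sum_right[where F = "\<lambda>i x. a i * u i x", OF u u[OF \<open>i \<in> J\<close>]])
    then show "L2_inner M (\<lambda>x. a i * u i x) (\<lambda>x. \<Sum>i\<in>J. a i * u i x)
        = (\<Sum>j\<in>J. a i * (cnj (a j) * L2_inner M (u i) (u j)))"
      unfolding L2_inner_cmult_left L2_inner_cmult_right .
  qed
  also have "\<dots> = (\<Sum>i\<in>J. \<Sum>j\<in>J. if j = i then a i * (cnj (a i) * L2_inner M (u i) (u i)) else 0)"
    using assms by (intro sum.cong refl) (auto simp: L2_orthogonal_def)
  also have "\<dots> = (\<Sum>i\<in>J. a i * cnj (a i) * L2_inner M (u i) (u i))"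
    using assms(2) by (simp add: mult.assoc)
  also have "\<dots> = complex_of_real (\<Sum>i\<in>J. (cmod (a i))\<^sup>2 * (L2_norm M (u i))\<^sup>2)"
    unfolding complex_norm_square[symmetric] L2_inner_self of_real_sum of_real_mult ..
  finally show ?thesis using of_real_eq_iff by blast
qed

text \<open>Test \<open>f\<close> against the sum \<open>g\<close> of its coefficients times the
  \<open>u i\<close>: the left side S equals <f, g>, while |g|^2 \<le> c^2 S, and Cauchy--Schwarz
  gives S^2 \<le> |f|^2 c^2 S. The vectors are not normalized because the \<open>d\<close> of the
  operator have no fixed length, and a small \<open>c\<close> is what makes its tail small.\<close>

lemma L2_Bessel:
  assumes "L2_orthogonal M u J" "finite J" "\<And>i. i \<in> J \<Longrightarrow> L2_norm M (u i) \<le> c" "f \<in> L2 M"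
  shows "(\<Sum>i\<in>J. (cmod (L2_inner M f (u i)))\<^sup>2) \<le> c\<^sup>2 * (L2_norm M f)\<^sup>2"
proof -
  define S where "S = (\<Sum>i\<in>J. (cmod (L2_inner M f (u i)))\<^sup>2)"
  define g where "g x = (\<Sum>i\<in>J. L2_inner M f (u i) * u i x)" for x
  have u: "\<And>i. i \<in> J \<Longrightarrow> u i \<in> L2 M" using assms(1) by (auto simp: L2_orthogonal_def)
  have gL: "g \<in> L2 M" unfolding g_def by (intro L2_sum L2_cmult u)
  have S0: "0 \<le> S" unfolding S_def by (intro sum_nonneg) simp
  have "(L2_norm M g)\<^sup>2 = (\<Sum>i\<in>J. (cmod (L2_inner M f (u i)))\<^sup>2 * (L2_norm M (u i))\<^sup>2)"
    unfolding g_def by (rule L2_norm_orthogonal_sum[OF assms(1,2)])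
  also have "\<dots> \<le> (\<Sum>i\<in>J. (cmod (L2_inner M f (u i)))\<^sup>2 * c\<^sup>2)"
    using assms(3) by (intro sum_mono mult_left_mono power_mono) auto
  finally have ng: "(L2_norm M g)\<^sup>2 \<le> c\<^sup>2 * S" by (simp add: S_def sum_distrib_left mult.commute)
  have "L2_inner M f g = (\<Sum>i\<in>J. cnj (L2_inner M f (u i)) * L2_inner M f (u i))"
    unfolding g_def using u by (subst L2_inner_sum_right[OF _ assms(4)])
      (auto intro: L2_cmult simp: L2_inner_cmult_right)
  also have "\<dots> = complex_of_real S"
    unfolding S_def of_real_sum complex_norm_square by (simp add: mult.commute)
  finally have "S \<le> L2_norm M f * L2_norm M g"
    using L2_Cauchy_Schwarz[OF assms(4) gL] S0 by simp
  then have "S\<^sup>2 \<le> (L2_norm M f)\<^sup>2 * (L2_norm M g)\<^sup>2"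
    using S0 by (metis power_mono power_mult_distrib)
  also have "\<dots> \<le> (L2_norm M f)\<^sup>2 * (c\<^sup>2 * S)" by (intro mult_left_mono ng) simp
  finally have "S * S \<le> (c\<^sup>2 * (L2_norm M f)\<^sup>2) * S" by (simp add: power2_eq_square algebra_simps)
  then show ?thesis unfolding S_def[symmetric]
    using S0 by (cases "S = 0") (auto simp: mult_le_cancel_right)
qed

text \<open>Square summable coefficients leave sums of small norm outside a finite set. The partial
  sums over an increasing sequence \<open>Y n\<close> of such sets converge at rate 2^-n, and their
  limit is the sum over the whole directed family of finite sets.\<close>

theorem L2_Riesz_Fischer:
  assumes fin: "finite_measure M" and u: "L2_orthogonal M u I"
    and c: "\<And>i. i \<in> I \<Longrightarrow> L2_norm M (u i) \<le> c"
    and B: "\<And>J. finite J \<Longrightarrow> J \<subseteq> I \<Longrightarrow> (\<Sum>i\<in>J. (cmod (a i))\<^sup>2) \<le> B"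
  obtains g where "has_L2_sum M (\<lambda>i x. a i * u i x) I g"
proof -
  let ?S = "\<lambda>J x. \<Sum>i\<in>J. a i * u i x"
  have uL: "\<And>i. i \<in> I \<Longrightarrow> u i \<in> L2 M" using u by (auto simp: L2_orthogonal_def)
  have SL: "J \<subseteq> I \<Longrightarrow> ?S J \<in> L2 M" for J by (intro L2_sum L2_cmult uL) auto
  have "(\<lambda>i. (cmod (a i))\<^sup>2) summable_on I"
    by (rule nonneg_bdd_above_summable_on) (auto intro!: bdd_aboveI2[where M = B] B)
  then have sm: "\<exists>X. finite X \<and> X \<subseteq> I \<and> (\<forall>J. finite J \<and> J \<subseteq> I \<and> J \<inter> X = {} \<longrightarrow>
      L2_norm M (?S J) < \<epsilon>)" if "\<epsilon> > 0" for \<epsilon>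
  proof -
    obtain s where s: "((\<lambda>i. (cmod (a i))\<^sup>2) has_sum s) I"
      using \<open>(\<lambda>i. (cmod (a i))\<^sup>2) summable_on I\<close> by (auto simp: summable_on_def)
    \<comment> \<open>Adding 1 to \<open>\<bar>c\<bar>\<close> keeps the divisor positive for every
      \<open>c\<close>.\<close>
    define \<delta> where "\<delta> = (\<epsilon> / (\<bar>c\<bar> + 1))\<^sup>2"
    have "\<delta> > 0" using that by (auto simp: \<delta>_def zero_less_power divide_pos_pos add_nonneg_pos)
    then have "\<forall>\<^sub>F J in finite_subsets_at_top I. dist (\<Sum>i\<in>J. (cmod (a i))\<^sup>2) s < \<delta> / 2"
      using s unfolding has_sum_def tendsto_iff by (meson half_gt_zero)
    then obtain X where X: "finite X" "X \<subseteq> I"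
      "\<And>Y. finite Y \<Longrightarrow> X \<subseteq> Y \<Longrightarrow> Y \<subseteq> I \<Longrightarrow> dist (\<Sum>i\<in>Y. (cmod (a i))\<^sup>2) s < \<delta> / 2"
      unfolding eventually_finite_subsets_at_top by metis
    have "L2_norm M (?S J) < \<epsilon>" if J: "finite J" "J \<subseteq> I" "J \<inter> X = {}" for J
    proof -
      have "dist (\<Sum>i\<in>X \<union> J. (cmod (a i))\<^sup>2) s < \<delta> / 2" "dist (\<Sum>i\<in>X. (cmod (a i))\<^sup>2) s < \<delta> / 2"
        using X J by (auto intro!: X(3))
      have *: "(\<Sum>i\<in>J. (cmod (a i))\<^sup>2) < \<delta>"
      proof -
        have "(\<Sum>i\<in>X \<union> J. (cmod (a i))\<^sup>2) = (\<Sum>i\<in>X. (cmod (a i))\<^sup>2) + (\<Sum>i\<in>J. (cmod (a i))\<^sup>2)"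
          using J X(1) by (intro sum.union_disjoint) auto
        then show ?thesis
          using \<open>dist (\<Sum>i\<in>X \<union> J. (cmod (a i))\<^sup>2) s < \<delta> / 2\<close> \<open>dist (\<Sum>i\<in>X. (cmod (a i))\<^sup>2) s < \<delta> / 2\<close>
          unfolding dist_real_def by linarith
      qed
      have "(L2_norm M (?S J))\<^sup>2 = (\<Sum>i\<in>J. (cmod (a i))\<^sup>2 * (L2_norm M (u i))\<^sup>2)"
        by (rule L2_norm_orthogonal_sum[OF L2_orthogonal_subset[OF u J(2)] J(1)])
      also have "\<dots> \<le> (\<Sum>i\<in>J. (cmod (a i))\<^sup>2 * (\<bar>c\<bar> + 1)\<^sup>2)"
      proof (intro sum_mono mult_left_mono power_mono)
        fix i assume "i \<in> J"
        then have "L2_norm M (u i) \<le> c" using c J(2) by auto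
        then show "L2_norm M (u i) \<le> \<bar>c\<bar> + 1" by linarith
      qed auto
      also have "\<dots> = (\<bar>c\<bar> + 1)\<^sup>2 * (\<Sum>i\<in>J. (cmod (a i))\<^sup>2)"
        by (simp add: sum_distrib_left mult.commute)
      also have "\<dots> < (\<bar>c\<bar> + 1)\<^sup>2 * \<delta>"
        by (intro mult_strict_left_mono * zero_less_power) simp
      also have "\<dots> = \<epsilon>\<^sup>2" by (simp add: \<delta>_def power_divide)
      finally show ?thesis using \<open>\<epsilon> > 0\<close> by (simp add: power2_less_imp_less)
    qed
    with X show ?thesis by metis
  qed
  have "\<exists>X. finite X \<and> X \<subseteq> I \<and> (\<forall>J. finite J \<and> J \<subseteq> I \<and> J \<inter> X = {} \<longrightarrow>
      L2_norm M (?S J) < (1/2)^n)" for n :: nat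
    by (intro sm) simp
  then obtain X where X: "\<And>n. finite (X n)" "\<And>n. X n \<subseteq> I"
    "\<And>n J. finite J \<Longrightarrow> J \<subseteq> I \<Longrightarrow> J \<inter> X n = {} \<Longrightarrow> L2_norm M (?S J) < (1/2)^(n::nat)"
    by metis
  define Y where "Y n = (\<Union>k\<le>n. X k)" for n
  have Y: "finite (Y n)" "Y n \<subseteq> I" "X n \<subseteq> Y n" for n using X by (auto simp: Y_def)
  have diff: "L2_norm M (\<lambda>x. ?S J x - ?S (Y n) x) \<le> (1/2)^n"
    if "finite J" "J \<subseteq> I" "Y n \<subseteq> J" for J n
  proof -
    have "?S J x - ?S (Y n) x = ?S (J - Y n) x" for x
      using that by (simp add: sum_diff)
    moreover have "L2_norm M (?S (J - Y n)) < (1/2)^n"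
      using that Y[of n] by (intro X(3)) auto
    ultimately show ?thesis by simp
  qed
  obtain g where g: "g \<in> L2 M" "\<And>n. L2_norm M (\<lambda>x. g x - ?S (Y n) x) \<le> (1/2)^n"
  proof (rule L2_complete_fast[OF fin, of "\<lambda>n. ?S (Y n)"])
    fix m n :: nat assume "n \<le> m"
    then have "Y n \<subseteq> Y m" unfolding Y_def by (intro UN_mono) auto
    then show "L2_norm M (\<lambda>x. ?S (Y m) x - ?S (Y n) x) \<le> (1/2)^n" by (intro diff Y)
  qed (use SL Y in auto)
  have "has_L2_sum M (\<lambda>i x. a i * u i x) I g"
    unfolding has_L2_sum_iff
  proof (intro conjI ballI allI impI g(1) L2_cmult uL)
    fix \<epsilon> :: real assume "\<epsilon> > 0"
    then obtain n where n: "(1/2)^n < \<epsilon>/2"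
      using real_arch_pow_inv[of "\<epsilon>/2" "1/2"] by auto
    have "L2_norm M (\<lambda>x. g x - ?S J x) < \<epsilon>" if J: "finite J" "Y n \<subseteq> J" "J \<subseteq> I" for J
    proof -
      have "L2_norm M (\<lambda>x. g x - ?S J x)
          \<le> L2_norm M (\<lambda>x. g x - ?S (Y n) x) + L2_norm M (\<lambda>x. ?S (Y n) x - ?S J x)"
        by (intro L2_norm_triangle_diff g SL Y J)
      also have "\<dots> \<le> (1/2)^n + (1/2)^n"
        using diff[OF J(1,3,2)] g(2)[of n] by (intro add_mono) (simp_all add: L2_norm_diff_commute)
      finally show ?thesis using n by simp
    qed
    then show "\<exists>X. finite X \<and> X \<subseteq> I \<and> (\<forall>Y. finite Y \<and> X \<subseteq> Y \<and> Y \<subseteq> I \<longrightarrow>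
        L2_norm M (\<lambda>x. g x - ?S Y x) < \<epsilon>)"
      using Y[of n] by blast
  qed
  then show ?thesis by (rule that)
qed

text \<open>Orthogonal vectors of norm at least \<epsilon> have mutual distance at least \<epsilon>,
  so a sequence of them is not Cauchy.\<close>

lemma L2_orthogonal_no_limit:
  assumes u: "L2_orthogonal M u UNIV" and "\<epsilon> > 0" and \<epsilon>: "\<And>n::nat. \<epsilon> \<le> L2_norm M (u n)"
    and g: "g \<in> L2 M"
  shows "\<not> (\<lambda>n. L2_norm M (\<lambda>x. u n x - g x)) \<longlonglongrightarrow> 0"
proof
  assume "(\<lambda>n. L2_norm M (\<lambda>x. u n x - g x)) \<longlonglongrightarrow> 0"
  moreover have "\<epsilon> / 2 > 0" using \<open>\<epsilon> > 0\<close> by simp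
  ultimately obtain N where N: "\<And>n. n \<ge> N \<Longrightarrow> norm (L2_norm M (\<lambda>x. u n x - g x) - 0) < \<epsilon> / 2"
    using LIMSEQ_D by blast
  have uL: "u n \<in> L2 M" for n using u by (simp add: L2_orthogonal_def)
  let ?d = "\<lambda>x. u N x - u (Suc N) x"
  have "L2_norm M ?d \<le> L2_norm M (\<lambda>x. u N x - g x) + L2_norm M (\<lambda>x. g x - u (Suc N) x)"
    by (intro L2_norm_triangle_diff uL g)
  also have "\<dots> < \<epsilon>"
    using N[of N] N[of "Suc N"] by (simp add: L2_norm_diff_commute[of M g])
  finally have lt: "(L2_norm M ?d)\<^sup>2 < \<epsilon>\<^sup>2" by (intro power_strict_mono) auto
  have "L2_inner M (u N) (\<lambda>x. - 1 * u (Suc N) x) = 0"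
    using u by (subst L2_inner_cmult_right) (simp add: L2_orthogonal_def)
  then have "(L2_norm M (\<lambda>x. u N x + - 1 * u (Suc N) x))\<^sup>2 = (L2_norm M (u N))\<^sup>2 + (L2_norm M (u (Suc N)))\<^sup>2"
    using uL L2_cmult[OF uL, of "-1" "Suc N"]
    by (subst L2_norm_add_power2) (simp_all add: L2_norm_uminus)
  then have "(L2_norm M ?d)\<^sup>2 = (L2_norm M (u N))\<^sup>2 + (L2_norm M (u (Suc N)))\<^sup>2" by simp
  moreover have "\<epsilon>\<^sup>2 \<le> (L2_norm M (u N))\<^sup>2"
    using \<epsilon> \<open>\<epsilon> > 0\<close> by (intro power_mono) auto
  ultimately show False using lt zero_le_power2[of "L2_norm M (u (Suc N))"] by linarith
qed

text \<open>Cantor's diagonal argument. The enumeration \<open>c\<close> may repeat elements, which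
  covers finite \<open>J\<close> as well.\<close>

lemma bounded_coordinates_subseq:
  fixes x :: "nat \<Rightarrow> 'j \<Rightarrow> complex"
  assumes "countable J" "\<And>j n. j \<in> J \<Longrightarrow> cmod (x n j) \<le> B j"
  obtains r :: "nat \<Rightarrow> nat" where "strict_mono r" "\<And>j. j \<in> J \<Longrightarrow> convergent (\<lambda>n. x (r n) j)"
proof (cases "J = {}")
  case True
  then show ?thesis by (intro that[of id]) (auto simp: strict_mono_def)
next
  case False
  define c where "c = from_nat_into J"
  have c: "c n \<in> J" for n unfolding c_def using False by (rule from_nat_into)
  interpret subseqs "\<lambda>n s. convergent (\<lambda>k. x (s k) (c n))"
  proof
    fix n and s :: "nat \<Rightarrow> nat"
    have "bounded (range (\<lambda>k. x (s k) (c n)))"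
      using assms(2)[OF c] by (auto simp: bounded_iff)
    then obtain l r where "strict_mono (r :: nat \<Rightarrow> nat)" "((\<lambda>k. x (s k) (c n)) \<circ> r) \<longlonglongrightarrow> l"
      using bounded_imp_convergent_subsequence by blast
    then show "\<exists>r'. strict_mono r' \<and> convergent (\<lambda>k. x ((s \<circ> r') k) (c n))"
      by (auto simp: convergent_def o_def)
  qed
  \<comment> \<open>From some index on, the diagonal sequence runs inside the subsequence chosen for
    the coordinate \<open>c n\<close>; the shift cuts off the terms before that.\<close>
  have "convergent (\<lambda>k. x ((diagseq \<circ> (+) (Suc n)) k) (c n))" for n
  proof (rule diagseq_holds)
    fix r s :: "nat \<Rightarrow> nat" and n
    assume "strict_mono r" "convergent (\<lambda>k. x (s k) (c n))"
    then show "convergent (\<lambda>k. x ((s \<circ> r) k) (c n))"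
      using convergent_subseq_convergent[of "\<lambda>k. x (s k) (c n)" r] by (simp add: o_def)
  qed
  moreover have "(\<lambda>k. x ((diagseq \<circ> (+) (Suc n)) k) (c n)) = (\<lambda>k. x (diagseq (k + Suc n)) (c n))" for n
    by (simp add: o_def add.commute[of n])
  ultimately have "convergent (\<lambda>k. x (diagseq (k + Suc n)) (c n))" for n
    by metis
  then have conv: "convergent (\<lambda>k. x (diagseq k) (c n))" for n
    by (subst (asm) convergent_ignore_initial_segment)
  show ?thesis
  proof (rule that[OF subseq_diagseq])
    fix j assume "j \<in> J"
    then obtain n where "j = c n"
      using from_nat_into_surj[OF assms(1)] unfolding c_def by metis
    then show "convergent (\<lambda>n. x (diagseq n) j)" using conv by simp
  qed
qed

text \<open>Values of operators defined by choice are known only up to norm 0; this transports a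
  series to such a value.\<close>

lemma has_L2_sum_norm_0:
  assumes "has_L2_sum M F I f" "g \<in> L2 M" "L2_norm M (\<lambda>x. g x - f x) = 0"
  shows "has_L2_sum M F I g"
proof -
  have f: "f \<in> L2 M" and F: "\<And>i. i \<in> I \<Longrightarrow> F i \<in> L2 M"
    and lim: "((\<lambda>J. L2_norm M (\<lambda>x. f x - (\<Sum>i\<in>J. F i x))) \<longlongrightarrow> 0) (finite_subsets_at_top I)"
    using assms(1) by (auto simp: has_L2_sum_def)
  have "((\<lambda>J. L2_norm M (\<lambda>x. g x - (\<Sum>i\<in>J. F i x))) \<longlongrightarrow> 0) (finite_subsets_at_top I)"
  proof (rule Lim_null_comparison[OF _ lim], rule eventually_finite_subsets_at_top_weakI)
    fix J assume "finite J" "J \<subseteq> I"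
    then have "(\<lambda>x. \<Sum>i\<in>J. F i x) \<in> L2 M" by (intro L2_sum F) auto
    from L2_norm_triangle_diff[OF assms(2) f this]
    show "norm (L2_norm M (\<lambda>x. g x - (\<Sum>i\<in>J. F i x))) \<le> L2_norm M (\<lambda>x. f x - (\<Sum>i\<in>J. F i x))"
      using assms(3) by simp
  qed
  then show ?thesis using assms(2) F by (simp add: has_L2_sum_def)
qed

subsection \<open>Orthogonal sums of rank-one projections\<close>

text \<open>Abstract form of the Leray transform: T f is the sum of <f, e_i + d_i> e_i.
  \<open>T_eq\<close> keeps the choice operator of the definition and asserts no convergence, so
  \<open>T f\<close> is some fixed unknown function wherever the series diverges.\<close>

locale L2_rank_one_sum = finite_measure M for M :: "'a measure" +
  fixes e d :: "'i \<Rightarrow> 'a \<Rightarrow> complex" and I :: "'i set"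
    and T :: "('a \<Rightarrow> complex) \<Rightarrow> 'a \<Rightarrow> complex"
  assumes e_L2: "i \<in> I \<Longrightarrow> e i \<in> L2 M" and d_L2: "i \<in> I \<Longrightarrow> d i \<in> L2 M"
    and ee: "i \<in> I \<Longrightarrow> j \<in> I \<Longrightarrow> L2_inner M (e i) (e j) = (if i = j then 1 else 0)"
    and ed: "i \<in> I \<Longrightarrow> j \<in> I \<Longrightarrow> L2_inner M (e i) (d j) = 0"
    and dd: "i \<in> I \<Longrightarrow> j \<in> I \<Longrightarrow> i \<noteq> j \<Longrightarrow> L2_inner M (d i) (d j) = 0"
    and T_eq: "f \<in> L2 M \<Longrightarrow> T f = (SOME g. has_L2_sum M
      (\<lambda>i x. L2_inner M f (\<lambda>y. e i y + d i y) * e i x) I g)"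
begin

definition K :: "'i \<Rightarrow> 'a \<Rightarrow> complex" where "K i x = e i x + d i x"

text \<open>The graph of the series, as opposed to \<open>T\<close> itself: for \<open>f\<close>
  outside the domain of convergence it relates \<open>f\<close> to nothing.\<close>

definition T_rel :: "('a \<Rightarrow> complex) \<Rightarrow> ('a \<Rightarrow> complex) \<Rightarrow> bool" where
  "T_rel f g \<longleftrightarrow> has_L2_sum M (\<lambda>i x. L2_inner M f (K i) * e i x) I g"

abbreviation A :: "('a \<Rightarrow> complex) \<Rightarrow> 'a \<Rightarrow> complex" where
  "A \<equiv> (\<lambda>f x. L2_adjoint M T f x - T f x)"

lemma T_SOME: "f \<in> L2 M \<Longrightarrow> T f = (SOME g. T_rel f g)"
  unfolding T_rel_def K_def[abs_def] by (rule T_eq)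

lemma K_L2: "i \<in> I \<Longrightarrow> K i \<in> L2 M"
  unfolding K_def[abs_def] by (intro L2_add e_L2 d_L2)

lemma eK: "i \<in> I \<Longrightarrow> j \<in> I \<Longrightarrow> L2_inner M (e i) (K j) = (if i = j then 1 else 0)"
  unfolding K_def[abs_def] by (subst L2_inner_add_right) (auto simp: e_L2 d_L2 ee ed)

lemma de: "i \<in> I \<Longrightarrow> j \<in> I \<Longrightarrow> L2_inner M (d i) (e j) = 0"
  by (subst L2_inner_commute) (simp add: ed)

lemma inner_K: "f \<in> L2 M \<Longrightarrow> j \<in> I \<Longrightarrow> L2_inner M f (K j) = L2_inner M f (e j) + L2_inner M f (d j)"
  unfolding K_def[abs_def] by (intro L2_inner_add_right e_L2 d_L2)

lemma e_orth: "L2_orthogonal M e I" and d_orth: "L2_orthogonal M d I" and K_orth: "L2_orthogonal M K I"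
proof -
  show "L2_orthogonal M e I" "L2_orthogonal M d I"
    by (auto simp: L2_orthogonal_def e_L2 d_L2 ee dd)
  have "L2_inner M (K i) (K j) = 0" if "i \<in> I" "j \<in> I" "i \<noteq> j" for i j
    using that unfolding inner_K[OF K_L2[OF that(1)] that(2)] unfolding K_def[abs_def]
    by (simp add: L2_inner_add_left e_L2 d_L2 ee ed dd de)
  then show "L2_orthogonal M K I" by (auto simp: L2_orthogonal_def K_L2)
qed

lemma e_norm: "i \<in> I \<Longrightarrow> L2_norm M (e i) = 1"
  using L2_inner_self[of M "e i"] ee[of i i] L2_norm_nonneg[of M "e i"]
  by (simp add: power2_eq_1_iff flip: of_real_power del: L2_norm_nonneg)

lemma T_rel_L2: "T_rel f g \<Longrightarrow> g \<in> L2 M"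
  by (simp add: T_rel_def has_L2_sum_def)

lemma T_rel_cmult: "T_rel f g \<Longrightarrow> T_rel (\<lambda>x. c * f x) (\<lambda>x. c * g x)"
  unfolding T_rel_def using has_L2_sum_cmult[of M _ I g c]
  by (simp add: L2_inner_cmult_left mult.assoc)

lemma T_rel_add:
  assumes "f \<in> L2 M" "f' \<in> L2 M" "T_rel f g" "T_rel f' g'"
  shows "T_rel (\<lambda>x. f x + f' x) (\<lambda>x. g x + g' x)"
  using has_L2_sum_add[OF assms(3,4)[unfolded T_rel_def]] unfolding T_rel_def
  by (subst has_L2_sum_cong) (auto simp: L2_inner_add_left assms(1,2) K_L2 distrib_right)

text \<open>The coefficient <e_j, e_i + d_i> is 1 for i = j and 0 otherwise, so the series of
  \<open>e j\<close> has a single nonzero term, and every \<open>e j\<close> lies in the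
  domain.\<close>

lemma T_rel_e: assumes "j \<in> I" shows "T_rel (e j) (e j)"
  unfolding T_rel_def has_L2_sum_iff
proof (intro conjI ballI allI impI)
  show "e j \<in> L2 M" using assms by (rule e_L2)
  show "(\<lambda>x. L2_inner M (e j) (K i) * e i x) \<in> L2 M" if "i \<in> I" for i
    by (intro L2_cmult e_L2 that)
  fix \<epsilon> :: real assume "\<epsilon> > 0"
  have "e j x - (\<Sum>i\<in>Y. L2_inner M (e j) (K i) * e i x) = 0" if "finite Y" "{j} \<subseteq> Y" "Y \<subseteq> I" for x Y
  proof -
    have "(\<Sum>i\<in>Y. L2_inner M (e j) (K i) * e i x) = (\<Sum>i\<in>Y. if i = j then e i x else 0)"
      using that assms by (intro sum.cong refl) (auto simp: eK)
    then show ?thesis using that by simp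
  qed
  then have "L2_norm M (\<lambda>x. e j x - (\<Sum>i\<in>Y. L2_inner M (e j) (K i) * e i x)) < \<epsilon>"
    if "finite Y \<and> {j} \<subseteq> Y \<and> Y \<subseteq> I" for Y
    using that \<open>\<epsilon> > 0\<close> by (simp only: L2_norm_zero)
  then show "\<exists>X. finite X \<and> X \<subseteq> I \<and> (\<forall>Y. finite Y \<and> X \<subseteq> Y \<and> Y \<subseteq> I \<longrightarrow>
      L2_norm M (\<lambda>x. e j x - (\<Sum>i\<in>Y. L2_inner M (e j) (K i) * e i x)) < \<epsilon>)"
    using assms by (intro exI[of _ "{j}"]) simp
qed

lemma T_rel_T: "f \<in> L2 M \<Longrightarrow> T_rel f g \<Longrightarrow> T_rel f (T f)"
  using someI[of "T_rel f" g] by (simp add: T_SOME)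

lemma T_rel_unique: "T_rel f g \<Longrightarrow> T_rel f h \<Longrightarrow> L2_norm M (\<lambda>x. g x - h x) = 0"
  unfolding T_rel_def by (rule has_L2_sum_unique)

lemma T_e: "j \<in> I \<Longrightarrow> L2_norm M (\<lambda>x. T (e j) x - e j x) = 0"
  using T_rel_unique[OF T_rel_T[OF e_L2 T_rel_e] T_rel_e] .

lemma T_rel_inner:
  assumes "T_rel f g" "h \<in> L2 M"
  shows "((\<lambda>i. L2_inner M f (K i) * L2_inner M (e i) h) has_sum L2_inner M g h) I"
  using has_L2_sum_inner[OF assms(1)[unfolded T_rel_def] assms(2)] by (simp add: L2_inner_cmult_left)

lemma T_rel_inner_e:
  assumes "T_rel f g" "j \<in> I"
  shows "L2_inner M g (e j) = L2_inner M f (K j)"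
proof -
  have "((\<lambda>i. L2_inner M f (K i) * L2_inner M (e i) (e j)) has_sum L2_inner M f (K j)) {j}"
    using assms(2) by (intro has_sum_finiteI) (auto simp: ee)
  then have "((\<lambda>i. L2_inner M f (K i) * L2_inner M (e i) (e j)) has_sum L2_inner M f (K j)) I"
    using assms(2) by (subst has_sum_cong_neutral[where T = "{j}"]) (auto simp: ee)
  with T_rel_inner[OF assms(1) e_L2[OF assms(2)]] show ?thesis by (rule has_sum_unique)
qed

text \<open>Any vector with the adjoint property shows that the choice in \<open>L2_adjoint\<close>
  succeeds; testing against the difference of the two vectors shows that they agree almost
  everywhere.\<close>

lemma adjoint_eq:
  assumes "k \<in> L2 M" "\<And>f. f \<in> L2 M \<Longrightarrow> L2_inner M (T f) g = L2_inner M f k"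
  shows "L2_adjoint M T g \<in> L2 M" "L2_norm M (\<lambda>x. L2_adjoint M T g x - k x) = 0"
proof -
  let ?k = "L2_adjoint M T g"
  have *: "?k \<in> L2 M \<and> (\<forall>f\<in>L2 M. L2_inner M (T f) g = L2_inner M f ?k)"
    unfolding L2_adjoint_def by (rule someI[of _ k]) (use assms in auto)
  then show kL: "?k \<in> L2 M" by simp
  have "L2_inner M f ?k = L2_inner M f k" if "f \<in> L2 M" for f
    using * assms(2) that by metis
  then have "L2_inner M (\<lambda>x. ?k x - k x) (\<lambda>x. ?k x - k x) = 0"
    using L2_diff[OF kL assms(1)] by (subst L2_inner_diff_right) (auto simp: kL assms(1))
  then show "L2_norm M (\<lambda>x. ?k x - k x) = 0" by (simp add: L2_inner_self)
qed

text \<open>Outside its domain \<open>T\<close> takes one and the same value \<open>c\<close>, and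
  \<open>f\<close>, 2 f and f + e_j all lie outside. An adjoint vector k of \<open>e j\<close> would
  give <f, k> = <2 f, k> = <f + e_j, k>, hence <e_j, k> = 0, against <T e_j, e_j> = 1.\<close>

lemma no_adjoint:
  assumes f: "f \<in> L2 M" and nT: "\<And>g. \<not> T_rel f g" and j: "j \<in> I"
  shows "\<not> (k \<in> L2 M \<and> (\<forall>f\<in>L2 M. L2_inner M (T f) (e j) = L2_inner M f k))"
proof
  assume k: "k \<in> L2 M \<and> (\<forall>f\<in>L2 M. L2_inner M (T f) (e j) = L2_inner M f k)"
  define c where "c = (SOME g::'a \<Rightarrow> complex. False)"
  have T_c: "T h = c" if "h \<in> L2 M" "\<And>g. \<not> T_rel h g" for h
    using that by (simp add: T_SOME c_def)
  have "\<not> T_rel (\<lambda>x. 2 * f x) g" for g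
    using T_rel_cmult[of "\<lambda>x. 2 * f x" g "1/2"] nT by auto
  then have 2: "T (\<lambda>x. 2 * f x) = c" by (intro T_c L2_cmult f)
  have "\<not> T_rel (\<lambda>x. f x + e j x) g" for g
  proof
    assume "T_rel (\<lambda>x. f x + e j x) g"
    from T_rel_add[OF L2_add[OF f e_L2[OF j]] L2_cmult[OF e_L2[OF j]] this T_rel_cmult[OF T_rel_e[OF j]], of "-1"]
    show False using nT by simp
  qed
  then have 3: "T (\<lambda>x. f x + e j x) = c" by (intro T_c L2_add f e_L2 j)
  have inner: "L2_inner M (T h) (e j) = L2_inner M h k" if "h \<in> L2 M" for h using k that by blast
  have "L2_inner M f k = L2_inner M (\<lambda>x. 2 * f x) k"
    using inner[OF f] inner[OF L2_cmult[OF f, of 2]] unfolding 2 T_c[OF f nT] by simp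
  then have f0: "L2_inner M f k = 0" by (simp add: L2_inner_cmult_left)
  have "L2_inner M f k = L2_inner M (\<lambda>x. f x + e j x) k"
    using inner[OF f] inner[OF L2_add[OF f e_L2[OF j]]] unfolding 3 T_c[OF f nT] by simp
  then have "L2_inner M (e j) k = 0" using f0 k by (simp add: L2_inner_add_left f e_L2 j)
  then have "L2_inner M (T (e j)) (e j) = 0" using inner[OF e_L2[OF j]] by simp
  moreover have "L2_inner M (T (e j)) (e j) = L2_inner M (e j) (K j)"
    by (rule T_rel_inner_e[OF T_rel_T[OF e_L2[OF j] T_rel_e[OF j]] j])
  ultimately show False using eK[OF j j] by simp
qed

text \<open>Apply compactness to the orthonormal sequence \<open>e (s n)\<close>. If
  \<open>T\<close> is everywhere defined, \<open>A\<close> sends \<open>e j\<close> to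
  \<open>d j\<close>; otherwise it sends \<open>e j\<close> to a fixed vector minus
  \<open>e j\<close>. Either way an orthogonal sequence with norms bounded below would have a
  convergent subsequence.\<close>

theorem compact_imp_small:
  assumes comp: "L2_compact_operator M A"
    and s: "inj s" "range s \<subseteq> I" and "\<epsilon> > 0"
  shows "\<exists>k::nat. L2_norm M (d (s k)) < \<epsilon>"
proof (rule ccontr)
  assume "\<not> ?thesis"
  then have \<epsilon>: "\<epsilon> \<le> L2_norm M (d (s k))" for k by (auto simp: not_less)
  have sI: "s k \<in> I" for k using s by auto
  have AL: "A (e (s k)) \<in> L2 M" for k
    using comp e_L2[OF sI] unfolding L2_compact_operator_def by blast
  have "\<exists>g\<in>L2 M. \<exists>k :: nat \<Rightarrow> nat. strict_mono k \<and>
      (\<lambda>n. L2_norm M (\<lambda>x. A (e (s (k n))) x - g x)) \<longlonglongrightarrow> 0"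
    by (rule comp[unfolded L2_compact_operator_def, THEN conjunct2, rule_format, of "\<lambda>n. e (s n)"])
      (auto simp: e_L2 sI e_norm)
  then obtain g r where g: "g \<in> L2 M" and r: "strict_mono (r :: nat \<Rightarrow> nat)"
    and lim: "(\<lambda>n. L2_norm M (\<lambda>x. A (e (s (r n))) x - g x)) \<longlonglongrightarrow> 0"
    by (elim bexE exE conjE)
  have sr: "m \<noteq> n \<Longrightarrow> s (r m) \<noteq> s (r n)" for m n
    using injD[OF s(1), of "r m" "r n"] strict_mono_eq[OF r, of m n] by blast
  have TL: "T (e j) \<in> L2 M" if "j \<in> I" for j
    using T_rel_T[OF e_L2 T_rel_e, OF that that] by (rule T_rel_L2)
  show False
  proof (cases "\<forall>f\<in>L2 M. \<exists>g. T_rel f g")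
    case True
    have "L2_norm M (\<lambda>x. A (e j) x - d j x) = 0" "A (e j) \<in> L2 M" if j: "j \<in> I" for j
    proof -
      have "L2_inner M (T f) (e j) = L2_inner M f (K j)" if "f \<in> L2 M" for f
      proof -
        obtain h where "T_rel f h" using True \<open>f \<in> L2 M\<close> by blast
        then show ?thesis using T_rel_inner_e[OF T_rel_T[OF \<open>f \<in> L2 M\<close>] j] by simp
      qed
      note adj = adjoint_eq[OF K_L2[OF j] this]
      show "A (e j) \<in> L2 M" by (intro L2_diff adj(1) TL j)
      have eq: "(\<lambda>x. A (e j) x - d j x) = (\<lambda>x. (L2_adjoint M T (e j) x - K j x) - (T (e j) x - e j x))"
        by (simp add: K_def fun_eq_iff)
      have "L2_norm M (\<lambda>x. (L2_adjoint M T (e j) x - K j x) - (T (e j) x - e j x))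
          \<le> L2_norm M (\<lambda>x. L2_adjoint M T (e j) x - K j x) + L2_norm M (\<lambda>x. - (T (e j) x - e j x))"
        using L2_norm_triangle[OF L2_diff[OF adj(1) K_L2[OF j]] L2_uminus[OF L2_diff[OF TL[OF j] e_L2[OF j]]]]
        by (simp only: add_uminus_conv_diff)
      then have "L2_norm M (\<lambda>x. A (e j) x - d j x) \<le> 0"
        unfolding eq using adj(2) T_e[OF j] L2_norm_uminus[of M "\<lambda>x. T (e j) x - e j x"] by simp
      then show "L2_norm M (\<lambda>x. A (e j) x - d j x) = 0" using L2_norm_nonneg[of M "\<lambda>x. A (e j) x - d j x"] by linarith
    qed note Ad = this
    have "(\<lambda>n. L2_norm M (\<lambda>x. d (s (r n)) x - g x)) \<longlonglongrightarrow> 0"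
    proof (rule Lim_null_comparison[OF _ lim], rule always_eventually, rule allI)
      fix n
      show "norm (L2_norm M (\<lambda>x. d (s (r n)) x - g x)) \<le> L2_norm M (\<lambda>x. A (e (s (r n))) x - g x)"
        using L2_norm_triangle_diff[OF d_L2[OF sI] AL g, of "r n" "r n"] Ad(1)[OF sI, of "r n"]
        by (simp add: L2_norm_diff_commute[of M "d (s (r n))"])
    qed
    moreover have "L2_orthogonal M (\<lambda>n. d (s (r n))) UNIV"
      using sr by (auto simp: L2_orthogonal_def d_L2 sI dd)
    ultimately show False
      using L2_orthogonal_no_limit[OF _ \<open>\<epsilon> > 0\<close> \<epsilon> g] by blast
  next
    case False
    then obtain f where f: "f \<in> L2 M" "\<And>g. \<not> T_rel f g" by blast
    \<comment> \<open>By \<open>no_adjoint\<close> the predicate inside \<open>L2_adjoint\<close> is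
      false for every \<open>e j\<close>, so all these adjoint values are the same chosen
      function.\<close>
    define c where "c = (SOME k::'a \<Rightarrow> complex. False)"
    have adj: "L2_adjoint M T (e j) = c" if "j \<in> I" for j
      unfolding L2_adjoint_def c_def using no_adjoint[OF f that] by (intro arg_cong[of _ _ Eps] ext) blast
    have A_eq: "A (e (s k)) x = c x - T (e (s k)) x" for k x by (simp add: adj sI)
    have cL: "c \<in> L2 M"
      using L2_add[OF AL TL[OF sI], of 0 0] by (simp add: adj sI)
    have "(\<lambda>n. L2_norm M (\<lambda>x. e (s (r n)) x - (c x - g x))) \<longlonglongrightarrow> 0"
    proof (rule Lim_null_comparison[OF _ lim], rule always_eventually, rule allI)
      fix n
      let ?e = "e (s (r n))"
      have "L2_norm M (\<lambda>x. ?e x - (c x - g x)) \<le> L2_norm M (\<lambda>x. ?e x - T ?e x) + L2_norm M (\<lambda>x. T ?e x - (c x - g x))"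
        by (intro L2_norm_triangle_diff e_L2 TL sI L2_diff cL g)
      also have "L2_norm M (\<lambda>x. ?e x - T ?e x) = 0"
        using T_e[OF sI] by (simp add: L2_norm_diff_commute[of M ?e])
      also have "L2_norm M (\<lambda>x. T ?e x - (c x - g x)) = L2_norm M (\<lambda>x. - (A ?e x - g x))"
        unfolding A_eq by (simp add: algebra_simps)
      finally show "norm (L2_norm M (\<lambda>x. ?e x - (c x - g x))) \<le> L2_norm M (\<lambda>x. A ?e x - g x)"
        unfolding L2_norm_uminus by simp
    qed
    moreover have "L2_orthogonal M (\<lambda>n. e (s (r n))) UNIV"
      using sr by (auto simp: L2_orthogonal_def e_L2 sI ee)
    ultimately show False
      using L2_orthogonal_no_limit[of M "\<lambda>n. e (s (r n))" 1 "\<lambda>x. c x - g x"] e_norm[OF sI] L2_diff[OF cL g]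
      by auto
  qed
qed

text \<open>Finitely many terms are estimated one by one. The tail consists of two orthogonal sums:
  the first has coefficients <f, e_i> on vectors of norm at most \<epsilon>, the second has
  coefficients <f, d_i>, to which Bessel's inequality applies with constant \<epsilon>. This is
  approximation of \<open>A\<close> by operators of finite rank in quantitative form.\<close>

lemma A_norm_le:
  assumes f: "f \<in> L2 M" and J0: "finite J0" "J0 \<subseteq> I" and \<epsilon>: "0 \<le> \<epsilon>" "\<And>i. i \<in> I - J0 \<Longrightarrow> L2_norm M (d i) \<le> \<epsilon>"
    and g: "has_L2_sum M (\<lambda>i x. L2_inner M f (e i) * d i x - L2_inner M f (d i) * e i x) I g"
  shows "L2_norm M g \<le> (\<Sum>i\<in>J0. cmod (L2_inner M f (e i)) * L2_norm M (d i) + cmod (L2_inner M f (d i)))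
      + 2 * \<epsilon> * L2_norm M f"
proof (rule has_L2_sum_norm_le[OF g J0])
  fix J assume J: "finite J" "J0 \<subseteq> J" "J \<subseteq> I"
  let ?F = "\<lambda>i x. L2_inner M f (e i) * d i x - L2_inner M f (d i) * e i x"
  have FL: "?F i \<in> L2 M" if "i \<in> I" for i using that by (intro L2_diff L2_cmult e_L2 d_L2)
  have S1: "L2_norm M (\<lambda>x. \<Sum>i\<in>J0. ?F i x)
      \<le> (\<Sum>i\<in>J0. cmod (L2_inner M f (e i)) * L2_norm M (d i) + cmod (L2_inner M f (d i)))"
  proof (rule order_trans[OF L2_norm_triangle_sum sum_mono])
    fix i assume "i \<in> J0"
    then have i: "i \<in> I" using J0 by auto
    show "?F i \<in> L2 M" by (rule FL[OF i])
    show "L2_norm M (?F i) \<le> cmod (L2_inner M f (e i)) * L2_norm M (d i) + cmod (L2_inner M f (d i))"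
      using L2_norm_triangle[OF L2_cmult[OF d_L2[OF i]] L2_uminus[OF L2_cmult[OF e_L2[OF i]]],
          of "L2_inner M f (e i)" "L2_inner M f (d i)"]
      by (simp add: L2_norm_uminus L2_norm_cmult e_norm[OF i])
  qed
  let ?R = "J - J0"
  have R: "finite ?R" "?R \<subseteq> I" "?R \<subseteq> I - J0" using J by auto
  have B1: "L2_norm M (\<lambda>x. \<Sum>i\<in>?R. L2_inner M f (e i) * d i x) \<le> \<epsilon> * L2_norm M f"
  proof (rule power2_le_imp_le)
    have "(L2_norm M (\<lambda>x. \<Sum>i\<in>?R. L2_inner M f (e i) * d i x))\<^sup>2
        = (\<Sum>i\<in>?R. (cmod (L2_inner M f (e i)))\<^sup>2 * (L2_norm M (d i))\<^sup>2)"
      by (rule L2_norm_orthogonal_sum[OF L2_orthogonal_subset[OF d_orth R(2)] R(1)])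
    also have "\<dots> \<le> (\<Sum>i\<in>?R. (cmod (L2_inner M f (e i)))\<^sup>2 * \<epsilon>\<^sup>2)"
      using R(3) by (intro sum_mono mult_left_mono power_mono \<epsilon>(2)) auto
    also have "\<dots> = \<epsilon>\<^sup>2 * (\<Sum>i\<in>?R. (cmod (L2_inner M f (e i)))\<^sup>2)"
      by (simp add: sum_distrib_left mult.commute)
    also have "\<dots> \<le> \<epsilon>\<^sup>2 * (1\<^sup>2 * (L2_norm M f)\<^sup>2)"
      using R(2) by (intro mult_left_mono L2_Bessel[OF L2_orthogonal_subset[OF e_orth R(2)] R(1) _ f])
        (auto simp: e_norm subset_iff)
    finally show "(L2_norm M (\<lambda>x. \<Sum>i\<in>?R. L2_inner M f (e i) * d i x))\<^sup>2 \<le> (\<epsilon> * L2_norm M f)\<^sup>2"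
      by (simp add: power_mult_distrib)
  qed (simp add: \<epsilon>(1))
  have B2: "L2_norm M (\<lambda>x. \<Sum>i\<in>?R. L2_inner M f (d i) * e i x) \<le> \<epsilon> * L2_norm M f"
  proof (rule power2_le_imp_le)
    have "(L2_norm M (\<lambda>x. \<Sum>i\<in>?R. L2_inner M f (d i) * e i x))\<^sup>2
        = (\<Sum>i\<in>?R. (cmod (L2_inner M f (d i)))\<^sup>2 * (L2_norm M (e i))\<^sup>2)"
      by (rule L2_norm_orthogonal_sum[OF L2_orthogonal_subset[OF e_orth R(2)] R(1)])
    also have "\<dots> = (\<Sum>i\<in>?R. (cmod (L2_inner M f (d i)))\<^sup>2)"
      using R(2) by (intro sum.cong) (auto simp: e_norm subset_iff)
    also have "\<dots> \<le> \<epsilon>\<^sup>2 * (L2_norm M f)\<^sup>2"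
      using R(3) by (intro L2_Bessel[OF L2_orthogonal_subset[OF d_orth R(2)] R(1) _ f] \<epsilon>(2)) auto
    finally show "(L2_norm M (\<lambda>x. \<Sum>i\<in>?R. L2_inner M f (d i) * e i x))\<^sup>2 \<le> (\<epsilon> * L2_norm M f)\<^sup>2"
      by (simp add: power_mult_distrib)
  qed (simp add: \<epsilon>(1))
  have P: "(\<lambda>x. \<Sum>i\<in>?R. L2_inner M f (e i) * d i x) \<in> L2 M"
      "(\<lambda>x. \<Sum>i\<in>?R. L2_inner M f (d i) * e i x) \<in> L2 M"
      "(\<lambda>x. \<Sum>i\<in>J0. ?F i x) \<in> L2 M"
    using R(2) J0(2) by (auto intro!: L2_sum L2_cmult e_L2 d_L2 L2_diff)
  have "(\<Sum>i\<in>J. ?F i x) = (\<Sum>i\<in>J0. ?F i x)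
      + ((\<Sum>i\<in>?R. L2_inner M f (e i) * d i x) + - (\<Sum>i\<in>?R. L2_inner M f (d i) * e i x))" for x
    using sum.subset_diff[OF J(2,1), of "\<lambda>i. ?F i x"] by (simp add: sum_subtractf)
  then have "L2_norm M (\<lambda>x. \<Sum>i\<in>J. ?F i x) \<le> L2_norm M (\<lambda>x. \<Sum>i\<in>J0. ?F i x)
      + (L2_norm M (\<lambda>x. \<Sum>i\<in>?R. L2_inner M f (e i) * d i x) + L2_norm M (\<lambda>x. - (\<Sum>i\<in>?R. L2_inner M f (d i) * e i x)))"
    using order_trans[OF L2_norm_triangle[OF P(3) L2_add[OF P(1) L2_uminus[OF P(2)]]]
        add_left_mono[OF L2_norm_triangle[OF P(1) L2_uminus[OF P(2)]]]]
    by simp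
  then show "L2_norm M (\<lambda>x. \<Sum>i\<in>J. ?F i x)
      \<le> (\<Sum>i\<in>J0. cmod (L2_inner M f (e i)) * L2_norm M (d i) + cmod (L2_inner M f (d i))) + 2 * \<epsilon> * L2_norm M f"
    using S1 B1 B2 unfolding L2_norm_uminus by linarith
qed

text \<open>Since only finitely many \<open>d i\<close> are large, all their norms are bounded, and
  Riesz--Fischer gives convergence of the series of \<open>T\<close> and of its adjoint everywhere.
  Compactness then follows along a subsequence on which all coordinates <f, e_i> and <f, d_i>
  converge, by the estimate \<open>A_norm_le\<close> for differences.\<close>

theorem small_imp_compact:
  assumes cI: "countable I" and fin: "\<And>\<epsilon>. \<epsilon> > 0 \<Longrightarrow> finite {i\<in>I. \<epsilon> \<le> L2_norm M (d i)}"
  shows "L2_compact_operator M A"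
proof -
  \<comment> \<open>Only finitely many norms are at least 1; the inserted 1 bounds all the
    others.\<close>
  define c where "c = Max (insert 1 ((\<lambda>i. L2_norm M (d i)) ` {i\<in>I. 1 \<le> L2_norm M (d i)}))"
  have c1: "1 \<le> c" unfolding c_def using fin[of 1] by (intro Max_ge) auto
  have c: "L2_norm M (d i) \<le> c" if "i \<in> I" for i
  proof (cases "1 \<le> L2_norm M (d i)")
    case True
    then show ?thesis unfolding c_def using fin[of 1] that by (intro Max_ge) auto
  qed (use c1 in auto)
  have Kn: "L2_norm M (K i) \<le> 1 + c" if "i \<in> I" for i
    using L2_norm_triangle[OF e_L2[OF that] d_L2[OF that]] c[OF that] e_norm[OF that]
    unfolding K_def[abs_def] by simp
  have fm: "finite_measure M" by unfold_locales
  have T: "T_rel f (T f)" if f: "f \<in> L2 M" for f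
  proof -
    have "(\<Sum>i\<in>J. (cmod (L2_inner M f (K i)))\<^sup>2) \<le> (1 + c)\<^sup>2 * (L2_norm M f)\<^sup>2" if "finite J" "J \<subseteq> I" for J
      using that Kn by (intro L2_Bessel[OF L2_orthogonal_subset[OF K_orth]] f) auto
    note bound = this
    obtain g where "has_L2_sum M (\<lambda>i x. L2_inner M f (K i) * e i x) I g"
      by (rule L2_Riesz_Fischer[OF fm e_orth _ bound, of 1]) (simp_all add: e_norm)
    then show ?thesis by (intro T_rel_T[OF f]) (simp add: T_rel_def)
  qed
  have adj: "has_L2_sum M (\<lambda>i x. L2_inner M g (e i) * K i x) I (L2_adjoint M T g)" if g: "g \<in> L2 M" for g
  proof -
    have "(\<Sum>i\<in>J. (cmod (L2_inner M g (e i)))\<^sup>2) \<le> 1\<^sup>2 * (L2_norm M g)\<^sup>2" if "finite J" "J \<subseteq> I" for J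
      using that e_norm by (intro L2_Bessel[OF L2_orthogonal_subset[OF e_orth]] g) auto
    note bound = this
    obtain k where k: "has_L2_sum M (\<lambda>i x. L2_inner M g (e i) * K i x) I k"
      by (rule L2_Riesz_Fischer[OF fm K_orth Kn bound])
    then have kL: "k \<in> L2 M" by (simp add: has_L2_sum_def)
    have "L2_inner M (T f) g = L2_inner M f k" if f: "f \<in> L2 M" for f
    proof -
      have "((\<lambda>i. L2_inner M g (e i) * L2_inner M (K i) f) has_sum L2_inner M k f) I"
        using has_L2_sum_inner[OF k f] by (simp add: L2_inner_cmult_left)
      then have "((\<lambda>i. cnj (L2_inner M g (e i) * L2_inner M (K i) f)) has_sum cnj (L2_inner M k f)) I"
        by (subst has_sum_cnj_iff)
      moreover have "cnj (L2_inner M g (e i) * L2_inner M (K i) f) = L2_inner M f (K i) * L2_inner M (e i) g" for i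
        by (simp add: L2_inner_commute[of M "e i" g] L2_inner_commute[of M f "K i"] mult.commute)
      ultimately have "((\<lambda>i. L2_inner M f (K i) * L2_inner M (e i) g) has_sum L2_inner M f k) I"
        by (simp add: L2_inner_commute[of M f k])
      with T_rel_inner[OF T[OF f] g] show ?thesis by (rule has_sum_unique)
    qed
    note a = adjoint_eq[OF kL this]
    show ?thesis by (rule has_L2_sum_norm_0[OF k a])
  qed
  \<comment> \<open>In the difference of <f, e_i> (e_i + d_i) and <f, e_i + d_i> e_i the terms <f,
    e_i> e_i cancel.\<close>
  have A: "has_L2_sum M (\<lambda>i x. L2_inner M f (e i) * d i x - L2_inner M f (d i) * e i x) I (A f)"
    if f: "f \<in> L2 M" for f
  proof -
    have "has_L2_sum M (\<lambda>i x. L2_inner M f (e i) * K i x + -1 * (L2_inner M f (K i) * e i x)) I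
        (\<lambda>x. L2_adjoint M T f x + -1 * T f x)"
      by (intro has_L2_sum_add has_L2_sum_cmult adj f) (use T[OF f] in \<open>simp add: T_rel_def\<close>)
    then show ?thesis
      by (subst has_L2_sum_cong[where G = "\<lambda>i x. L2_inner M f (e i) * K i x + -1 * (L2_inner M f (K i) * e i x)"])
        (auto simp: inner_K f K_def algebra_simps)
  qed
  have Adiff: "has_L2_sum M (\<lambda>i x. L2_inner M (\<lambda>x. f x - f' x) (e i) * d i x - L2_inner M (\<lambda>x. f x - f' x) (d i) * e i x) I
     (\<lambda>x. A f x - A f' x)" if f: "f \<in> L2 M" "f' \<in> L2 M" for f f'
  proof -
    have "has_L2_sum M (\<lambda>i x. (L2_inner M f (e i) * d i x - L2_inner M f (d i) * e i x)
        + -1 * (L2_inner M f' (e i) * d i x - L2_inner M f' (d i) * e i x)) I (\<lambda>x. A f x + -1 * A f' x)"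
      by (rule has_L2_sum_add[OF A[OF f(1)] has_L2_sum_cmult[OF A[OF f(2)]]])
    then show ?thesis
      by (subst has_L2_sum_cong[where G = "\<lambda>i x. (L2_inner M f (e i) * d i x - L2_inner M f (d i) * e i x)
        + -1 * (L2_inner M f' (e i) * d i x - L2_inner M f' (d i) * e i x)"])
        (auto simp: L2_inner_diff_left f e_L2 d_L2 algebra_simps)
  qed
  have AL: "A f \<in> L2 M" if "f \<in> L2 M" for f using A[OF that] by (simp add: has_L2_sum_def)
  show ?thesis
    unfolding L2_compact_operator_def
  proof (intro conjI ballI allI impI AL)
    fix f :: "nat \<Rightarrow> 'a \<Rightarrow> complex"
    assume "(\<forall>n. f n \<in> L2 M) \<and> (\<exists>C. \<forall>n. L2_norm M (f n) \<le> C)"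
    then obtain C where f: "\<And>n. f n \<in> L2 M" and C: "\<And>n. L2_norm M (f n) \<le> C" by auto
    have C0: "0 \<le> C" using C[of 0] L2_norm_nonneg[of M "f 0"] by linarith
    obtain r1 where r1: "strict_mono (r1 :: nat \<Rightarrow> nat)"
      "\<And>i. i \<in> I \<Longrightarrow> convergent (\<lambda>n. L2_inner M (f (r1 n)) (e i))"
    proof (rule bounded_coordinates_subseq[OF cI, of "\<lambda>n i. L2_inner M (f n) (e i)" "\<lambda>i. C * 1"])
      fix i n assume "i \<in> I"
      then show "cmod (L2_inner M (f n) (e i)) \<le> C * 1"
        using L2_Cauchy_Schwarz[OF f e_L2, of i n] C[of n] e_norm[of i] by simp
    qed auto
    obtain r2 where r2: "strict_mono (r2 :: nat \<Rightarrow> nat)"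
      "\<And>i. i \<in> I \<Longrightarrow> convergent (\<lambda>n. L2_inner M (f (r1 (r2 n))) (d i))"
    proof (rule bounded_coordinates_subseq[OF cI, of "\<lambda>n i. L2_inner M (f (r1 n)) (d i)" "\<lambda>i. C * L2_norm M (d i)"])
      fix i n assume "i \<in> I"
      then show "cmod (L2_inner M (f (r1 n)) (d i)) \<le> C * L2_norm M (d i)"
        using L2_Cauchy_Schwarz[OF f d_L2, of i "r1 n"] C[of "r1 n"]
        by (meson L2_norm_nonneg mult_right_mono order_trans)
    qed auto
    define r where "r = r1 \<circ> r2"
    have r: "strict_mono r" unfolding r_def using r1(1) r2(1) by (rule strict_mono_o)
    have ce: "convergent (\<lambda>n. L2_inner M (f (r n)) (e i))" if "i \<in> I" for i
      using convergent_subseq_convergent[OF r1(2)[OF that] r2(1)] by (simp add: r_def o_def)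
    have cd: "convergent (\<lambda>n. L2_inner M (f (r n)) (d i))" if "i \<in> I" for i
      using r2(2)[OF that] by (simp add: r_def)
    have "\<exists>N. \<forall>m\<ge>N. \<forall>n\<ge>N. L2_norm M (\<lambda>x. A (f (r m)) x - A (f (r n)) x) < \<eta>" if "\<eta> > 0" for \<eta>
    proof -
      \<comment> \<open>Differences of members of the sequence have norm at most 2 \<open>C\<close>,
        so with this \<epsilon> the tail contributes at most \<eta>/2. The number \<theta> below is
        chosen such that the terms of \<open>J0\<close> contribute at most \<eta>/4.\<close>
      define \<epsilon> where "\<epsilon> = \<eta> / (4 * (C + C + 1))"
      have \<epsilon>0: "\<epsilon> > 0" using \<open>\<eta> > 0\<close> C0 by (simp add: \<epsilon>_def)
      define J0 where "J0 = {i\<in>I. \<epsilon> \<le> L2_norm M (d i)}"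
      have J0: "finite J0" "J0 \<subseteq> I" using fin[OF \<epsilon>0] by (auto simp: J0_def)
      define \<theta> where "\<theta> = \<eta> / (4 * (real (card J0) + 1) * (c + 1))"
      have \<theta>0: "\<theta> > 0" using \<open>\<eta> > 0\<close> c1 by (simp add: \<theta>_def)
      have E: "\<forall>\<^sub>F n in sequentially. cmod (z n - lim z) < \<theta> / 2" if "convergent z" for z :: "nat \<Rightarrow> complex"
        using tendstoD[OF that[unfolded convergent_LIMSEQ_iff], of "\<theta> / 2"] \<theta>0 by (simp add: dist_norm)
      have "\<forall>\<^sub>F n in sequentially. \<forall>i\<in>J0.
          cmod (L2_inner M (f (r n)) (e i) - lim (\<lambda>n. L2_inner M (f (r n)) (e i))) < \<theta> / 2 \<and>
          cmod (L2_inner M (f (r n)) (d i) - lim (\<lambda>n. L2_inner M (f (r n)) (d i))) < \<theta> / 2"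
        using J0 by (intro eventually_ball_finite ballI eventually_conj E ce cd) auto
      then obtain N where "\<forall>n\<ge>N. \<forall>i\<in>J0.
          cmod (L2_inner M (f (r n)) (e i) - lim (\<lambda>n. L2_inner M (f (r n)) (e i))) < \<theta> / 2 \<and>
          cmod (L2_inner M (f (r n)) (d i) - lim (\<lambda>n. L2_inner M (f (r n)) (d i))) < \<theta> / 2"
        unfolding eventually_sequentially by blast
      then have N: "\<And>n i. n \<ge> N \<Longrightarrow> i \<in> J0 \<Longrightarrow> cmod (L2_inner M (f (r n)) (e i) - lim (\<lambda>n. L2_inner M (f (r n)) (e i))) < \<theta> / 2"
        "\<And>n i. n \<ge> N \<Longrightarrow> i \<in> J0 \<Longrightarrow> cmod (L2_inner M (f (r n)) (d i) - lim (\<lambda>n. L2_inner M (f (r n)) (d i))) < \<theta> / 2"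
        by blast+
      have "L2_norm M (\<lambda>x. A (f (r m)) x - A (f (r n)) x) < \<eta>" if mn: "m \<ge> N" "n \<ge> N" for m n
      proof -
        let ?h = "\<lambda>x. f (r m) x - f (r n) x"
        have hL: "?h \<in> L2 M" by (intro L2_diff f)
        have tri: "cmod (a - b) < \<theta>" if "cmod (a - z) < \<theta> / 2" "cmod (b - z) < \<theta> / 2" for a b z :: complex
          using norm_triangle_ineq4[of "a - z" "b - z"] that by simp
        have e\<theta>: "cmod (L2_inner M ?h (e i)) < \<theta>" if "i \<in> J0" for i
          using J0 that by (subst L2_inner_diff_left[OF f f e_L2]) (auto intro: tri N mn)
        have d\<theta>: "cmod (L2_inner M ?h (d i)) < \<theta>" if "i \<in> J0" for i
          using J0 that by (subst L2_inner_diff_left[OF f f d_L2]) (auto intro: tri N mn)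
        have "(\<Sum>i\<in>J0. cmod (L2_inner M ?h (e i)) * L2_norm M (d i) + cmod (L2_inner M ?h (d i)))
            \<le> (\<Sum>i\<in>J0. \<theta> * c + \<theta>)"
          using J0 c by (intro sum_mono add_mono mult_mono less_imp_le[OF e\<theta>] less_imp_le[OF d\<theta>])
            (auto simp: \<theta>0 less_imp_le)
        also have "\<dots> \<le> (real (card J0) + 1) * (\<theta> * (c + 1))"
          using \<theta>0 c1 by (simp add: algebra_simps)
        also have "\<dots> = \<eta> / 4"
        proof -
          have "p * (\<eta> / (4 * p * q) * q) = \<eta> / 4" if "p > 0" "q > 0" for p q :: real
            using that by simp
          from this[of "real (card J0) + 1" "c + 1"] show ?thesis unfolding \<theta>_def using c1 by linarith
        qed
        finally have 1: "(\<Sum>i\<in>J0. cmod (L2_inner M ?h (e i)) * L2_norm M (d i) + cmod (L2_inner M ?h (d i))) \<le> \<eta> / 4" .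
        have "L2_norm M ?h \<le> C + C"
          using L2_norm_triangle[OF f L2_uminus[OF f], of "r m" "r n"] C[of "r m"] C[of "r n"]
          by (simp add: L2_norm_uminus)
        then have "2 * \<epsilon> * L2_norm M ?h \<le> 2 * \<epsilon> * (C + C + 1)" using \<epsilon>0 by (intro mult_left_mono) auto
        also have "\<dots> = \<eta> / 2"
        proof -
          have "2 * (\<eta> / (4 * p)) * p = \<eta> / 2" if "p > 0" for p :: real
            using that by simp
          from this[of "C + C + 1"] show ?thesis unfolding \<epsilon>_def using C0 by linarith
        qed
        finally have 2: "2 * \<epsilon> * L2_norm M ?h \<le> \<eta> / 2" .
        have "L2_norm M (\<lambda>x. A (f (r m)) x - A (f (r n)) x)
          \<le> (\<Sum>i\<in>J0. cmod (L2_inner M ?h (e i)) * L2_norm M (d i) + cmod (L2_inner M ?h (d i))) + 2 * \<epsilon> * L2_norm M ?h"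
          using \<epsilon>0 by (intro A_norm_le hL J0 Adiff f) (auto simp: J0_def)
        with 1 2 \<open>\<eta> > 0\<close> show ?thesis by linarith
      qed
      then show ?thesis by blast
    qed
    note cauchy = this
    obtain g where "g \<in> L2 M" "(\<lambda>n. L2_norm M (\<lambda>x. A (f (r n)) x - g x)) \<longlonglongrightarrow> 0"
      by (rule L2_complete[where f = "\<lambda>n. A (f (r n))", OF fm AL[OF f] cauchy])
    then show "\<exists>g\<in>L2 M. \<exists>k. strict_mono k \<and> (\<lambda>n. L2_norm M (\<lambda>x. A (f (k n)) x - g x)) \<longlonglongrightarrow> 0"
      by (intro bexI[of _ g] exI[of _ r] conjI r)
  qed
qed

end

subsection \<open>Geometry of a smooth strongly convex Reinhardt domain\<close>

text \<open>First and second derivatives are fixed as bounded linear maps,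
  \<open>\<rho>'' z u v\<close> being the derivative of \<open>\<rho>' z v\<close> in the direction
  \<open>u\<close>, so that the chain rule applies to them directly.\<close>

locale smooth_reinhardt =
  fixes D U :: "C2 set" and \<rho> :: "C2 \<Rightarrow> real"
    and \<rho>' :: "C2 \<Rightarrow> C2 \<Rightarrow>\<^sub>L real" and \<rho>'' :: "C2 \<Rightarrow> C2 \<Rightarrow>\<^sub>L C2 \<Rightarrow>\<^sub>L real"
  assumes D_open: "open D" and D_nonempty: "D \<noteq> {}" and D_bounded: "bounded D"
    and D_Reinhardt: "Reinhardt D" and D_convex: "convex D"
    and U_open: "open U" and frontier_U: "frontier D \<subseteq> U"
    and \<rho>_deriv: "z \<in> U \<Longrightarrow> (\<rho> has_derivative blinfun_apply (\<rho>' z)) (at z)"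
    and \<rho>'_deriv: "z \<in> U \<Longrightarrow> (\<rho>' has_derivative blinfun_apply (\<rho>'' z)) (at z)"
    and \<rho>''_cont: "continuous_on U \<rho>''"
    and D_U: "D \<inter> U = {z \<in> U. \<rho> z < 0}"
    and nondegenerate: "z \<in> frontier D \<Longrightarrow> \<exists>v. \<rho>' z v \<noteq> 0"
    and strict: "z \<in> frontier D \<Longrightarrow> v \<noteq> 0 \<Longrightarrow> \<rho>' z v = 0 \<Longrightarrow> \<rho>'' z v v > 0"
begin

abbreviation b :: real where "b \<equiv> outer_radius D"
abbreviation \<phi> :: "real \<Rightarrow> real" where "\<phi> \<equiv> profile D"

section \<open>Reduction to real points and complete Reinhardt shape\<close>

definition pt :: "real \<Rightarrow> real \<Rightarrow> C2" where
  "pt x y = (complex_of_real x, complex_of_real y)"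

lemma pt_sel: "fst (pt x y) = of_real x" "snd (pt x y) = of_real y"
  by (simp_all add: pt_def)

lemma cmod_pt [simp]: "cmod (fst (pt x y)) = \<bar>x\<bar>" "cmod (snd (pt x y)) = \<bar>y\<bar>"
  unfolding pt_sel norm_of_real by simp_all

lemma pt_diff: "pt x y - pt x' y' = (x - x') *\<^sub>R pt 1 0 + (y - y') *\<^sub>R pt 0 1"
  by (simp add: pt_def scaleR_conv_of_real)

lemma rot_mem: "z \<in> D \<Longrightarrow> (cis \<alpha> * fst z, cis \<beta> * snd z) \<in> D"
  using D_Reinhardt unfolding Reinhardt_def rot_def by blast

lemma mem_cmod: "z \<in> D \<longleftrightarrow> pt (cmod (fst z)) (cmod (snd z)) \<in> D"
proof
  assume "z \<in> D"
  from rot_mem[OF this, of "- Arg (fst z)" "- Arg (snd z)"]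
  show "pt (cmod (fst z)) (cmod (snd z)) \<in> D"
    using rcis_cmod_Arg[of "fst z"] rcis_cmod_Arg[of "snd z"]
    unfolding rcis_def pt_def by (metis (no_types, lifting) cis_mult cis_zero mult.commute mult.left_commute
        add.left_inverse mult.right_neutral)
next
  assume "pt (cmod (fst z)) (cmod (snd z)) \<in> D"
  from rot_mem[OF this, of "Arg (fst z)" "Arg (snd z)"]
  show "z \<in> D"
    using rcis_cmod_Arg[of "fst z"] rcis_cmod_Arg[of "snd z"]
    unfolding rcis_def by (simp add: pt_sel mult.commute)
qed

lemma pt_convex:
  assumes "pt x y \<in> D" "pt x' y' \<in> D" "0 \<le> u" "0 \<le> v" "u + v = 1"
  shows "pt (u * x + v * x') (u * y + v * y') \<in> D"
  using convexD[OF D_convex assms] by (simp add: pt_def scaleR_conv_of_real)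

lemma pt_abs: "pt x y \<in> D \<longleftrightarrow> pt \<bar>x\<bar> \<bar>y\<bar> \<in> D"
  using mem_cmod[of "pt x y"] by simp

text \<open>Reflection is a rotation by \<pi>, and a coordinate of smaller modulus lies on the
  segment between a coordinate and its negative. Convexity thus makes \<open>D\<close> a complete
  Reinhardt domain.\<close>

lemma pt_shrink:
  assumes "pt x y \<in> D" "\<bar>x'\<bar> \<le> \<bar>x\<bar>" "\<bar>y'\<bar> \<le> \<bar>y\<bar>"
  shows "pt x' y' \<in> D"
proof -
  have 1: "pt x' y \<in> D" if "pt x y \<in> D" "\<bar>x'\<bar> \<le> \<bar>x\<bar>" for x y x'
  proof (cases "x = 0")
    case False
    have "pt (- x) y \<in> D" using that(1) by (subst (asm) pt_abs, subst pt_abs) simp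
    from pt_convex[OF that(1) this, of "(1 + x'/x) / 2" "(1 - x'/x) / 2"]
    show ?thesis using that(2) False
      by (auto simp: field_simps abs_if split: if_splits)
  qed (use that in auto)
  have 2: "pt x y' \<in> D" if "pt x y \<in> D" "\<bar>y'\<bar> \<le> \<bar>y\<bar>" for x y y'
  proof (cases "y = 0")
    case False
    have "pt x (- y) \<in> D" using that(1) by (subst (asm) pt_abs, subst pt_abs) simp
    from pt_convex[OF that(1) this, of "(1 + y'/y) / 2" "(1 - y'/y) / 2"]
    show ?thesis using that(2) False
      by (auto simp: field_simps abs_if split: if_splits)
  qed (use that in auto)
  show ?thesis using 1 2 assms by blast
qed

lemma shrink_mem:
  assumes "z \<in> D" "cmod (fst w) \<le> cmod (fst z)" "cmod (snd w) \<le> cmod (snd z)"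
  shows "w \<in> D"
  using assms pt_shrink[of "cmod (fst z)" "cmod (snd z)"] by (subst mem_cmod) (auto simp: mem_cmod[of z])

lemma zero_mem: "0 \<in> D"
proof -
  obtain z where "z \<in> D" using D_nonempty by auto
  then show ?thesis by (rule shrink_mem) auto
qed

lemma pt_dist: "dist (pt x y) (pt x' y') \<le> \<bar>x - x'\<bar> + \<bar>y - y'\<bar>"
proof -
  have "dist (pt x y) (pt x' y') \<le> norm (complex_of_real (x - x')) + norm (complex_of_real (y - y'))"
    unfolding dist_norm pt_def using norm_Pair_le[of "complex_of_real (x - x')" "complex_of_real (y - y')"] by simp
  then show ?thesis by (simp only: norm_of_real)
qed

lemma pt_enlarge:
  assumes "pt x y \<in> D"
  obtains \<epsilon> where "\<epsilon> > 0" "pt (x + \<epsilon>) (y + \<epsilon>) \<in> D"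
proof -
  obtain d where d: "d > 0" "\<And>z. dist z (pt x y) < d \<Longrightarrow> z \<in> D"
    using D_open assms unfolding open_dist by blast
  have "dist (pt (x + d/4) (y + d/4)) (pt x y) \<le> d/4 + d/4"
    using pt_dist[of "x + d/4" "y + d/4" x y] d(1) by simp
  then show ?thesis using d by (intro that[of "d/4"]) auto
qed

lemma bdd: "bdd_above {cmod (fst z) |z. z \<in> D}" "bdd_above {cmod (snd z) |z. z \<in> D \<and> P z}"
proof -
  obtain B where B: "\<And>z. z \<in> D \<Longrightarrow> norm z \<le> B" using D_bounded by (auto simp: bounded_iff)
  have 1: "cmod (fst z) \<le> B" if "z \<in> D" for z
    using norm_fst_le[of "fst z" "snd z"] B[OF that] by simp
  have 2: "cmod (snd z) \<le> B" if "z \<in> D" for z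
    using norm_snd_le[of "snd z" "fst z"] B[OF that] by simp
  show "bdd_above {cmod (fst z) |z. z \<in> D}" by (rule bdd_aboveI[of _ B]) (use 1 in auto)
  show "bdd_above {cmod (snd z) |z. z \<in> D \<and> P z}" by (rule bdd_aboveI[of _ B]) (use 2 in auto)
qed

section \<open>Outer radius and profile\<close>

lemma mem_less_b: assumes "pt x y \<in> D" shows "\<bar>x\<bar> < b"
proof -
  have "pt \<bar>x\<bar> \<bar>y\<bar> \<in> D" using assms pt_abs by simp
  then obtain \<epsilon> where \<epsilon>: "\<epsilon> > 0" "pt (\<bar>x\<bar> + \<epsilon>) (\<bar>y\<bar> + \<epsilon>) \<in> D" by (rule pt_enlarge)
  have "\<bar>x\<bar> + \<epsilon> \<le> b"
    unfolding outer_radius_def using \<epsilon>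
    by (intro cSup_upper bdd CollectI exI[of _ "pt (\<bar>x\<bar> + \<epsilon>) (\<bar>y\<bar> + \<epsilon>)"]) auto
  then show ?thesis using \<epsilon>(1) by simp
qed

lemma b_pos: "0 < b"
  using mem_less_b[of 0 0] zero_mem by (simp add: pt_def zero_prod_def)

lemma less_b_mem: assumes "\<bar>r\<bar> < b" shows "pt r 0 \<in> D"
proof -
  have "\<exists>x\<in>{cmod (fst z) |z. z \<in> D}. \<bar>r\<bar> < x"
    by (rule less_cSupD) (use assms D_nonempty in \<open>auto simp: outer_radius_def\<close>)
  then obtain z where "z \<in> D" "\<bar>r\<bar> < cmod (fst z)" by auto
  then show ?thesis by - (rule shrink_mem[of z], auto)
qed

text \<open>Openness, through \<open>pt_enlarge\<close>, prevents the supremum from being attained,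
  hence the strict inequality.\<close>

lemma mem_iff_profile: assumes "0 \<le> r" "r < b" shows "pt r t \<in> D \<longleftrightarrow> \<bar>t\<bar> < \<phi> r"
proof
  let ?S = "{cmod (snd z) |z. z \<in> D \<and> cmod (fst z) = r}"
  have nonempty: "x \<in> A \<Longrightarrow> A \<noteq> {}" for x :: real and A by auto
  have "cmod (snd (pt r 0)) \<in> ?S"
    using less_b_mem[of r] assms by (intro CollectI exI[of _ "pt r 0"] conjI refl) auto
  then have ne: "?S \<noteq> {}" by (rule nonempty)
  show "\<bar>t\<bar> < \<phi> r" if "pt r t \<in> D"
  proof -
    have "pt \<bar>r\<bar> \<bar>t\<bar> \<in> D" using that pt_abs by simp
    then obtain \<epsilon> where \<epsilon>: "\<epsilon> > 0" "pt (\<bar>r\<bar> + \<epsilon>) (\<bar>t\<bar> + \<epsilon>) \<in> D" by (rule pt_enlarge)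
    then have "pt r (\<bar>t\<bar> + \<epsilon>) \<in> D" by (intro pt_shrink[OF \<epsilon>(2)]) auto
    then have "\<bar>t\<bar> + \<epsilon> \<in> ?S"
      using \<epsilon>(1) assms by (intro CollectI exI[of _ "pt r (\<bar>t\<bar> + \<epsilon>)"] conjI) (simp_all add: abs_of_nonneg)
    then have "\<bar>t\<bar> + \<epsilon> \<le> \<phi> r"
      unfolding profile_def by (rule cSup_upper[OF _ bdd(2)])
    then show ?thesis using \<epsilon>(1) by simp
  qed
  show "pt r t \<in> D" if "\<bar>t\<bar> < \<phi> r"
  proof -
    have "\<exists>x\<in>?S. \<bar>t\<bar> < x"
      by (rule less_cSupD[OF ne]) (use that in \<open>simp add: profile_def\<close>)
    then obtain z where "z \<in> D" "\<bar>t\<bar> < cmod (snd z)" "cmod (fst z) = r" by auto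
    then show ?thesis using assms by - (rule shrink_mem[of z], auto)
  qed
qed

lemma \<phi>_pos: "0 \<le> r \<Longrightarrow> r < b \<Longrightarrow> 0 < \<phi> r"
  using mem_iff_profile[of r 0] less_b_mem[of r] by simp

lemma mem_D_iff: "z \<in> D \<longleftrightarrow> cmod (fst z) < b \<and> cmod (snd z) < \<phi> (cmod (fst z))"
  using mem_iff_profile[of "cmod (fst z)" "cmod (snd z)"] mem_less_b[of "cmod (fst z)" "cmod (snd z)"]
  by (subst mem_cmod) auto

lemma \<phi>_antimono: assumes "0 \<le> x" "x \<le> r" "r < b" shows "\<phi> r \<le> \<phi> x"
proof (rule dense_le)
  fix t assume t: "t < \<phi> r"
  show "t \<le> \<phi> x"
  proof (cases "0 \<le> t")
    case True
    then have "pt r t \<in> D" using t assms by (subst mem_iff_profile) auto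
    then have "pt x t \<in> D" by (rule pt_shrink) (use assms in auto)
    then show ?thesis using assms mem_iff_profile[of x t] by auto
  qed (use \<phi>_pos[of x] assms in auto)
qed

section \<open>The boundary and the gradient of \<rho> on it\<close>

lemma frontier_eq: "frontier D = closure D - D"
  using D_open by (simp add: frontier_def interior_open)

lemma frontierI: assumes "\<And>t. 0 < t \<Longrightarrow> t < 1 \<Longrightarrow> t *\<^sub>R z \<in> D" "z \<notin> D" shows "z \<in> frontier D"
proof -
  have "((\<lambda>t. t *\<^sub>R z) \<longlongrightarrow> 1 *\<^sub>R z) (at_left 1)" by (intro tendsto_intros)
  moreover have "\<forall>\<^sub>F t in at_left (1::real). t *\<^sub>R z \<in> D"
    using assms(1) eventually_at_left_real[of 0 "1::real"] by (auto elim: eventually_mono)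
  then have "\<forall>\<^sub>F t in at_left (1::real). t *\<^sub>R z \<in> closure D"
    by eventually_elim (rule closure_subset[THEN subsetD])
  ultimately have "z \<in> closure D"
    using Lim_in_closed_set[of "closure D" "\<lambda>t. t *\<^sub>R z" "at_left (1::real)" z] by simp
  then show ?thesis using assms(2) by (simp add: frontier_eq)
qed

lemma frontier_profile:
  assumes "cmod (fst z) < b" "cmod (snd z) = \<phi> (cmod (fst z))"
  shows "z \<in> frontier D"
proof (rule frontierI)
  show "z \<notin> D" using assms by (simp add: mem_D_iff)
  fix t :: real assume t: "0 < t" "t < 1"
  let ?x = "cmod (fst z)"
  have "t * ?x \<le> ?x" using t by (simp add: mult_left_le_one_le)
  then have tb: "t * ?x < b" using assms by simp
  have "t * cmod (snd z) < cmod (snd z)" using assms t \<phi>_pos[of ?x] by simp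
  also have "\<dots> \<le> \<phi> (t * ?x)"
    unfolding assms(2) using \<open>t * ?x \<le> ?x\<close> assms t by (intro \<phi>_antimono) auto
  finally show "t *\<^sub>R z \<in> D" using t tb by (simp add: mem_D_iff)
qed

lemma frontier_imp_U: "z \<in> frontier D \<Longrightarrow> z \<in> U"
  using frontier_U by blast

lemma compact_frontier: "compact (frontier D)"
  using D_bounded by (simp add: compact_frontier_bounded)

lemma closure_scale:
  assumes "z \<in> closure D" "d \<in> D" "0 < t" "t \<le> 1" shows "z + t *\<^sub>R (d - z) \<in> D"
  using mem_interior_closure_convex_shrink[OF D_convex _ assms(1,3,4), of d] assms(2) D_open
  by (simp add: interior_open algebra_simps)

lemma \<rho>_cont: "z \<in> U \<Longrightarrow> isCont \<rho> z"
  using \<rho>_deriv has_derivative_continuous by blast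

lemma \<rho>'_cont: "continuous_on U \<rho>'"
  using \<rho>'_deriv has_derivative_continuous continuous_at_imp_continuous_on by blast

lemma \<rho>_frontier: assumes z: "z \<in> frontier D" shows "\<rho> z = 0"
proof -
  have zU: "z \<in> U" by (rule frontier_imp_U[OF z])
  have "\<not> \<rho> z < 0" using z zU D_U by (auto simp: frontier_eq)
  moreover have "\<not> 0 < \<rho> z"
  proof
    assume "0 < \<rho> z"
    then have "\<forall>\<^sub>F w in nhds z. 0 < \<rho> w"
      using \<rho>_cont[OF zU] by (intro order_tendstoD[of \<rho> "\<rho> z"]) (auto simp: isCont_def tendsto_at_iff_tendsto_nhds)
    moreover have "\<forall>\<^sub>F w in nhds z. w \<in> U" using zU U_open by (simp add: eventually_nhds_in_open)
    ultimately have "\<forall>\<^sub>F w in nhds z. 0 < \<rho> w \<and> w \<in> U" by (rule eventually_conj)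
    then obtain S where S: "open S" "z \<in> S" "\<And>w. w \<in> S \<Longrightarrow> 0 < \<rho> w \<and> w \<in> U"
      unfolding eventually_nhds by blast
    have "z \<in> closure D" using z by (simp add: frontier_eq)
    then obtain w where "w \<in> S" "w \<in> D"
      using S(1,2) by (metis closure_iff_nhds_not_empty subset_refl disjoint_iff)
    then have "w \<in> D \<inter> U" "0 < \<rho> w" using S(3)[of w] by auto
    then show False unfolding D_U by simp
  qed
  ultimately show ?thesis by simp
qed

text \<open>A segment from the boundary point into \<open>D\<close> gives the weak inequality.
  Openness makes it strict: equality would be violated after moving \<open>d\<close> a little in a
  direction in which \<rho> increases at \<open>z\<close>.\<close>

lemma \<rho>'_neg: assumes z: "z \<in> frontier D" and d: "d \<in> D" shows "\<rho>' z (d - z) < 0"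
proof -
  have zU: "z \<in> U" by (rule frontier_imp_U[OF z])
  have le: "\<rho>' z (d - z) \<le> 0" if d: "d \<in> D" for d
  proof -
    have "((\<lambda>t. z + t *\<^sub>R (d - z)) has_derivative (\<lambda>t. t *\<^sub>R (d - z))) (at 0 within {0<..})"
      by (auto intro!: derivative_eq_intros)
    moreover have "(\<rho> has_derivative blinfun_apply (\<rho>' z)) (at (z + 0 *\<^sub>R (d - z)))"
      using \<rho>_deriv[OF zU] by simp
    ultimately have "((\<lambda>t. \<rho> (z + t *\<^sub>R (d - z))) has_derivative (\<lambda>t. \<rho>' z (t *\<^sub>R (d - z)))) (at 0 within {0<..})"
      by (rule has_derivative_compose)
    then have "((\<lambda>t. \<rho> (z + t *\<^sub>R (d - z))) has_real_derivative \<rho>' z (d - z)) (at 0 within {0<..})"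
      by (simp add: has_field_derivative_def blinfun.scaleR_right mult_commute_abs)
    then have lim: "((\<lambda>t. \<rho> (z + t *\<^sub>R (d - z)) / t) \<longlongrightarrow> \<rho>' z (d - z)) (at_right 0)"
      by (simp add: has_field_derivative_iff \<rho>_frontier[OF z])
    have "((\<lambda>t. z + t *\<^sub>R (d - z)) \<longlongrightarrow> z + 0 *\<^sub>R (d - z)) (at_right (0::real))" by (intro tendsto_intros)
    then have ev: "\<forall>\<^sub>F t in at_right (0::real). z + t *\<^sub>R (d - z) \<in> U"
      using U_open zU by (intro topological_tendstoD[of _ z]) auto
    have "\<forall>\<^sub>F t in at_right (0::real). \<rho> (z + t *\<^sub>R (d - z)) / t \<le> 0"
      using ev eventually_at_right_real[of 0 "1::real", OF zero_less_one]
    proof eventually_elim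
      case (elim t)
      then have "z + t *\<^sub>R (d - z) \<in> D" using z d by (intro closure_scale) (auto simp: frontier_eq)
      then have "\<rho> (z + t *\<^sub>R (d - z)) < 0" using elim D_U by blast
      then show ?case using elim by (simp add: divide_le_0_iff)
    qed
    then show ?thesis by (intro tendsto_upperbound[OF lim]) auto
  qed
  obtain v where v: "\<rho>' z v > 0"
  proof -
    obtain v where "\<rho>' z v \<noteq> 0" using nondegenerate[OF z] by blast
    then show ?thesis using that[of v] that[of "- v"] by (cases "\<rho>' z v > 0") (auto simp: blinfun.minus_right)
  qed
  have "((\<lambda>t. d + t *\<^sub>R v) \<longlongrightarrow> d + 0 *\<^sub>R v) (at_right (0::real))" by (intro tendsto_intros)
  then have "\<forall>\<^sub>F t in at_right (0::real). d + t *\<^sub>R v \<in> D"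
    using D_open d by (intro topological_tendstoD[of _ d]) auto
  then have "\<forall>\<^sub>F t in at_right (0::real). d + t *\<^sub>R v \<in> D \<and> t > 0"
    using eventually_at_right_less[of "0::real"] by (rule eventually_conj)
  then obtain t where t: "d + t *\<^sub>R v \<in> D" "t > 0"
    using eventually_happens'[of "at_right (0::real)"] by auto
  have "\<rho>' z (d + t *\<^sub>R v - z) \<le> 0" by (rule le[OF t(1)])
  also have "\<rho>' z (d + t *\<^sub>R v - z) = \<rho>' z (d - z) + t * \<rho>' z v"
    by (simp add: blinfun.add_right blinfun.diff_right blinfun.scaleR_right)
  finally show ?thesis using t(2) v by (smt (verit) mult_pos_pos)
qed

text \<open>Along such a segment \<rho> vanishes, so its first and second derivatives in the
  direction \<open>v\<close> vanish, against strong convexity. Strict monotonicity of the profile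
  and its limit at \<open>b\<close> are both reduced to this.\<close>

lemma no_segment:
  assumes v: "v \<noteq> 0" and \<epsilon>: "\<epsilon> > 0" and seg: "\<And>t. \<bar>t\<bar> < \<epsilon> \<Longrightarrow> z + t *\<^sub>R v \<in> frontier D"
  shows False
proof -
  have ball: "t \<in> ball 0 \<epsilon> \<longleftrightarrow> \<bar>t\<bar> < \<epsilon>" for t :: real by (simp add: dist_norm)
  have path: "((\<lambda>t. z + t *\<^sub>R v) has_derivative (\<lambda>t. t *\<^sub>R v)) (at t)" for t :: real
    by (auto intro!: derivative_eq_intros)
  have 0: "\<rho>' (z + t *\<^sub>R v) v = 0" if t: "\<bar>t\<bar> < \<epsilon>" for t
  proof -
    have "((\<lambda>t. \<rho> (z + t *\<^sub>R v)) has_derivative (\<lambda>h. \<rho>' (z + t *\<^sub>R v) (h *\<^sub>R v))) (at t)"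
      by (rule has_derivative_compose[OF path \<rho>_deriv[OF frontier_imp_U[OF seg[OF t]]]])
    moreover have "((\<lambda>t. \<rho> (z + t *\<^sub>R v)) has_derivative (\<lambda>h. 0)) (at t)"
    proof (rule has_derivative_transform_within_open[of "\<lambda>t. 0" _ _ _ "ball 0 \<epsilon>"])
      fix x :: real assume "x \<in> ball 0 \<epsilon>"
      then show "0 = \<rho> (z + x *\<^sub>R v)" using \<rho>_frontier[OF seg] by (simp add: ball)
    qed (use t in \<open>auto simp: ball\<close>)
    ultimately have "(\<lambda>h. \<rho>' (z + t *\<^sub>R v) (h *\<^sub>R v)) = (\<lambda>h. 0)" by (rule has_derivative_unique)
    from fun_cong[OF this, of 1] show ?thesis by simp
  qed
  have z: "z \<in> frontier D" using seg[of 0] \<epsilon> by simp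
  have "(\<rho>' has_derivative blinfun_apply (\<rho>'' z)) (at (z + 0 *\<^sub>R v))"
    using \<rho>'_deriv[OF frontier_imp_U[OF z]] by simp
  from has_derivative_compose[OF path this]
  have "((\<lambda>t. \<rho>' (z + t *\<^sub>R v)) has_derivative (\<lambda>h. \<rho>'' z (h *\<^sub>R v))) (at 0)" .
  from blinfun.FDERIV[OF this has_derivative_const[of v]]
  have "((\<lambda>t. \<rho>' (z + t *\<^sub>R v) v) has_derivative (\<lambda>h. \<rho>'' z (h *\<^sub>R v) v)) (at 0)" by simp
  moreover have "((\<lambda>t. \<rho>' (z + t *\<^sub>R v) v) has_derivative (\<lambda>h. 0)) (at 0)"
    by (rule has_derivative_transform_within_open[of "\<lambda>t. 0" _ _ _ "ball 0 \<epsilon>"]) (auto simp: 0 ball \<epsilon>)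
  ultimately have "(\<lambda>h. \<rho>'' z (h *\<^sub>R v) v) = (\<lambda>h. 0)" by (rule has_derivative_unique)
  from fun_cong[OF this, of 1] have "\<rho>'' z v v = 0" by simp
  moreover have "\<rho>' z v = 0" using 0[of 0] \<epsilon> by simp
  ultimately show False using strict[OF z v] by simp
qed

definition \<gamma> :: "real \<Rightarrow> C2" where "\<gamma> r = pt r (\<phi> r)"

lemma \<gamma>_frontier: "0 \<le> r \<Longrightarrow> r < b \<Longrightarrow> \<gamma> r \<in> frontier D"
  using \<phi>_pos[of r] by (intro frontier_profile) (auto simp: \<gamma>_def)

lemma \<phi>_strict: assumes "0 \<le> x" "x < r" "r < b" shows "\<phi> r < \<phi> x"
proof (rule ccontr)
  assume "\<not> ?thesis"
  then have eq: "\<phi> r = \<phi> x" using \<phi>_antimono[of x r] assms by simp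
  have const: "\<phi> y = \<phi> x" if "x \<le> y" "y \<le> r" for y
    using \<phi>_antimono[of x y] \<phi>_antimono[of y r] that assms eq by simp
  show False
  proof (rule no_segment[of "pt 1 0" "(r - x) / 2" "pt ((x + r) / 2) (\<phi> x)"])
    fix t :: real assume t: "\<bar>t\<bar> < (r - x) / 2"
    let ?y = "(x + r) / 2 + t"
    have y: "x \<le> ?y" "?y \<le> r" using t by (auto simp: abs_less_iff field_simps)
    have "pt ((x + r) / 2) (\<phi> x) + t *\<^sub>R pt 1 0 = \<gamma> ?y"
      using const[OF y] by (simp add: pt_def \<gamma>_def scaleR_conv_of_real)
    then show "pt ((x + r) / 2) (\<phi> x) + t *\<^sub>R pt 1 0 \<in> frontier D"
      using \<gamma>_frontier[of ?y] y assms by simp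
  qed (use assms in \<open>auto simp: pt_def zero_prod_def\<close>)
qed

text \<open>A positive lower bound for \<phi> up to \<open>b\<close> would put a vertical segment
  over the point \<open>b\<close> into the boundary.\<close>

lemma \<phi>_tendsto_0: "(\<phi> \<longlongrightarrow> 0) (at_left b)"
proof (rule decreasing_tendsto)
  show "\<forall>\<^sub>F r in at_left b. 0 \<le> \<phi> r"
    using eventually_at_left_real[OF b_pos] by eventually_elim (auto intro: less_imp_le \<phi>_pos)
  fix c :: real assume c: "0 < c"
  have "\<exists>r\<ge>0. r < b \<and> \<phi> r < c"
  proof (rule ccontr)
    assume "\<not> ?thesis"
    then have ge: "c \<le> \<phi> r" if "0 \<le> r" "r < b" for r using that by (auto simp: not_less)
    show False
    proof (rule no_segment[of "pt 0 1" "c / 2" "pt b (c / 2)"])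
      fix t :: real assume t: "\<bar>t\<bar> < c / 2"
      let ?y = "c / 2 + t"
      have y: "0 < ?y" "?y < c" using t by (auto simp: abs_less_iff field_simps)
      have "pt b ?y \<in> frontier D"
      proof (rule frontierI)
        show "pt b ?y \<notin> D" using b_pos by (auto simp: mem_D_iff)
        fix s :: real assume s: "0 < s" "s < 1"
        have "s * ?y < ?y" using s y by simp
        also have "\<dots> < \<phi> (s * b)" using ge[of "s * b"] s b_pos y by simp
        finally have *: "s * ?y < \<phi> (s * b)" .
        have "s *\<^sub>R pt b ?y = pt (s * b) (s * ?y)" by (simp add: pt_def scaleR_conv_of_real)
        moreover have "pt (s * b) (s * ?y) \<in> D"
          using * s b_pos y by (subst mem_iff_profile) (auto simp: abs_mult)
        ultimately show "s *\<^sub>R pt b ?y \<in> D" by simp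
      qed
      then show "pt b (c / 2) + t *\<^sub>R pt 0 1 \<in> frontier D"
        by (simp add: pt_def scaleR_conv_of_real)
    qed (use c in \<open>auto simp: pt_def zero_prod_def\<close>)
  qed
  then obtain r0 where r0: "0 \<le> r0" "r0 < b" "\<phi> r0 < c" by blast
  show "\<forall>\<^sub>F r in at_left b. \<phi> r < c"
    using eventually_at_left_real[OF r0(2)]
  proof eventually_elim
    case (elim r)
    then show ?case using \<phi>_antimono[of r0 r] r0 by auto
  qed
qed

section \<open>Normal direction and derivatives of the profile\<close>

definition p :: "real \<Rightarrow> real" where "p r = \<rho>' (\<gamma> r) (pt 1 0)"
definition q :: "real \<Rightarrow> real" where "q r = \<rho>' (\<gamma> r) (pt 0 1)"
definition l :: "real \<Rightarrow> real" where "l r = p r / q r"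

lemma support_pq: assumes "0 \<le> r" "r < b" "pt x t \<in> D" shows "p r * (x - r) + q r * (t - \<phi> r) < 0"
  using \<rho>'_neg[OF \<gamma>_frontier[OF assms(1,2)] assms(3)]
  unfolding p_def q_def unfolding \<gamma>_def pt_diff
  by (simp add: blinfun.add_right blinfun.scaleR_right mult.commute)

lemma q_pos: assumes "0 \<le> r" "r < b" shows "0 < q r"
  using support_pq[OF assms less_b_mem, of r] assms \<phi>_pos[OF assms] by (simp add: zero_less_mult_iff)

lemma support_l: assumes "0 \<le> r" "r < b" "pt x t \<in> D" shows "l r * (x - r) + (t - \<phi> r) < 0"
proof -
  have "(p r * (x - r) + q r * (t - \<phi> r)) / q r < 0"
    using support_pq[OF assms] q_pos[OF assms(1,2)] by (simp add: divide_neg_pos)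
  then show ?thesis using q_pos[OF assms(1,2)] by (simp add: l_def add_divide_distrib)
qed

text \<open>The normal at \<open>\<gamma> r\<close> gives a line of slope \<open>- l r\<close> above
  the graph. It is obtained for ordinates below the graph and passed to the limit; negative
  ordinates are treated through the point on the axis.\<close>

lemma supergradient: assumes "0 \<le> r" "r < b" "0 \<le> x" "x < b" shows "\<phi> x - \<phi> r \<le> - l r * (x - r)"
proof -
  have "t \<le> \<phi> r - l r * (x - r)" if "t < \<phi> x" for t
  proof (cases "0 \<le> t")
    case True
    then have "pt x t \<in> D" using that assms by (subst mem_iff_profile) auto
    from support_l[OF assms(1,2) this] show ?thesis by simp
  next
    case False
    have "pt x 0 \<in> D" using assms by (intro less_b_mem) auto
    from support_l[OF assms(1,2) this] False show ?thesis by simp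
  qed
  then have "\<phi> x \<le> \<phi> r - l r * (x - r)" by (rule dense_le)
  then show ?thesis by simp
qed

lemma l_mono: assumes "0 \<le> x" "x \<le> r" "r < b" shows "l x \<le> l r"
proof (cases "x = r")
  case False
  have "(l r - l x) * (r - x) \<ge> 0"
    using supergradient[of r x] supergradient[of x r] assms by (simp add: algebra_simps)
  then show ?thesis using False assms by (simp add: zero_le_mult_iff)
qed simp

lemma l_pos: assumes "0 < r" "r < b" shows "0 < l r"
proof -
  have "\<phi> r < \<phi> 0" by (rule \<phi>_strict) (use assms in auto)
  moreover have "\<phi> 0 - \<phi> r \<le> l r * r" using supergradient[of r 0] assms by simp
  ultimately have "0 < l r * r" by simp
  then show ?thesis using assms by (simp add: zero_less_mult_iff)
qed

lemma \<phi>_lipschitz: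
  assumes "0 \<le> x" "x \<le> r" "r < b"
  shows "\<phi> r \<le> \<phi> x" "\<phi> x - \<phi> r \<le> l r * (r - x)"
  using supergradient[of r x] \<phi>_antimono[of x r] assms by (auto simp: algebra_simps)

lemma \<phi>_continuous_on: assumes "c < b" shows "continuous_on {0..c} \<phi>"
proof (cases "0 \<le> c")
  case True
  have lc: "l r \<le> l c" if "r \<in> {0..c}" for r using l_mono[of r c] that assms by auto
  have *: "\<bar>\<phi> x - \<phi> y\<bar> \<le> \<bar>l c\<bar> * \<bar>x - y\<bar>" if "x \<in> {0..c}" "y \<in> {0..c}" "x \<le> y" for x y
  proof -
    have "\<bar>\<phi> x - \<phi> y\<bar> \<le> l y * (y - x)" using \<phi>_lipschitz[of x y] that assms by auto
    also have "\<dots> \<le> \<bar>l c\<bar> * (y - x)"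
      using lc[OF that(2)] that by (intro mult_right_mono) auto
    finally show ?thesis using that by simp
  qed
  have "\<bar>l c\<bar>-lipschitz_on {0..c} \<phi>"
  proof (rule lipschitz_onI)
    fix x y assume "x \<in> {0..c}" "y \<in> {0..c}"
    then show "dist (\<phi> x) (\<phi> y) \<le> \<bar>l c\<bar> * dist x y"
      using *[of x y] *[of y x] by (cases "x \<le> y") (auto simp: dist_real_def abs_minus_commute)
  qed simp
  then show ?thesis by (rule lipschitz_on_continuous_on)
qed auto

lemma continuous_on_imp_isCont:
  fixes f :: "real \<Rightarrow> 'b::topological_space"
  assumes "\<And>c. c < b \<Longrightarrow> continuous_on {0..c} f" "0 < r" "r < b"
  shows "isCont f r"
proof -
  have "continuous_on {0<..<(r + b)/2} f"
    by (rule continuous_on_subset[OF assms(1)[of "(r + b)/2"]]) (use assms in auto)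
  then show ?thesis using assms(2,3) by (subst (asm) continuous_on_eq_continuous_at) auto
qed

lemma \<gamma>_continuous_on: assumes "c < b" shows "continuous_on {0..c} \<gamma>"
  unfolding \<gamma>_def[abs_def] pt_def by (intro continuous_intros \<phi>_continuous_on assms)

lemma \<rho>'\<gamma>_continuous_on: assumes "c < b" shows "continuous_on {0..c} (\<lambda>r. \<rho>' (\<gamma> r))"
  by (rule continuous_on_compose2[OF \<rho>'_cont \<gamma>_continuous_on[OF assms]])
    (use assms \<gamma>_frontier frontier_U in auto)

lemma \<rho>''\<gamma>_continuous_on: assumes "c < b" shows "continuous_on {0..c} (\<lambda>r. \<rho>'' (\<gamma> r))"
  by (rule continuous_on_compose2[OF \<rho>''_cont \<gamma>_continuous_on[OF assms]])
    (use assms \<gamma>_frontier frontier_U in auto)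

lemma l_continuous_on: assumes "c < b" shows "continuous_on {0..c} l"
  unfolding l_def[abs_def] p_def q_def
proof (intro continuous_intros \<rho>'\<gamma>_continuous_on assms ballI)
  fix r assume "r \<in> {0..c}"
  then show "\<rho>' (\<gamma> r) (pt 0 1) \<noteq> 0" using q_pos[of r] assms by (auto simp: q_def)
qed

lemma l_isCont: "0 < r \<Longrightarrow> r < b \<Longrightarrow> isCont l r"
  by (rule continuous_on_imp_isCont[OF l_continuous_on])

lemma \<phi>_isCont: "0 < r \<Longrightarrow> r < b \<Longrightarrow> isCont \<phi> r"
  by (rule continuous_on_imp_isCont[OF \<phi>_continuous_on])

text \<open>The difference quotient of \<open>\<phi>\<close> between \<open>r\<close> and \<open>x\<close> is squeezed between the slopes
  \<open>- l r\<close> and \<open>- l x\<close> of the two supporting lines, and \<open>l\<close> is continuous.\<close>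

lemma \<phi>_deriv: assumes r: "0 < r" "r < b" shows "(\<phi> has_real_derivative - l r) (at r)"
proof -
  have lim: "((\<lambda>x. \<bar>l x - l r\<bar>) \<longlongrightarrow> 0) (at r)"
    using l_isCont[OF r] by (auto simp: isCont_def tendsto_rabs_zero_iff LIM_zero_iff)
  have lim0: "((\<lambda>x. (\<phi> x - \<phi> r) / (x - r) - (- l r)) \<longlongrightarrow> 0) (at r)"
  proof (rule Lim_null_comparison[OF _ lim])
    have "\<forall>\<^sub>F x in at r. x \<in> {0<..<b}" using r by (intro eventually_at_in_open') auto
    moreover have "\<forall>\<^sub>F x in at r. x \<noteq> r" by (simp add: eventually_at_filter)
    ultimately show "\<forall>\<^sub>F x in at r. norm ((\<phi> x - \<phi> r) / (x - r) - (- l r)) \<le> \<bar>l x - l r\<bar>"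
    proof eventually_elim
      case (elim x)
      have 1: "\<phi> x - \<phi> r + l r * (x - r) \<le> 0" using supergradient[of r x] r elim by simp
      have 2: "\<phi> x - \<phi> r + l r * (x - r) \<ge> (l r - l x) * (x - r)"
        using supergradient[of x r] r elim by (simp add: algebra_simps)
      have "- (\<phi> x - \<phi> r + l r * (x - r)) \<le> (l x - l r) * (x - r)"
        using 2 by (simp add: algebra_simps)
      also have "\<dots> \<le> \<bar>l x - l r\<bar> * \<bar>x - r\<bar>"
        unfolding abs_mult[symmetric] by (rule abs_ge_self)
      finally have "\<bar>\<phi> x - \<phi> r + l r * (x - r)\<bar> \<le> \<bar>l x - l r\<bar> * \<bar>x - r\<bar>"
        using 1 by linarith
      then have "\<bar>(\<phi> x - \<phi> r + l r * (x - r)) / (x - r)\<bar> \<le> \<bar>l x - l r\<bar>"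
        using elim by (simp add: abs_divide pos_divide_le_eq)
      moreover have "(\<phi> x - \<phi> r + l r * (x - r)) / (x - r) = (\<phi> x - \<phi> r) / (x - r) - (- l r)"
        using elim by (simp add: add_divide_distrib)
      ultimately show ?case by simp
    qed
  qed
  show ?thesis unfolding has_field_derivative_iff by (rule LIM_zero_cancel[OF lim0])
qed

lemma \<gamma>_deriv: assumes r: "0 < r" "r < b" shows "(\<gamma> has_vector_derivative pt 1 (- l r)) (at r)"
proof -
  have "((\<lambda>r. (complex_of_real r, complex_of_real (\<phi> r))) has_vector_derivative
      (complex_of_real 1, complex_of_real (- l r))) (at r)"
    by (intro has_vector_derivative_Pair has_vector_derivative_of_real)
      (use \<phi>_deriv[OF r] in \<open>auto simp: has_real_derivative_iff_has_vector_derivative\<close>)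
  then show ?thesis by (simp add: \<gamma>_def[abs_def] pt_def)
qed

lemma \<rho>'\<gamma>_deriv:
  assumes r: "0 < r" "r < b"
  shows "((\<lambda>r. \<rho>' (\<gamma> r) v) has_real_derivative \<rho>'' (\<gamma> r) (pt 1 (- l r)) v) (at r)"
proof -
  have "\<gamma> r \<in> U" using r by (intro frontier_imp_U \<gamma>_frontier) auto
  from has_derivative_compose[OF \<gamma>_deriv[OF r, unfolded has_vector_derivative_def] \<rho>'_deriv[OF this]]
  have "((\<lambda>r. \<rho>' (\<gamma> r)) has_derivative (\<lambda>h. \<rho>'' (\<gamma> r) (h *\<^sub>R pt 1 (- l r)))) (at r)" .
  from blinfun.FDERIV[OF this has_derivative_const[of v]]
  have "((\<lambda>r. \<rho>' (\<gamma> r) v) has_derivative (\<lambda>h. \<rho>'' (\<gamma> r) (h *\<^sub>R pt 1 (- l r)) v)) (at r)" by simp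
  then show ?thesis
    by (simp add: has_field_derivative_def blinfun.scaleR_right blinfun.scaleR_left mult_commute_abs)
qed

definition l' :: "real \<Rightarrow> real" where
  "l' r = (\<rho>'' (\<gamma> r) (pt 1 (- l r)) (pt 1 0) * q r - p r * \<rho>'' (\<gamma> r) (pt 1 (- l r)) (pt 0 1)) / (q r * q r)"

text \<open>\<open>l\<close> is a quotient of gradient components along the differentiable curve
  \<gamma>. As the derivative of \<phi> is \<open>- l\<close>, this and the continuity of
  \<open>l'\<close> make \<phi> twice continuously differentiable on the open interval.\<close>

lemma l_deriv: assumes r: "0 < r" "r < b" shows "(l has_real_derivative l' r) (at r)"
proof -
  have "(p has_real_derivative \<rho>'' (\<gamma> r) (pt 1 (- l r)) (pt 1 0)) (at r)"
    "(q has_real_derivative \<rho>'' (\<gamma> r) (pt 1 (- l r)) (pt 0 1)) (at r)"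
    unfolding p_def[abs_def] q_def[abs_def] by (intro \<rho>'\<gamma>_deriv r)+
  then have "((\<lambda>r. p r / q r) has_real_derivative l' r) (at r)"
    unfolding l'_def using q_pos[of r] r by (intro DERIV_divide) auto
  then show ?thesis by (simp add: l_def[abs_def])
qed

lemma l'_isCont: assumes r: "0 < r" "r < b" shows "isCont l' r"
proof (rule continuous_on_imp_isCont[OF _ r])
  fix c assume c: "c < b"
  show "continuous_on {0..c} l'"
    unfolding l'_def[abs_def] p_def q_def pt_def
  proof (intro continuous_intros \<rho>'\<gamma>_continuous_on \<rho>''\<gamma>_continuous_on l_continuous_on c ballI)
    fix r assume "r \<in> {0..c}"
    then show "\<rho>' (\<gamma> r) (complex_of_real 0, complex_of_real 1) * \<rho>' (\<gamma> r) (complex_of_real 0, complex_of_real 1) \<noteq> 0"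
      using q_pos[of r] c by (auto simp: q_def pt_def)
  qed
qed

lemma l'_nonneg: assumes r: "0 < r" "r < b" shows "0 \<le> l' r"
proof (rule ccontr)
  assume "\<not> ?thesis"
  then obtain d where d: "0 < d" "\<And>h. 0 < h \<Longrightarrow> h < d \<Longrightarrow> l r > l (r + h)"
    using DERIV_neg_dec_right[OF l_deriv[OF r]] by auto
  define h where "h = min (d/2) ((b - r)/2)"
  have "0 < h" "h < d" "r + h < b" using d r by (auto simp: h_def min_def field_simps)
  then show False using d(2)[of h] l_mono[of r "r + h"] r by simp
qed

section \<open>The coordinate s as a function of the first radius\<close>

definition \<sigma> :: "real \<Rightarrow> real" where "\<sigma> r = r * l r / (r * l r + \<phi> r)"
definition \<sigma>' :: "real \<Rightarrow> real" where
  "\<sigma>' r = ((l r + r * l' r) * \<phi> r + r * l r * l r) / (r * l r + \<phi> r)\<^sup>2"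

lemma den_pos: assumes "0 < r" "r < b" shows "0 < r * l r + \<phi> r"
  using l_pos[OF assms] \<phi>_pos[of r] assms by (intro add_pos_pos mult_pos_pos) auto

lemma \<sigma>_bounds: assumes "0 < r" "r < b" shows "0 < \<sigma> r" "\<sigma> r < 1"
  using den_pos[OF assms] l_pos[OF assms] \<phi>_pos[of r] assms by (auto simp: \<sigma>_def)

text \<open>These are the reciprocals of the intercepts of the supporting line at
  \<open>\<gamma> r\<close> on the two axes, so that line reads x \<sigma>/r + y (1-\<sigma>)/\<phi>
  = 1. They are the coefficients in the Leray kernel.\<close>

lemma \<sigma>_div: assumes "0 < r" "r < b"
  shows "\<sigma> r / r = l r / (r * l r + \<phi> r)" "(1 - \<sigma> r) / \<phi> r = 1 / (r * l r + \<phi> r)"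
proof -
  show "\<sigma> r / r = l r / (r * l r + \<phi> r)" using assms by (simp add: \<sigma>_def)
  have "1 - \<sigma> r = \<phi> r / (r * l r + \<phi> r)" using den_pos[OF assms] by (simp add: \<sigma>_def diff_divide_eq_iff)
  then show "(1 - \<sigma> r) / \<phi> r = 1 / (r * l r + \<phi> r)" using \<phi>_pos[of r] assms by simp
qed

lemma \<sigma>_deriv: assumes r: "0 < r" "r < b" shows "(\<sigma> has_real_derivative \<sigma>' r) (at r)"
proof -
  have "((\<lambda>r. r * l r / (r * l r + \<phi> r)) has_real_derivative
    ((1 * l r + l' r * r) * (r * l r + \<phi> r) - r * l r * (1 * l r + l' r * r + - l r)) / ((r * l r + \<phi> r) * (r * l r + \<phi> r))) (at r)"
    using den_pos[OF r] by (intro DERIV_divide DERIV_mult DERIV_add DERIV_ident l_deriv \<phi>_deriv r) auto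
  then show ?thesis unfolding \<sigma>_def[abs_def] \<sigma>'_def by (simp add: algebra_simps power2_eq_square)
qed

lemma \<sigma>'_pos: assumes r: "0 < r" "r < b" shows "0 < \<sigma>' r"
proof -
  have "0 < (l r + r * l' r) * \<phi> r + r * l r * l r"
    using l_pos[OF r] l'_nonneg[OF r] \<phi>_pos[of r] r
    by (intro add_pos_pos mult_pos_pos add_pos_nonneg) auto
  then show ?thesis using den_pos[OF r] by (auto simp: \<sigma>'_def)
qed

lemma \<sigma>'_isCont: assumes r: "0 < r" "r < b" shows "isCont \<sigma>' r"
  unfolding \<sigma>'_def[abs_def] using den_pos[OF r]
  by (intro continuous_intros l_isCont l'_isCont \<phi>_isCont r) auto

lemma \<sigma>_isCont: assumes r: "0 < r" "r < b" shows "isCont \<sigma> r"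
  using \<sigma>_deriv[OF r] by (rule DERIV_isCont)

lemma \<sigma>_tendsto_0: "(\<sigma> \<longlongrightarrow> 0) (at_right 0)"
proof (rule Lim_null_comparison)
  have c: "0 < b/2" "b/2 < b" using b_pos by auto
  show "((\<lambda>r. r * l (b/2) / \<phi> (b/2)) \<longlongrightarrow> 0) (at_right 0)"
    using tendsto_mult_left_zero[of "\<lambda>r. r" "at_right 0" "l (b/2) / \<phi> (b/2)"] by simp
  show "\<forall>\<^sub>F r in at_right 0. norm (\<sigma> r) \<le> r * l (b/2) / \<phi> (b/2)"
    using eventually_at_right_real[OF c(1)]
  proof eventually_elim
    case (elim r)
    then have r: "0 < r" "r < b" using c by auto
    have "\<phi> (b/2) \<le> r * l r + \<phi> r"
      using \<phi>_antimono[of r "b/2"] l_pos[OF r] r elim c by (intro add_increasing) auto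
    moreover have "r * l r \<le> r * l (b/2)" using l_mono[of r "b/2"] elim c by simp
    ultimately have "r * l r / (r * l r + \<phi> r) \<le> r * l (b/2) / \<phi> (b/2)"
      using l_pos[OF r] r \<phi>_pos[of "b/2"] c by (intro frac_le) auto
    moreover have "norm (\<sigma> r) = \<sigma> r" using \<sigma>_bounds[OF r] by simp
    ultimately show ?case by (simp add: \<sigma>_def)
  qed
qed

text \<open>\<open>1 - \<sigma> r\<close> is \<phi> divided by \<open>r * l r + \<phi> r\<close>;
  the numerator tends to 0 while \<open>r * l r\<close> stays bounded below. This covers finite and
  infinite slope at \<open>b\<close> alike.\<close>

lemma \<sigma>_tendsto_1: "(\<sigma> \<longlongrightarrow> 1) (at_left b)"
proof -
  have c: "0 < b/2" "b/2 < b" using b_pos by auto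
  have "((\<lambda>r. 1 - \<sigma> r) \<longlongrightarrow> 0) (at_left b)"
  proof (rule Lim_null_comparison)
    show "((\<lambda>r. \<phi> r / (b/2 * l (b/2))) \<longlongrightarrow> 0) (at_left b)"
      using tendsto_divide[OF \<phi>_tendsto_0 tendsto_const, of "b/2 * l (b/2)"] c l_pos[OF c] by simp
    show "\<forall>\<^sub>F r in at_left b. norm (1 - \<sigma> r) \<le> \<phi> r / (b/2 * l (b/2))"
      using eventually_at_left_real[OF c(2)]
    proof eventually_elim
      case (elim r)
      then have r: "0 < r" "r < b" using c by auto
      have "b/2 * l (b/2) \<le> r * l r" using elim c l_mono[of "b/2" r] l_pos[OF c] by (intro mult_mono) auto
      then have "b/2 * l (b/2) \<le> r * l r + \<phi> r" using \<phi>_pos[of r] r by simp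
      then have "\<phi> r / (r * l r + \<phi> r) \<le> \<phi> r / (b/2 * l (b/2))"
        using \<phi>_pos[of r] r mult_pos_pos[OF c(1) l_pos[OF c]] by (intro divide_left_mono) (auto intro: mult_pos_pos den_pos)
      moreover have "1 - \<sigma> r = \<phi> r / (r * l r + \<phi> r)" using den_pos[OF r] by (simp add: \<sigma>_def field_simps)
      moreover have "norm (1 - \<sigma> r) = 1 - \<sigma> r" using \<sigma>_bounds[OF r] by simp
      ultimately show ?case by simp
    qed
  qed
  from tendsto_diff[OF tendsto_const[of 1] this] show ?thesis by simp
qed

text \<open>\<open>w\<close> stays in \<open>D\<close> after a slight dilation, so it keeps a
  uniform relative distance from all supporting lines. The bound \<open>k < 1\<close> makes the
  expansion of the kernel converge uniformly in the boundary point.\<close>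

lemma support_\<sigma>:
  assumes w: "w \<in> D"
  obtains k where "0 \<le> k" "k < 1"
    "\<And>r. 0 < r \<Longrightarrow> r < b \<Longrightarrow> \<sigma> r / r * cmod (fst w) + (1 - \<sigma> r) / \<phi> r * cmod (snd w) \<le> k"
proof -
  obtain \<epsilon> where \<epsilon>: "\<epsilon> > 0" "pt (cmod (fst w) + \<epsilon>) (cmod (snd w) + \<epsilon>) \<in> D"
    using w mem_cmod pt_enlarge by metis
  define x where "x = cmod (fst w)"
  define y where "y = cmod (snd w)"
  \<comment> \<open>The available enlargement by \<epsilon> is additive; the divisor
    \<open>x + y + 1\<close> keeps the dilation of both coordinates within it.\<close>
  define \<tau> where "\<tau> = 1 + \<epsilon> / (x + y + 1)"
  have xy: "0 \<le> x" "0 \<le> y" by (auto simp: x_def y_def)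
  have \<tau>: "1 < \<tau>" using \<epsilon>(1) xy by (simp add: \<tau>_def)
  have le: "u * \<tau> \<le> u + \<epsilon>" if "0 \<le> u" "u \<le> x + y + 1" for u
  proof -
    have "u * (\<epsilon> / (x + y + 1)) \<le> \<epsilon>" using that \<epsilon>(1) xy by (simp add: pos_divide_le_eq mult.commute mult_left_mono)
    then show ?thesis by (simp add: \<tau>_def distrib_left)
  qed
  have mem: "pt (x * \<tau>) (y * \<tau>) \<in> D"
    using \<epsilon> xy le[of x] le[of y] \<tau> by (intro pt_shrink[OF \<epsilon>(2)]) (auto simp: x_def[symmetric] y_def[symmetric])
  show ?thesis
  proof (rule that[of "1 / \<tau>"])
    fix r assume r: "0 < r" "r < b"
    have "l r * (x * \<tau>) + y * \<tau> < r * l r + \<phi> r"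
      using support_l[of r, OF _ r(2) mem] r by (simp add: algebra_simps)
    then have "(l r * x + y) * \<tau> / (r * l r + \<phi> r) \<le> 1"
      using den_pos[OF r] by (simp add: algebra_simps)
    then have "(l r * x + y) / (r * l r + \<phi> r) \<le> 1 / \<tau>" using \<tau> by (simp add: field_simps)
    then show "\<sigma> r / r * cmod (fst w) + (1 - \<sigma> r) / \<phi> r * cmod (snd w) \<le> 1 / \<tau>"
      unfolding \<sigma>_div[OF r] x_def y_def by (simp add: add_divide_distrib)
  qed (use \<tau> in auto)
qed

end

subsection \<open>Symmetry of second derivatives\<close>

text \<open>The mean value theorem for the function \<open>g\<close> of x given by f (z + x u + t v)
  - f (z + x u) reduces the second difference to a difference of \<open>f'\<close> near
  \<open>z\<close>, which the derivative \<open>F\<close> of \<open>f'\<close> at \<open>z\<close>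
  controls. The second difference is symmetric in \<open>u\<close> and \<open>v\<close>, whence the
  symmetry of \<open>F\<close>.\<close>

lemma second_difference:
  fixes f :: "'a::real_normed_vector \<Rightarrow> real" and F :: "'a \<Rightarrow>\<^sub>L 'a \<Rightarrow>\<^sub>L real"
  assumes S: "open S" "z \<in> S" and f: "\<And>x. x \<in> S \<Longrightarrow> (f has_derivative blinfun_apply (f' x)) (at x)"
    and F: "(f' has_derivative blinfun_apply F) (at z)" and e: "e > 0"
  obtains t0 where "t0 > 0" "\<And>t. 0 < t \<Longrightarrow> t < t0 \<Longrightarrow>
    \<bar>f (z + t *\<^sub>R u + t *\<^sub>R v) - f (z + t *\<^sub>R u) - f (z + t *\<^sub>R v) + f z - t\<^sup>2 * F v u\<bar> \<le> e * t\<^sup>2"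
proof -
  define c where "c = norm u + norm v"
  have c0: "0 \<le> c" by (simp add: c_def)
  \<comment> \<open>Two errors of size \<open>e' * (t * c)\<close>, applied to \<open>u\<close> and
    multiplied by \<open>t\<close>, add up to at most \<open>e * t\<^sup>2\<close>; the 1 avoids
    division by 0.\<close>
  define e' where "e' = e / (2 * c * norm u + 1)"
  have k0: "0 < 2 * c * norm u + 1" using c0 by (simp add: add_nonneg_pos)
  have e'0: "0 < e'" using e k0 by (simp add: e'_def)
  obtain d where d: "0 < d" "\<And>y. norm (y - z) < d \<Longrightarrow> norm (f' y - f' z - F (y - z)) \<le> e' * norm (y - z)"
    using F e'0 unfolding has_derivative_at_alt by blast
  obtain d1 where d1: "0 < d1" "\<And>y. norm (y - z) < d1 \<Longrightarrow> y \<in> S"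
    using S unfolding open_dist dist_norm by blast
  show ?thesis
  proof (rule that[of "min d d1 / (c + 1)"])
    show "0 < min d d1 / (c + 1)" using d(1) d1(1) c0 by simp
    fix t :: real assume t: "0 < t" "t < min d d1 / (c + 1)"
    then have "t * (c + 1) < min d d1" using c0 by (simp add: pos_less_divide_eq)
    then have tc: "t * c < d" "t * c < d1" using t(1) by (auto simp: distrib_left)
    have n1: "norm ((z + x *\<^sub>R u + t *\<^sub>R v) - z) \<le> t * c" "norm ((z + x *\<^sub>R u) - z) \<le> t * c"
      if "0 \<le> x" "x \<le> t" for x
    proof -
      have "norm (x *\<^sub>R u) \<le> t * norm u" "norm (t *\<^sub>R v) = t * norm v"
        using that t(1) by (auto intro: mult_right_mono)
      then show "norm ((z + x *\<^sub>R u + t *\<^sub>R v) - z) \<le> t * c" "norm ((z + x *\<^sub>R u) - z) \<le> t * c"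
        using norm_triangle_ineq[of "x *\<^sub>R u" "t *\<^sub>R v"] t(1) by (auto simp: c_def distrib_left add.assoc intro: add_increasing2)
    qed
    define g where "g x = f (z + x *\<^sub>R u + t *\<^sub>R v) - f (z + x *\<^sub>R u)" for x
    have "(g has_real_derivative f' (z + x *\<^sub>R u + t *\<^sub>R v) u - f' (z + x *\<^sub>R u) u) (at x)" if "0 \<le> x" "x \<le> t" for x
    proof -
      have m: "z + x *\<^sub>R u + t *\<^sub>R v \<in> S" "z + x *\<^sub>R u \<in> S"
        using n1[OF that] tc(2) by (auto intro!: d1(2) elim: le_less_trans)
      have 1: "((\<lambda>x. z + x *\<^sub>R u + t *\<^sub>R v) has_derivative (\<lambda>h. h *\<^sub>R u)) (at x)"
        "((\<lambda>x. z + x *\<^sub>R u) has_derivative (\<lambda>h. h *\<^sub>R u)) (at x)"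
        by (auto intro!: derivative_eq_intros)
      have "(g has_derivative (\<lambda>h. f' (z + x *\<^sub>R u + t *\<^sub>R v) (h *\<^sub>R u) - f' (z + x *\<^sub>R u) (h *\<^sub>R u))) (at x)"
        unfolding g_def[abs_def]
        by (intro has_derivative_diff has_derivative_compose[OF 1(1) f] has_derivative_compose[OF 1(2) f] m)
      moreover have "(\<lambda>h. f' (z + x *\<^sub>R u + t *\<^sub>R v) (h *\<^sub>R u) - f' (z + x *\<^sub>R u) (h *\<^sub>R u))
          = (*) (f' (z + x *\<^sub>R u + t *\<^sub>R v) u - f' (z + x *\<^sub>R u) u)"
        by (auto simp: blinfun.scaleR_right fun_eq_iff algebra_simps)
      ultimately show ?thesis by (simp add: has_field_derivative_def)
    qed
    from MVT2[OF t(1) this] obtain \<xi> where \<xi>: "0 < \<xi>" "\<xi> < t"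
      "g t - g 0 = t * (f' (z + \<xi> *\<^sub>R u + t *\<^sub>R v) u - f' (z + \<xi> *\<^sub>R u) u)" by auto
    define A where "A = f' (z + \<xi> *\<^sub>R u + t *\<^sub>R v) - f' z - F (\<xi> *\<^sub>R u + t *\<^sub>R v)"
    define B where "B = f' (z + \<xi> *\<^sub>R u) - f' z - F (\<xi> *\<^sub>R u)"
    have n\<xi>: "norm ((z + \<xi> *\<^sub>R u + t *\<^sub>R v) - z) \<le> t * c" "norm ((z + \<xi> *\<^sub>R u) - z) \<le> t * c"
      using n1[of \<xi>] \<xi> by auto
    have "norm A \<le> e' * (t * c)"
      using order_trans[OF d(2)[OF le_less_trans[OF n\<xi>(1) tc(1)]] mult_left_mono[OF n\<xi>(1) less_imp_le[OF e'0]]]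
      by (simp add: A_def add.assoc)
    moreover have "norm B \<le> e' * (t * c)"
      using order_trans[OF d(2)[OF le_less_trans[OF n\<xi>(2) tc(1)]] mult_left_mono[OF n\<xi>(2) less_imp_le[OF e'0]]]
      by (simp add: B_def)
    ultimately have AB: "norm (A - B) \<le> 2 * e' * (t * c)" using norm_triangle_ineq4[of A B] by simp
    have "f' (z + \<xi> *\<^sub>R u + t *\<^sub>R v) u - f' (z + \<xi> *\<^sub>R u) u = (A - B) u + t * F v u"
      by (simp add: A_def B_def blinfun.diff_left blinfun.add_right blinfun.add_left blinfun.scaleR_right blinfun.scaleR_left)
    then have "g t - g 0 - t\<^sup>2 * F v u = t * (A - B) u"
      unfolding \<xi>(3) by (simp add: algebra_simps power2_eq_square)
    then have "\<bar>g t - g 0 - t\<^sup>2 * F v u\<bar> = t * \<bar>(A - B) u\<bar>" using t(1) by (simp add: abs_mult)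
    also have "\<dots> \<le> t * (norm (A - B) * norm u)"
      using norm_blinfun[of "A - B" u] t(1) by (intro mult_left_mono) auto
    also have "\<dots> \<le> t * (2 * e' * (t * c) * norm u)"
      using t(1) by (intro mult_left_mono mult_right_mono AB) auto
    also have "\<dots> = e' * (2 * c * norm u) * t\<^sup>2" by (simp add: power2_eq_square)
    also have "\<dots> \<le> e' * (2 * c * norm u + 1) * t\<^sup>2" using e'0 by (intro mult_right_mono mult_left_mono) auto
    also have "\<dots> = e * t\<^sup>2" using k0 by (simp add: e'_def)
    finally show "\<bar>f (z + t *\<^sub>R u + t *\<^sub>R v) - f (z + t *\<^sub>R u) - f (z + t *\<^sub>R v) + f z - t\<^sup>2 * F v u\<bar> \<le> e * t\<^sup>2"
      by (simp add: g_def algebra_simps)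
  qed
qed

lemma second_derivative_symmetric:
  fixes f :: "'a::real_normed_vector \<Rightarrow> real" and F :: "'a \<Rightarrow>\<^sub>L 'a \<Rightarrow>\<^sub>L real"
  assumes S: "open S" "z \<in> S" and f: "\<And>x. x \<in> S \<Longrightarrow> (f has_derivative blinfun_apply (f' x)) (at x)"
    and F: "(f' has_derivative blinfun_apply F) (at z)"
  shows "F u v = F v u"
proof -
  have "\<bar>F v u - F u v\<bar> \<le> 2 * e" if e: "e > 0" for e
  proof -
    obtain t1 where t1: "t1 > 0" "\<And>t. 0 < t \<Longrightarrow> t < t1 \<Longrightarrow>
      \<bar>f (z + t *\<^sub>R u + t *\<^sub>R v) - f (z + t *\<^sub>R u) - f (z + t *\<^sub>R v) + f z - t\<^sup>2 * F v u\<bar> \<le> e * t\<^sup>2"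
      using second_difference[OF S f F e, of u v] by metis
    obtain t2 where t2: "t2 > 0" "\<And>t. 0 < t \<Longrightarrow> t < t2 \<Longrightarrow>
      \<bar>f (z + t *\<^sub>R v + t *\<^sub>R u) - f (z + t *\<^sub>R v) - f (z + t *\<^sub>R u) + f z - t\<^sup>2 * F u v\<bar> \<le> e * t\<^sup>2"
      using second_difference[OF S f F e, of v u] by metis
    define t where "t = min t1 t2 / 2"
    have t: "0 < t" "t < t1" "t < t2" using t1(1) t2(1) by (auto simp: t_def)
    have "z + t *\<^sub>R v + t *\<^sub>R u = z + t *\<^sub>R u + t *\<^sub>R v" by simp
    note t2(2)[OF t(1,3), unfolded this]
    then have "\<bar>t\<^sup>2 * F v u - t\<^sup>2 * F u v\<bar> \<le> 2 * (e * t\<^sup>2)"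
      using t1(2)[OF t(1,2)] by linarith
    moreover have "\<bar>t\<^sup>2 * F v u - t\<^sup>2 * F u v\<bar> = t\<^sup>2 * \<bar>F v u - F u v\<bar>"
      by (simp only: right_diff_distrib[symmetric] abs_mult abs_power2)
    ultimately have "t\<^sup>2 * \<bar>F v u - F u v\<bar> \<le> t\<^sup>2 * (2 * e)" by (simp add: mult_ac)
    then show ?thesis using t(1) by simp
  qed
  then have "\<bar>F v u - F u v\<bar> \<le> 0 + \<epsilon>" if "\<epsilon> > 0" for \<epsilon> using that by (metis add_0 field_sum_of_halves half_gt_zero mult_2)
  then have "\<bar>F v u - F u v\<bar> \<le> 0" by (rule field_le_epsilon)
  then show ?thesis by simp
qed

subsection \<open>The Leray form in polar coordinates\<close>

definition J :: "C2 \<Rightarrow> C2" where "J v = (\<i> * fst v, \<i> * snd v)"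

lemma J_scaleR: "J (c *\<^sub>R v) = c *\<^sub>R J v" and J_add: "J (u + v) = J u + J v" and J_J: "J (J v) = - v"
  and norm_J: "norm (J v) = norm v"
  by (simp_all add: J_def prod_eq_iff distrib_left norm_prod_def norm_mult)

lemma bounded_linear_J: "bounded_linear J"
  by (rule bounded_linear_intro[of _ 1]) (simp_all add: J_add J_scaleR norm_J)

text \<open>Commuting with \<open>J\<close> makes a real linear form complex linear, hence
  determined by its values on the two coordinate vectors.\<close>

lemma complex_linear_expand:
  fixes F :: "C2 \<Rightarrow> complex"
  assumes add: "\<And>u v. F (u + v) = F u + F v" and sc: "\<And>c v. F (c *\<^sub>R v) = c *\<^sub>R F v"
    and J: "\<And>v. F (J v) = \<i> * F v"
  shows "F v = F (1, 0) * fst v + F (0, 1) * snd v"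
proof -
  have "v = (Re (fst v) *\<^sub>R (1, 0) + Im (fst v) *\<^sub>R J (1, 0)) + (Re (snd v) *\<^sub>R (0, 1) + Im (snd v) *\<^sub>R J (0, 1))"
    by (simp add: J_def prod_eq_iff scaleR_conv_of_real complex_eq mult.commute)
  then have "F v = (Re (fst v) *\<^sub>R F (1, 0) + Im (fst v) *\<^sub>R (\<i> * F (1, 0)))
      + (Re (snd v) *\<^sub>R F (0, 1) + Im (snd v) *\<^sub>R (\<i> * F (0, 1)))"
    by (metis add sc J)
  also have "\<dots> = F (1, 0) * (Re (fst v) + \<i> * Im (fst v)) + F (0, 1) * (Re (snd v) + \<i> * Im (snd v))"
    by (simp add: scaleR_conv_of_real algebra_simps)
  finally show ?thesis by (simp only: complex_eq[symmetric])
qed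

context smooth_reinhardt
begin

section \<open>The form \<partial>\<rho> and its derivative\<close>

lemma \<rho>''_sym: "z \<in> U \<Longrightarrow> \<rho>'' z u v = \<rho>'' z v u"
  by (rule second_derivative_symmetric[OF U_open _ \<rho>_deriv \<rho>'_deriv])

definition dz :: "C2 \<Rightarrow> C2 \<Rightarrow> complex" where
  "dz z v = (of_real (\<rho>' z v) - \<i> * of_real (\<rho>' z (J v))) / 2"

text \<open>\<open>dz z\<close> is the value of \<partial>\<rho> at \<open>z\<close>, and
  \<open>H z u v\<close> is the derivative of \<open>dz z v\<close> in the direction
  \<open>u\<close>: real linear in \<open>u\<close>, complex linear in \<open>v\<close>.\<close>

definition H :: "C2 \<Rightarrow> C2 \<Rightarrow> C2 \<Rightarrow> complex" where
  "H z u v = (of_real (\<rho>'' z u v) - \<i> * of_real (\<rho>'' z u (J v))) / 2"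

lemmas bl = blinfun.add_right blinfun.add_left blinfun.scaleR_right blinfun.scaleR_left
  blinfun.minus_right blinfun.minus_left blinfun.diff_right blinfun.diff_left

lemma dz_linear: "dz z (u + v) = dz z u + dz z v" "dz z (c *\<^sub>R v) = c *\<^sub>R dz z v" "dz z (J v) = \<i> * dz z v"
  by (simp_all add: dz_def J_add J_scaleR J_J bl scaleR_conv_of_real field_simps)

lemma dz_minus: "dz z (- v) = - dz z v"
  using dz_linear(2)[of z "-1" v] by simp

lemma H_linear: "H z u (v + w) = H z u v + H z u w" "H z u (c *\<^sub>R v) = c *\<^sub>R H z u v" "H z u (J v) = \<i> * H z u v"
  "H z (u + w) v = H z u v + H z w v" "H z (c *\<^sub>R u) v = c *\<^sub>R H z u v"
  by (simp_all add: H_def J_add J_scaleR J_J bl scaleR_conv_of_real field_simps)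

lemma H_minus: "H z u (- v) = - H z u v"
  using H_linear(2)[of z u "-1" v] by simp

lemma dz_expand: "dz z v = dz z (1, 0) * fst v + dz z (0, 1) * snd v"
  by (rule complex_linear_expand) (rule dz_linear)+

lemma H_expand: "H z u v = H z u (1, 0) * fst v + H z u (0, 1) * snd v"
  by (rule complex_linear_expand) (rule H_linear)+

lemma del_\<rho>: assumes "z \<in> U" shows "del (\<lambda>x. complex_of_real (\<rho> x)) z = dz z"
proof -
  have "((\<lambda>x. complex_of_real (\<rho> x)) has_derivative (\<lambda>v. of_real (\<rho>' z v))) (at z)"
    by (rule has_derivative_of_real[OF \<rho>_deriv[OF assms]])
  from frechet_derivative_at[OF this, symmetric]
  show ?thesis by (auto simp: del_def dz_def J_def fun_eq_iff)
qed

lemma dz_deriv: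
  assumes "z \<in> U" shows "((\<lambda>z. dz z v) has_derivative (\<lambda>u. H z u v)) (at z)"
proof -
  have "((\<lambda>z. \<rho>' z w) has_derivative (\<lambda>u. \<rho>'' z u w)) (at z)" for w
    using blinfun.FDERIV[OF \<rho>'_deriv[OF assms] has_derivative_const[of w]] by simp
  note d = this
  show ?thesis unfolding dz_def H_def
    by (intro bounded_linear.has_derivative[OF bounded_linear_divide] has_derivative_diff
        has_derivative_mult_right has_derivative_of_real d)
qed

lemma delbar_wirtinger:
  assumes z: "z \<in> U"
  shows "delbar (wirtinger1 \<rho>) z u = (H z u (1, 0) + \<i> * H z (J u) (1, 0)) / 2"
    "delbar (wirtinger2 \<rho>) z u = (H z u (0, 1) + \<i> * H z (J u) (0, 1)) / 2"
proof -
  have "(wirtinger1 \<rho> has_derivative (\<lambda>u. H z u (1, 0))) (at z)"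
    by (rule has_derivative_transform_within_open[OF dz_deriv[OF z] U_open z]) (simp add: wirtinger1_def del_\<rho>)
  from frechet_derivative_at[OF this, symmetric]
  show "delbar (wirtinger1 \<rho>) z u = (H z u (1, 0) + \<i> * H z (J u) (1, 0)) / 2"
    by (simp add: delbar_def J_def)
  have "(wirtinger2 \<rho> has_derivative (\<lambda>u. H z u (0, 1))) (at z)"
    by (rule has_derivative_transform_within_open[OF dz_deriv[OF z] U_open z]) (simp add: wirtinger2_def del_\<rho>)
  from frechet_derivative_at[OF this, symmetric]
  show "delbar (wirtinger2 \<rho>) z u = (H z u (0, 1) + \<i> * H z (J u) (0, 1)) / 2"
    by (simp add: delbar_def J_def)
qed

text \<open>The \<open>(2,0)\<close>-part of the second differential is symmetric, hence drops out.\<close>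

lemma delbar_del_eq: assumes z: "z \<in> U" shows "delbar_del \<rho> z u v = H z u v - H z v u"
proof -
  have "delbar_del \<rho> z u v =
      ((H z u (1, 0) * fst v + H z u (0, 1) * snd v) + \<i> * (H z (J u) (1, 0) * fst v + H z (J u) (0, 1) * snd v)
      - ((H z v (1, 0) * fst u + H z v (0, 1) * snd u) + \<i> * (H z (J v) (1, 0) * fst u + H z (J v) (0, 1) * snd u))) / 2"
    unfolding delbar_del_def delbar_wirtinger[OF z] by (simp add: field_simps)
  then have 1: "delbar_del \<rho> z u v = ((H z u v + \<i> * H z (J u) v) - (H z v u + \<i> * H z (J v) u)) / 2"
    unfolding H_expand[of z u v, symmetric] H_expand[of z "J u" v, symmetric]
      H_expand[of z v u, symmetric] H_expand[of z "J v" u, symmetric] .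
  have "H z u v - \<i> * H z (J u) v = H z v u - \<i> * H z (J v) u"
    using \<rho>''_sym[OF z, of u v] \<rho>''_sym[OF z, of u "J v"] \<rho>''_sym[OF z, of "J u" v] \<rho>''_sym[OF z, of "J u" "J v"]
    by (simp add: H_def field_simps)
  moreover have "((a + b) - (c + d)) / 2 = a - c" if "a - b = c - d" for a b c d :: complex
  proof -
    have "(a + b) - (c + d) = 2 * (a - c)" using that by algebra
    then show ?thesis by simp
  qed
  ultimately show ?thesis unfolding 1 by blast
qed

lemma leray_form_eq:
  assumes z: "z \<in> U"
  shows "leray_form \<rho> z u v w = dz z u * (H z v w - H z w v) - dz z v * (H z u w - H z w u)
    + dz z w * (H z u v - H z v u)"
  unfolding leray_form_def Let_def del_\<rho>[OF z] delbar_del_eq[OF z] ..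

lemma norm_dz: "norm (dz z v) \<le> norm (\<rho>' z) * norm v"
proof -
  have "norm (dz z v) \<le> (\<bar>\<rho>' z v\<bar> + \<bar>\<rho>' z (J v)\<bar>) / 2"
    using norm_triangle_ineq4[of "complex_of_real (\<rho>' z v)" "\<i> * of_real (\<rho>' z (J v))"]
    by (simp add: dz_def norm_divide norm_mult)
  also have "\<dots> \<le> norm (\<rho>' z) * norm v"
    using norm_blinfun[of "\<rho>' z" v] norm_blinfun[of "\<rho>' z" "J v"] by (simp add: norm_J)
  finally show ?thesis .
qed

lemma norm_H: "norm (H z u v) \<le> norm (\<rho>'' z) * norm u * norm v"
proof -
  have *: "\<bar>\<rho>'' z u w\<bar> \<le> norm (\<rho>'' z) * norm u * norm w" for w
  proof -
    have "\<bar>\<rho>'' z u w\<bar> \<le> norm (\<rho>'' z u) * norm w" using norm_blinfun[of "\<rho>'' z u" w] by simp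
    also have "\<dots> \<le> norm (\<rho>'' z) * norm u * norm w" by (intro mult_right_mono norm_blinfun) simp
    finally show ?thesis .
  qed
  have "norm (H z u v) \<le> (\<bar>\<rho>'' z u v\<bar> + \<bar>\<rho>'' z u (J v)\<bar>) / 2"
    using norm_triangle_ineq4[of "complex_of_real (\<rho>'' z u v)" "\<i> * of_real (\<rho>'' z u (J v))"]
    by (simp add: H_def norm_divide norm_mult)
  also have "\<dots> \<le> norm (\<rho>'' z) * norm u * norm v"
    using *[of v] *[of "J v"] by (simp add: norm_J)
  finally show ?thesis .
qed

lemma norm_leray_form:
  assumes z: "z \<in> U"
  shows "norm (leray_form \<rho> z u v w) \<le> 6 * norm (\<rho>' z) * norm (\<rho>'' z) * (norm u * norm v * norm w)"
proof -
  have t: "norm (dz z a * (H z c d - H z d c)) \<le> 2 * norm (\<rho>' z) * norm (\<rho>'' z) * (norm a * norm c * norm d)" for a c d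
  proof -
    have "norm (H z c d - H z d c) \<le> 2 * norm (\<rho>'' z) * norm c * norm d"
      using norm_triangle_ineq4[of "H z c d" "H z d c"] norm_H[of z c d] norm_H[of z d c]
      by (simp add: mult.commute mult.left_commute)
    then have "norm (dz z a) * norm (H z c d - H z d c) \<le> (norm (\<rho>' z) * norm a) * (2 * norm (\<rho>'' z) * norm c * norm d)"
      by (intro mult_mono norm_dz) auto
    then show ?thesis by (simp add: norm_mult mult_ac)
  qed
  let ?N = "2 * norm (\<rho>' z) * norm (\<rho>'' z) * (norm u * norm v * norm w)"
  have "norm (leray_form \<rho> z u v w) \<le> ?N + ?N + ?N"
    unfolding leray_form_eq[OF z]
    using norm_triangle_ineq[of "dz z u * (H z v w - H z w v) - dz z v * (H z u w - H z w u)" "dz z w * (H z u v - H z v u)"]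
      norm_triangle_ineq4[of "dz z u * (H z v w - H z w v)" "dz z v * (H z u w - H z w u)"]
      t[of u v w] t[of v u w] t[of w u v] by (simp add: mult_ac)
  then show ?thesis by (simp add: mult_ac)
qed

section \<open>The moving frame of the polar chart and the kernel\<close>

lemma polar_chart_eq: "polar_chart D (r, \<alpha>, \<beta>) = (of_real r * cis \<alpha>, of_real (\<phi> r) * cis \<beta>)"
  by (simp add: polar_chart_def)

lemma polar_chart_frontier: "0 < r \<Longrightarrow> r < b \<Longrightarrow> polar_chart D (r, \<alpha>, \<beta>) \<in> frontier D"
  using \<phi>_pos[of r] by (intro frontier_profile) (auto simp: polar_chart_eq norm_mult)

lemma polar_chart_U: "0 < r \<Longrightarrow> r < b \<Longrightarrow> polar_chart D (r, \<alpha>, \<beta>) \<in> U"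
  by (intro frontier_imp_U polar_chart_frontier)

definition E1 :: "real \<Rightarrow> C2" where "E1 \<alpha> = (cis \<alpha>, 0)"
definition E2 :: "real \<Rightarrow> C2" where "E2 \<beta> = (0, cis \<beta>)"

lemma polar_chart_E: "polar_chart D (r, \<alpha>, \<beta>) = r *\<^sub>R E1 \<alpha> + \<phi> r *\<^sub>R E2 \<beta>"
  by (simp add: polar_chart_eq E1_def E2_def scaleR_conv_of_real)

lemma E_deriv:
  assumes "(f has_real_derivative d) (at x)"
  shows "((\<lambda>x. E1 (f x)) has_vector_derivative d *\<^sub>R J (E1 (f x))) (at x)"
    "((\<lambda>x. E2 (f x)) has_vector_derivative d *\<^sub>R J (E2 (f x))) (at x)"
proof -
  have "((\<lambda>x. cis (f x)) has_derivative (\<lambda>t. (d * t) *\<^sub>R (\<i> * cis (f x)))) (at x)"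
    using has_derivative_cis[OF assms[unfolded has_field_derivative_def]] .
  then have c: "((\<lambda>x. cis (f x)) has_vector_derivative d *\<^sub>R (\<i> * cis (f x))) (at x)"
    by (simp add: has_vector_derivative_def mult.commute)
  show "((\<lambda>x. E1 (f x)) has_vector_derivative d *\<^sub>R J (E1 (f x))) (at x)"
    using has_vector_derivative_Pair[OF c has_vector_derivative_const[of 0]]
    by (simp add: E1_def J_def)
  show "((\<lambda>x. E2 (f x)) has_vector_derivative d *\<^sub>R J (E2 (f x))) (at x)"
    using has_vector_derivative_Pair[OF has_vector_derivative_const[of 0] c]
    by (simp add: E2_def J_def)
qed

definition T1 :: "real \<Rightarrow> real \<Rightarrow> real \<Rightarrow> C2" where "T1 r \<alpha> \<beta> = E1 \<alpha> - l r *\<^sub>R E2 \<beta>"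
definition T2 :: "real \<Rightarrow> real \<Rightarrow> C2" where "T2 r \<alpha> = r *\<^sub>R J (E1 \<alpha>)"
definition T3 :: "real \<Rightarrow> real \<Rightarrow> C2" where "T3 r \<beta> = \<phi> r *\<^sub>R J (E2 \<beta>)"

lemma polar_chart_deriv:
  assumes r: "0 < r" "r < b"
  shows "(polar_chart D has_derivative (\<lambda>h. fst h *\<^sub>R T1 r \<alpha> \<beta> + fst (snd h) *\<^sub>R T2 r \<alpha> + snd (snd h) *\<^sub>R T3 r \<beta>))
    (at (r, \<alpha>, \<beta>))"
proof -
  let ?p = "(r, \<alpha>, \<beta>)"
  have E: "(E1 has_derivative (\<lambda>h. h *\<^sub>R J (E1 \<alpha>))) (at (fst (snd ?p)))" "(E2 has_derivative (\<lambda>h. h *\<^sub>R J (E2 \<beta>))) (at (snd (snd ?p)))"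
    using E_deriv[OF DERIV_ident] by (auto simp: has_vector_derivative_def)
  have \<phi>d: "(\<phi> has_derivative (\<lambda>h. - l r * h)) (at (fst ?p))"
    using \<phi>_deriv[OF r] unfolding has_field_derivative_def by (simp only: fst_conv)
  have 1: "((\<lambda>p::real\<times>real\<times>real. fst (snd p)) has_derivative (\<lambda>h. fst (snd h))) (at ?p)"
    "((\<lambda>p::real\<times>real\<times>real. snd (snd p)) has_derivative (\<lambda>h. snd (snd h))) (at ?p)"
    "((\<lambda>p::real\<times>real\<times>real. fst p) has_derivative fst) (at ?p)"
    by (auto intro!: derivative_eq_intros)
  have "((\<lambda>p. fst p *\<^sub>R E1 (fst (snd p)) + \<phi> (fst p) *\<^sub>R E2 (snd (snd p))) has_derivative
    (\<lambda>h. (fst ?p *\<^sub>R (fst (snd h) *\<^sub>R J (E1 \<alpha>)) + fst h *\<^sub>R E1 (fst (snd ?p)))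
      + (\<phi> (fst ?p) *\<^sub>R (snd (snd h) *\<^sub>R J (E2 \<beta>)) + (- l r * fst h) *\<^sub>R E2 (snd (snd ?p))))) (at ?p)"
    by (intro has_derivative_add has_derivative_scaleR 1(3) has_derivative_compose[OF 1(1) E(1)]
        has_derivative_compose[OF 1(2) E(2)] has_derivative_compose[OF 1(3) \<phi>d])
  moreover have "(\<lambda>p. fst p *\<^sub>R E1 (fst (snd p)) + \<phi> (fst p) *\<^sub>R E2 (snd (snd p))) = polar_chart D"
    by (auto simp: polar_chart_E)
  moreover have "(\<lambda>h. (fst ?p *\<^sub>R (fst (snd h) *\<^sub>R J (E1 \<alpha>)) + fst h *\<^sub>R E1 (fst (snd ?p)))
      + (\<phi> (fst ?p) *\<^sub>R (snd (snd h) *\<^sub>R J (E2 \<beta>)) + (- l r * fst h) *\<^sub>R E2 (snd (snd ?p))))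
      = (\<lambda>h. fst h *\<^sub>R T1 r \<alpha> \<beta> + fst (snd h) *\<^sub>R T2 r \<alpha> + snd (snd h) *\<^sub>R T3 r \<beta>)"
    by (auto simp: T1_def T2_def T3_def fun_eq_iff scaleR_diff_right mult.commute)
  ultimately show ?thesis by simp
qed

lemma chart_tangent_eq:
  assumes r: "0 < r" "r < b"
  shows "chart_tangent D (r, \<alpha>, \<beta>) (1, 0, 0) = T1 r \<alpha> \<beta>"
    "chart_tangent D (r, \<alpha>, \<beta>) (0, 1, 0) = T2 r \<alpha>"
    "chart_tangent D (r, \<alpha>, \<beta>) (0, 0, 1) = T3 r \<beta>"
  unfolding chart_tangent_def frechet_derivative_at[OF polar_chart_deriv[OF r], symmetric] by simp_all

lemma chart_paths:
  assumes r: "0 < r" "r < b"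
  shows "((\<lambda>t. polar_chart D (t, \<alpha>, \<beta>)) has_vector_derivative T1 r \<alpha> \<beta>) (at r)"
    "((\<lambda>t. polar_chart D (r, t, \<beta>)) has_vector_derivative T2 r \<alpha>) (at \<alpha>)"
    "((\<lambda>t. polar_chart D (r, \<alpha>, t)) has_vector_derivative T3 r \<beta>) (at \<beta>)"
proof -
  have 1: "((\<lambda>t::real. (t, \<alpha>, \<beta>)) has_derivative (\<lambda>h. (h, 0, 0))) (at r)"
    "((\<lambda>t::real. (r, t, \<beta>)) has_derivative (\<lambda>h. (0, h, 0))) (at \<alpha>)"
    "((\<lambda>t::real. (r, \<alpha>, t)) has_derivative (\<lambda>h. (0, 0, h))) (at \<beta>)"
    by (auto intro!: derivative_eq_intros simp: zero_prod_def)
  show "((\<lambda>t. polar_chart D (t, \<alpha>, \<beta>)) has_vector_derivative T1 r \<alpha> \<beta>) (at r)"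
    using has_derivative_compose[OF 1(1) polar_chart_deriv[OF r]] by (simp add: has_vector_derivative_def)
  show "((\<lambda>t. polar_chart D (r, t, \<beta>)) has_vector_derivative T2 r \<alpha>) (at \<alpha>)"
    using has_derivative_compose[OF 1(2) polar_chart_deriv[OF r]] by (simp add: has_vector_derivative_def)
  show "((\<lambda>t. polar_chart D (r, \<alpha>, t)) has_vector_derivative T3 r \<beta>) (at \<beta>)"
    using has_derivative_compose[OF 1(3) polar_chart_deriv[OF r]] by (simp add: has_vector_derivative_def)
qed

lemma \<rho>'_path_0:
  assumes c: "(c has_vector_derivative T) (at t)" and S: "open S" "t \<in> S" "\<And>s. s \<in> S \<Longrightarrow> c s \<in> frontier D"
  shows "\<rho>' (c t) T = 0"
proof -
  have "((\<lambda>s. \<rho> (c s)) has_derivative (\<lambda>h. \<rho>' (c t) (h *\<^sub>R T))) (at t)"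
    using has_derivative_compose[OF c[unfolded has_vector_derivative_def] \<rho>_deriv[OF frontier_imp_U[OF S(3)[OF S(2)]]]] .
  moreover have "((\<lambda>s. \<rho> (c s)) has_derivative (\<lambda>h. 0)) (at t)"
    by (rule has_derivative_transform_within_open[OF has_derivative_const S(1,2)]) (simp add: \<rho>_frontier S(3))
  ultimately have "(\<lambda>h. \<rho>' (c t) (h *\<^sub>R T)) = (\<lambda>h. 0)" by (rule has_derivative_unique)
  from fun_cong[OF this, of 1] show ?thesis by simp
qed

lemma \<rho>'_tangent:
  fixes r \<alpha> \<beta> :: real
  assumes r: "0 < r" "r < b"
  defines "z \<equiv> polar_chart D (r, \<alpha>, \<beta>)"
  shows "\<rho>' z (E1 \<alpha>) = l r * \<rho>' z (E2 \<beta>)" "\<rho>' z (J (E1 \<alpha>)) = 0" "\<rho>' z (J (E2 \<beta>)) = 0"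
proof -
  have "\<rho>' z (T1 r \<alpha> \<beta>) = 0"
    unfolding z_def by (rule \<rho>'_path_0[OF chart_paths(1)[OF r], of "{0<..<b}"]) (use r polar_chart_frontier in auto)
  then show "\<rho>' z (E1 \<alpha>) = l r * \<rho>' z (E2 \<beta>)" by (simp add: T1_def bl)
  have "\<rho>' z (T2 r \<alpha>) = 0"
    unfolding z_def by (rule \<rho>'_path_0[OF chart_paths(2)[OF r], of UNIV]) (use r polar_chart_frontier in auto)
  then show "\<rho>' z (J (E1 \<alpha>)) = 0" using r by (simp add: T2_def bl)
  have "\<rho>' z (T3 r \<beta>) = 0"
    unfolding z_def by (rule \<rho>'_path_0[OF chart_paths(3)[OF r], of UNIV]) (use r polar_chart_frontier in auto)
  then show "\<rho>' z (J (E2 \<beta>)) = 0" using r \<phi>_pos[of r] by (simp add: T3_def bl)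
qed

text \<open>Half the radial derivative of \<rho> in the second coordinate. In
  \<open>leray_form_chart\<close> it is the only trace of the choice of \<rho>, and it cancels in
  the kernel.\<close>

definition nrm :: "C2 \<Rightarrow> real \<Rightarrow> real" where "nrm z \<beta> = \<rho>' z (E2 \<beta>) / 2"

lemma dz_E:
  fixes r \<alpha> \<beta> :: real
  assumes r: "0 < r" "r < b"
  defines "z \<equiv> polar_chart D (r, \<alpha>, \<beta>)"
  shows "dz z (E1 \<alpha>) = of_real (l r * nrm z \<beta>)" "dz z (E2 \<beta>) = of_real (nrm z \<beta>)"
  using \<rho>'_tangent[OF r, of \<alpha> \<beta>] by (simp_all add: dz_def nrm_def z_def)

lemma dz_path:
  assumes c: "(c has_vector_derivative T) (at t)" "c t \<in> U" and E: "(E has_vector_derivative E') (at t)"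
  shows "((\<lambda>t. dz (c t) (E t)) has_vector_derivative H (c t) T (E t) + dz (c t) E') (at t)"
proof -
  have 1: "((\<lambda>s. \<rho>' (c s)) has_derivative (\<lambda>h. \<rho>'' (c t) (h *\<^sub>R T))) (at t)"
    using has_derivative_compose[OF c(1)[unfolded has_vector_derivative_def] \<rho>'_deriv[OF c(2)]] .
  have 2: "((\<lambda>s. J (E s)) has_derivative (\<lambda>h. J (h *\<^sub>R E'))) (at t)"
    using bounded_linear.has_derivative[OF bounded_linear_J E[unfolded has_vector_derivative_def]] .
  have "((\<lambda>s. dz (c s) (E s)) has_derivative (\<lambda>h. (of_real (\<rho>' (c t) (h *\<^sub>R E') + \<rho>'' (c t) (h *\<^sub>R T) (E t))
     - \<i> * of_real (\<rho>' (c t) (J (h *\<^sub>R E')) + \<rho>'' (c t) (h *\<^sub>R T) (J (E t)))) / 2)) (at t)"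
    unfolding dz_def
    by (intro bounded_linear.has_derivative[OF bounded_linear_divide] has_derivative_diff
        has_derivative_mult_right has_derivative_of_real blinfun.FDERIV[OF 1 E[unfolded has_vector_derivative_def]] blinfun.FDERIV[OF 1 2])
  moreover have "(\<lambda>h. (of_real (\<rho>' (c t) (h *\<^sub>R E') + \<rho>'' (c t) (h *\<^sub>R T) (E t))
     - \<i> * of_real (\<rho>' (c t) (J (h *\<^sub>R E')) + \<rho>'' (c t) (h *\<^sub>R T) (J (E t)))) / 2)
     = (\<lambda>h. h *\<^sub>R (H (c t) T (E t) + dz (c t) E'))"
    by (auto simp: fun_eq_iff J_scaleR bl H_def dz_def scaleR_conv_of_real field_simps)
  ultimately show ?thesis by (simp add: has_vector_derivative_def)
qed

text \<open>The relation \<open>dz z (E1 \<alpha>) = l r * dz z (E2 \<beta>)\<close> holds on the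
  whole chart. Differentiating it along the three coordinate curves relates second derivatives of
  \<rho> to \<open>l'\<close> and the gradient. The frame vectors turn along the angular curves,
  which produces the imaginary terms.\<close>

lemma H_tangent:
  fixes r \<alpha> \<beta> :: real
  assumes r: "0 < r" "r < b"
  defines "z \<equiv> polar_chart D (r, \<alpha>, \<beta>)"
  shows "H z (T1 r \<alpha> \<beta>) (E1 \<alpha>) = of_real (l' r * nrm z \<beta>) + of_real (l r) * H z (T1 r \<alpha> \<beta>) (E2 \<beta>)"
    "H z (T2 r \<alpha>) (E1 \<alpha>) + \<i> * of_real (l r * nrm z \<beta>) = of_real (l r) * H z (T2 r \<alpha>) (E2 \<beta>)"
    "H z (T3 r \<beta>) (E1 \<alpha>) = of_real (l r) * (H z (T3 r \<beta>) (E2 \<beta>) + \<i> * of_real (nrm z \<beta>))"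
proof -
  have zU: "z \<in> U" unfolding z_def by (rule polar_chart_U[OF r])
  have Ec: "((\<lambda>s. E1 \<alpha>) has_vector_derivative 0) (at t)" "((\<lambda>s. E2 \<beta>) has_vector_derivative 0) (at t)" for t
    by (rule has_vector_derivative_const)+
  have E: "(E1 has_vector_derivative J (E1 \<alpha>)) (at \<alpha>)" "(E2 has_vector_derivative J (E2 \<beta>)) (at \<beta>)"
    using E_deriv[OF DERIV_ident] by auto
  have dz0: "dz w 0 = 0" for w by (simp add: dz_def J_def blinfun.zero_right zero_prod_def[symmetric])
  have G: "dz (polar_chart D (t, \<alpha>, \<beta>)) (E1 \<alpha>) = of_real (l t) * dz (polar_chart D (t, \<alpha>, \<beta>)) (E2 \<beta>)"
    if "0 < t" "t < b" for t \<alpha> \<beta> using dz_E[OF that] by simp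
  have "((\<lambda>t. dz (polar_chart D (t, \<alpha>, \<beta>)) (E1 \<alpha>)) has_vector_derivative H z (T1 r \<alpha> \<beta>) (E1 \<alpha>) + dz z 0) (at r)"
    using dz_path[OF chart_paths(1)[OF r] _ Ec(1)] zU by (simp add: z_def)
  moreover have "((\<lambda>t. dz (polar_chart D (t, \<alpha>, \<beta>)) (E1 \<alpha>)) has_vector_derivative
      of_real (l r) * (H z (T1 r \<alpha> \<beta>) (E2 \<beta>) + dz z 0) + of_real (l' r) * dz z (E2 \<beta>)) (at r)"
  proof (rule has_vector_derivative_transform_within_open[of _ _ _ "{0<..<b}"])
    have l: "((\<lambda>t. complex_of_real (l t)) has_vector_derivative of_real (l' r)) (at r)"
      using l_deriv[OF r] by (intro has_vector_derivative_of_real) (simp add: has_real_derivative_iff_has_vector_derivative)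
    have "((\<lambda>t. dz (polar_chart D (t, \<alpha>, \<beta>)) (E2 \<beta>)) has_vector_derivative H z (T1 r \<alpha> \<beta>) (E2 \<beta>) + dz z 0) (at r)"
      using dz_path[OF chart_paths(1)[OF r] _ Ec(2)] zU by (simp add: z_def)
    from has_vector_derivative_mult[OF l this]
    show "((\<lambda>t. of_real (l t) * dz (polar_chart D (t, \<alpha>, \<beta>)) (E2 \<beta>)) has_vector_derivative
      of_real (l r) * (H z (T1 r \<alpha> \<beta>) (E2 \<beta>) + dz z 0) + of_real (l' r) * dz z (E2 \<beta>)) (at r)"
      by (simp add: z_def)
  qed (use r G in auto)
  ultimately have "H z (T1 r \<alpha> \<beta>) (E1 \<alpha>) + dz z 0
      = of_real (l r) * (H z (T1 r \<alpha> \<beta>) (E2 \<beta>) + dz z 0) + of_real (l' r) * dz z (E2 \<beta>)"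
    by (rule vector_derivative_unique_at)
  then show "H z (T1 r \<alpha> \<beta>) (E1 \<alpha>) = of_real (l' r * nrm z \<beta>) + of_real (l r) * H z (T1 r \<alpha> \<beta>) (E2 \<beta>)"
    using dz_E(2)[OF r, of \<alpha> \<beta>] by (simp add: dz0 z_def)
  have "((\<lambda>t. dz (polar_chart D (r, t, \<beta>)) (E1 t)) has_vector_derivative H z (T2 r \<alpha>) (E1 \<alpha>) + dz z (J (E1 \<alpha>))) (at \<alpha>)"
    using dz_path[OF chart_paths(2)[OF r] _ E(1)] zU by (simp add: z_def)
  moreover have "((\<lambda>t. dz (polar_chart D (r, t, \<beta>)) (E1 t)) has_vector_derivative
      of_real (l r) * (H z (T2 r \<alpha>) (E2 \<beta>) + dz z 0)) (at \<alpha>)"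
    unfolding G[OF r] using dz_path[OF chart_paths(2)[OF r] _ Ec(2)] zU
    by (intro has_vector_derivative_mult_right) (simp add: z_def)
  ultimately have "H z (T2 r \<alpha>) (E1 \<alpha>) + dz z (J (E1 \<alpha>)) = of_real (l r) * (H z (T2 r \<alpha>) (E2 \<beta>) + dz z 0)"
    by (rule vector_derivative_unique_at)
  then show "H z (T2 r \<alpha>) (E1 \<alpha>) + \<i> * of_real (l r * nrm z \<beta>) = of_real (l r) * H z (T2 r \<alpha>) (E2 \<beta>)"
    using dz_E(1)[OF r, of \<alpha> \<beta>] by (simp add: dz0 dz_linear z_def)
  have "((\<lambda>t. dz (polar_chart D (r, \<alpha>, t)) (E1 \<alpha>)) has_vector_derivative H z (T3 r \<beta>) (E1 \<alpha>) + dz z 0) (at \<beta>)"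
    using dz_path[OF chart_paths(3)[OF r] _ Ec(1)] zU by (simp add: z_def)
  moreover have "((\<lambda>t. dz (polar_chart D (r, \<alpha>, t)) (E1 \<alpha>)) has_vector_derivative
      of_real (l r) * (H z (T3 r \<beta>) (E2 \<beta>) + dz z (J (E2 \<beta>)))) (at \<beta>)"
    unfolding G[OF r] using dz_path[OF chart_paths(3)[OF r] _ E(2)] zU
    by (intro has_vector_derivative_mult_right) (simp add: z_def)
  ultimately have "H z (T3 r \<beta>) (E1 \<alpha>) + dz z 0 = of_real (l r) * (H z (T3 r \<beta>) (E2 \<beta>) + dz z (J (E2 \<beta>)))"
    by (rule vector_derivative_unique_at)
  then show "H z (T3 r \<beta>) (E1 \<alpha>) = of_real (l r) * (H z (T3 r \<beta>) (E2 \<beta>) + \<i> * of_real (nrm z \<beta>))"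
    using dz_E(2)[OF r, of \<alpha> \<beta>] by (simp add: dz0 dz_linear z_def)
qed

text \<open>\<open>T1\<close> is complex tangential, so only two of the three terms survive, and in
  these the second derivative \<open>H z (T1 r \<alpha> \<beta>) (E2 \<beta>)\<close>, which
  \<open>H_tangent\<close> leaves open, cancels.\<close>

lemma leray_form_chart:
  fixes r \<alpha> \<beta> :: real
  assumes r: "0 < r" "r < b"
  defines "z \<equiv> polar_chart D (r, \<alpha>, \<beta>)"
  shows "leray_form \<rho> z (T1 r \<alpha> \<beta>) (T2 r \<alpha>) (T3 r \<beta>)
    = - of_real (\<sigma>' r * ((r * l r + \<phi> r) * nrm z \<beta>)\<^sup>2)"
proof -
  have zU: "z \<in> U" unfolding z_def by (rule polar_chart_U[OF r])
  define M where "M = complex_of_real (nrm z \<beta>)"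
  define L where "L = complex_of_real (l r)"
  note HT = H_tangent[OF r, of \<alpha> \<beta>, folded z_def]
  have d: "dz z (T1 r \<alpha> \<beta>) = 0" "dz z (T2 r \<alpha>) = of_real r * (\<i> * (L * M))" "dz z (T3 r \<beta>) = of_real (\<phi> r) * (\<i> * M)"
    using dz_E[OF r, of \<alpha> \<beta>] dz_linear(1)[of z "E1 \<alpha>" "(- l r) *\<^sub>R E2 \<beta>"]
    by (simp_all add: T1_def T2_def T3_def dz_linear dz_minus z_def[symmetric] M_def L_def scaleR_conv_of_real)
  have HT1: "H z u (T1 r \<alpha> \<beta>) = H z u (E1 \<alpha>) - L * H z u (E2 \<beta>)" for u
    using H_linear(1)[of z u "E1 \<alpha>" "(- l r) *\<^sub>R E2 \<beta>"] by (simp add: T1_def H_linear H_minus L_def scaleR_conv_of_real)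
  have h12: "H z (T1 r \<alpha> \<beta>) (T2 r \<alpha>) = of_real r * (\<i> * (of_real (l' r) * M + L * H z (T1 r \<alpha> \<beta>) (E2 \<beta>)))"
    using HT(1) by (simp add: T2_def H_linear L_def M_def scaleR_conv_of_real)
  have h13: "H z (T1 r \<alpha> \<beta>) (T3 r \<beta>) = of_real (\<phi> r) * (\<i> * H z (T1 r \<alpha> \<beta>) (E2 \<beta>))"
    by (simp add: T3_def H_linear scaleR_conv_of_real)
  have h21: "H z (T2 r \<alpha>) (T1 r \<alpha> \<beta>) = - \<i> * (L * M)"
    unfolding HT1 using HT(2) by (simp add: L_def M_def algebra_simps)
  have h31: "H z (T3 r \<beta>) (T1 r \<alpha> \<beta>) = \<i> * (L * M)"
    unfolding HT1 using HT(3) by (simp add: L_def M_def algebra_simps)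
  have "\<sigma>' r * ((r * l r + \<phi> r) * nrm z \<beta>)\<^sup>2 = ((l r + r * l' r) * \<phi> r + r * l r * l r) * (nrm z \<beta>)\<^sup>2"
    using den_pos[OF r] by (simp add: \<sigma>'_def power_mult_distrib)
  then have "complex_of_real (\<sigma>' r * ((r * l r + \<phi> r) * nrm z \<beta>)\<^sup>2)
      = ((L + of_real r * of_real (l' r)) * of_real (\<phi> r) + of_real r * L * L) * M\<^sup>2"
    by (simp only:) (simp add: L_def M_def)
  then show ?thesis
    unfolding leray_form_eq[OF zU] d h12 h13 h21 h31
    by (simp add: power2_eq_square algebra_simps)
qed

lemma nrm_pos: assumes r: "0 < r" "r < b" shows "0 < nrm (polar_chart D (r, \<alpha>, \<beta>)) \<beta>"
  and \<rho>'_radial: "\<rho>' (polar_chart D (r, \<alpha>, \<beta>)) (polar_chart D (r, \<alpha>, \<beta>))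
    = 2 * ((r * l r + \<phi> r) * nrm (polar_chart D (r, \<alpha>, \<beta>)) \<beta>)"
proof -
  let ?z = "polar_chart D (r, \<alpha>, \<beta>)"
  show eq: "\<rho>' ?z ?z = 2 * ((r * l r + \<phi> r) * nrm ?z \<beta>)"
    using \<rho>'_tangent(1)[OF r, of \<alpha> \<beta>] by (subst (2) polar_chart_E) (simp add: bl nrm_def algebra_simps)
  have "\<rho>' ?z (0 - ?z) < 0" by (rule \<rho>'_neg[OF polar_chart_frontier[OF r] zero_mem])
  then have "0 < \<rho>' ?z ?z" by (simp add: bl)
  then show "0 < nrm ?z \<beta>" unfolding eq using den_pos[OF r] by (simp add: zero_less_mult_iff)
qed

text \<open>The form and the squared denominator both contain the square of \<open>k * M\<close>,
  and with it \<rho> disappears. Dividing the equation of the supporting line by \<open>k\<close>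
  puts the denominator in the normalized form with \<sigma>.\<close>

lemma leray_kernel_eq:
  assumes r: "0 < r" "r < b"
  shows "leray_kernel D \<rho> (r, \<alpha>, \<beta>) w = of_real (\<sigma>' r / (4 * pi\<^sup>2)) /
    (1 - (cis (- \<alpha>) * of_real (\<sigma> r / r) * fst w + cis (- \<beta>) * of_real ((1 - \<sigma> r) / \<phi> r) * snd w))\<^sup>2"
proof -
  let ?z = "polar_chart D (r, \<alpha>, \<beta>)"
  have zU: "?z \<in> U" by (rule polar_chart_U[OF r])
  define k where "k = r * l r + \<phi> r"
  define M where "M = nrm ?z \<beta>"
  have k0: "k > 0" using den_pos[OF r] by (simp add: k_def)
  have M0: "M > 0" using nrm_pos[OF r] by (simp add: M_def)
  have w1: "wirtinger1 \<rho> ?z = of_real (l r * M) * cis (- \<alpha>)"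
  proof -
    have "dz ?z (E1 \<alpha>) = dz ?z (1, 0) * cis \<alpha>" by (subst dz_expand) (simp add: E1_def)
    then have "dz ?z (1, 0) = dz ?z (E1 \<alpha>) * cis (- \<alpha>)" by (simp add: mult.assoc cis_mult)
    then show ?thesis by (simp add: wirtinger1_def del_\<rho>[OF zU] dz_E[OF r] M_def)
  qed
  have w2: "wirtinger2 \<rho> ?z = of_real M * cis (- \<beta>)"
  proof -
    have "dz ?z (E2 \<beta>) = dz ?z (0, 1) * cis \<beta>" by (subst dz_expand) (simp add: E2_def)
    then have "dz ?z (0, 1) = dz ?z (E2 \<beta>) * cis (- \<beta>)" by (simp add: mult.assoc cis_mult)
    then show ?thesis by (simp add: wirtinger2_def del_\<rho>[OF zU] dz_E[OF r] M_def)
  qed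
  let ?X = "1 - (cis (- \<alpha>) * of_real (\<sigma> r / r) * fst w + cis (- \<beta>) * of_real ((1 - \<sigma> r) / \<phi> r) * snd w)"
  have k_eq: "of_real k * complex_of_real (\<sigma> r / r) = of_real (l r)" "of_real k * complex_of_real ((1 - \<sigma> r) / \<phi> r) = 1"
    unfolding \<sigma>_div[OF r] k_def[symmetric] using k0 by simp_all
  have "of_real (k * M) * ?X = of_real (k * M) - (cis (- \<alpha>) * of_real M * (of_real k * complex_of_real (\<sigma> r / r)) * fst w
     + cis (- \<beta>) * of_real M * (of_real k * complex_of_real ((1 - \<sigma> r) / \<phi> r)) * snd w)"
    by (simp add: algebra_simps)
  also have "\<dots> = wirtinger1 \<rho> ?z * (fst ?z - fst w) + wirtinger2 \<rho> ?z * (snd ?z - snd w)"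
  proof -
    have alg: "(R * L + P) * M - (x1 * M * L * w1 + x2 * M * 1 * w2) = L * M * x1 * (R * y1 - w1) + M * x2 * (P * y2 - w2)"
      if "x1 * y1 = 1" "x2 * y2 = 1" for R L P M x1 x2 y1 y2 w1 w2 :: complex
      using that by algebra
    have c: "cis (- \<alpha>) * cis \<alpha> = 1" "cis (- \<beta>) * cis \<beta> = 1" by (simp_all add: cis_mult)
    have kc: "complex_of_real (k * M) = (of_real r * of_real (l r) + of_real (\<phi> r)) * of_real M"
      by (simp add: k_def)
    have fz: "fst ?z = of_real r * cis \<alpha>" "snd ?z = of_real (\<phi> r) * cis \<beta>"
      by (simp_all add: polar_chart_eq)
    show ?thesis
      unfolding w1 w2 k_eq kc fz of_real_mult[of "l r" M] by (rule alg[OF c])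
  qed
  finally have den: "wirtinger1 \<rho> ?z * (fst ?z - fst w) + wirtinger2 \<rho> ?z * (snd ?z - snd w) = of_real (k * M) * ?X" ..
  \<comment> \<open>The sign of this square cancels the minus sign of
    \<open>leray_form_chart\<close>.\<close>
  have "(2 * complex_of_real pi * \<i>)\<^sup>2 = - of_real (4 * pi\<^sup>2)" by (simp add: power_mult_distrib)
  then have "leray_kernel D \<rho> (r, \<alpha>, \<beta>) w = 1 / (- of_real (4 * pi\<^sup>2)) * (- of_real (\<sigma>' r * (k * M)\<^sup>2) / (of_real (k * M) * ?X)\<^sup>2)"
    unfolding leray_kernel_def Let_def chart_tangent_eq[OF r] leray_form_chart[OF r] den
    by (simp add: k_def M_def)
  also have "\<dots> = of_real (\<sigma>' r / (4 * pi\<^sup>2)) / ?X\<^sup>2"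
    using k0 M0 by (simp add: power_mult_distrib)
  finally show ?thesis .
qed

section \<open>Surface density of the polar chart\<close>

lemma norm_E: "norm (E1 \<alpha>) = 1" "norm (E2 \<beta>) = 1"
  by (simp_all add: E1_def E2_def norm_prod_def)

lemma inner_J: "E1 \<alpha> \<bullet> J (E1 \<alpha>) = 0" "E2 \<beta> \<bullet> J (E2 \<beta>) = 0" "E1 \<alpha> \<bullet> E2 \<beta> = 0"
  "E1 \<alpha> \<bullet> J (E2 \<beta>) = 0" "J (E1 \<alpha>) \<bullet> E2 \<beta> = 0" "J (E1 \<alpha>) \<bullet> J (E2 \<beta>) = 0"
  by (simp_all add: E1_def E2_def J_def inner_prod_def inner_complex_def)

lemma inner_J': "J (E1 \<alpha>) \<bullet> E1 \<alpha> = 0" "J (E2 \<beta>) \<bullet> E2 \<beta> = 0" "E2 \<beta> \<bullet> E1 \<alpha> = 0"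
  "J (E2 \<beta>) \<bullet> E1 \<alpha> = 0" "E2 \<beta> \<bullet> J (E1 \<alpha>) = 0" "J (E2 \<beta>) \<bullet> J (E1 \<alpha>) = 0"
  by (subst inner_commute, rule inner_J)+

lemma inner_E: "E1 \<alpha> \<bullet> E1 \<alpha> = 1" "E2 \<beta> \<bullet> E2 \<beta> = 1" "J (E1 \<alpha>) \<bullet> J (E1 \<alpha>) = 1" "J (E2 \<beta>) \<bullet> J (E2 \<beta>) = 1"
  by (simp_all add: dot_square_norm norm_E norm_J)

lemma inner_T:
  "T1 r \<alpha> \<beta> \<bullet> T1 r \<alpha> \<beta> = 1 + (l r)\<^sup>2" "T2 r \<alpha> \<bullet> T2 r \<alpha> = r\<^sup>2" "T3 r \<beta> \<bullet> T3 r \<beta> = (\<phi> r)\<^sup>2"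
  "T1 r \<alpha> \<beta> \<bullet> T2 r \<alpha> = 0" "T1 r \<alpha> \<beta> \<bullet> T3 r \<beta> = 0" "T2 r \<alpha> \<bullet> T3 r \<beta> = 0"
  by (simp_all add: T1_def T2_def T3_def inner_diff_left inner_diff_right inner_J inner_J' inner_E power2_eq_square)

lemma gram_det_eq: assumes r: "0 < r" "r < b"
  shows "sqrt (gram_det D (r, \<alpha>, \<beta>)) = r * \<phi> r * sqrt (1 + (l r)\<^sup>2)"
proof -
  have "gram_det D (r, \<alpha>, \<beta>) = (1 + (l r)\<^sup>2) * r\<^sup>2 * (\<phi> r)\<^sup>2"
    unfolding gram_det_def Let_def chart_tangent_eq[OF r]
    by (simp add: det_3 inner_T inner_commute[of "T2 _ _" "T1 _ _ _"] inner_commute[of "T3 _ _" "T1 _ _ _"] inner_commute[of "T3 _ _" "T2 _ _"])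
  then show ?thesis using r \<phi>_pos[of r] by (simp add: real_sqrt_mult)
qed

text \<open>On the chart frame the Leray form is, up to sign, \<sigma>' times a factor bounded away
  from 0 by compactness of the boundary. It is also at most a constant times the product of the
  lengths of the orthogonal frame vectors, which is the surface density. Comparing both controls
  \<sigma>' up to the two exceptional circles and makes the kernels of the monomial components
  bounded.\<close>

lemma \<sigma>'_bound:
  obtains C where "0 \<le> C" "\<And>r. 0 < r \<Longrightarrow> r < b \<Longrightarrow> \<sigma>' r \<le> C * (r * \<phi> r * sqrt (1 + (l r)\<^sup>2))"
proof -
  have \<gamma>0: "\<gamma> 0 \<in> frontier D" by (rule \<gamma>_frontier[OF order_refl b_pos])
  have ne: "frontier D \<noteq> {}"
  proof
    assume "frontier D = {}"
    with \<gamma>0 show False by (simp only: empty_iff)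
  qed
  have c1: "continuous_on (frontier D) (\<lambda>z. norm (\<rho>' z) * norm (\<rho>'' z))"
    by (intro continuous_intros continuous_on_subset[OF \<rho>'_cont frontier_U] continuous_on_subset[OF \<rho>''_cont frontier_U])
  from continuous_attains_sup[OF compact_frontier ne c1]
  obtain z1 where z1: "z1 \<in> frontier D" "\<forall>z\<in>frontier D. norm (\<rho>' z) * norm (\<rho>'' z) \<le> norm (\<rho>' z1) * norm (\<rho>'' z1)" ..
  define B where "B = norm (\<rho>' z1) * norm (\<rho>'' z1)"
  have B: "norm (\<rho>' z) * norm (\<rho>'' z) \<le> B" if "z \<in> frontier D" for z
    using z1(2) that by (simp add: B_def)
  have c2: "continuous_on (frontier D) (\<lambda>z. \<rho>' z z)"
    by (intro continuous_intros continuous_on_subset[OF \<rho>'_cont frontier_U])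
  from continuous_attains_inf[OF compact_frontier ne c2]
  obtain z0 where z0: "z0 \<in> frontier D" "\<forall>z\<in>frontier D. \<rho>' z0 z0 \<le> \<rho>' z z" ..
  define \<mu> where "\<mu> = \<rho>' z0 z0 / 2"
  have \<mu>: "0 < \<mu>" using \<rho>'_neg[OF z0(1) zero_mem] by (simp add: \<mu>_def bl)
  have B0: "0 \<le> B" by (simp add: B_def)
  show ?thesis
  proof (rule that[of "6 * B / \<mu>\<^sup>2"])
    fix r assume r: "0 < r" "r < b"
    let ?z = "polar_chart D (r, 0, 0)"
    let ?N = "norm (T1 r 0 0) * norm (T2 r 0) * norm (T3 r 0)"
    have zf: "?z \<in> frontier D" by (rule polar_chart_frontier[OF r])
    have \<Lambda>: "\<mu> \<le> (r * l r + \<phi> r) * nrm ?z 0"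
      using bspec[OF z0(2) zf] \<rho>'_radial[OF r, of 0 0] by (simp add: \<mu>_def)
    have "\<sigma>' r * \<mu>\<^sup>2 \<le> \<sigma>' r * ((r * l r + \<phi> r) * nrm ?z 0)\<^sup>2"
      using \<sigma>'_pos[OF r] \<mu> \<Lambda> by (intro mult_left_mono power_mono) auto
    also have "\<dots> = norm (leray_form \<rho> ?z (T1 r 0 0) (T2 r 0) (T3 r 0))"
      unfolding leray_form_chart[OF r] norm_minus_cancel norm_of_real using \<sigma>'_pos[OF r] by simp
    also have "\<dots> \<le> 6 * norm (\<rho>' ?z) * norm (\<rho>'' ?z) * ?N"
      by (rule norm_leray_form[OF frontier_imp_U[OF zf]])
    also have "\<dots> \<le> 6 * B * ?N"
      using B[OF zf] by (intro mult_right_mono) (auto simp: mult.assoc)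
    also have "?N = r * \<phi> r * sqrt (1 + (l r)\<^sup>2)"
      using r \<phi>_pos[of r] by (simp add: norm_eq_sqrt_inner inner_T)
    finally show "\<sigma>' r \<le> 6 * B / \<mu>\<^sup>2 * (r * \<phi> r * sqrt (1 + (l r)\<^sup>2))"
      using \<mu> by (simp add: pos_le_divide_eq)
  qed (use B0 in auto)
qed

end

subsection \<open>Integration lemmas\<close>

lemma FTC_nonneg_open:
  fixes F f :: "real \<Rightarrow> real"
  assumes "a < b" "\<And>x. a < x \<Longrightarrow> x < b \<Longrightarrow> (F has_real_derivative f x) (at x)"
    "\<And>x. a < x \<Longrightarrow> x < b \<Longrightarrow> isCont f x" "\<And>x. a < x \<Longrightarrow> x < b \<Longrightarrow> 0 \<le> f x"
    "(F \<longlongrightarrow> A) (at_right a)" "(F \<longlongrightarrow> B) (at_left b)"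
  shows "set_integrable lborel {a<..<b} f" "(LINT x:{a<..<b}|lborel. f x) = B - A"
proof -
  have "set_integrable lborel (einterval (ereal a) (ereal b)) f" "(LBINT x=ereal a..ereal b. f x) = B - A"
    by (rule interval_integral_FTC_nonneg[where F = F]; use assms in \<open>simp add: ereal_tendsto_simps\<close>)+
  then show "set_integrable lborel {a<..<b} f" "(LINT x:{a<..<b}|lborel. f x) = B - A"
    using assms(1) by (simp_all add: interval_lebesgue_integral_def)
qed

lemma set_Fubini:
  fixes F :: "'a::euclidean_space \<times> 'b::euclidean_space \<Rightarrow> complex"
  assumes F: "set_integrable lborel (X \<times> Y) F"
  shows "set_integrable lborel X (\<lambda>x. LINT y:Y|lborel. F (x, y))"
    "(LINT p:X \<times> Y|lborel. F p) = (LINT x:X|lborel. LINT y:Y|lborel. F (x, y))"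
    "AE x in lborel. x \<in> X \<longrightarrow> set_integrable lborel Y (\<lambda>y. F (x, y))"
proof -
  let ?f = "\<lambda>p. indicator (X \<times> Y) p *\<^sub>R F p"
  have f: "integrable (lborel \<Otimes>\<^sub>M lborel) ?f"
    using F unfolding set_integrable_def lborel_prod .
  have eq: "?f (x, y) = indicator X x *\<^sub>R (indicator Y y *\<^sub>R F (x, y))" for x y
    by (simp add: indicator_times)
  show "set_integrable lborel X (\<lambda>x. LINT y:Y|lborel. F (x, y))"
    using lborel_pair.integrable_fst'[OF f]
    unfolding eq set_integrable_def set_lebesgue_integral_def integral_scaleR_right .
  show "(LINT p:X \<times> Y|lborel. F p) = (LINT x:X|lborel. LINT y:Y|lborel. F (x, y))"
    using lborel_pair.integral_fst'[OF f]
    unfolding eq set_lebesgue_integral_def lborel_prod integral_scaleR_right by simp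
  show "AE x in lborel. x \<in> X \<longrightarrow> set_integrable lborel Y (\<lambda>y. F (x, y))"
    using lborel_pair.AE_integrable_fst'[OF f]
  proof eventually_elim
    case (elim x)
    then show ?case unfolding eq set_integrable_def by (auto simp: indicator_def)
  qed
qed

lemma set_integrable_times:
  fixes f :: "'a::euclidean_space \<Rightarrow> complex" and g :: "'b::euclidean_space \<Rightarrow> complex"
  assumes f: "set_integrable lborel X f" and g: "set_integrable lborel Y g"
  shows "set_integrable lborel (X \<times> Y) (\<lambda>p. f (fst p) * g (snd p))"
    "(LINT p:X \<times> Y|lborel. f (fst p) * g (snd p)) = (LINT x:X|lborel. f x) * (LINT y:Y|lborel. g y)"
proof -
  let ?f = "\<lambda>x. indicator X x *\<^sub>R f x" and ?g = "\<lambda>y. indicator Y y *\<^sub>R g y"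
  have fi: "integrable lborel ?f" and gi: "integrable lborel ?g"
    using assms by (auto simp: set_integrable_def)
  have [measurable]: "?f \<in> borel_measurable lborel" "?g \<in> borel_measurable lborel"
    using fi gi by auto
  have "integrable (lborel \<Otimes>\<^sub>M lborel) (\<lambda>p. ?f (fst p) * ?g (snd p))"
  proof (rule lborel_pair.Fubini_integrable)
    show "(\<lambda>p. ?f (fst p) * ?g (snd p)) \<in> borel_measurable (lborel \<Otimes>\<^sub>M lborel)" by measurable
    show "integrable lborel (\<lambda>x. LINT y|lborel. norm (?f (fst (x, y)) * ?g (snd (x, y))))"
      unfolding fst_conv snd_conv norm_mult using integrable_norm[OF fi] by simp
    show "AE x in lborel. integrable lborel (\<lambda>y. ?f (fst (x, y)) * ?g (snd (x, y)))"
      unfolding fst_conv snd_conv by (intro AE_I2 integrable_mult_right gi)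
  qed
  moreover have "(\<lambda>p. ?f (fst p) * ?g (snd p)) = (\<lambda>p. indicator (X \<times> Y) p *\<^sub>R (f (fst p) * g (snd p)))"
    by (auto simp: indicator_def fun_eq_iff)
  ultimately show i: "set_integrable lborel (X \<times> Y) (\<lambda>p. f (fst p) * g (snd p))"
    unfolding set_integrable_def lborel_prod by simp
  show "(LINT p:X \<times> Y|lborel. f (fst p) * g (snd p)) = (LINT x:X|lborel. f x) * (LINT y:Y|lborel. g y)"
    unfolding set_Fubini(2)[OF i] fst_conv snd_conv by simp
qed

section \<open>Characters of the torus\<close>

definition angles :: "(real \<times> real) set" where "angles = {0..<2 * pi} \<times> {0..<2 * pi}"

lemma angles_measurable [measurable, simp]: "angles \<in> sets borel"
  unfolding angles_def by (intro borel_Times) auto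

lemma set_integrable_cis: "set_integrable lborel {0..<2 * pi} (\<lambda>t. cis (of_int n * t))"
proof (rule set_integrable_bound[of _ _ "\<lambda>t. 1::real"])
  show "set_integrable lborel {0..<2 * pi} (\<lambda>t. 1::real)"
    by (simp add: set_integrable_def)
  show "set_borel_measurable lborel {0..<2 * pi} (\<lambda>t. cis (of_int n * t))"
    unfolding set_borel_measurable_def
    by (intro borel_measurable_scaleR borel_measurable_indicator) (auto intro!: borel_measurable_continuous_onI continuous_intros)
qed auto

lemma integral_cis: "(LINT t:{0..<2 * pi}|lborel. cis (of_int n * t)) = (if n = 0 then of_real (2 * pi) else 0)"
proof (cases "n = 0")
  case True
  then show ?thesis by (simp add: set_lebesgue_integral_def) (simp add: scaleR_conv_of_real)
next
  case False
  have "(LINT t:{0..<2 * pi}|lborel. cis (of_int n * t)) = (LINT t:{0..2 * pi}|lborel. cis (of_int n * t))"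
    unfolding set_lebesgue_integral_def
  proof (rule integral_cong_AE)
    show "AE t in lborel. indicator {0..<2 * pi} t *\<^sub>R cis (of_int n * t) = indicator {0..2 * pi} t *\<^sub>R cis (of_int n * t)"
      using AE_lborel_singleton[of "2 * pi"] by eventually_elim (auto simp: indicator_def)
    have "(\<lambda>t. cis (of_int n * t)) \<in> borel_measurable lborel"
      unfolding measurable_lborel2 by (intro borel_measurable_continuous_onI continuous_intros)
    then show "(\<lambda>t. indicator {0..<2 * pi} t *\<^sub>R cis (of_int n * t)) \<in> borel_measurable lborel"
      "(\<lambda>t. indicator {0..2 * pi} t *\<^sub>R cis (of_int n * t)) \<in> borel_measurable lborel"
      by (auto intro!: borel_measurable_scaleR borel_measurable_indicator)
  qed
  also have "\<dots> = cis (of_int n * (2 * pi)) / (\<i> * of_int n) - cis (of_int n * 0) / (\<i> * of_int n)"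
    unfolding set_lebesgue_integral_def
  proof (rule integral_FTC_Icc)
    fix t :: real assume "0 \<le> t" "t \<le> 2 * pi"
    have d: "((\<lambda>t. cis (of_int n * t)) has_derivative (\<lambda>h. (of_int n * h) *\<^sub>R (\<i> * cis (of_int n * t)))) (at t within {0..2 * pi})"
      by (auto intro!: derivative_eq_intros)
    show "((\<lambda>t. cis (of_int n * t) / (\<i> * of_int n)) has_vector_derivative cis (of_int n * t)) (at t within {0..2 * pi})"
    proof -
      have "(\<lambda>h. (of_int n * h) *\<^sub>R (\<i> * cis (of_int n * t)) / (\<i> * of_int n)) = (\<lambda>h. h *\<^sub>R cis (of_int n * t))"
        using False by (simp add: fun_eq_iff scaleR_conv_of_real field_simps)
      then show ?thesis
        using bounded_linear.has_derivative[OF bounded_linear_divide[of "\<i> * of_int n"] d]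
        unfolding has_vector_derivative_def by (simp only:)
    qed
  qed (auto intro!: continuous_intros)
  also have "cis (of_int n * (2 * pi)) = 1"
    using cis_multiple_2pi[of "of_int n"] by (simp add: mult.commute)
  finally show ?thesis using False by simp
qed

definition cis2 :: "int \<Rightarrow> int \<Rightarrow> real \<times> real \<Rightarrow> complex" where
  "cis2 n m \<theta> = cis (of_int n * fst \<theta> + of_int m * snd \<theta>)"

lemma cis2_mult: "cis2 n m \<theta> = cis (of_int n * fst \<theta>) * cis (of_int m * snd \<theta>)"
  by (simp add: cis2_def cis_mult)

lemma set_integrable_cis2: "set_integrable lborel angles (cis2 n m)"
  and integral_cis2: "(LINT \<theta>:angles|lborel. cis2 n m \<theta>) = (if n = 0 \<and> m = 0 then of_real (4 * pi\<^sup>2) else 0)"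
proof -
  show "set_integrable lborel angles (cis2 n m)"
    unfolding angles_def cis2_mult[abs_def] by (rule set_integrable_times(1)[OF set_integrable_cis set_integrable_cis])
  have "(LINT \<theta>:angles|lborel. cis2 n m \<theta>)
      = (LINT t:{0..<2 * pi}|lborel. cis (of_int n * t)) * (LINT t:{0..<2 * pi}|lborel. cis (of_int m * t))"
    unfolding angles_def cis2_mult[abs_def] by (rule set_integrable_times(2)[OF set_integrable_cis set_integrable_cis])
  then show "(LINT \<theta>:angles|lborel. cis2 n m \<theta>) = (if n = 0 \<and> m = 0 then of_real (4 * pi\<^sup>2) else 0)"
    unfolding integral_cis by (auto simp: power2_eq_square)
qed

lemma cis2_measurable [measurable]: "cis2 n m \<in> borel_measurable borel"
  unfolding cis2_def[abs_def] by (intro borel_measurable_continuous_onI continuous_intros)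

lemma norm_cis2 [simp]: "norm (cis2 n m \<theta>) = 1"
  by (simp add: cis2_def)

lemma cis2_cnj: "cnj (cis2 n m \<theta>) = cis2 (- n) (- m) \<theta>" and cis2_add: "cis2 n m \<theta> * cis2 n' m' \<theta> = cis2 (n + n') (m + m') \<theta>"
  and cis2_0: "cis2 0 0 \<theta> = 1"
  by (simp_all add: cis2_def cis_cnj cis_mult algebra_simps)

text \<open>Multiplying by the conjugate character, which has modulus 1, preserves integrability and
  removes the angles; Fubini's theorem then isolates the radial factor.\<close>

lemma set_integrable_monomial:
  fixes X :: "'a::euclidean_space set"
  assumes F: "set_integrable lborel (X \<times> angles) (\<lambda>p. v (fst p) * cis2 n m (snd p))"
  shows "set_integrable lborel X v"
    "(LINT p:X \<times> angles|lborel. v (fst p) * cis2 n m (snd p))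
      = (if n = 0 \<and> m = 0 then of_real (4 * pi\<^sup>2) * (LINT x:X|lborel. v x) else 0)"
proof -
  have "set_integrable lborel (X \<times> angles) (\<lambda>p. (v (fst p) * cis2 n m (snd p)) * cis2 (- n) (- m) (snd p))"
    using F unfolding set_integrable_def
  proof (rule Bochner_Integration.integrable_bound)
    have "(\<lambda>p. indicator (X \<times> angles) p *\<^sub>R (v (fst p) * cis2 n m (snd p))) \<in> borel_measurable lborel"
      using F unfolding set_integrable_def by auto
    moreover have "(\<lambda>p :: 'a \<times> real \<times> real. cis2 (- n) (- m) (snd p)) \<in> borel_measurable lborel"
      unfolding measurable_lborel2 cis2_def by (intro borel_measurable_continuous_onI continuous_intros)
    ultimately have "(\<lambda>p :: 'a \<times> real \<times> real. (indicator (X \<times> angles) p *\<^sub>R (v (fst p) * cis2 n m (snd p))) * cis2 (- n) (- m) (snd p)) \<in> borel_measurable lborel"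
      by (rule borel_measurable_times)
    then show "(\<lambda>p. indicator (X \<times> angles) p *\<^sub>R (v (fst p) * cis2 n m (snd p) * cis2 (- n) (- m) (snd p))) \<in> borel_measurable lborel"
      by simp
  qed (auto simp: norm_mult)
  then have v: "set_integrable lborel (X \<times> angles) (\<lambda>p. v (fst p))"
    by (simp add: mult.assoc cis2_add cis2_0)
  have "set_integrable lborel X (\<lambda>x. LINT y:angles|lborel. v x)"
    using set_Fubini(1)[OF v] by simp
  moreover have "(LINT y:angles|lborel. c) = of_real (4 * pi\<^sup>2) * c" for c :: complex
    using set_integral_mult_right[where A = angles and M = lborel and a = c and f = "cis2 0 0"] integral_cis2[of 0 0]
    by (simp add: cis2_0 mult.commute)
  ultimately have "set_integrable lborel X (\<lambda>x. of_real (4 * pi\<^sup>2) * v x)" by simp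
  then show vi: "set_integrable lborel X v"
    by (subst (asm) set_integrable_mult_right_iff) auto
  show "(LINT p:X \<times> angles|lborel. v (fst p) * cis2 n m (snd p))
      = (if n = 0 \<and> m = 0 then of_real (4 * pi\<^sup>2) * (LINT x:X|lborel. v x) else 0)"
    using set_integrable_times(2)[OF vi set_integrable_cis2[of n m]] unfolding integral_cis2 by (simp add: mult.commute)
qed

subsection \<open>Invariant measures on the boundary\<close>

locale reinhardt_measure = smooth_reinhardt D U \<rho> \<rho>' \<rho>''
  for D U :: "C2 set" and \<rho> \<rho>' \<rho>'' +
  fixes \<mu> :: "C2 measure" and h :: "C2 \<Rightarrow> real"
  assumes h_cont: "continuous_on (frontier D) h"
    and h_pos: "\<zeta> \<in> frontier D \<Longrightarrow> h \<zeta> > 0"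
    and h_rot: "\<zeta> \<in> frontier D \<Longrightarrow> h (rot \<alpha> \<beta> \<zeta>) = h \<zeta>"
    and \<mu>_def: "\<mu> = density (surface_measure D) (\<lambda>\<zeta>. ennreal (h \<zeta>))"
begin

text \<open>The density of \<mu> with respect to dr, d\<theta>1, d\<theta>2; by invariance of
  \<open>h\<close> it depends on the radius alone.\<close>

definition W :: "real \<Rightarrow> real" where "W r = h (\<gamma> r) * (r * \<phi> r * sqrt (1 + (l r)\<^sup>2))"

lemma W_pos: assumes "0 < r" "r < b" shows "0 < W r"
proof -
  have "0 < sqrt (1 + (l r)\<^sup>2)" by (simp add: add_pos_nonneg)
  then show ?thesis
    unfolding W_def using h_pos[OF \<gamma>_frontier[of r]] \<phi>_pos[of r] assms by simp
qed

lemma h_chart: assumes "0 < r" "r < b" shows "h (polar_chart D (r, \<alpha>, \<beta>)) = h (\<gamma> r)"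
proof -
  have "polar_chart D (r, \<alpha>, \<beta>) = rot \<alpha> \<beta> (\<gamma> r)"
    by (simp add: polar_chart_eq rot_def \<gamma>_def pt_def mult.commute)
  then show ?thesis using h_rot[OF \<gamma>_frontier[of r]] assms by simp
qed

lemma h\<gamma>_continuous_on: assumes "c < b" shows "continuous_on {0..c} (\<lambda>r. h (\<gamma> r))"
  by (rule continuous_on_compose2[OF h_cont \<gamma>_continuous_on[OF assms]]) (use assms \<gamma>_frontier in auto)

lemma W_isCont: assumes r: "0 < r" "r < b" shows "isCont W r"
  unfolding W_def[abs_def]
  by (intro continuous_intros l_isCont \<phi>_isCont r continuous_on_imp_isCont[OF h\<gamma>_continuous_on])

lemma h_bounds:
  obtains h0 h1 where "0 < h0" "\<And>\<zeta>. \<zeta> \<in> frontier D \<Longrightarrow> h0 \<le> h \<zeta>" "\<And>\<zeta>. \<zeta> \<in> frontier D \<Longrightarrow> h \<zeta> \<le> h1"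
proof -
  have ne: "frontier D \<noteq> {}"
  proof
    assume "frontier D = {}"
    with \<gamma>_frontier[OF order_refl b_pos] show False by (simp only: empty_iff)
  qed
  from continuous_attains_inf[OF compact_frontier ne h_cont]
  obtain x where x: "x \<in> frontier D" "\<forall>z\<in>frontier D. h x \<le> h z" ..
  from continuous_attains_sup[OF compact_frontier ne h_cont]
  obtain y where y: "y \<in> frontier D" "\<forall>z\<in>frontier D. h z \<le> h y" ..
  show ?thesis by (rule that[of "h x" "h y"]) (use x y h_pos in auto)
qed

lemma isCont_set_measurable:
  fixes f :: "real \<Rightarrow> 'b::euclidean_space"
  assumes "\<And>r. 0 < r \<Longrightarrow> r < b \<Longrightarrow> isCont f r"
  shows "set_borel_measurable lborel {0<..<b} f"
  unfolding set_borel_measurable_def measurable_lborel2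
  using assms by (intro borel_measurable_continuous_on_indicator continuous_at_imp_continuous_on) auto

lemma l_set_integrable: "set_integrable lborel {0<..<b} l"
proof (rule FTC_nonneg_open(1)[OF b_pos, of "\<lambda>r. - \<phi> r" _ "- \<phi> 0" "- 0"])
  fix r assume r: "0 < r" "r < b"
  show "((\<lambda>r. - \<phi> r) has_real_derivative l r) (at r)"
    using DERIV_minus[OF \<phi>_deriv[OF r]] by simp
  show "isCont l r" by (rule l_isCont[OF r])
  show "0 \<le> l r" using l_pos[OF r] by simp
next
  have c: "continuous_on {0..b/2} \<phi>" using b_pos by (intro \<phi>_continuous_on) auto
  have "(\<phi> \<longlongrightarrow> \<phi> 0) (at_right 0)"
    using continuous_on_Icc_at_rightD[OF c] b_pos by simp
  then show "((\<lambda>r. - \<phi> r) \<longlongrightarrow> - \<phi> 0) (at_right 0)" by (rule tendsto_minus)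
  show "((\<lambda>r. - \<phi> r) \<longlongrightarrow> - 0) (at_left b)" by (rule tendsto_minus[OF \<phi>_tendsto_0])
qed

text \<open>The slope may blow up at \<open>b\<close>, but
  \<open>sqrt (1 + (l r)\<^sup>2) \<le> 1 + l r\<close>, and \<open>l\<close> has the bounded
  antiderivative - \<phi>.\<close>

lemma W_set_integrable: "set_integrable lborel {0<..<b} W"
proof -
  obtain h0 h1 where h: "0 < h0" "\<And>\<zeta>. \<zeta> \<in> frontier D \<Longrightarrow> h0 \<le> h \<zeta>" "\<And>\<zeta>. \<zeta> \<in> frontier D \<Longrightarrow> h \<zeta> \<le> h1"
    using h_bounds by metis
  have "h1 > 0" using h(1) h(2)[OF \<gamma>_frontier[OF order_refl b_pos]] h(3)[OF \<gamma>_frontier[OF order_refl b_pos]] by linarith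
  have le: "norm (W r) \<le> norm (h1 * (b * \<phi> 0) * (1 + l r))" if r: "0 < r" "r < b" for r
  proof -
    have l0: "0 < l r" by (rule l_pos[OF r])
    have "sqrt (1 + (l r)\<^sup>2) \<le> 1 + l r"
      using l0 by (intro real_le_lsqrt) (auto simp: power2_sum)
    moreover have "\<phi> r \<le> \<phi> 0" using \<phi>_antimono[of 0 r] r by simp
    ultimately have "r * \<phi> r * sqrt (1 + (l r)\<^sup>2) \<le> (b * \<phi> 0) * (1 + l r)"
      using r \<phi>_pos[of r] l0 by (intro mult_mono) auto
    then have "W r \<le> h1 * ((b * \<phi> 0) * (1 + l r))"
      unfolding W_def using h(3)[OF \<gamma>_frontier[of r]] r \<phi>_pos[of r] \<open>h1 > 0\<close> by - (rule mult_mono, auto)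
    then show ?thesis using W_pos[OF r] by simp
  qed
  show ?thesis
  proof (rule set_integrable_bound[of _ _ "\<lambda>r. h1 * (b * \<phi> 0) * (1 + l r)"])
    have "set_integrable lborel {0<..<b} (\<lambda>r. 1 :: real)"
      using b_pos by (simp add: set_integrable_def integrable_indicator_iff)
    from set_integral_add(1)[OF this l_set_integrable]
    show "set_integrable lborel {0<..<b} (\<lambda>r. h1 * (b * \<phi> 0) * (1 + l r))" by simp
    show "set_borel_measurable lborel {0<..<b} W" by (rule isCont_set_measurable[OF W_isCont])
    show "AE x\<in>{0<..<b} in lborel. norm (W x) \<le> norm (h1 * (b * \<phi> 0) * (1 + l x))"
      using le by auto
  qed
qed

section \<open>The measure in polar coordinates\<close>

lemma polar_box_eq: "polar_box D = {0<..<b} \<times> angles"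
  by (simp add: polar_box_def angles_def)

lemma polar_box_measurable [measurable]: "polar_box D \<in> sets borel"
  unfolding polar_box_eq by (intro borel_Times) auto

lemma chart_measurable: "polar_chart D \<in> measurable (restrict_space lborel (polar_box D)) (restrict_space borel (frontier D))"
proof (rule measurable_restrict_space2)
  show "polar_chart D \<in> space (restrict_space lborel (polar_box D)) \<rightarrow> frontier D"
    using polar_chart_frontier by (auto simp: space_restrict_space polar_box_eq)
  have "continuous_on (polar_box D) (polar_chart D)"
  proof (rule continuous_at_imp_continuous_on, rule ballI)
    fix p assume "p \<in> polar_box D"
    then obtain r \<alpha> \<beta> where "p = (r, \<alpha>, \<beta>)" "0 < r" "r < b"
      by (intro that[of "fst p" "fst (snd p)" "snd (snd p)"]) (auto simp: polar_box_def mem_Times_iff)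
    then show "isCont (polar_chart D) p"
      using has_derivative_continuous[OF polar_chart_deriv] by blast
  qed
  then have "polar_chart D \<in> borel_measurable (restrict_space borel (polar_box D))"
    by (rule borel_measurable_continuous_on_restrict)
  then show "polar_chart D \<in> borel_measurable (restrict_space lborel (polar_box D))"
    by (simp add: measurable_def space_restrict_space sets_restrict_space)
qed

lemma sets_\<mu> [measurable_cong, simp]: "sets \<mu> = sets (restrict_space borel (frontier D))"
  by (simp add: \<mu>_def surface_measure_def)

lemma space_\<mu>: "space \<mu> = frontier D"
  using sets_eq_imp_space_eq[OF sets_\<mu>] by (simp add: space_restrict_space)

lemma measurable_\<mu>: "measurable \<mu> N = measurable (restrict_space borel (frontier D)) N"
  by (rule measurable_cong_sets) auto

lemma \<mu>_integral:
  fixes F :: "C2 \<Rightarrow> 'b::{banach, second_countable_topology}"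
  assumes F: "F \<in> borel_measurable \<mu>"
  shows "integrable \<mu> F \<longleftrightarrow> set_integrable lborel (polar_box D) (\<lambda>p. W (fst p) *\<^sub>R F (polar_chart D p))"
    "integral\<^sup>L \<mu> F = (LINT p:polar_box D|lborel. W (fst p) *\<^sub>R F (polar_chart D p))"
proof -
  let ?B = "restrict_space lborel (polar_box D)" and ?N = "restrict_space borel (frontier D)"
  let ?g = "\<lambda>p. sqrt (gram_det D p)"
  have F': "F \<in> borel_measurable ?N" using F unfolding measurable_\<mu> .
  have h: "h \<in> borel_measurable ?N" by (rule borel_measurable_continuous_on_restrict[OF h_cont])
  have g_eq: "?g p = fst p * \<phi> (fst p) * sqrt (1 + (l (fst p))\<^sup>2)" if "p \<in> polar_box D" for p
  proof -
    obtain r \<alpha> \<beta> where "p = (r, \<alpha>, \<beta>)" "0 < r" "r < b" using \<open>p \<in> polar_box D\<close> by (intro that[of "fst p" "fst (snd p)" "snd (snd p)"]) (auto simp: polar_box_def mem_Times_iff)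
    then show ?thesis by (simp add: gram_det_eq)
  qed
  have c\<phi>: "continuous_on {0<..<b} \<phi>" and cl: "continuous_on {0<..<b} l"
    by (auto intro!: continuous_at_imp_continuous_on \<phi>_isCont l_isCont)
  have cf: "continuous_on (polar_box D) fst" and im: "fst ` polar_box D \<subseteq> {0<..<b}"
    by (rule continuous_on_fst[OF continuous_on_id], auto simp: polar_box_eq)
  have "continuous_on (polar_box D) (\<lambda>p. fst p * \<phi> (fst p) * sqrt (1 + (l (fst p))\<^sup>2))"
    by (rule continuous_on_mult[OF continuous_on_mult[OF cf continuous_on_compose2[OF c\<phi> cf im]]
      continuous_on_real_sqrt[OF continuous_on_add[OF continuous_on_const continuous_on_power[OF continuous_on_compose2[OF cl cf im]]]]])
  then have "(\<lambda>p. fst p * \<phi> (fst p) * sqrt (1 + (l (fst p))\<^sup>2)) \<in> borel_measurable (restrict_space borel (polar_box D))"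
    by (rule borel_measurable_continuous_on_restrict)
  then have "(\<lambda>p. fst p * \<phi> (fst p) * sqrt (1 + (l (fst p))\<^sup>2)) \<in> borel_measurable ?B"
    by (simp add: measurable_def space_restrict_space sets_restrict_space)
  then have g: "?g \<in> borel_measurable ?B"
    by (subst measurable_cong[where g = "\<lambda>p. fst p * \<phi> (fst p) * sqrt (1 + (l (fst p))\<^sup>2)"])
      (auto simp: space_restrict_space g_eq)
  have g0: "AE p in ?B. 0 \<le> ?g p"
  proof (rule AE_I2)
    fix p assume "p \<in> space ?B"
    then have "p \<in> polar_box D" by (simp add: space_restrict_space)
    then show "0 \<le> ?g p" unfolding g_eq[OF \<open>p \<in> polar_box D\<close>] using \<phi>_pos[of "fst p"] by (auto simp: polar_box_eq)
  qed
  let ?S = "surface_measure D"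
  have hS: "h \<in> borel_measurable ?S" "F \<in> borel_measurable ?S"
    using h F' by (simp_all add: surface_measure_def)
  have h0: "AE x in ?S. 0 \<le> h x"
    by (rule AE_I2) (use h_pos in \<open>auto simp: surface_measure_def space_restrict_space intro: less_imp_le\<close>)
  have hF: "(\<lambda>x. h x *\<^sub>R F x) \<in> borel_measurable ?N" using h F' by (rule borel_measurable_scaleR)
  have ch: "polar_chart D \<in> measurable (density ?B (\<lambda>p. ennreal (?g p))) ?N"
    using chart_measurable by simp
  have hFc: "(\<lambda>p. h (polar_chart D p) *\<^sub>R F (polar_chart D p)) \<in> borel_measurable ?B"
    using measurable_compose[OF chart_measurable hF] .
  have eq: "indicator (polar_box D) p *\<^sub>R (?g p *\<^sub>R (h (polar_chart D p) *\<^sub>R F (polar_chart D p)))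
    = indicator (polar_box D) p *\<^sub>R (W (fst p) *\<^sub>R F (polar_chart D p))" for p
  proof (cases "p \<in> polar_box D")
    case True
    then obtain r \<alpha> \<beta> where p: "p = (r, \<alpha>, \<beta>)" "0 < r" "r < b" by (intro that[of "fst p" "fst (snd p)" "snd (snd p)"]) (auto simp: polar_box_def mem_Times_iff)
    then show ?thesis unfolding g_eq[OF True] by (simp add: h_chart W_def)
  qed simp
  show "integrable \<mu> F \<longleftrightarrow> set_integrable lborel (polar_box D) (\<lambda>p. W (fst p) *\<^sub>R F (polar_chart D p))"
    unfolding \<mu>_def integrable_density[OF hS(2,1) h0]
    unfolding surface_measure_def integrable_distr_eq[OF ch hF] integrable_density[OF hFc g g0]
    by (subst integrable_restrict_space) (simp, simp only: set_integrable_def eq)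
  show "integral\<^sup>L \<mu> F = (LINT p:polar_box D|lborel. W (fst p) *\<^sub>R F (polar_chart D p))"
    unfolding \<mu>_def integral_density[OF hS(2,1) h0]
    unfolding surface_measure_def integral_distr[OF ch hF] integral_density[OF hFc g g0]
    by (subst integral_restrict_space) (simp, simp only: set_lebesgue_integral_def eq)
qed

lemma finite_\<mu>: "finite_measure \<mu>"
proof
  have "set_integrable lborel {0<..<b} (\<lambda>r. complex_of_real (W r))"
    using integrable_of_real[OF W_set_integrable[unfolded set_integrable_def]]
    by (simp add: set_integrable_def scaleR_conv_of_real)
  from set_integrable_times(1)[OF this set_integrable_cis2[of 0 0]]
  have "integrable \<mu> (\<lambda>x. 1 :: complex)"
    by (subst \<mu>_integral) (simp_all add: polar_box_eq cis2_0 scaleR_conv_of_real)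
  then show "emeasure \<mu> (space \<mu>) \<noteq> \<infinity>" by (simp add: integrable_iff_bounded)
qed

sublocale finite_measure \<mu> by (rule finite_\<mu>)

subsection \<open>Monomials\<close>

lemma monomial_integral:
  assumes F: "integrable \<mu> F" and v: "\<And>r \<theta>. 0 < r \<Longrightarrow> r < b \<Longrightarrow> F (polar_chart D (r, \<theta>)) = v r * cis2 n m \<theta>"
  shows "set_integrable lborel {0<..<b} (\<lambda>r. of_real (W r) * v r)"
    "integral\<^sup>L \<mu> F = (if n = 0 \<and> m = 0 then of_real (4 * pi\<^sup>2) * (LINT r:{0<..<b}|lborel. of_real (W r) * v r) else 0)"
proof -
  have Fm: "F \<in> borel_measurable \<mu>" using F by auto
  have eq: "indicator (polar_box D) p *\<^sub>R (W (fst p) *\<^sub>R F (polar_chart D p))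
      = indicator ({0<..<b} \<times> angles) p *\<^sub>R ((of_real (W (fst p)) * v (fst p)) * cis2 n m (snd p))" for p
    using v[of "fst p" "snd p"] by (auto simp: polar_box_eq indicator_def scaleR_conv_of_real)
  have i: "set_integrable lborel ({0<..<b} \<times> angles) (\<lambda>p. (of_real (W (fst p)) * v (fst p)) * cis2 n m (snd p))"
    using F unfolding \<mu>_integral(1)[OF Fm] set_integrable_def eq .
  show "set_integrable lborel {0<..<b} (\<lambda>r. of_real (W r) * v r)"
    by (rule set_integrable_monomial(1)[OF i])
  show "integral\<^sup>L \<mu> F = (if n = 0 \<and> m = 0 then of_real (4 * pi\<^sup>2) * (LINT r:{0<..<b}|lborel. of_real (W r) * v r) else 0)"
  proof -
    have "integral\<^sup>L \<mu> F = (LINT p:{0<..<b} \<times> angles|lborel. (of_real (W (fst p)) * v (fst p)) * cis2 n m (snd p))"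
      unfolding \<mu>_integral(2)[OF Fm] set_lebesgue_integral_def eq ..
    then show ?thesis unfolding set_integrable_monomial(2)[OF i] .
  qed
qed

definition coef :: "(C2 \<Rightarrow> complex) \<Rightarrow> real \<Rightarrow> complex" where "coef F r = F (\<gamma> r)"

lemma \<gamma>_chart: "\<gamma> r = polar_chart D (r, 0, 0)"
  by (simp add: \<gamma>_def pt_def polar_chart_eq)

lemma monomial_coef:
  assumes "monomial D n m F" "0 < r" "r < b"
  shows "F (polar_chart D (r, \<theta>)) = coef F r * cis2 n m \<theta>"
proof -
  obtain g where "\<forall>r \<alpha> \<beta>. 0 < r \<and> r < b \<longrightarrow>
      F (polar_chart D (r, \<alpha>, \<beta>)) = g r * cis (of_int n * \<alpha> + of_int m * \<beta>)"
    using assms(1) unfolding monomial_def ..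
  then have g: "F (polar_chart D (r, \<alpha>, \<beta>)) = g r * cis (of_int n * \<alpha> + of_int m * \<beta>)" for \<alpha> \<beta>
    using assms(2,3) by simp
  have "coef F r = g r" using g[of 0 0] by (simp add: coef_def \<gamma>_chart)
  then show ?thesis using g[of "fst \<theta>" "snd \<theta>"] by (simp add: cis2_def)
qed

lemma monomialI:
  assumes "\<And>r \<theta>. 0 < r \<Longrightarrow> r < b \<Longrightarrow> F (polar_chart D (r, \<theta>)) = v r * cis2 n m \<theta>"
  shows "monomial D n m F"
  unfolding monomial_def using assms[of _ "(_, _)"] by (intro exI[of _ v]) (auto simp: cis2_def)

lemma inner_monomial:
  assumes F: "F \<in> L2 \<mu>" "monomial D n m F" and G: "G \<in> L2 \<mu>" "monomial D n' m' G"
  shows "set_integrable lborel {0<..<b} (\<lambda>r. of_real (W r) * (coef F r * cnj (coef G r)))"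
    "L2_inner \<mu> F G = (if n = n' \<and> m = m' then of_real (4 * pi\<^sup>2) *
      (LINT r:{0<..<b}|lborel. of_real (W r) * (coef F r * cnj (coef G r))) else 0)"
proof -
  have eq: "F (polar_chart D (r, \<theta>)) * cnj (G (polar_chart D (r, \<theta>)))
      = (coef F r * cnj (coef G r)) * cis2 (n - n') (m - m') \<theta>" if "0 < r" "r < b" for r \<theta>
    unfolding monomial_coef[OF F(2) that] monomial_coef[OF G(2) that]
    using cis2_add[of n m \<theta> "- n'" "- m'"] by (simp add: cis2_cnj mult_ac)
  note i = L2_inner_integrable[OF F(1) G(1)]
  show "set_integrable lborel {0<..<b} (\<lambda>r. of_real (W r) * (coef F r * cnj (coef G r)))"
    by (rule monomial_integral(1)[OF i eq])
  show "L2_inner \<mu> F G = (if n = n' \<and> m = m' then of_real (4 * pi\<^sup>2) *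
      (LINT r:{0<..<b}|lborel. of_real (W r) * (coef F r * cnj (coef G r))) else 0)"
    unfolding L2_inner_def using monomial_integral(2)[OF i eq] by simp
qed

end

subsection \<open>Expansion in monomials\<close>

lemma L2_dominated_convergence:
  assumes f: "f \<in> borel_measurable M" "\<And>n. s n \<in> borel_measurable M"
    and w: "integrable M (\<lambda>x. (w x)\<^sup>2)" "\<And>x. x \<in> space M \<Longrightarrow> cmod (f x) \<le> w x"
      "\<And>n x. x \<in> space M \<Longrightarrow> cmod (s n x) \<le> w x"
    and lim: "\<And>x. x \<in> space M \<Longrightarrow> (\<lambda>n. s n x) \<longlonglongrightarrow> f x"
  shows "(\<lambda>n. L2_norm M (\<lambda>x. f x - s n x)) \<longlonglongrightarrow> 0"
proof -
  have "(\<lambda>n. LINT x|M. (cmod (f x - s n x))\<^sup>2) \<longlonglongrightarrow> (LINT x|M. 0)"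
  proof (rule integral_dominated_convergence)
    show "integrable M (\<lambda>x. 4 * (w x)\<^sup>2)" using w(1) by simp
    show "AE x in M. (\<lambda>n. (cmod (f x - s n x))\<^sup>2) \<longlonglongrightarrow> 0"
    proof (rule AE_I2)
      fix x assume "x \<in> space M"
      have "(\<lambda>n. (cmod (f x - s n x))\<^sup>2) \<longlonglongrightarrow> (cmod (f x - f x))\<^sup>2"
        by (intro tendsto_intros lim \<open>x \<in> space M\<close>)
      then show "(\<lambda>n. (cmod (f x - s n x))\<^sup>2) \<longlonglongrightarrow> 0" by simp
    qed
    show "AE x in M. norm ((cmod (f x - s n x))\<^sup>2) \<le> 4 * (w x)\<^sup>2" for n
    proof (rule AE_I2)
      fix x assume x: "x \<in> space M"
      have "cmod (f x - s n x) \<le> 2 * w x"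
        using norm_triangle_ineq4[of "f x" "s n x"] w(2)[OF x] w(3)[OF x, of n] by linarith
      then have "(cmod (f x - s n x))\<^sup>2 \<le> (2 * w x)\<^sup>2" by (intro power_mono) auto
      then show "norm ((cmod (f x - s n x))\<^sup>2) \<le> 4 * (w x)\<^sup>2" by (simp add: power_mult_distrib)
    qed
  qed (use f in auto)
  then have "(\<lambda>n. sqrt (LINT x|M. (cmod (f x - s n x))\<^sup>2)) \<longlonglongrightarrow> sqrt 0"
    by (intro tendsto_real_sqrt) simp
  then show ?thesis by (simp add: L2_norm_def)
qed

context reinhardt_measure
begin

section \<open>Fourier projections onto monomials\<close>

definition avg :: "int \<Rightarrow> int \<Rightarrow> (C2 \<Rightarrow> complex) \<Rightarrow> real \<Rightarrow> complex" where
  "avg n m f r = (LINT \<theta>|lborel. indicator (polar_box D) (r, \<theta>) *\<^sub>R (f (polar_chart D (r, \<theta>)) * cis2 (- n) (- m) \<theta>)) / of_real (4 * pi\<^sup>2)"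

text \<open>(z / |z|)^n for integer \<open>n\<close>, total and of modulus at most 1 also at z = 0,
  so that projections are Borel functions on all of C^2.\<close>

definition unit_pow :: "int \<Rightarrow> complex \<Rightarrow> complex" where
  "unit_pow n z = (if 0 \<le> n then sgn z ^ nat n else cnj (sgn z) ^ nat (- n))"

definition proj :: "int \<Rightarrow> int \<Rightarrow> (C2 \<Rightarrow> complex) \<Rightarrow> C2 \<Rightarrow> complex" where
  "proj n m f \<zeta> = avg n m f (cmod (fst \<zeta>)) * (unit_pow n (fst \<zeta>) * unit_pow m (snd \<zeta>))"

lemma unit_pow_cis: assumes "0 < r" shows "unit_pow n (of_real r * cis \<alpha>) = cis (of_int n * \<alpha>)"
proof -
  have "sgn (of_real r * cis \<alpha>) = cis \<alpha>" using assms by (simp add: sgn_mult sgn_of_real)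
  then show ?thesis
    using Complex.DeMoivre[of \<alpha> "nat n"] Complex.DeMoivre[of "- \<alpha>" "nat (- n)"]
    by (cases "0 \<le> n") (simp_all add: unit_pow_def cis_cnj)
qed

lemma unit_pow_measurable [measurable]: "unit_pow n \<in> borel_measurable borel"
proof -
  have "(sgn :: complex \<Rightarrow> complex) \<in> borel_measurable borel"
    unfolding sgn_div_norm[abs_def] by measurable
  moreover have "cnj \<in> borel_measurable borel"
    by (intro borel_measurable_continuous_onI continuous_intros)
  ultimately show ?thesis unfolding unit_pow_def[abs_def]
    by (cases "0 \<le> n") (auto intro!: borel_measurable_power measurable_compose[of sgn borel borel cnj])
qed

lemma proj_chart: "0 < r \<Longrightarrow> r < b \<Longrightarrow> proj n m f (polar_chart D (r, \<theta>)) = avg n m f r * cis2 n m \<theta>"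
  using \<phi>_pos[of r] polar_chart_eq[of r "fst \<theta>" "snd \<theta>"]
  by (simp add: proj_def unit_pow_cis cis2_mult norm_mult)

lemma proj_monomial: "monomial D n m (proj n m f)"
  by (rule monomialI) (rule proj_chart)

lemma avg_eq: "0 < r \<Longrightarrow> r < b \<Longrightarrow>
    avg n m f r = (LINT \<theta>:angles|lborel. f (polar_chart D (r, \<theta>)) * cis2 (- n) (- m) \<theta>) / of_real (4 * pi\<^sup>2)"
  by (simp add: avg_def set_lebesgue_integral_def polar_box_eq indicator_times)

lemma chart_comp_measurable:
  assumes "f \<in> borel_measurable \<mu>"
  shows "(\<lambda>p. indicator (polar_box D) p *\<^sub>R (f (polar_chart D p) :: complex)) \<in> borel_measurable borel"
proof -
  have "(\<lambda>p. f (polar_chart D p)) \<in> borel_measurable (restrict_space lborel (polar_box D))"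
    using measurable_compose[OF chart_measurable] assms unfolding measurable_\<mu> by blast
  then show ?thesis
    by (subst (asm) borel_measurable_restrict_space_iff) (auto simp: mult.commute)
qed

lemma avg_measurable:
  assumes f: "f \<in> borel_measurable \<mu>" shows "avg n m f \<in> borel_measurable borel"
proof -
  have c: "(\<lambda>p :: real \<times> real \<times> real. cis2 (- n) (- m) (snd p)) \<in> borel_measurable borel"
    unfolding cis2_def by (intro borel_measurable_continuous_onI continuous_intros)
  have "(\<lambda>p. (indicator (polar_box D) p *\<^sub>R f (polar_chart D p)) * cis2 (- n) (- m) (snd p)) \<in> borel_measurable borel"
    by (rule borel_measurable_times[OF chart_comp_measurable[OF f] c])
  then have "(\<lambda>p. indicator (polar_box D) p *\<^sub>R (f (polar_chart D p) * cis2 (- n) (- m) (snd p))) \<in> borel_measurable (lborel \<Otimes>\<^sub>M lborel)"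
    by (simp add: lborel_prod)
  then have "(\<lambda>(r, \<theta>). indicator (polar_box D) (r, \<theta>) *\<^sub>R (f (polar_chart D (r, \<theta>)) * cis2 (- n) (- m) \<theta>)) \<in> borel_measurable (lborel \<Otimes>\<^sub>M lborel)"
    by (simp add: case_prod_beta')
  from lborel.borel_measurable_lebesgue_integral[OF this]
  have "(\<lambda>r. LINT \<theta>|lborel. indicator (polar_box D) (r, \<theta>) *\<^sub>R (f (polar_chart D (r, \<theta>)) * cis2 (- n) (- m) \<theta>)) \<in> borel_measurable borel"
    by simp
  then show ?thesis unfolding avg_def[abs_def] by (rule borel_measurable_divide) simp
qed

lemma proj_measurable: assumes "f \<in> borel_measurable \<mu>" shows "proj n m f \<in> borel_measurable \<mu>"
proof -
  have c: "(\<lambda>\<zeta>::C2. cmod (fst \<zeta>)) \<in> borel_measurable borel" "(\<lambda>\<zeta>::C2. fst \<zeta>) \<in> borel_measurable borel"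
    "(\<lambda>\<zeta>::C2. snd \<zeta>) \<in> borel_measurable borel"
    by (intro borel_measurable_continuous_onI continuous_intros)+
  have "proj n m f \<in> borel_measurable borel"
    unfolding proj_def[abs_def]
    by (intro borel_measurable_times measurable_compose[OF c(1) avg_measurable[OF assms]]
        measurable_compose[OF c(2) unit_pow_measurable] measurable_compose[OF c(3) unit_pow_measurable])
  then show ?thesis unfolding measurable_\<mu> by (rule measurable_restrict_space1)
qed

lemma angles_finite: "finite_measure (restrict_space lborel angles)"
proof
  have "bounded angles" unfolding angles_def by (intro bounded_Times bounded_Ico)
  then have "emeasure lborel angles \<noteq> \<infinity>"
    using emeasure_bounded_finite[of angles] by simp
  then show "emeasure (restrict_space lborel angles) (space (restrict_space lborel angles)) \<noteq> \<infinity>"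
    by (simp add: emeasure_restrict_space space_restrict_space)
qed

text \<open>Cauchy--Schwarz against a single character on the torus of mass 4 \<pi>^2. The slice of
  \<open>f\<close> is known to be square integrable only for almost every radius, hence the form of
  the statement.\<close>

lemma avg_bound:
  assumes f: "f \<in> L2 \<mu>"
  shows "AE r in lborel. r \<in> {0<..<b} \<longrightarrow>
    (cmod (avg n m f r))\<^sup>2 \<le> (LINT \<theta>:angles|lborel. (cmod (f (polar_chart D (r, \<theta>))))\<^sup>2) / (4 * pi\<^sup>2)"
proof -
  let ?\<Theta> = "restrict_space lborel angles"
  have fm: "f \<in> borel_measurable \<mu>" by (rule L2_measurable[OF f])
  have i: "integrable \<mu> (\<lambda>x. complex_of_real ((cmod (f x))\<^sup>2))"
    using L2_integrable_square[OF f] by (rule integrable_of_real)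
  then have "set_integrable lborel ({0<..<b} \<times> angles) (\<lambda>p. W (fst p) *\<^sub>R complex_of_real ((cmod (f (polar_chart D p)))\<^sup>2))"
    using \<mu>_integral(1)[of "\<lambda>x. complex_of_real ((cmod (f x))\<^sup>2)"] unfolding polar_box_eq by auto
  from set_Fubini(3)[OF this]
  show ?thesis
  proof eventually_elim
    case (elim r)
    show ?case
    proof
      assume r: "r \<in> {0<..<b}"
      let ?g = "\<lambda>\<theta>. f (polar_chart D (r, \<theta>))"
      have W0: "W r \<noteq> 0" using W_pos[of r] r by auto
      have "set_integrable lborel angles (\<lambda>\<theta>. of_real (W r) * complex_of_real ((cmod (?g \<theta>))\<^sup>2))"
        using elim r by (simp add: scaleR_conv_of_real)
      then have "set_integrable lborel angles (\<lambda>\<theta>. complex_of_real ((cmod (?g \<theta>))\<^sup>2))"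
        using W0 by (subst (asm) set_integrable_mult_right_iff) auto
      then have gi: "set_integrable lborel angles (\<lambda>\<theta>. (cmod (?g \<theta>))\<^sup>2)"
        unfolding set_integrable_def using integrable_Re[of lborel "\<lambda>\<theta>. indicator angles \<theta> *\<^sub>R complex_of_real ((cmod (?g \<theta>))\<^sup>2)"]
        by simp
      have "(\<lambda>\<theta>. (r, \<theta>)) \<in> borel_measurable borel"
        by (intro borel_measurable_continuous_onI continuous_intros)
      from measurable_compose[OF this chart_comp_measurable[OF fm]]
      have "(\<lambda>\<theta>. indicator angles \<theta> *\<^sub>R ?g \<theta>) \<in> borel_measurable borel"
        using r by (simp add: polar_box_eq indicator_times)
      then have gm: "?g \<in> borel_measurable ?\<Theta>"
        by (subst borel_measurable_restrict_space_iff) (auto simp: mult.commute)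
      have gL: "?g \<in> L2 ?\<Theta>"
        using gm gi by (intro L2_I) (auto simp: integrable_restrict_space set_integrable_def)
      have cm: "cis2 n m \<in> borel_measurable ?\<Theta>" for n m
        by (rule measurable_restrict_space1) simp
      have cL: "cis2 n m \<in> L2 ?\<Theta>"
        by (rule L2_I_bounded[OF angles_finite cm, of _ _ 1]) simp
      have "L2_norm ?\<Theta> (cis2 n m) = sqrt (LINT \<theta>:angles|lborel. 1)"
        unfolding L2_norm_def norm_cis2 one_power2 set_lebesgue_integral_def
        by (subst integral_restrict_space) simp_all
      moreover have "complex_of_real (LINT \<theta>:angles|lborel. 1) = of_real (4 * pi\<^sup>2)"
        using integral_cis2[of 0 0] unfolding cis2_0 set_integral_complex_of_real[symmetric] of_real_1 by simp
      then have "(LINT \<theta>:angles|lborel. 1) = 4 * pi\<^sup>2" unfolding of_real_eq_iff .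
      ultimately have nc: "(L2_norm ?\<Theta> (cis2 n m))\<^sup>2 = 4 * pi\<^sup>2" by simp
      have ng: "(L2_norm ?\<Theta> ?g)\<^sup>2 = (LINT \<theta>:angles|lborel. (cmod (?g \<theta>))\<^sup>2)"
        by (simp add: L2_norm_power2 integral_restrict_space set_lebesgue_integral_def)
      have "avg n m f r = L2_inner ?\<Theta> ?g (cis2 n m) / of_real (4 * pi\<^sup>2)"
        using avg_eq[of r n m f] r by (simp add: L2_inner_def integral_restrict_space set_lebesgue_integral_def cis2_cnj)
      then have "cmod (avg n m f r) = cmod (L2_inner ?\<Theta> ?g (cis2 n m)) / (4 * pi\<^sup>2)"
        by (simp add: norm_divide norm_mult norm_power)
      also have "\<dots> \<le> (L2_norm ?\<Theta> ?g * L2_norm ?\<Theta> (cis2 n m)) / (4 * pi\<^sup>2)"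
        by (intro divide_right_mono L2_Cauchy_Schwarz gL cL) simp
      finally have "(cmod (avg n m f r))\<^sup>2 \<le> ((L2_norm ?\<Theta> ?g * L2_norm ?\<Theta> (cis2 n m)) / (4 * pi\<^sup>2))\<^sup>2"
        by (intro power_mono) auto
      also have "\<dots> = (LINT \<theta>:angles|lborel. (cmod (?g \<theta>))\<^sup>2) * (4 * pi\<^sup>2) / (4 * pi\<^sup>2)\<^sup>2"
        unfolding power_divide power_mult_distrib[of "L2_norm ?\<Theta> ?g"] nc ng ..
      also have "\<dots> = (LINT \<theta>:angles|lborel. (cmod (?g \<theta>))\<^sup>2) / (4 * pi\<^sup>2)"
        by (simp add: power2_eq_square)
      finally show "(cmod (avg n m f r))\<^sup>2 \<le> (LINT \<theta>:angles|lborel. (cmod (f (polar_chart D (r, \<theta>))))\<^sup>2) / (4 * pi\<^sup>2)" .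
    qed
  qed
qed

lemma proj_L2: assumes f: "f \<in> L2 \<mu>" shows "proj n m f \<in> L2 \<mu>"
proof (rule L2_I)
  have fm: "f \<in> borel_measurable \<mu>" by (rule L2_measurable[OF f])
  show pm: "proj n m f \<in> borel_measurable \<mu>" by (rule proj_measurable[OF fm])
  have "integrable \<mu> (\<lambda>x. complex_of_real ((cmod (f x))\<^sup>2))"
    using L2_integrable_square[OF f] by (rule integrable_of_real)
  then have F: "set_integrable lborel ({0<..<b} \<times> angles) (\<lambda>p. W (fst p) *\<^sub>R complex_of_real ((cmod (f (polar_chart D p)))\<^sup>2))"
    using \<mu>_integral(1)[of "\<lambda>x. complex_of_real ((cmod (f x))\<^sup>2)"] fm unfolding polar_box_eq by auto
  have "set_integrable lborel {0<..<b} (\<lambda>r. of_real (W r * (cmod (avg n m f r))\<^sup>2) :: complex)"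
  proof (rule set_integrable_bound)
    show "set_integrable lborel {0<..<b} (\<lambda>r. (LINT \<theta>:angles|lborel. W r *\<^sub>R complex_of_real ((cmod (f (polar_chart D (r, \<theta>))))\<^sup>2)) / of_real (4 * pi\<^sup>2))"
      using set_Fubini(1)[OF F] by simp
    show "set_borel_measurable lborel {0<..<b} (\<lambda>r. of_real (W r * (cmod (avg n m f r))\<^sup>2) :: complex)"
    proof -
      have "set_borel_measurable lborel {0<..<b} W" by (rule isCont_set_measurable[OF W_isCont])
      then have [measurable]: "(\<lambda>r. indicator {0<..<b} r *\<^sub>R W r) \<in> borel_measurable borel"
        unfolding set_borel_measurable_def measurable_lborel2 .
      have [measurable]: "avg n m f \<in> borel_measurable borel" by (rule avg_measurable[OF fm])
      have "(\<lambda>r. complex_of_real ((indicator {0<..<b} r *\<^sub>R W r) * (cmod (avg n m f r))\<^sup>2)) \<in> borel_measurable borel"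
        by measurable
      then show ?thesis unfolding set_borel_measurable_def by (simp add: scaleR_conv_of_real mult.assoc)
    qed
    show "AE r\<in>{0<..<b} in lborel. norm (of_real (W r * (cmod (avg n m f r))\<^sup>2) :: complex)
        \<le> norm ((LINT \<theta>:angles|lborel. W r *\<^sub>R complex_of_real ((cmod (f (polar_chart D (r, \<theta>))))\<^sup>2)) / of_real (4 * pi\<^sup>2))"
      using avg_bound[OF f, of n m]
    proof eventually_elim
      case (elim r)
      show ?case
      proof
        assume r: "r \<in> {0<..<b}"
        let ?I = "LINT \<theta>:angles|lborel. (cmod (f (polar_chart D (r, \<theta>))))\<^sup>2"
        have I: "(LINT \<theta>:angles|lborel. W r *\<^sub>R complex_of_real ((cmod (f (polar_chart D (r, \<theta>))))\<^sup>2)) = complex_of_real (W r * ?I)"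
          unfolding scaleR_conv_of_real of_real_mult[symmetric] set_integral_complex_of_real by simp
        have "0 \<le> W r * (cmod (avg n m f r))\<^sup>2" using W_pos[of r] r by simp
        then have "norm (of_real (W r * (cmod (avg n m f r))\<^sup>2) :: complex) = W r * (cmod (avg n m f r))\<^sup>2"
          by (simp only: norm_of_real abs_of_nonneg)
        also have "\<dots> \<le> W r * (?I / (4 * pi\<^sup>2))"
          using elim r W_pos[of r] by (intro mult_left_mono) auto
        also have "\<dots> \<le> \<bar>W r * ?I / (4 * pi\<^sup>2)\<bar>" unfolding times_divide_eq_right by (rule abs_ge_self)
        also have "\<dots> = norm (complex_of_real (W r * ?I) / of_real (4 * pi\<^sup>2))"
          by (simp only: of_real_divide[symmetric] norm_of_real)
        finally show "norm (of_real (W r * (cmod (avg n m f r))\<^sup>2) :: complex)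
            \<le> norm ((LINT \<theta>:angles|lborel. W r *\<^sub>R complex_of_real ((cmod (f (polar_chart D (r, \<theta>))))\<^sup>2)) / of_real (4 * pi\<^sup>2))"
          unfolding I .
      qed
    qed
  qed
  from set_integrable_times(1)[OF this set_integrable_cis2[of 0 0]]
  have "set_integrable lborel (polar_box D) (\<lambda>p. of_real (W (fst p) * (cmod (avg n m f (fst p)))\<^sup>2) :: complex)"
    unfolding polar_box_eq by (simp add: cis2_0)
  moreover have "indicator (polar_box D) p *\<^sub>R (of_real (W (fst p) * (cmod (avg n m f (fst p)))\<^sup>2) :: complex)
      = indicator (polar_box D) p *\<^sub>R (W (fst p) *\<^sub>R complex_of_real ((cmod (proj n m f (polar_chart D p)))\<^sup>2))" for p
    using proj_chart[of "fst p" n m f "snd p"]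
    by (auto simp: polar_box_eq indicator_def norm_mult scaleR_conv_of_real)
  ultimately have "integrable \<mu> (\<lambda>x. complex_of_real ((cmod (proj n m f x))\<^sup>2))"
    using pm by (subst \<mu>_integral(1)) (auto simp: set_integrable_def)
  from integrable_Re[OF this]
  show "integrable \<mu> (\<lambda>x. (cmod (proj n m f x))\<^sup>2)" by simp
qed

text \<open>Integrating over the angles against a monomial of degree (n, m) produces the Fourier
  coefficient, so \<open>proj n m\<close> is the orthogonal projection onto the monomials of that
  degree.\<close>

lemma proj_inner:
  assumes f: "f \<in> L2 \<mu>" and G: "G \<in> L2 \<mu>" "monomial D n m G"
  shows "L2_inner \<mu> (proj n m f) G = L2_inner \<mu> f G"
proof -
  note i = L2_inner_integrable[OF f G(1)]
  have im: "(\<lambda>x. f x * cnj (G x)) \<in> borel_measurable \<mu>" using i by auto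
  let ?F = "\<lambda>p. W (fst p) *\<^sub>R (f (polar_chart D p) * cnj (G (polar_chart D p)))"
  have F: "set_integrable lborel ({0<..<b} \<times> angles) ?F"
    using i unfolding \<mu>_integral(1)[OF im] polar_box_eq .
  have c: "coef (proj n m f) r = avg n m f r" if "0 < r" "r < b" for r
    using proj_chart[OF that, of n m f "(0, 0)"] by (simp add: coef_def \<gamma>_chart cis2_def)
  have inner: "(LINT \<theta>:angles|lborel. ?F (r, \<theta>)) = of_real (4 * pi\<^sup>2) * (of_real (W r) * (avg n m f r * cnj (coef G r)))"
    if r: "r \<in> {0<..<b}" for r
  proof -
    have "?F (r, \<theta>) = (of_real (W r) * cnj (coef G r)) * (f (polar_chart D (r, \<theta>)) * cis2 (- n) (- m) \<theta>)" for \<theta>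
      using monomial_coef[OF G(2), of r \<theta>] r by (simp add: cis2_cnj scaleR_conv_of_real mult_ac)
    then have "(LINT \<theta>:angles|lborel. ?F (r, \<theta>)) = (of_real (W r) * cnj (coef G r)) * (LINT \<theta>:angles|lborel. f (polar_chart D (r, \<theta>)) * cis2 (- n) (- m) \<theta>)"
      by simp
    also have "(LINT \<theta>:angles|lborel. f (polar_chart D (r, \<theta>)) * cis2 (- n) (- m) \<theta>) = of_real (4 * pi\<^sup>2) * avg n m f r"
      using r by (simp add: avg_eq)
    finally show ?thesis by (simp add: mult_ac)
  qed
  have "L2_inner \<mu> f G = (LINT r:{0<..<b}|lborel. LINT \<theta>:angles|lborel. ?F (r, \<theta>))"
    unfolding L2_inner_def \<mu>_integral(2)[OF im] polar_box_eq by (rule set_Fubini(2)[OF F])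
  also have "\<dots> = (LINT r:{0<..<b}|lborel. of_real (4 * pi\<^sup>2) * (of_real (W r) * (coef (proj n m f) r * cnj (coef G r))))"
  proof (rule set_lebesgue_integral_cong)
    show "\<forall>r. r \<in> {0<..<b} \<longrightarrow> (LINT \<theta>:angles|lborel. ?F (r, \<theta>)) = of_real (4 * pi\<^sup>2) * (of_real (W r) * (coef (proj n m f) r * cnj (coef G r)))"
    proof (intro allI impI)
      fix r assume r: "r \<in> {0<..<b}"
      then have "coef (proj n m f) r = avg n m f r" using c[of r] by simp
      with inner[OF r] show "(LINT \<theta>:angles|lborel. ?F (r, \<theta>)) = of_real (4 * pi\<^sup>2) * (of_real (W r) * (coef (proj n m f) r * cnj (coef G r)))"
        by (simp only:)
    qed
  qed simp
  also have "\<dots> = L2_inner \<mu> (proj n m f) G"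
    unfolding inner_monomial(2)[OF proj_L2[OF f] proj_monomial G] by simp
  finally show ?thesis ..
qed

section \<open>Density of finite sums of bounded monomials\<close>

inductive mono_span :: "(int \<times> int) set \<Rightarrow> (C2 \<Rightarrow> complex) \<Rightarrow> bool" where
  mono: "monomial D n m F \<Longrightarrow> F \<in> borel_measurable \<mu> \<Longrightarrow> (\<And>x. x \<in> frontier D \<Longrightarrow> cmod (F x) \<le> B) \<Longrightarrow> mono_span {(n, m)} F"
| add: "mono_span S F \<Longrightarrow> mono_span S' G \<Longrightarrow> mono_span (S \<union> S') (\<lambda>x. F x + G x)"

lemma mono_span_finite: "mono_span S F \<Longrightarrow> finite S"
  by (induction rule: mono_span.induct) auto

lemma mono_span_L2: "mono_span S F \<Longrightarrow> F \<in> L2 \<mu>"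
proof (induction rule: mono_span.induct)
  case (mono n m F B)
  then show ?case by (intro L2_I_bounded[OF finite_\<mu>]) (auto simp: space_\<mu>)
next
  case (add S F S' G)
  then show ?case by (intro L2_add)
qed

text \<open>The set \<open>S\<close> carried by \<open>mono_span\<close> contains the degrees that
  occur in \<open>F\<close>, so orthogonality to those degrees is orthogonality to the whole
  sum.\<close>

lemma mono_span_orth:
  assumes "mono_span S F" "f \<in> L2 \<mu>"
    and "\<And>n m G. (n, m) \<in> S \<Longrightarrow> G \<in> L2 \<mu> \<Longrightarrow> monomial D n m G \<Longrightarrow> L2_inner \<mu> f G = 0"
  shows "L2_inner \<mu> f F = 0"
  using assms
proof (induction rule: mono_span.induct)
  case (mono n m F B)
  show ?case by (rule mono.prems(2)[OF _ mono_span_L2[OF mono_span.mono[OF mono.hyps]] mono.hyps(1)]) simp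
next
  case (add S F S' G)
  have "L2_inner \<mu> f F = 0" "L2_inner \<mu> f G = 0" using add by auto
  then show ?case
    by (subst L2_inner_add_right[OF mono_span_L2[OF add.hyps(1)] mono_span_L2[OF add.hyps(2)] add.prems(1)]) simp
qed

lemma monomial_mult:
  assumes "monomial D n m F" "monomial D n' m' G"
  shows "monomial D (n + n') (m + m') (\<lambda>x. F x * G x)"
proof (rule monomialI)
  fix r :: real and \<theta> assume "0 < r" "r < b"
  then show "F (polar_chart D (r, \<theta>)) * G (polar_chart D (r, \<theta>)) = (coef F r * coef G r) * cis2 (n + n') (m + m') \<theta>"
    by (simp add: monomial_coef[OF assms(1)] monomial_coef[OF assms(2)] cis2_add[symmetric] mult_ac)
qed

text \<open>Products stay in the class because its monomials are bounded. This makes it an algebra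
  containing the coordinates and their conjugates, hence all real polynomials used in the
  Stone--Weierstrass approximation.\<close>

lemma mono_span_mult_mono:
  assumes G: "monomial D n' m' G" "G \<in> borel_measurable \<mu>" "\<And>x. x \<in> frontier D \<Longrightarrow> cmod (G x) \<le> B'"
    and F: "mono_span S F"
  shows "\<exists>S''. mono_span S'' (\<lambda>x. F x * G x)"
  using F
proof (induction rule: mono_span.induct)
  case (mono n m F B)
  have B: "cmod (F x * G x) \<le> \<bar>B\<bar> * \<bar>B'\<bar>" if "x \<in> frontier D" for x
    using mono(3)[OF that] G(3)[OF that] unfolding norm_mult by (intro mult_mono) auto
  show ?case
    by (rule exI, rule mono_span.mono[OF monomial_mult[OF mono(1) G(1)] borel_measurable_times[OF mono(2) G(2)] B])
next
  case (add S F S' H)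
  then obtain S1 S2 where "mono_span S1 (\<lambda>x. F x * G x)" "mono_span S2 (\<lambda>x. H x * G x)" by (elim exE)
  from mono_span.add[OF this] show ?case by (auto simp: distrib_right)
qed

lemma mono_span_mult:
  assumes F: "mono_span S F" and G: "mono_span S' G"
  shows "\<exists>S''. mono_span S'' (\<lambda>x. F x * G x)"
  using G
proof (induction rule: mono_span.induct)
  case (mono n m G B)
  show ?case by (rule mono_span_mult_mono[OF mono F])
next
  case (add S1 G S2 H)
  then obtain S1 S2 where "mono_span S1 (\<lambda>x. F x * G x)" "mono_span S2 (\<lambda>x. F x * H x)" by (elim exE)
  from mono_span.add[OF this] show ?case by (auto simp: distrib_left)
qed

lemma continuous_frontier_bounded:
  fixes F :: "C2 \<Rightarrow> complex"
  assumes "continuous_on (frontier D) F"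
  obtains B where "\<forall>x\<in>frontier D. cmod (F x) \<le> B"
proof -
  from compact_imp_bounded[OF compact_continuous_image[OF assms compact_frontier]]
  obtain B where "\<forall>z\<in>F ` frontier D. norm z \<le> B" unfolding bounded_iff ..
  then show ?thesis by (intro that[of B]) simp
qed

lemma mono_span_continuous:
  assumes "monomial D n m F" "continuous_on (frontier D) F"
  shows "mono_span {(n, m)} F"
proof -
  obtain B where B: "\<forall>x\<in>frontier D. cmod (F x) \<le> B" by (rule continuous_frontier_bounded[OF assms(2)])
  have "F \<in> borel_measurable \<mu>"
    unfolding measurable_\<mu> by (rule borel_measurable_continuous_on_restrict[OF assms(2)])
  from mono_span.mono[OF assms(1) this bspec[OF B]] show ?thesis .
qed

lemma mono_span_const: "\<exists>S. mono_span S (\<lambda>x. c)"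
  by (rule exI, rule mono_span_continuous, rule monomialI[where v = "\<lambda>r. c" and n = 0 and m = 0]) (auto simp: cis2_0)

lemma mono_span_coord:
  "\<exists>S. mono_span S (\<lambda>x. fst x)" "\<exists>S. mono_span S (\<lambda>x. cnj (fst x))"
  "\<exists>S. mono_span S (\<lambda>x. snd x)" "\<exists>S. mono_span S (\<lambda>x. cnj (snd x))"
proof -
  have chart: "fst (polar_chart D (r, \<theta>)) = of_real r * cis (fst \<theta>)" "snd (polar_chart D (r, \<theta>)) = of_real (\<phi> r) * cis (snd \<theta>)" for r \<theta>
    using polar_chart_eq[of r "fst \<theta>" "snd \<theta>"] by simp_all
  show "\<exists>S. mono_span S (\<lambda>x. fst x)"
    by (rule exI, rule mono_span_continuous, rule monomialI[where v = "\<lambda>r. of_real r" and n = 1 and m = 0])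
      (auto simp: chart cis2_def intro!: continuous_intros)
  show "\<exists>S. mono_span S (\<lambda>x. cnj (fst x))"
    by (rule exI, rule mono_span_continuous, rule monomialI[where v = "\<lambda>r. of_real r" and n = "-1" and m = 0])
      (auto simp: chart cis2_def cis_cnj intro!: continuous_intros)
  show "\<exists>S. mono_span S (\<lambda>x. snd x)"
    by (rule exI, rule mono_span_continuous, rule monomialI[where v = "\<lambda>r. of_real (\<phi> r)" and n = 0 and m = 1])
      (auto simp: chart cis2_def intro!: continuous_intros)
  show "\<exists>S. mono_span S (\<lambda>x. cnj (snd x))"
    by (rule exI, rule mono_span_continuous, rule monomialI[where v = "\<lambda>r. of_real (\<phi> r)" and n = 0 and m = "-1"])
      (auto simp: chart cis2_def cis_cnj intro!: continuous_intros)
qed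

definition spannable :: "(C2 \<Rightarrow> complex) \<Rightarrow> bool" where "spannable F \<longleftrightarrow> (\<exists>S. mono_span S F)"

lemma spannable_add: "spannable F \<Longrightarrow> spannable G \<Longrightarrow> spannable (\<lambda>x. F x + G x)"
  unfolding spannable_def by (elim exE) (rule exI, rule mono_span.add)

lemma spannable_mult: "spannable F \<Longrightarrow> spannable G \<Longrightarrow> spannable (\<lambda>x. F x * G x)"
  unfolding spannable_def by (elim exE) (rule mono_span_mult)

lemma spannable_const: "spannable (\<lambda>x. c)"
  unfolding spannable_def by (rule mono_span_const)

text \<open>A real linear functional on C^2 is a combination of the real and imaginary parts of the
  two coordinates, and these are combinations of the coordinates and their conjugates.\<close>

lemma spannable_polynomial:
  fixes g :: "C2 \<Rightarrow> real"
  assumes "real_polynomial_function g"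
  shows "spannable (\<lambda>x. of_real (g x))"
  using assms
proof (induction rule: real_polynomial_function.induct)
  case (linear f)
  interpret f: bounded_linear f by fact
  have eq: "complex_of_real (f x) = ((fst x + cnj (fst x)) * of_real (f (1, 0) / 2) + (fst x + - 1 * cnj (fst x)) * (of_real (f (\<i>, 0)) / (2 * \<i>)))
     + ((snd x + cnj (snd x)) * of_real (f (0, 1) / 2) + (snd x + - 1 * cnj (snd x)) * (of_real (f (0, \<i>)) / (2 * \<i>)))" for x
  proof -
    have "x = (Re (fst x) *\<^sub>R (1, 0) + Im (fst x) *\<^sub>R (\<i>, 0)) + (Re (snd x) *\<^sub>R (0, 1) + Im (snd x) *\<^sub>R (0, \<i>))"
      by (simp add: prod_eq_iff complex_eq_iff)
    then have "f x = (Re (fst x) *\<^sub>R f (1, 0) + Im (fst x) *\<^sub>R f (\<i>, 0)) + (Re (snd x) *\<^sub>R f (0, 1) + Im (snd x) *\<^sub>R f (0, \<i>))"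
      by (metis f.add f.scaleR)
    then show ?thesis
      by (simp add: complex_eq_iff Re_divide Im_divide field_simps)
  qed
  have "spannable (\<lambda>x. ((fst x + cnj (fst x)) * of_real (f (1, 0) / 2) + (fst x + - 1 * cnj (fst x)) * (of_real (f (\<i>, 0)) / (2 * \<i>)))
     + ((snd x + cnj (snd x)) * of_real (f (0, 1) / 2) + (snd x + - 1 * cnj (snd x)) * (of_real (f (0, \<i>)) / (2 * \<i>))))"
    by (intro spannable_add spannable_mult spannable_const mono_span_coord[folded spannable_def])
  with ext[of "\<lambda>x. complex_of_real (f x)", OF eq] show ?case by (rule ssubst[where P = spannable])
next
  case (const c)
  show ?case by (rule spannable_const)
next
  case (add f g)
  then show ?case using spannable_add by simp
next
  case (mult f g)
  then show ?case using spannable_mult by simp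
qed

definition approximable :: "(C2 \<Rightarrow> complex) \<Rightarrow> bool" where
  "approximable f \<longleftrightarrow> f \<in> L2 \<mu> \<and> (\<forall>\<epsilon>>0. \<exists>F. spannable F \<and> L2_norm \<mu> (\<lambda>x. f x - F x) < \<epsilon>)"

lemma spannable_L2: "spannable F \<Longrightarrow> F \<in> L2 \<mu>"
  unfolding spannable_def by (elim exE) (rule mono_span_L2)

lemma approximable_L2: "approximable f \<Longrightarrow> f \<in> L2 \<mu>"
  by (simp add: approximable_def)

lemma approximableD:
  assumes "approximable f" "\<epsilon> > 0"
  obtains F where "spannable F" "L2_norm \<mu> (\<lambda>x. f x - F x) < \<epsilon>"
  using assms unfolding approximable_def by auto

lemma approximable_limit:
  assumes f: "f \<in> L2 \<mu>" and s: "\<And>n. approximable (s n)" and lim: "(\<lambda>n. L2_norm \<mu> (\<lambda>x. f x - s n x)) \<longlonglongrightarrow> 0"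
  shows "approximable f"
  unfolding approximable_def
proof (intro conjI allI impI f)
  fix \<epsilon> :: real assume "\<epsilon> > 0"
  then obtain n where "norm (L2_norm \<mu> (\<lambda>x. f x - s n x) - 0) < \<epsilon> / 2"
    using LIMSEQ_D[OF lim, of "\<epsilon> / 2"] by auto
  then have n: "L2_norm \<mu> (\<lambda>x. f x - s n x) < \<epsilon> / 2" by simp
  obtain F where F: "spannable F" "L2_norm \<mu> (\<lambda>x. s n x - F x) < \<epsilon> / 2"
    using approximableD[OF s, of "\<epsilon> / 2" n] \<open>\<epsilon> > 0\<close> by auto
  have "L2_norm \<mu> (\<lambda>x. f x - F x) < \<epsilon>"
    using L2_norm_triangle_diff[OF f approximable_L2[OF s, of n] spannable_L2[OF F(1)]] n F(2) by linarith
  with F(1) show "\<exists>F. spannable F \<and> L2_norm \<mu> (\<lambda>x. f x - F x) < \<epsilon>" by auto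
qed

lemma approximable_add:
  assumes "approximable f" "approximable g"
  shows "approximable (\<lambda>x. f x + g x)"
  unfolding approximable_def
proof (intro conjI allI impI L2_add approximable_L2 assms)
  fix \<epsilon> :: real assume "\<epsilon> > 0"
  then have e: "\<epsilon> / 2 > 0" by simp
  obtain F where F: "spannable F" "L2_norm \<mu> (\<lambda>x. f x - F x) < \<epsilon> / 2" using approximableD[OF assms(1) e] .
  obtain G where G: "spannable G" "L2_norm \<mu> (\<lambda>x. g x - G x) < \<epsilon> / 2" using approximableD[OF assms(2) e] .
  have "L2_norm \<mu> (\<lambda>x. (f x - F x) + (g x - G x)) \<le> L2_norm \<mu> (\<lambda>x. f x - F x) + L2_norm \<mu> (\<lambda>x. g x - G x)"
    by (intro L2_norm_triangle L2_diff approximable_L2 assms spannable_L2 F(1) G(1))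
  also have "\<dots> < \<epsilon>" using F(2) G(2) by simp
  finally have "L2_norm \<mu> (\<lambda>x. f x + g x - (F x + G x)) < \<epsilon>" by (simp add: algebra_simps)
  with spannable_add[OF F(1) G(1)] show "\<exists>F. spannable F \<and> L2_norm \<mu> (\<lambda>x. f x + g x - F x) < \<epsilon>" by auto
qed

lemma approximable_cmult:
  assumes "approximable f"
  shows "approximable (\<lambda>x. c * f x)"
  unfolding approximable_def
proof (intro conjI allI impI L2_cmult approximable_L2 assms)
  fix \<epsilon> :: real assume "\<epsilon> > 0"
  then have e: "\<epsilon> / (cmod c + 1) > 0" by (simp add: add_nonneg_pos)
  obtain F where F: "spannable F" "L2_norm \<mu> (\<lambda>x. f x - F x) < \<epsilon> / (cmod c + 1)" using approximableD[OF assms e] .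
  have "L2_norm \<mu> (\<lambda>x. c * f x - c * F x) = cmod c * L2_norm \<mu> (\<lambda>x. f x - F x)"
    unfolding right_diff_distrib[symmetric] by (rule L2_norm_cmult)
  also have "\<dots> \<le> cmod c * (\<epsilon> / (cmod c + 1))" using F(2) by (intro mult_left_mono) auto
  also have "\<dots> < \<epsilon>" using \<open>\<epsilon> > 0\<close> by (simp add: add_nonneg_pos pos_divide_less_eq)
  finally have "L2_norm \<mu> (\<lambda>x. c * f x - c * F x) < \<epsilon>" .
  with spannable_mult[OF spannable_const F(1)] show "\<exists>F. spannable F \<and> L2_norm \<mu> (\<lambda>x. c * f x - F x) < \<epsilon>" by auto
qed

lemma approximable_sum: "(\<And>i. i \<in> I \<Longrightarrow> approximable (F i)) \<Longrightarrow> approximable (\<lambda>x. \<Sum>i\<in>I. F i x)"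
proof (induction I rule: infinite_finite_induct)
  case (insert i I)
  then show ?case using approximable_add[of "F i" "\<lambda>x. \<Sum>i\<in>I. F i x"] by simp
next
  case empty
  show ?case using approximable_cmult[of "\<lambda>x. 1" 0] spannable_const[of 0]
    by (auto simp: approximable_def intro!: exI[of _ "\<lambda>x. 0"])
next
  case (infinite I)
  then show ?case using spannable_const[of 0]
    by (auto simp: approximable_def intro!: exI[of _ "\<lambda>x. 0"])
qed

lemma approximable_cong:
  assumes "approximable f" "\<And>x. x \<in> frontier D \<Longrightarrow> f x = g x"
  shows "approximable g"
proof -
  have "f \<in> L2 \<mu> \<longleftrightarrow> g \<in> L2 \<mu>" by (rule L2_cong) (simp add: space_\<mu> assms(2))
  moreover have "L2_norm \<mu> (\<lambda>x. f x - F x) = L2_norm \<mu> (\<lambda>x. g x - F x)" for F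
    by (rule L2_norm_cong) (simp add: space_\<mu> assms(2))
  ultimately show ?thesis using assms(1) unfolding approximable_def by simp
qed

lemma approximable_continuous:
  fixes g :: "C2 \<Rightarrow> real"
  assumes g: "continuous_on (frontier D) g"
  shows "approximable (\<lambda>x. of_real (g x))"
proof -
  have "\<exists>p. real_polynomial_function p \<and> (\<forall>x\<in>frontier D. \<bar>g x - p x\<bar> < 1 / real (Suc n))" for n
    using Stone_Weierstrass_real_polynomial_function[OF compact_frontier g, of "1 / real (Suc n)"] by (metis of_nat_0_less_iff zero_less_Suc zero_less_divide_1_iff)
  then obtain P where P: "\<And>n. real_polynomial_function (P n)" "\<And>n x. x \<in> frontier D \<Longrightarrow> \<bar>g x - P n x\<bar> < 1 / real (Suc n)"
    by metis
  have cg: "continuous_on (frontier D) (\<lambda>x. complex_of_real (g x))" by (intro continuous_intros g)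
  obtain B where "\<forall>x\<in>frontier D. cmod (complex_of_real (g x)) \<le> B" by (rule continuous_frontier_bounded[OF cg])
  then have B: "\<And>x. x \<in> frontier D \<Longrightarrow> cmod (complex_of_real (g x)) \<le> B" by (rule bspec)
  have gm: "(\<lambda>x. complex_of_real (g x)) \<in> borel_measurable \<mu>"
    unfolding measurable_\<mu> by (rule borel_measurable_continuous_on_restrict[OF cg])
  have gL: "(\<lambda>x. complex_of_real (g x)) \<in> L2 \<mu>"
    by (rule L2_I_bounded[OF finite_\<mu> gm]) (use B in \<open>auto simp: space_\<mu>\<close>)
  have sP: "spannable (\<lambda>x. of_real (P n x))" for n by (rule spannable_polynomial[OF P(1)])
  show ?thesis
  proof (rule approximable_limit[OF gL])
    show "approximable (\<lambda>x. of_real (P n x))" for n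
      unfolding approximable_def using spannable_L2[OF sP] sP
      by (intro conjI allI impI exI[of _ "\<lambda>x. of_real (P n x)"]) auto
    show "(\<lambda>n. L2_norm \<mu> (\<lambda>x. of_real (g x) - of_real (P n x))) \<longlonglongrightarrow> 0"
    proof (rule L2_dominated_convergence[OF gm, where w = "\<lambda>x. B + 1"])
      show "(\<lambda>x. complex_of_real (P n x)) \<in> borel_measurable \<mu>" for n by (rule L2_measurable[OF spannable_L2[OF sP]])
      show "integrable \<mu> (\<lambda>x. (B + 1)\<^sup>2)" by simp
      fix x assume "x \<in> space \<mu>"
      then have x: "x \<in> frontier D" by (simp add: space_\<mu>)
      show "cmod (complex_of_real (g x)) \<le> B + 1" using B[OF x] by simp
      show "cmod (complex_of_real (P n x)) \<le> B + 1" for n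
      proof -
        have "\<bar>g x - P n x\<bar> < 1 / real (Suc n)" by (rule P(2)[OF x])
        also have "\<dots> \<le> 1" by simp
        finally show ?thesis using B[OF x] unfolding norm_of_real by linarith
      qed
      have "(\<lambda>n. P n x) \<longlonglongrightarrow> g x"
      proof (rule LIM_zero_cancel, rule Lim_null_comparison)
        show "(\<lambda>n. 1 / real (Suc n)) \<longlonglongrightarrow> 0" by (rule LIMSEQ_Suc[OF lim_1_over_n])
        show "\<forall>\<^sub>F n in sequentially. norm (P n x - g x) \<le> 1 / real (Suc n)"
          using P(2)[OF x] by (intro always_eventually allI) (simp add: abs_minus_commute less_imp_le del: of_nat_Suc)
      qed
      then show "(\<lambda>n. complex_of_real (P n x)) \<longlonglongrightarrow> of_real (g x)" by (rule tendsto_of_real)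
    qed
  qed
qed

lemma indicator_measurable_\<mu>:
  assumes "B \<in> sets borel"
  shows "(\<lambda>x. indicator B x :: complex) \<in> borel_measurable \<mu>"
  unfolding measurable_\<mu> by (rule measurable_restrict_space1) (use assms in simp)

lemma indicator_L2: assumes "B \<in> sets borel" shows "(\<lambda>x. indicator B x :: complex) \<in> L2 \<mu>"
  by (rule L2_I_bounded[OF finite_\<mu> indicator_measurable_\<mu>[OF assms], of 1]) (auto simp: indicator_def)

text \<open>The continuous functions max 0 (1 - n dist(x, C)) decrease to the indicator of a
  nonempty closed set.\<close>

lemma approximable_closed:
  assumes C: "closed C"
  shows "approximable (\<lambda>x. indicator C x)"
proof (cases "C = {}")
  case True
  then show ?thesis using approximable_sum[of "{}"] by simp
next
  case False
  define s where "s n x = max 0 (1 - real n * infdist x C)" for n x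
  have sc: "continuous_on (frontier D) (s n)" for n unfolding s_def[abs_def] by (intro continuous_intros)
  have CB: "C \<in> sets borel" using C by simp
  show ?thesis
  proof (rule approximable_limit[OF indicator_L2[OF CB], of "\<lambda>n x. of_real (s n x)"])
    show "approximable (\<lambda>x. of_real (s n x))" for n by (rule approximable_continuous[OF sc])
    show "(\<lambda>n. L2_norm \<mu> (\<lambda>x. indicator C x - of_real (s n x))) \<longlonglongrightarrow> 0"
    proof (rule L2_dominated_convergence[OF indicator_measurable_\<mu>[OF CB], where w = "\<lambda>x. 1"])
      show "(\<lambda>x. complex_of_real (s n x)) \<in> borel_measurable \<mu>" for n
        by (rule L2_measurable[OF approximable_L2[OF approximable_continuous[OF sc]]])
      fix x
      show "cmod (indicator C x) \<le> 1" by (simp add: indicator_def)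
      show "cmod (complex_of_real (s n x)) \<le> 1" for n
        using infdist_nonneg[of x C] by (simp only: norm_of_real) (simp add: s_def max_def)
      show "(\<lambda>n. complex_of_real (s n x)) \<longlonglongrightarrow> indicator C x"
      proof (cases "x \<in> C")
        case True
        then have "s n x = 1" for n by (simp add: s_def)
        then show ?thesis using True by simp
      next
        case x: False
        then have d: "infdist x C > 0" using infdist_pos_not_in_closed[OF C False] by simp
        obtain N where N: "1 < real N * infdist x C" using reals_Archimedean3[OF d] by blast
        have "s n x = 0" if "n \<ge> N" for n
        proof -
          have "real N * infdist x C \<le> real n * infdist x C" using that d by (intro mult_right_mono) auto
          then show ?thesis using N by (simp add: s_def)
        qed
        then have "\<forall>\<^sub>F n in sequentially. complex_of_real (s n x) = 0"
          unfolding eventually_sequentially by auto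
        then have "(\<lambda>n. complex_of_real (s n x)) \<longlonglongrightarrow> 0" by (rule tendsto_eventually)
        then show ?thesis using x by simp
      qed
    qed simp
  qed
qed

text \<open>Dynkin's theorem, starting from the closed sets, which generate the Borel sets and are
  stable under intersection.\<close>

lemma approximable_indicator:
  assumes "B \<in> sets borel"
  shows "approximable (\<lambda>x. indicator B x)"
proof -
  have st: "Int_stable (Collect closed :: C2 set set)" by (auto simp: Int_stable_def)
  have B: "B \<in> sigma_sets UNIV (Collect closed)"
    using assms unfolding borel_eq_closed by simp
  have sig: "A \<in> sigma_sets UNIV (Collect closed) \<Longrightarrow> A \<in> sets borel" for A :: "C2 set"
    unfolding borel_eq_closed by simp
  have one: "approximable (\<lambda>x. 1)" using approximable_closed[of UNIV] by simp
  show ?thesis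
  proof (rule sigma_sets_induct_disjoint[OF st _ B])
    show "approximable (\<lambda>x. indicator A x)" if "A \<in> Collect closed" for A using that approximable_closed by simp
    show "approximable (\<lambda>x. indicator {} x)" using approximable_closed[of "{}"] by simp
    show "approximable (\<lambda>x. indicator (UNIV - A) x)" if "approximable (\<lambda>x. indicator A x)" for A
      using approximable_add[OF one approximable_cmult[OF that, of "-1"]]
      by (rule approximable_cong) (auto simp: indicator_def)
    fix A :: "nat \<Rightarrow> C2 set"
    assume A: "disjoint_family A" "range A \<subseteq> sigma_sets UNIV (Collect closed)" "\<And>i. approximable (\<lambda>x. indicator (A i) x)"
    have Ab: "A i \<in> sets borel" for i using A(2) sig by auto
    have Ub: "(\<Union>i. A i) \<in> sets borel" using Ab by auto
    define s where "s n x = (indicator (\<Union>i<n. A i) x :: complex)" for n x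
    have sb: "(\<Union>i<n. A i) \<in> sets borel" for n using Ab by auto
    have sa: "approximable (s n)" for n
    proof (rule approximable_cong[OF approximable_sum[of "{..<n}" "\<lambda>i x. indicator (A i) x"]])
      show "approximable (\<lambda>x. indicator (A i) x)" for i by (rule A(3))
      fix x
      have "disjoint_family_on A {..<n}" using A(1) by (auto simp: disjoint_family_on_def)
      then show "(\<Sum>i<n. indicator (A i) x) = s n x"
        unfolding s_def by (subst indicator_UN_disjoint) auto
    qed
    show "approximable (\<lambda>x. indicator (\<Union>i. A i) x)"
    proof (rule approximable_limit[OF indicator_L2[OF Ub] sa])
      show "(\<lambda>n. L2_norm \<mu> (\<lambda>x. indicator (\<Union>i. A i) x - s n x)) \<longlonglongrightarrow> 0"
      proof (rule L2_dominated_convergence[OF indicator_measurable_\<mu>[OF Ub], where w = "\<lambda>x. 1"])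
        show "s n \<in> borel_measurable \<mu>" for n unfolding s_def[abs_def] by (rule indicator_measurable_\<mu>[OF sb])
        fix x
        show "cmod (indicator (\<Union>i. A i) x) \<le> 1" "cmod (s n x) \<le> 1" for n by (auto simp: s_def indicator_def)
        show "(\<lambda>n. s n x) \<longlonglongrightarrow> indicator (\<Union>i. A i) x"
        proof (cases "\<exists>i. x \<in> A i")
          case True
          then obtain i where i: "x \<in> A i" ..
          have "s n x = 1" if "n \<ge> Suc i" for n
            unfolding s_def using i that by (intro indicator_simps(1)) auto
          then have "\<forall>\<^sub>F n in sequentially. s n x = 1" unfolding eventually_sequentially by (intro exI[of _ "Suc i"]) auto
          then have "(\<lambda>n. s n x) \<longlonglongrightarrow> 1" by (rule tendsto_eventually)
          moreover have "x \<in> (\<Union>i. A i)" using i by auto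
          ultimately show ?thesis by (simp only: indicator_simps(1))
        next
          case False
          then have z: "s n x = 0" for n unfolding s_def by (intro indicator_simps(2)) auto
          have "x \<notin> (\<Union>i. A i)" using False by auto
          then have i: "(indicator (\<Union>i. A i) x :: complex) = 0" by (rule indicator_simps(2))
          show ?thesis unfolding z i by (rule tendsto_const)
        qed
      qed simp
    qed
  qed auto
qed

lemma approximable_all:
  assumes f: "f \<in> L2 \<mu>"
  shows "approximable f"
proof -
  have fm: "f \<in> borel_measurable \<mu>" by (rule L2_measurable[OF f])
  from borel_measurable_implies_sequence_metric[OF fm, of 0]
  obtain s where s: "\<forall>i. simple_function \<mu> (s i)" "\<forall>x\<in>space \<mu>. (\<lambda>i. s i x) \<longlonglongrightarrow> f x"
    "\<forall>i. \<forall>x\<in>space \<mu>. dist (s i x) 0 \<le> 2 * dist (f x) 0" by (elim exE conjE)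
  show ?thesis
  proof (rule approximable_limit[OF f])
    fix n
    have sf: "simple_function \<mu> (s n)" using s(1) by simp
    have fin: "finite (s n ` space \<mu>)" using sf by (simp add: simple_function_def)
    have "\<forall>y. \<exists>B. B \<in> sets borel \<and> s n -` {y} \<inter> space \<mu> = frontier D \<inter> B"
    proof
      fix y
      have "s n -` {y} \<inter> space \<mu> \<in> sets (restrict_space borel (frontier D))"
        using simple_functionD(2)[OF sf, of "{y}"] by simp
      then obtain B where "s n -` {y} \<inter> space \<mu> = frontier D \<inter> B" "B \<in> sets borel"
        unfolding sets_restrict_space by (rule imageE)
      then show "\<exists>B. B \<in> sets borel \<and> s n -` {y} \<inter> space \<mu> = frontier D \<inter> B" by (intro exI conjI)
    qed
    from choice[OF this] obtain B where "\<forall>y. B y \<in> sets borel \<and> s n -` {y} \<inter> space \<mu> = frontier D \<inter> B y" ..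
    then have B: "\<And>y. B y \<in> sets borel" "\<And>y. s n -` {y} \<inter> space \<mu> = frontier D \<inter> B y"
      by simp_all
    show "approximable (s n)"
    proof (rule approximable_cong[OF approximable_sum[of "s n ` space \<mu>" "\<lambda>y x. y * indicator (B y) x"]])
      show "approximable (\<lambda>x. y * indicator (B y) x)" for y
        by (intro approximable_cmult approximable_indicator B(1))
      fix x assume x: "x \<in> frontier D"
      have "x \<in> B y \<longleftrightarrow> s n x = y" for y using B(2)[of y] x by (auto simp: space_\<mu>)
      then have "(\<Sum>y\<in>s n ` space \<mu>. y * indicator (B y) x) = (\<Sum>y\<in>s n ` space \<mu>. if y = s n x then y else 0)"
        by (intro sum.cong refl) (auto simp: indicator_def)
      also have "\<dots> = s n x" using fin x by (simp add: space_\<mu>)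
      finally show "(\<Sum>y\<in>s n ` space \<mu>. y * indicator (B y) x) = s n x" .
    qed
  next
    show "(\<lambda>n. L2_norm \<mu> (\<lambda>x. f x - s n x)) \<longlonglongrightarrow> 0"
    proof (rule L2_dominated_convergence[OF fm, where w = "\<lambda>x. 2 * cmod (f x)"])
      show "s n \<in> borel_measurable \<mu>" for n using s(1) by (auto intro: borel_measurable_simple_function)
      show "integrable \<mu> (\<lambda>x. (2 * cmod (f x))\<^sup>2)" using L2_integrable_square[OF f] by (simp add: power_mult_distrib)
      fix x assume x: "x \<in> space \<mu>"
      show "cmod (f x) \<le> 2 * cmod (f x)" by simp
      show "cmod (s n x) \<le> 2 * cmod (f x)" for n using s(3) x by (simp add: dist_norm)
      show "(\<lambda>n. s n x) \<longlonglongrightarrow> f x" using s(2) x by simp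
    qed
  qed
qed

text \<open>Once \<open>Y\<close> contains all degrees of a finite sum \<open>F\<close> close to
  \<open>f\<close>, the remainder f - P is orthogonal to P - F, so the partial sum P approximates
  \<open>f\<close> at least as well as \<open>F\<close> does.\<close>

theorem monomial_expansion:
  assumes f: "f \<in> L2 \<mu>"
  shows "has_L2_sum \<mu> (\<lambda>k. proj (fst k) (snd k) f) UNIV f"
  unfolding has_L2_sum_iff
proof (intro conjI ballI allI impI f proj_L2)
  fix \<epsilon> :: real assume "\<epsilon> > 0"
  obtain F where F: "spannable F" "L2_norm \<mu> (\<lambda>x. f x - F x) < \<epsilon>"
    using approximableD[OF approximable_all[OF f] \<open>\<epsilon> > 0\<close>] .
  obtain S where S: "mono_span S F" using F(1) unfolding spannable_def ..
  have FL: "F \<in> L2 \<mu>" by (rule spannable_L2[OF F(1)])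
  have "L2_norm \<mu> (\<lambda>x. f x - (\<Sum>k\<in>Y. proj (fst k) (snd k) f x)) < \<epsilon>" if Y: "finite Y" "S \<subseteq> Y" for Y
  proof -
    let ?P = "\<lambda>x. \<Sum>k\<in>Y. proj (fst k) (snd k) f x"
    have PL: "?P \<in> L2 \<mu>" by (intro L2_sum proj_L2 f)
    have RL: "(\<lambda>x. f x - ?P x) \<in> L2 \<mu>" by (intro L2_diff f PL)
    have orth: "L2_inner \<mu> (\<lambda>x. f x - ?P x) G = 0" if G: "(n, m) \<in> Y" "G \<in> L2 \<mu>" "monomial D n m G" for n m G
    proof -
      have "L2_inner \<mu> ?P G = (\<Sum>k\<in>Y. L2_inner \<mu> (proj (fst k) (snd k) f) G)"
        by (intro L2_inner_sum_left proj_L2 f G(2))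
      also have "\<dots> = (\<Sum>k\<in>Y. if k = (n, m) then L2_inner \<mu> (proj n m f) G else 0)"
        by (intro sum.cong refl) (auto simp: inner_monomial(2)[OF proj_L2[OF f] proj_monomial G(2,3)])
      also have "\<dots> = L2_inner \<mu> (proj n m f) G" using Y(1) G(1) by simp
      also have "\<dots> = L2_inner \<mu> f G" by (rule proj_inner[OF f G(2,3)])
      finally show ?thesis by (simp add: L2_inner_diff_left[OF f PL G(2)])
    qed
    have 1: "L2_inner \<mu> (\<lambda>x. f x - ?P x) F = 0"
      by (rule mono_span_orth[OF S RL]) (use orth Y(2) in auto)
    have 2: "L2_inner \<mu> (\<lambda>x. f x - ?P x) ?P = 0"
    proof -
      have "L2_inner \<mu> (\<lambda>x. f x - ?P x) ?P = (\<Sum>k\<in>Y. L2_inner \<mu> (\<lambda>x. f x - ?P x) (proj (fst k) (snd k) f))"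
        by (intro L2_inner_sum_right proj_L2 f RL)
      also have "\<dots> = (\<Sum>k\<in>Y. 0)"
        by (intro sum.cong refl orth[OF _ proj_L2[OF f] proj_monomial]) simp
      finally show ?thesis by simp
    qed
    have 3: "L2_inner \<mu> (\<lambda>x. f x - ?P x) (\<lambda>x. ?P x - F x) = 0"
      using 1 2 by (simp add: L2_inner_diff_right[OF PL FL RL])
    have "(L2_norm \<mu> (\<lambda>x. (f x - ?P x) + (?P x - F x)))\<^sup>2
        = (L2_norm \<mu> (\<lambda>x. f x - ?P x))\<^sup>2 + (L2_norm \<mu> (\<lambda>x. ?P x - F x))\<^sup>2"
      by (subst L2_norm_add_power2[OF RL L2_diff[OF PL FL]]) (simp add: 3)
    then have "(L2_norm \<mu> (\<lambda>x. f x - ?P x))\<^sup>2 \<le> (L2_norm \<mu> (\<lambda>x. f x - F x))\<^sup>2" by simp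
    then have "L2_norm \<mu> (\<lambda>x. f x - ?P x) \<le> L2_norm \<mu> (\<lambda>x. f x - F x)"
      by (rule power2_le_imp_le) simp
    then show ?thesis using F(2) by simp
  qed
  then show "\<exists>X. finite X \<and> X \<subseteq> UNIV \<and> (\<forall>Y. finite Y \<and> X \<subseteq> Y \<and> Y \<subseteq> UNIV \<longrightarrow>
      L2_norm \<mu> (\<lambda>x. f x - (\<Sum>k\<in>Y. proj (fst k) (snd k) f x)) < \<epsilon>)"
    using mono_span_finite[OF S] by (intro exI[of _ S]) simp
qed

end

subsection \<open>The Leray transform on monomials\<close>

text \<open>The reciprocal of the beta integral B(n + 1, m + 1), and at the same time n + m + 1
  times the binomial coefficient of n + m over n, which is the coefficient of x^n y^m in 1 / (1 - x
  - y)^2.\<close>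

definition ck :: "nat \<Rightarrow> nat \<Rightarrow> real" where "ck n m = fact (n + m + 1) / (fact n * fact m)"

lemma ck_pos: "0 < ck n m"
  by (simp add: ck_def)

text \<open>Integration by parts, raising \<open>n\<close> while lowering \<open>m\<close>. An
  antiderivative is given instead of an integral so that it can be composed with \<sigma>.\<close>

lemma beta_antiderivative:
  "\<exists>F. (\<forall>s. (F has_real_derivative s ^ n * (1 - s) ^ m) (at s)) \<and> F 1 - F 0 = 1 / ck n m"
proof (induction m arbitrary: n)
  case 0
  have "((\<lambda>s. s ^ Suc n / real (Suc n)) has_real_derivative s ^ n * (1 - s) ^ 0) (at s)" for s :: real
    using DERIV_cdivide[OF DERIV_pow[of "Suc n" s UNIV], of "real (Suc n)"] by (simp del: of_nat_Suc)
  then show ?case by (intro exI[of _ "\<lambda>s. s ^ Suc n / real (Suc n)"]) (simp add: ck_def)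
next
  case (Suc m)
  obtain F where F: "\<And>s. (F has_real_derivative s ^ Suc n * (1 - s) ^ m) (at s)" "F 1 - F 0 = 1 / ck (Suc n) m"
    using Suc[of "Suc n"] by auto
  let ?G = "\<lambda>s. s ^ Suc n * (1 - s) ^ Suc m / real (Suc n) + real (Suc m) / real (Suc n) * F s"
  have "(?G has_real_derivative s ^ n * (1 - s) ^ Suc m) (at s)" for s
  proof -
    have 1: "((\<lambda>s. s ^ Suc n) has_real_derivative real (Suc n) * s ^ n) (at s)"
      using DERIV_pow[of "Suc n" s UNIV] by simp
    have 2: "((\<lambda>s. (1 - s) ^ Suc m) has_real_derivative - real (Suc m) * (1 - s) ^ m) (at s)"
      by (rule DERIV_cong[OF DERIV_power[OF DERIV_diff[OF DERIV_const DERIV_ident]]]) (simp add: algebra_simps)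
    have 3: "(?G has_real_derivative ((real (Suc n) * s ^ n) * (1 - s) ^ Suc m + (- real (Suc m) * (1 - s) ^ m) * s ^ Suc n) / real (Suc n)
      + real (Suc m) / real (Suc n) * (s ^ Suc n * (1 - s) ^ m)) (at s)"
      by (intro DERIV_add DERIV_cdivide DERIV_mult 1 2 DERIV_cmult F(1))
    have "((N * a) * c + (- M * d) * e) / N + M / N * (e * d) = a * c" if "N \<noteq> 0" for N M a c d e :: real
      using that by (simp add: field_simps)
    from DERIV_cong[OF 3 this] show ?thesis by simp
  qed
  moreover have "?G 1 - ?G 0 = real (Suc m) / real (Suc n) * (F 1 - F 0)" by (simp add: right_diff_distrib)
  moreover have "real (Suc m) / real (Suc n) * (1 / ck (Suc n) m) = 1 / ck n (Suc m)"
  proof -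
    have "M / N * (N * a * c) / X = a * (M * c) / X" if "N \<noteq> 0" for M N a c X :: real using that by simp
    from this[of "real (Suc n)"] show ?thesis
      unfolding ck_def fact_Suc[of n] fact_Suc[of m] add_Suc add_Suc_right by (simp del: of_nat_Suc fact_Suc)
  qed
  ultimately show ?case unfolding F(2) by (intro exI[of _ ?G]) simp
qed

context reinhardt_measure
begin

text \<open>The substitution s = \<sigma> r, carried out on the antiderivative, with the limits 0
  and 1 of \<sigma> at the ends of the interval.\<close>

lemma \<sigma>_FTC:
  assumes F: "\<And>s. (F has_real_derivative f s) (at s)" and f: "continuous_on UNIV f" "\<And>s. 0 < s \<Longrightarrow> s < 1 \<Longrightarrow> 0 \<le> f s"
  shows "set_integrable lborel {0<..<b} (\<lambda>r. f (\<sigma> r) * \<sigma>' r)" "(LINT r:{0<..<b}|lborel. f (\<sigma> r) * \<sigma>' r) = F 1 - F 0"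
proof -
  have Fc: "isCont F s" for s using F by (rule DERIV_isCont)
  have 1: "((\<lambda>r. F (\<sigma> r)) has_real_derivative f (\<sigma> r) * \<sigma>' r) (at r)" if "0 < r" "r < b" for r
    by (rule DERIV_chain2[OF F \<sigma>_deriv[OF that]])
  have 2: "isCont (\<lambda>r. f (\<sigma> r) * \<sigma>' r) r" if "0 < r" "r < b" for r
    using f(1) by (intro continuous_intros isCont_o2[OF \<sigma>_isCont[OF that]] \<sigma>'_isCont[OF that]) (auto simp: continuous_on_eq_continuous_at)
  have 3: "0 \<le> f (\<sigma> r) * \<sigma>' r" if "0 < r" "r < b" for r
    using f(2) \<sigma>_bounds[OF that] \<sigma>'_pos[OF that] by simp
  note 4 = isCont_tendsto_compose[OF Fc \<sigma>_tendsto_0]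
  note 5 = isCont_tendsto_compose[OF Fc \<sigma>_tendsto_1]
  show "set_integrable lborel {0<..<b} (\<lambda>r. f (\<sigma> r) * \<sigma>' r)" by (rule FTC_nonneg_open(1)[OF b_pos 1 2 3 4 5])
  show "(LINT r:{0<..<b}|lborel. f (\<sigma> r) * \<sigma>' r) = F 1 - F 0" by (rule FTC_nonneg_open(2)[OF b_pos 1 2 3 4 5])
qed

lemma beta_\<sigma>:
  "set_integrable lborel {0<..<b} (\<lambda>r. \<sigma> r ^ n * (1 - \<sigma> r) ^ m * \<sigma>' r)"
  "(LINT r:{0<..<b}|lborel. \<sigma> r ^ n * (1 - \<sigma> r) ^ m * \<sigma>' r) = 1 / ck n m"
proof -
  obtain F where F: "\<forall>s. (F has_real_derivative s ^ n * (1 - s) ^ m) (at s)" "F 1 - F 0 = 1 / ck n m"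
    using beta_antiderivative[of n m] by (elim exE conjE)
  have c: "continuous_on UNIV (\<lambda>s::real. s ^ n * (1 - s) ^ m)" by (intro continuous_intros)
  have nn: "0 \<le> s ^ n * (1 - s) ^ m" if "0 < s" "s < 1" for s :: real using that by simp
  show "set_integrable lborel {0<..<b} (\<lambda>r. \<sigma> r ^ n * (1 - \<sigma> r) ^ m * \<sigma>' r)"
    by (rule \<sigma>_FTC(1)[OF spec[OF F(1)] c nn])
  show "(LINT r:{0<..<b}|lborel. \<sigma> r ^ n * (1 - \<sigma> r) ^ m * \<sigma>' r) = 1 / ck n m"
    unfolding F(2)[symmetric] by (rule \<sigma>_FTC(2)[OF spec[OF F(1)] c nn])
qed

text \<open>The radial part of the coefficient of w1^n w2^m in the Leray kernel, up to the constant
  \<open>ck n m / (4 * pi\<^sup>2)\<close>.\<close>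

definition v :: "nat \<Rightarrow> nat \<Rightarrow> real \<Rightarrow> real" where
  "v n m r = (\<sigma> r / r) ^ n * ((1 - \<sigma> r) / \<phi> r) ^ m * \<sigma>' r"

text \<open>Dividing by \<open>W\<close> turns integration against the kernel into an inner product
  with respect to \<mu>.\<close>

definition rad :: "nat \<Rightarrow> nat \<Rightarrow> real \<Rightarrow> real" where
  "rad i j r = indicator {0<..<b} r * (v i j r / W r)"

text \<open>The degree \<open>(n, m)\<close> of the monomial and the exponents \<open>(i, j)\<close> of its radial part are independent.\<close>

definition radial_monomial :: "int \<Rightarrow> int \<Rightarrow> nat \<Rightarrow> nat \<Rightarrow> C2 \<Rightarrow> complex" where
  "radial_monomial n m i j \<zeta> = of_real (rad i j (cmod (fst \<zeta>))) * (unit_pow n (fst \<zeta>) * unit_pow m (snd \<zeta>))"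

lemma v_pos: "0 < r \<Longrightarrow> r < b \<Longrightarrow> 0 < v n m r"
  using \<sigma>_bounds[of r] \<sigma>'_pos[of r] \<phi>_pos[of r] by (simp add: v_def)

lemma v_isCont: assumes r: "0 < r" "r < b" shows "isCont (v n m) r"
  unfolding v_def[abs_def] using r \<phi>_pos[of r]
  by (intro continuous_intros \<sigma>_isCont \<sigma>'_isCont \<phi>_isCont) auto

lemma rad_measurable: "rad i j \<in> borel_measurable borel"
proof -
  have "set_borel_measurable lborel {0<..<b} (\<lambda>r. v i j r / W r)"
  proof (rule isCont_set_measurable)
    fix r assume r: "0 < r" "r < b"
    show "isCont (\<lambda>r. v i j r / W r) r"
      using W_pos[OF r] by (intro continuous_intros v_isCont W_isCont r) auto
  qed
  then show ?thesis unfolding set_borel_measurable_def rad_def[abs_def] by simp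
qed

text \<open>\<sigma>/r and (1-\<sigma>)/\<phi> are reciprocals of the intercepts of a supporting
  line, which are at least b/2 and \<phi> 0 respectively; \<open>\<sigma>'_bound\<close> takes care
  of \<sigma>'/W.\<close>

lemma rad_bounded: obtains B where "0 \<le> B" "\<And>r. \<bar>rad i j r\<bar> \<le> B"
proof -
  obtain C where C: "0 \<le> C" "\<And>r. 0 < r \<Longrightarrow> r < b \<Longrightarrow> \<sigma>' r \<le> C * (r * \<phi> r * sqrt (1 + (l r)\<^sup>2))"
    by (rule \<sigma>'_bound) (rule that)
  obtain h0 h1 where h: "0 < h0" "\<And>\<zeta>. \<zeta> \<in> frontier D \<Longrightarrow> h0 \<le> h \<zeta>" "\<And>\<zeta>. \<zeta> \<in> frontier D \<Longrightarrow> h \<zeta> \<le> h1"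
    by (rule h_bounds) (rule that)
  let ?B = "(2 / b) ^ i * (1 / \<phi> 0) ^ j * (C / h0)"
  have \<phi>0: "0 < \<phi> 0" using \<phi>_pos[of 0] b_pos by simp
  have B0: "0 \<le> ?B" using b_pos \<phi>0 C(1) h(1) by simp
  have "\<bar>rad i j r\<bar> \<le> ?B" for r
  proof (cases "r \<in> {0<..<b}")
    case True
    then have r: "0 < r" "r < b" by auto
    have d: "0 < r * l r + \<phi> r" by (rule den_pos[OF r])
    have "\<phi> (b/2) - \<phi> r \<le> - l r * (b/2 - r)" using supergradient[of r "b/2"] r b_pos by simp
    then have "l r * (b/2) \<le> r * l r + \<phi> r" using \<phi>_pos[of "b/2"] b_pos by (simp add: algebra_simps)
    then have 1: "\<sigma> r / r \<le> 2 / b" unfolding \<sigma>_div[OF r] using d b_pos by (simp add: field_simps)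
    have "\<phi> 0 - \<phi> r \<le> - l r * (0 - r)" using supergradient[of r 0] r b_pos by simp
    then have "\<phi> 0 \<le> r * l r + \<phi> r" by (simp add: algebra_simps)
    then have 2: "(1 - \<sigma> r) / \<phi> r \<le> 1 / \<phi> 0" unfolding \<sigma>_div[OF r] using \<phi>0 by (simp add: frac_le)
    have "\<sigma>' r \<le> C * (r * \<phi> r * sqrt (1 + (l r)\<^sup>2))" by (rule C(2)[OF r])
    also have "\<dots> \<le> C / h0 * W r"
    proof -
      have "h0 * (r * \<phi> r * sqrt (1 + (l r)\<^sup>2)) \<le> W r"
        unfolding W_def using h(2)[OF \<gamma>_frontier[of r]] r \<phi>_pos[of r] by (intro mult_right_mono) auto
      then have "C / h0 * (h0 * (r * \<phi> r * sqrt (1 + (l r)\<^sup>2))) \<le> C / h0 * W r"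
        using C(1) h(1) by (intro mult_left_mono) auto
      then show ?thesis using h(1) by simp
    qed
    finally have 3: "\<sigma>' r / W r \<le> C / h0" using W_pos[OF r] by (simp add: pos_divide_le_eq)
    have nn: "0 \<le> \<sigma> r / r" "0 \<le> (1 - \<sigma> r) / \<phi> r" "0 \<le> \<sigma>' r / W r"
      using \<sigma>_bounds[OF r] r \<phi>_pos[of r] \<sigma>'_pos[OF r] W_pos[OF r] by auto
    have "\<bar>rad i j r\<bar> = (\<sigma> r / r) ^ i * ((1 - \<sigma> r) / \<phi> r) ^ j * (\<sigma>' r / W r)"
      using True v_pos[OF r, of i j] W_pos[OF r] by (simp add: rad_def v_def)
    also have "\<dots> \<le> ?B"
      using 1 2 3 nn b_pos \<phi>0 by (intro mult_mono power_mono mult_nonneg_nonneg) auto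
    finally show ?thesis .
  qed (use B0 in \<open>simp add: rad_def\<close>)
  with B0 show ?thesis by (rule that)
qed

lemma norm_unit_pow: "norm (unit_pow n z) \<le> 1"
  unfolding unit_pow_def by (auto simp: norm_power norm_sgn power_le_one)

lemma radial_monomial_L2: "radial_monomial n m i j \<in> L2 \<mu>"
proof -
  obtain B where B: "0 \<le> B" "\<And>r. \<bar>rad i j r\<bar> \<le> B" by (rule rad_bounded) (rule that)
  have c: "(\<lambda>\<zeta>::C2. cmod (fst \<zeta>)) \<in> borel_measurable borel" "(\<lambda>\<zeta>::C2. fst \<zeta>) \<in> borel_measurable borel"
    "(\<lambda>\<zeta>::C2. snd \<zeta>) \<in> borel_measurable borel"
    by (intro borel_measurable_continuous_onI continuous_intros)+
  have rm: "(\<lambda>r. complex_of_real (rad i j r)) \<in> borel_measurable borel"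
    using rad_measurable[of i j] by simp
  have "radial_monomial n m i j \<in> borel_measurable borel"
    unfolding radial_monomial_def[abs_def]
    by (intro borel_measurable_times measurable_compose[OF c(1) rm]
        measurable_compose[OF c(2) unit_pow_measurable] measurable_compose[OF c(3) unit_pow_measurable])
  then have meas: "radial_monomial n m i j \<in> borel_measurable \<mu>"
    unfolding measurable_\<mu> by (rule measurable_restrict_space1)
  have bd: "cmod (radial_monomial n m i j x) \<le> B * (1 * 1)" for x
    unfolding radial_monomial_def norm_mult norm_of_real
    using B by (intro mult_mono norm_unit_pow) auto
  show ?thesis by (rule L2_I_bounded[OF finite_\<mu> meas bd])
qed

lemma radial_monomial_chart:
  assumes "0 < r" "r < b"
  shows "radial_monomial n m i j (polar_chart D (r, \<theta>)) = of_real (v i j r / W r) * cis2 n m \<theta>"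
  using assms \<phi>_pos[of r] polar_chart_eq[of r "fst \<theta>" "snd \<theta>"]
  by (simp add: radial_monomial_def unit_pow_cis cis2_mult norm_mult rad_def)

lemma radial_monomial_monomial: "monomial D n m (radial_monomial n m i j)"
  by (rule monomialI) (rule radial_monomial_chart)

lemma coef_radial_monomial: "0 < r \<Longrightarrow> r < b \<Longrightarrow> coef (radial_monomial n m i j) r = of_real (v i j r / W r)"
  using radial_monomial_chart[of r n m i j "(0, 0)"] by (simp add: coef_def \<gamma>_chart cis2_def)

lemma coef_v_integrable:
  assumes F: "F \<in> L2 \<mu>" "monomial D n m F"
  shows "set_integrable lborel {0<..<b} (\<lambda>r. coef F r * of_real (v i j r))"
    "L2_inner \<mu> F (radial_monomial n m i j) = of_real (4 * pi\<^sup>2) * (LINT r:{0<..<b}|lborel. coef F r * of_real (v i j r))"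
proof -
  have eq: "indicator {0<..<b} r *\<^sub>R (of_real (W r) * (coef F r * cnj (coef (radial_monomial n m i j) r)))
      = indicator {0<..<b} r *\<^sub>R (coef F r * of_real (v i j r))" for r
    using W_pos[of r] by (auto simp: indicator_def coef_radial_monomial)
  show "set_integrable lborel {0<..<b} (\<lambda>r. coef F r * of_real (v i j r))"
    using inner_monomial(1)[OF F radial_monomial_L2[of n m i j] radial_monomial_monomial[of n m i j]]
    unfolding set_integrable_def eq .
  show "L2_inner \<mu> F (radial_monomial n m i j) = of_real (4 * pi\<^sup>2) * (LINT r:{0<..<b}|lborel. coef F r * of_real (v i j r))"
    unfolding inner_monomial(2)[OF F radial_monomial_L2 radial_monomial_monomial] set_lebesgue_integral_def eq by simp
qed

definition mon :: "nat \<Rightarrow> nat \<Rightarrow> C2 \<Rightarrow> complex" where "mon n m \<zeta> = fst \<zeta> ^ n * snd \<zeta> ^ m"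

definition ker :: "nat \<Rightarrow> nat \<Rightarrow> C2 \<Rightarrow> complex" where
  "ker n m \<zeta> = of_real (ck n m / (4 * pi\<^sup>2)) * radial_monomial (int n) (int m) n m \<zeta>"

lemma ker_L2: "ker n m \<in> L2 \<mu>"
  unfolding ker_def[abs_def] by (rule L2_cmult[OF radial_monomial_L2])

lemma monomial_cmult: assumes "monomial D n m F" shows "monomial D n m (\<lambda>x. c * F x)"
  by (rule monomialI[where v = "\<lambda>r. c * coef F r"]) (simp add: monomial_coef[OF assms])

lemma ker_monomial: "monomial D (int n) (int m) (ker n m)"
  unfolding ker_def[abs_def] by (rule monomial_cmult[OF radial_monomial_monomial])

lemma mon_chart: "mon n m (polar_chart D (r, \<theta>)) = of_real (r ^ n * \<phi> r ^ m) * cis2 (int n) (int m) \<theta>"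
  using polar_chart_eq[of r "fst \<theta>" "snd \<theta>"]
  by (simp add: mon_def power_mult_distrib Complex.DeMoivre cis2_mult)

lemma mon_monomial: "monomial D (int n) (int m) (mon n m)"
  by (rule monomialI) (rule mon_chart)

lemma mon_L2: "mon n m \<in> L2 \<mu>"
proof -
  have "continuous_on (frontier D) (mon n m)" unfolding mon_def[abs_def] by (intro continuous_intros)
  then show ?thesis using mono_span_L2[OF mono_span_continuous[OF mon_monomial]] by simp
qed

lemma coef_mon: "coef (mon n m) r = of_real (r ^ n * \<phi> r ^ m)"
  using mon_chart[of n m r "(0, 0)"] by (simp add: coef_def \<gamma>_chart cis2_def)

lemma inner_ker:
  assumes F: "F \<in> L2 \<mu>" "monomial D (int n) (int m) F"
  shows "L2_inner \<mu> F (ker n m) = of_real (ck n m) * (LINT r:{0<..<b}|lborel. coef F r * of_real (v n m r))"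
  unfolding ker_def[abs_def] L2_inner_cmult_right coef_v_integrable(2)[OF F] by simp

lemma mon_v: "0 < r \<Longrightarrow> r < b \<Longrightarrow> r ^ n * \<phi> r ^ m * v n m r = \<sigma> r ^ n * (1 - \<sigma> r) ^ m * \<sigma>' r"
  using \<phi>_pos[of r] by (simp add: v_def power_divide)

lemma inner_mon_ker: "L2_inner \<mu> (mon n m) (ker n m) = 1"
proof -
  have "(LINT r:{0<..<b}|lborel. coef (mon n m) r * of_real (v n m r)) = (LINT r:{0<..<b}|lborel. complex_of_real (\<sigma> r ^ n * (1 - \<sigma> r) ^ m * \<sigma>' r))"
  proof (rule set_lebesgue_integral_cong)
    show "\<forall>r. r \<in> {0<..<b} \<longrightarrow> coef (mon n m) r * of_real (v n m r) = complex_of_real (\<sigma> r ^ n * (1 - \<sigma> r) ^ m * \<sigma>' r)"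
      unfolding coef_mon of_real_mult[symmetric] using mon_v by auto
  qed simp
  also have "\<dots> = of_real (1 / ck n m)" unfolding set_integral_complex_of_real beta_\<sigma>(2) ..
  finally show ?thesis unfolding inner_ker[OF mon_L2 mon_monomial] using ck_pos[of n m] by simp
qed

text \<open>Expand 1 / (1 - x)^2 as the sum of the (j + 1) x^j, and each power binomially. Every
  term is a radial function times a character, and integration over the angles keeps only the one
  with exponents (n, m).\<close>

lemma leray_integral_monomial:
  assumes F: "F \<in> L2 \<mu>" "monomial D (int n) (int m) F" and w: "w \<in> D"
  shows "leray_integral D \<rho> F w = L2_inner \<mu> F (ker n m) * mon n m w"
proof -
  obtain k where k: "0 \<le> k" "k < 1"
    "\<And>r. 0 < r \<Longrightarrow> r < b \<Longrightarrow> \<sigma> r / r * cmod (fst w) + (1 - \<sigma> r) / \<phi> r * cmod (snd w) \<le> k"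
    by (rule support_\<sigma>[OF w]) (rule that)
  define x where "x p = cis2 (-1) 0 (snd p) * of_real (\<sigma> (fst p) / fst p) * fst w
      + cis2 0 (-1) (snd p) * of_real ((1 - \<sigma> (fst p)) / \<phi> (fst p)) * snd w" for p :: "real \<times> real \<times> real"
  define G where "G p = coef F (fst p) * of_real (\<sigma>' (fst p)) * cis2 (int n) (int m) (snd p) / of_real (4 * pi\<^sup>2)" for p :: "real \<times> real \<times> real"
  define T where "T j p = G p * (of_nat (Suc j) * x p ^ j)" for j p
  have box: "0 < fst p" "fst p < b" if "p \<in> polar_box D" for p using that by (auto simp: polar_box_eq)
  have x_le: "norm (x p) \<le> k" if "p \<in> polar_box D" for p
  proof -
    note r = box[OF that]
    have "norm (x p) \<le> \<sigma> (fst p) / fst p * cmod (fst w) + (1 - \<sigma> (fst p)) / \<phi> (fst p) * cmod (snd w)"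
      unfolding x_def using \<sigma>_bounds[OF r] r \<phi>_pos[of "fst p"]
      by (intro norm_triangle_mono) (simp_all only: norm_mult norm_cis2 norm_of_real abs_of_nonneg divide_nonneg_nonneg less_imp_le mult_1 order_refl diff_ge_0_iff_ge)
    then show ?thesis using k(3)[OF r] by linarith
  qed
  have sums_p: "(\<lambda>j. T j p) sums (F (polar_chart D p) * leray_kernel D \<rho> p w)" if "p \<in> polar_box D" for p
  proof -
    note r = box[OF that]
    have "norm (x p) < 1" using x_le[OF that] k(2) by linarith
    from sums_mult[OF geometric_deriv_sums[OF this], of "G p"]
    have "(\<lambda>j. T j p) sums (G p * (1 / (1 - x p)\<^sup>2))" unfolding T_def .
    moreover have "leray_kernel D \<rho> p w = of_real (\<sigma>' (fst p) / (4 * pi\<^sup>2)) / (1 - x p)\<^sup>2"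
      using leray_kernel_eq[OF r, of "fst (snd p)" "snd (snd p)" w] by (simp add: x_def cis2_def)
    moreover have "F (polar_chart D p) = coef F (fst p) * cis2 (int n) (int m) (snd p)"
      using monomial_coef[OF F(2) r, of "snd p"] by simp
    ultimately show ?thesis by (simp add: G_def mult_ac)
  qed
  \<comment> \<open>Up to a constant, the term with w1^i w2^j; its angular degree is (n - i, m -
    j).\<close>
  define t where "t i j p = (coef F (fst p) * of_real (v i j (fst p))) * cis2 (int n - int i) (int m - int j) (snd p)" for i j and p :: "real \<times> real \<times> real"
  have ti: "set_integrable lborel ({0<..<b} \<times> angles) (t i j)" for i j
    unfolding t_def by (rule set_integrable_times(1)[OF coef_v_integrable(1)[OF F] set_integrable_cis2])
  have t_int: "(LINT p:{0<..<b} \<times> angles|lborel. t i j p)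
      = (if i = n \<and> j = m then of_real (4 * pi\<^sup>2) * (LINT r:{0<..<b}|lborel. coef F r * of_real (v n m r)) else 0)" for i j
    unfolding t_def set_integrable_times(2)[OF coef_v_integrable(1)[OF F] set_integrable_cis2] integral_cis2
    by (auto simp: mult.commute)
  have T_eq: "T j p = (\<Sum>i\<le>j. (of_nat (Suc j) / of_real (4 * pi\<^sup>2) * of_nat (j choose i) * fst w ^ i * snd w ^ (j - i)) * t i (j - i) p)" for j p
  proof -
    have c1: "(cis2 (-1) 0 \<theta>) ^ i = cis2 (- int i) 0 \<theta>" "(cis2 0 (-1) \<theta>) ^ i = cis2 0 (- int i) \<theta>" for i \<theta>
      by (simp_all add: cis2_def Complex.DeMoivre)
    have alg: "C * S * Z / P * J * (B * (z * a * w) ^ i * (z' * a' * w') ^ i') = (J / P * B * w ^ i * w' ^ i') * ((C * (a ^ i * a' ^ i' * S)) * (Z * (z ^ i * z' ^ i')))"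
      for C S Z P J B z a w z' a' w' :: complex and i i'
      unfolding power_mult_distrib divide_inverse by (simp only: mult_ac)
    have c2: "cis2 (int n) (int m) \<theta> * (cis2 (- int i) 0 \<theta> * cis2 0 (- int i') \<theta>) = cis2 (int n - int i) (int m - int i') \<theta>" for i i' \<theta>
      by (simp add: cis2_add)
    have "T j p = (\<Sum>i\<le>j. G p * of_nat (Suc j) * (of_nat (j choose i) * (cis2 (-1) 0 (snd p) * of_real (\<sigma> (fst p) / fst p) * fst w) ^ i
        * (cis2 0 (-1) (snd p) * of_real ((1 - \<sigma> (fst p)) / \<phi> (fst p)) * snd w) ^ (j - i)))"
      unfolding T_def x_def binomial_ring by (simp add: sum_distrib_left mult.assoc)
    also have "\<dots> = (\<Sum>i\<le>j. (of_nat (Suc j) / of_real (4 * pi\<^sup>2) * of_nat (j choose i) * fst w ^ i * snd w ^ (j - i)) * t i (j - i) p)"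
    proof (intro sum.cong refl)
      fix i
      have "G p * of_nat (Suc j) * (of_nat (j choose i) * (cis2 (-1) 0 (snd p) * of_real (\<sigma> (fst p) / fst p) * fst w) ^ i
        * (cis2 0 (-1) (snd p) * of_real ((1 - \<sigma> (fst p)) / \<phi> (fst p)) * snd w) ^ (j - i))
        = (of_nat (Suc j) / of_real (4 * pi\<^sup>2) * of_nat (j choose i) * fst w ^ i * snd w ^ (j - i)) *
         ((coef F (fst p) * of_real (v i (j - i) (fst p))) * (cis2 (int n) (int m) (snd p) * (cis2 (- int i) 0 (snd p) * cis2 0 (- int (j - i)) (snd p))))"
        unfolding G_def v_def of_real_mult of_real_power c1[symmetric] by (rule alg)
      then show "G p * of_nat (Suc j) * (of_nat (j choose i) * (cis2 (-1) 0 (snd p) * of_real (\<sigma> (fst p) / fst p) * fst w) ^ i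
        * (cis2 0 (-1) (snd p) * of_real ((1 - \<sigma> (fst p)) / \<phi> (fst p)) * snd w) ^ (j - i))
        = (of_nat (Suc j) / of_real (4 * pi\<^sup>2) * of_nat (j choose i) * fst w ^ i * snd w ^ (j - i)) * t i (j - i) p"
        unfolding c2 t_def .
    qed
    finally show ?thesis .
  qed
  let ?f = "\<lambda>j p. indicator (polar_box D) p *\<^sub>R T j p"
  have f_eq: "?f j p = (\<Sum>i\<le>j. (of_nat (Suc j) / of_real (4 * pi\<^sup>2) * of_nat (j choose i) * fst w ^ i * snd w ^ (j - i)) * (indicator ({0<..<b} \<times> angles) p *\<^sub>R t i (j - i) p))" for j p
    unfolding T_eq polar_box_eq by (simp add: scaleR_sum_right)
  have fi: "integrable lborel (?f j)" for j
    unfolding f_eq using ti unfolding set_integrable_def by (intro Bochner_Integration.integrable_sum integrable_mult_right) auto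
  have f_int: "integral\<^sup>L lborel (?f j) = (if j = n + m then L2_inner \<mu> F (ker n m) * mon n m w else 0)" for j
  proof -
    let ?c = "\<lambda>i. of_nat (Suc j) / of_real (4 * pi\<^sup>2) * of_nat (j choose i) * fst w ^ i * snd w ^ (j - i)"
    let ?I = "of_real (4 * pi\<^sup>2) * (LINT r:{0<..<b}|lborel. coef F r * of_real (v n m r))"
    have "integral\<^sup>L lborel (?f j) = (\<Sum>i\<le>j. ?c i * (LINT p:{0<..<b} \<times> angles|lborel. t i (j - i) p))"
    proof -
      have ti': "integrable lborel (\<lambda>p. indicator ({0<..<b} \<times> angles) p *\<^sub>R t i i' p)" for i i'
        using ti unfolding set_integrable_def .
      have "integral\<^sup>L lborel (?f j) = (\<Sum>i\<le>j. LINT p|lborel. ?c i * (indicator ({0<..<b} \<times> angles) p *\<^sub>R t i (j - i) p))"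
        unfolding f_eq by (rule Bochner_Integration.integral_sum) (intro integrable_mult_right ti')
      then show ?thesis unfolding set_lebesgue_integral_def integral_mult_right_zero .
    qed
    also have "\<dots> = (\<Sum>i\<le>j. if i = n then (if j = n + m then ?c n * ?I else 0) else 0)"
      unfolding t_int by (intro sum.cong refl) auto
    also have "\<dots> = (if j = n + m then ?c n * ?I else 0)" by auto
    also have "\<dots> = (if j = n + m then L2_inner \<mu> F (ker n m) * mon n m w else 0)"
    proof (cases "j = n + m")
      case True
      have "real (Suc (n + m)) * real (n + m choose n) = ck n m"
        using binomial_fact[of n "n + m", where 'a = real] by (simp add: ck_def)
      then have "complex_of_real (ck n m) = of_nat (Suc (n + m)) * of_nat (n + m choose n)"
        by (metis of_real_mult of_real_of_nat_eq)
      then have "?c n * ?I = of_real (ck n m) * (LINT r:{0<..<b}|lborel. coef F r * of_real (v n m r)) * (fst w ^ n * snd w ^ m)"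
        using True by (simp del: of_nat_Suc of_nat_add)
      then show ?thesis unfolding inner_ker[OF F] mon_def using True by (simp del: of_nat_Suc of_nat_add)
    qed simp
    finally show ?thesis .
  qed
  have Gi: "integrable lborel (\<lambda>p. norm (?f 0 p))" using fi by (rule integrable_norm)
  \<comment> \<open>Since |x p| \<le> k < 1 on the whole box, the terms are dominated by (j + 1) k^j
    times the integrable zeroth term, which allows sum and integral to be interchanged.\<close>
  have f_le: "norm (?f j p) \<le> (of_nat (Suc j) * k ^ j) * norm (?f 0 p)" for j p
  proof (cases "p \<in> polar_box D")
    case True
    have "norm (x p) ^ j \<le> k ^ j" using x_le[OF True] by (intro power_mono) auto
    then have "norm (G p) * (real (Suc j) * norm (x p) ^ j) \<le> norm (G p) * (real (Suc j) * k ^ j)"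
      by (intro mult_left_mono) auto
    then show ?thesis using True by (simp add: T_def norm_mult norm_power mult_ac del: of_nat_Suc)
  qed simp
  have sk: "summable (\<lambda>j. of_nat (Suc j) * k ^ j)"
    using geometric_deriv_sums[of k] k by (auto simp: sums_iff)
  have "(\<lambda>j. integral\<^sup>L lborel (?f j)) sums (LINT p|lborel. (\<Sum>j. ?f j p))"
  proof (rule sums_integral[OF fi])
    show "AE p in lborel. summable (\<lambda>j. norm (?f j p))"
    proof (rule AE_I2)
      fix p
      show "summable (\<lambda>j. norm (?f j p))"
        by (rule summable_comparison_test'[OF summable_mult2[OF sk, of "norm (?f 0 p)"], of 0]) (use f_le in auto)
    qed
    show "summable (\<lambda>j. LINT p|lborel. norm (?f j p))"
    proof (rule summable_comparison_test'[OF summable_mult2[OF sk, of "LINT p|lborel. norm (?f 0 p)"], of 0])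
      fix j :: nat
      have "(LINT p|lborel. norm (?f j p)) \<le> (LINT p|lborel. (of_nat (Suc j) * k ^ j) * norm (?f 0 p))"
        by (intro integral_mono integrable_norm fi integrable_mult_right Gi f_le)
      then show "norm (LINT p|lborel. norm (?f j p)) \<le> of_nat (Suc j) * k ^ j * (LINT p|lborel. norm (?f 0 p))"
        by simp
    qed
  qed
  moreover have "(\<Sum>j. ?f j p) = indicator (polar_box D) p *\<^sub>R (F (polar_chart D p) * leray_kernel D \<rho> p w)" for p
  proof (cases "p \<in> polar_box D")
    case True
    then show ?thesis using sums_unique[OF sums_p[OF True]] by simp
  qed simp
  ultimately have "(\<lambda>j. integral\<^sup>L lborel (?f j)) sums leray_integral D \<rho> F w"
    unfolding leray_integral_def set_lebesgue_integral_def by simp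
  moreover have "(\<lambda>j. integral\<^sup>L lborel (?f j)) sums (L2_inner \<mu> F (ker n m) * mon n m w)"
    unfolding f_int using sums_single[of "n + m" "\<lambda>j. L2_inner \<mu> F (ker n m) * mon n m w"] by simp
  ultimately show ?thesis by (rule sums_unique2)
qed

lemma leray_boundary_value_monomial:
  assumes F: "F \<in> L2 \<mu>" "monomial D (int n) (int m) F" and z: "z \<in> frontier D"
  shows "leray_boundary_value D \<rho> F z = L2_inner \<mu> F (ker n m) * mon n m z"
proof -
  have "z islimpt D" using z by (auto simp: frontier_eq closure_def)
  then have nt: "\<not> trivial_limit (at z within D)" by (simp add: trivial_limit_within)
  have "((\<lambda>w. L2_inner \<mu> F (ker n m) * mon n m w) \<longlongrightarrow> L2_inner \<mu> F (ker n m) * mon n m z) (at z within D)"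
    unfolding mon_def by (intro tendsto_intros)
  moreover have "\<forall>\<^sub>F w in at z within D. L2_inner \<mu> F (ker n m) * mon n m w = leray_integral D \<rho> F w"
    unfolding eventually_at_filter using leray_integral_monomial[OF F] by (intro always_eventually) simp
  ultimately have "(leray_integral D \<rho> F \<longlongrightarrow> L2_inner \<mu> F (ker n m) * mon n m z) (at z within D)"
    by (rule Lim_transform_eventually)
  then show ?thesis unfolding leray_boundary_value_def by (rule tendsto_Lim[OF nt])
qed

section \<open>The Leray operator as a sum of rank-one operators\<close>

abbreviation quadrant :: "(int \<times> int) set" where "quadrant \<equiv> {0..} \<times> {0..}"

definition mon' :: "int \<times> int \<Rightarrow> C2 \<Rightarrow> complex" where "mon' k = mon (nat (fst k)) (nat (snd k))"
definition ker' :: "int \<times> int \<Rightarrow> C2 \<Rightarrow> complex" where "ker' k = ker (nat (fst k)) (nat (snd k))"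

lemma quadrant_monomial:
  assumes "k \<in> quadrant"
  shows "monomial D (fst k) (snd k) (mon' k)" "monomial D (fst k) (snd k) (ker' k)"
  using assms mon_monomial[of "nat (fst k)" "nat (snd k)"] ker_monomial[of "nat (fst k)" "nat (snd k)"]
  by (auto simp: mon'_def ker'_def)

lemma mon'_L2: "mon' k \<in> L2 \<mu>" and ker'_L2: "ker' k \<in> L2 \<mu>"
  by (simp_all add: mon'_def ker'_def mon_L2 ker_L2)

lemma expansion_inner:
  assumes F: "\<forall>n m. monomial D n m (F (n, m))" "has_L2_sum \<mu> F UNIV f"
    and G: "G \<in> L2 \<mu>" "monomial D n m G"
  shows "L2_inner \<mu> f G = L2_inner \<mu> (F (n, m)) G"
proof -
  have FL: "F k \<in> L2 \<mu>" for k using F(2) unfolding has_L2_sum_def by (elim conjE) (rule bspec[OF _ UNIV_I])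
  have z: "L2_inner \<mu> (F k) G = 0" if "k \<noteq> (n, m)" for k
    using inner_monomial(2)[OF FL F(1)[rule_format] G, of "fst k" "snd k"] that by (cases k) auto
  have "((\<lambda>k. L2_inner \<mu> (F k) G) has_sum L2_inner \<mu> (F (n, m)) G) {(n, m)}"
    by (intro has_sum_finiteI) auto
  then have "((\<lambda>k. L2_inner \<mu> (F k) G) has_sum L2_inner \<mu> (F (n, m)) G) UNIV"
    by (subst has_sum_cong_neutral[where T = "{(n, m)}"]) (auto simp: z)
  with has_L2_sum_inner[OF F(2) G(1)] show ?thesis by (rule has_sum_unique)
qed

text \<open>The definition chooses among all monomial expansions of \<open>f\<close>. By
  orthogonality of degrees each of them has the coefficients <f, ker'>, and one exists by
  \<open>monomial_expansion\<close>, so the choice of the expansion disappears from the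
  formula.\<close>

lemma leray_op_eq:
  assumes f: "f \<in> L2 \<mu>"
  shows "leray_op D \<rho> \<mu> f = (SOME g. has_L2_sum \<mu> (\<lambda>k x. L2_inner \<mu> f (ker' k) * mon' k x) quadrant g)"
proof -
  have cong: "has_L2_sum \<mu> (\<lambda>k. leray_boundary_value D \<rho> (F k)) quadrant g
      \<longleftrightarrow> has_L2_sum \<mu> (\<lambda>k x. L2_inner \<mu> f (ker' k) * mon' k x) quadrant g"
    if F: "\<forall>n m. monomial D n m (F (n, m))" "has_L2_sum \<mu> F UNIV f" for F g
  proof (rule has_L2_sum_cong)
    fix k :: "int \<times> int" and x assume k: "k \<in> quadrant" and x: "x \<in> space \<mu>"
    have FL: "F k \<in> L2 \<mu>" using F(2) unfolding has_L2_sum_def by (elim conjE) (rule bspec[OF _ UNIV_I])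
    have Fk: "monomial D (fst k) (snd k) (F k)" using F(1)[rule_format, of "fst k" "snd k"] by simp
    have "monomial D (int (nat (fst k))) (int (nat (snd k))) (F k)" using Fk k by (auto simp: mem_Times_iff)
    from leray_boundary_value_monomial[OF FL this, of x] x
    have "leray_boundary_value D \<rho> (F k) x = L2_inner \<mu> (F k) (ker' k) * mon' k x"
      by (simp add: space_\<mu> ker'_def mon'_def)
    also have "L2_inner \<mu> (F k) (ker' k) = L2_inner \<mu> f (ker' k)"
      using expansion_inner[OF F ker'_L2 quadrant_monomial(2)[OF k]] by simp
    finally show "leray_boundary_value D \<rho> (F k) x = L2_inner \<mu> f (ker' k) * mon' k x" .
  qed
  have P: "\<forall>n m. monomial D n m ((\<lambda>k. proj (fst k) (snd k) f) (n, m))" by (simp add: proj_monomial)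
  note E = monomial_expansion[OF f]
  show ?thesis unfolding leray_op_def
  proof (intro arg_cong[where f = Eps] ext iffI)
    fix g
    assume "\<exists>F. (\<forall>n m. monomial D n m (F (n, m))) \<and> has_L2_sum \<mu> F UNIV f \<and>
      has_L2_sum \<mu> (\<lambda>k. leray_boundary_value D \<rho> (F k)) quadrant g"
    then show "has_L2_sum \<mu> (\<lambda>k x. L2_inner \<mu> f (ker' k) * mon' k x) quadrant g"
    proof (elim exE conjE)
      fix F assume F: "\<forall>n m. monomial D n m (F (n, m))" "has_L2_sum \<mu> F UNIV f"
        "has_L2_sum \<mu> (\<lambda>k. leray_boundary_value D \<rho> (F k)) quadrant g"
      show ?thesis using F(3) unfolding cong[OF F(1,2)] .
    qed
  next
    fix g
    assume "has_L2_sum \<mu> (\<lambda>k x. L2_inner \<mu> f (ker' k) * mon' k x) quadrant g"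
    then have "has_L2_sum \<mu> (\<lambda>k. leray_boundary_value D \<rho> ((\<lambda>k. proj (fst k) (snd k) f) k)) quadrant g"
      unfolding cong[OF P E] .
    with P E show "\<exists>F. (\<forall>n m. monomial D n m (F (n, m))) \<and> has_L2_sum \<mu> F UNIV f \<and>
      has_L2_sum \<mu> (\<lambda>k. leray_boundary_value D \<rho> (F k)) quadrant g"
      by (intro exI[of _ "\<lambda>k. proj (fst k) (snd k) f"] conjI)
  qed
qed

definition \<kappa> :: "int \<times> int \<Rightarrow> real" where "\<kappa> k = (L2_norm \<mu> (mon' k))\<^sup>2 * (L2_norm \<mu> (ker' k))\<^sup>2"

definition e :: "int \<times> int \<Rightarrow> C2 \<Rightarrow> complex" where "e k x = of_real (1 / L2_norm \<mu> (mon' k)) * mon' k x"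
text \<open>Scaled such that \<open>e k + d k\<close> is \<open>L2_norm \<mu> (mon' k)\<close> times
  \<open>ker' k\<close>. Then <f, e + d> e = <f, ker'> mon', and <mon', ker'> = 1 makes
  \<open>d k\<close> orthogonal to \<open>e k\<close>.\<close>

definition d :: "int \<times> int \<Rightarrow> C2 \<Rightarrow> complex" where "d k x = of_real (L2_norm \<mu> (mon' k)) * ker' k x - e k x"

lemma inner_mon'_ker': "L2_inner \<mu> (mon' k) (ker' k) = 1"
  by (simp add: mon'_def ker'_def inner_mon_ker)

lemma mon'_norm_pos: "0 < L2_norm \<mu> (mon' k)"
proof -
  have "L2_norm \<mu> (mon' k) \<noteq> 0"
    using L2_inner_0_if_norm_0[OF mon'_L2 ker'_L2, of k k] inner_mon'_ker'[of k] by auto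
  then show ?thesis using L2_norm_nonneg[of \<mu> "mon' k"] by linarith
qed

lemma e_L2: "e k \<in> L2 \<mu>" and d_L2: "d k \<in> L2 \<mu>"
  unfolding d_def[abs_def] e_def[abs_def] by (intro L2_cmult L2_diff mon'_L2 ker'_L2)+

lemma e_norm1: "L2_inner \<mu> (e k) (e k) = 1"
proof -
  have "L2_norm \<mu> (e k) = 1" unfolding e_def[abs_def] L2_norm_cmult norm_of_real using mon'_norm_pos[of k] by simp
  then show ?thesis by (simp add: L2_inner_self)
qed

lemma e_ker: "L2_inner \<mu> (e k) (\<lambda>x. of_real (L2_norm \<mu> (mon' k)) * ker' k x) = 1"
  unfolding e_def[abs_def] L2_inner_cmult_right L2_inner_cmult_left inner_mon'_ker' using mon'_norm_pos[of k] by simp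

lemma e_d: "L2_inner \<mu> (e k) (d k) = 0"
  unfolding d_def[abs_def] by (subst L2_inner_diff_right[OF L2_cmult[OF ker'_L2] e_L2 e_L2]) (simp only: e_ker e_norm1 diff_self)

lemma d_norm: "(L2_norm \<mu> (d k))\<^sup>2 = \<kappa> k - 1"
proof -
  have "(L2_norm \<mu> (\<lambda>x. e k x + d k x))\<^sup>2 = (L2_norm \<mu> (e k))\<^sup>2 + (L2_norm \<mu> (d k))\<^sup>2"
    by (simp add: L2_norm_add_power2[OF e_L2 d_L2] e_d)
  moreover have "(\<lambda>x. e k x + d k x) = (\<lambda>x. of_real (L2_norm \<mu> (mon' k)) * ker' k x)" by (simp add: d_def)
  moreover have "(L2_norm \<mu> (e k))\<^sup>2 = 1" using e_norm1[of k] unfolding L2_inner_self by (metis of_real_eq_1_iff)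
  ultimately show ?thesis by (simp add: L2_norm_cmult \<kappa>_def power_mult_distrib)
qed

lemma e_monomial: "k \<in> quadrant \<Longrightarrow> monomial D (fst k) (snd k) (e k)"
  unfolding e_def[abs_def] by (rule monomial_cmult[OF quadrant_monomial(1)])

lemma d_monomial: assumes "k \<in> quadrant" shows "monomial D (fst k) (snd k) (d k)"
proof (rule monomialI)
  fix r :: real and \<theta> assume r: "0 < r" "r < b"
  show "d k (polar_chart D (r, \<theta>)) = (of_real (L2_norm \<mu> (mon' k)) * coef (ker' k) r - coef (e k) r) * cis2 (fst k) (snd k) \<theta>"
    unfolding d_def monomial_coef[OF quadrant_monomial(2)[OF assms] r] monomial_coef[OF e_monomial[OF assms] r]
    by (simp add: algebra_simps)
qed

lemma quadrant_orth:
  assumes "j \<in> quadrant" "k \<in> quadrant" "j \<noteq> k"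
  shows "L2_inner \<mu> (e j) (e k) = 0" "L2_inner \<mu> (e j) (d k) = 0" "L2_inner \<mu> (d j) (d k) = 0"
  using assms(3) inner_monomial(2)[OF e_L2 e_monomial[OF assms(1)] e_L2 e_monomial[OF assms(2)]]
    inner_monomial(2)[OF e_L2 e_monomial[OF assms(1)] d_L2 d_monomial[OF assms(2)]]
    inner_monomial(2)[OF d_L2 d_monomial[OF assms(1)] d_L2 d_monomial[OF assms(2)]]
  by (auto simp: prod_eq_iff)

sublocale leray: L2_rank_one_sum \<mu> e d quadrant "leray_op D \<rho> \<mu>"
proof unfold_locales
  fix j k :: "int \<times> int" assume jk: "j \<in> quadrant" "k \<in> quadrant"
  show "L2_inner \<mu> (e j) (e k) = (if j = k then 1 else 0)" using quadrant_orth(1)[OF jk] e_norm1 by simp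
  show "L2_inner \<mu> (e j) (d k) = 0" using quadrant_orth(2)[OF jk] e_d by (cases "j = k") auto
  show "L2_inner \<mu> (d j) (d k) = 0" if "j \<noteq> k" using quadrant_orth(3)[OF jk that] .
next
  fix f assume f: "f \<in> L2 \<mu>"
  have "L2_inner \<mu> f (\<lambda>y. e k y + d k y) * e k x = L2_inner \<mu> f (ker' k) * mon' k x" for k x
  proof -
    have "(\<lambda>y. e k y + d k y) = (\<lambda>y. of_real (L2_norm \<mu> (mon' k)) * ker' k y)" by (simp add: d_def)
    then show ?thesis using mon'_norm_pos[of k] by (simp add: L2_inner_cmult_right e_def)
  qed
  then show "leray_op D \<rho> \<mu> f = (SOME g. has_L2_sum \<mu> (\<lambda>i x. L2_inner \<mu> f (\<lambda>y. e i y + d i y) * e i x) quadrant g)"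
    unfolding leray_op_eq[OF f] by simp
qed (rule e_L2 d_L2)+

text \<open>The two angular factors 4 \<pi>^2 of the squared norms cancel against the square of the
  constant in \<open>ker\<close>.\<close>

lemma \<kappa>_integrals:
  "set_integrable lborel {0<..<b} (\<lambda>r. (r ^ n * \<phi> r ^ m)\<^sup>2 * W r)"
  "set_integrable lborel {0<..<b} (\<lambda>r. (v n m r)\<^sup>2 / W r)"
  "\<kappa> (int n, int m) = (ck n m)\<^sup>2 * (LINT r:{0<..<b}|lborel. (r ^ n * \<phi> r ^ m)\<^sup>2 * W r) * (LINT r:{0<..<b}|lborel. (v n m r)\<^sup>2 / W r)"
proof -
  have e1: "indicator {0<..<b} r *\<^sub>R (of_real (W r) * (coef (mon n m) r * cnj (coef (mon n m) r)))
      = complex_of_real (indicator {0<..<b} r *\<^sub>R ((r ^ n * \<phi> r ^ m)\<^sup>2 * W r))" for r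
    by (simp add: coef_mon scaleR_conv_of_real power2_eq_square mult_ac)
  let ?R = "radial_monomial (int n) (int m) n m"
  have e2: "indicator {0<..<b} r *\<^sub>R (of_real (W r) * (coef ?R r * cnj (coef ?R r)))
      = complex_of_real (indicator {0<..<b} r *\<^sub>R ((v n m r)\<^sup>2 / W r))" for r
    using W_pos[of r] by (auto simp: coef_radial_monomial indicator_def power2_eq_square)
  note i1 = inner_monomial[OF mon_L2 mon_monomial mon_L2 mon_monomial, of n m n m, unfolded set_integrable_def set_lebesgue_integral_def e1]
  note i2 = inner_monomial[OF radial_monomial_L2 radial_monomial_monomial radial_monomial_L2 radial_monomial_monomial,
    of "int n" "int m" n m "int n" "int m" n m, unfolded set_integrable_def set_lebesgue_integral_def e2]
  show 1: "set_integrable lborel {0<..<b} (\<lambda>r. (r ^ n * \<phi> r ^ m)\<^sup>2 * W r)"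
    using integrable_Re[OF i1(1)] unfolding set_integrable_def by simp
  show 2: "set_integrable lborel {0<..<b} (\<lambda>r. (v n m r)\<^sup>2 / W r)"
    using integrable_Re[OF i2(1)] unfolding set_integrable_def by simp
  have "complex_of_real ((L2_norm \<mu> (mon n m))\<^sup>2) = of_real (4 * pi\<^sup>2 * (LINT r:{0<..<b}|lborel. (r ^ n * \<phi> r ^ m)\<^sup>2 * W r))"
    using i1(2) unfolding L2_inner_self integral_complex_of_real set_lebesgue_integral_def by simp
  then have n1: "(L2_norm \<mu> (mon n m))\<^sup>2 = 4 * pi\<^sup>2 * (LINT r:{0<..<b}|lborel. (r ^ n * \<phi> r ^ m)\<^sup>2 * W r)"
    unfolding of_real_eq_iff .
  have "complex_of_real ((L2_norm \<mu> ?R)\<^sup>2) = of_real (4 * pi\<^sup>2 * (LINT r:{0<..<b}|lborel. (v n m r)\<^sup>2 / W r))"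
    using i2(2) unfolding L2_inner_self integral_complex_of_real set_lebesgue_integral_def by simp
  then have n2: "(L2_norm \<mu> ?R)\<^sup>2 = 4 * pi\<^sup>2 * (LINT r:{0<..<b}|lborel. (v n m r)\<^sup>2 / W r)"
    unfolding of_real_eq_iff .
  have "L2_norm \<mu> (ker n m) = ck n m / (4 * pi\<^sup>2) * L2_norm \<mu> ?R"
    unfolding ker_def[abs_def] L2_norm_cmult norm_of_real using ck_pos[of n m] by simp
  note nk = this
  have "\<kappa> (int n, int m) = (4 * pi\<^sup>2 * X) * ((ck n m / (4 * pi\<^sup>2))\<^sup>2 * (4 * pi\<^sup>2 * Y))"
    if "X = (LINT r:{0<..<b}|lborel. (r ^ n * \<phi> r ^ m)\<^sup>2 * W r)" "Y = (LINT r:{0<..<b}|lborel. (v n m r)\<^sup>2 / W r)" for X Y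
    unfolding \<kappa>_def mon'_def ker'_def that fst_conv snd_conv nat_int nk power_mult_distrib[of "ck n m / (4 * pi\<^sup>2)"] n1 n2 ..
  moreover have "(P * X) * ((c / P)\<^sup>2 * (P * Y)) = c\<^sup>2 * X * Y" if "P \<noteq> 0" for P X Y c :: real
    using that by (simp add: power2_eq_square)
  ultimately show "\<kappa> (int n, int m) = (ck n m)\<^sup>2 * (LINT r:{0<..<b}|lborel. (r ^ n * \<phi> r ^ m)\<^sup>2 * W r) * (LINT r:{0<..<b}|lborel. (v n m r)\<^sup>2 / W r)"
    by simp
qed

end

subsection \<open>A defect in the Cauchy--Schwarz inequality\<close>

text \<open>For every \<open>t\<close> the integral of \<open>A / t + t * B - 2 * S\<close> is nonnegative; it is bounded
  below because \<open>A / S\<close> cannot be close to \<open>t\<close> on both \<open>R1\<close> and \<open>R2\<close>.\<close>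

lemma Cauchy_Schwarz_defect:
  fixes A B S :: "real \<Rightarrow> real"
  assumes int: "set_integrable lborel X A" "set_integrable lborel X B" "set_integrable lborel X S"
    and X: "X \<in> sets lborel"
    and pos: "\<And>x. x \<in> X \<Longrightarrow> 0 < A x" "\<And>x. x \<in> X \<Longrightarrow> 0 < S x" "\<And>x. x \<in> X \<Longrightarrow> A x * B x = (S x)\<^sup>2"
    and IA: "0 < (LINT x:X|lborel. A x)" and IB: "0 < (LINT x:X|lborel. B x)"
    and R1: "R1 \<in> sets lborel" "R1 \<subseteq> X" "\<mu> \<le> (LINT x:R1|lborel. S x)"
    and R2: "R2 \<in> sets lborel" "R2 \<subseteq> X" "\<mu> \<le> (LINT x:R2|lborel. S x)"
    and \<tau>: "1 < \<tau>" "\<And>x y. x \<in> R2 \<Longrightarrow> y \<in> R1 \<Longrightarrow> \<tau>\<^sup>2 * (A y / S y) \<le> A x / S x"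
  shows "2 * (LINT x:X|lborel. S x) + (\<tau> - 1)\<^sup>2 / \<tau> * \<mu>
    \<le> 2 * sqrt ((LINT x:X|lborel. A x) * (LINT x:X|lborel. B x))"
proof -
  let ?IA = "LINT x:X|lborel. A x" and ?IB = "LINT x:X|lborel. B x" and ?IS = "LINT x:X|lborel. S x"
  \<comment> \<open>For this \<open>t\<close> the integrals of A/t and t B are both the square root
    of the product of the integrals of A and B.\<close>
  define t where "t = sqrt (?IA / ?IB)"
  define \<eta> where "\<eta> = (\<tau> - 1)\<^sup>2 / \<tau>"
  define E where "E x = (A x / t + t * B x) - 2 * S x" for x
  define w where "w x = A x / S x / t" for x
  have t: "0 < t" using IA IB by (simp add: t_def)
  have \<eta>: "0 \<le> \<eta>" using \<tau>(1) by (simp add: \<eta>_def)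
  have E_eq: "E x = S x * ((w x - 1)\<^sup>2 / w x)" and w: "0 < w x" if x: "x \<in> X" for x
  proof -
    show "0 < w x" using pos(1,2)[OF x] t by (simp add: w_def)
    have B: "B x = S x / (w x * t)" using pos[OF x] t by (simp add: w_def field_simps power2_eq_square)
    have A: "A x = w x * t * S x" using pos[OF x] t by (simp add: w_def)
    show "E x = S x * ((w x - 1)\<^sup>2 / w x)" unfolding E_def A B using \<open>0 < w x\<close> t
      by (simp add: field_simps power2_eq_square)
  qed
  have E0: "0 \<le> E x" if "x \<in> X" for x unfolding E_eq[OF that] using w[OF that] pos(2)[OF that] by simp
  \<comment> \<open>The function (w - 1)^2 / w is invariant under inversion of w and increasing for
    w \<ge> 1.\<close>
  have w_far: "\<eta> \<le> (w - 1)\<^sup>2 / w" if "0 < w" "\<tau> \<le> w \<or> \<tau> \<le> 1 / w" for w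
  proof -
    have *: "(\<tau> - 1)\<^sup>2 / \<tau> \<le> (u - 1)\<^sup>2 / u" if "\<tau> \<le> u" for u
    proof -
      have "0 \<le> (u - \<tau>) * (u * \<tau> - 1)" using that \<tau>(1) less_1_mult[of u \<tau>] by (intro mult_nonneg_nonneg) auto
      then show ?thesis using that \<tau>(1) by (simp add: field_simps power2_eq_square)
    qed
    have "(1 / w - 1)\<^sup>2 / (1 / w) = (w - 1)\<^sup>2 / w" using that(1) by (simp add: field_simps power2_eq_square)
    with that(2) *[of w] *[of "1 / w"] show ?thesis by (auto simp: \<eta>_def)
  qed
  have int_E: "set_integrable lborel X E"
    unfolding E_def[abs_def] using int by (intro set_integral_diff set_integral_add) (auto intro: set_integrable_divide)
  have sub: "\<eta> * \<mu> \<le> (LINT x:X|lborel. E x)"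
    if R: "R \<in> sets lborel" "R \<subseteq> X" "\<mu> \<le> (LINT x:R|lborel. S x)" and far: "\<And>x. x \<in> R \<Longrightarrow> \<tau> \<le> w x \<or> \<tau> \<le> 1 / w x" for R
  proof -
    have iR: "set_integrable lborel R E" "set_integrable lborel R S"
      using set_integrable_subset[OF int_E R(1,2)] set_integrable_subset[OF int(3) R(1,2)] .
    have "\<eta> * \<mu> \<le> \<eta> * (LINT x:R|lborel. S x)" using R(3) \<eta> by (rule mult_left_mono)
    also have "\<dots> = (LINT x:R|lborel. \<eta> * S x)" by simp
    also have "\<dots> \<le> (LINT x:R|lborel. E x)"
    proof (rule set_integral_mono)
      fix x assume x: "x \<in> R"
      then have xX: "x \<in> X" using R(2) by auto
      show "\<eta> * S x \<le> E x" unfolding E_eq[OF xX] using mult_left_mono[OF w_far[OF w[OF xX] far[OF x]], of "S x"] pos(2)[OF xX]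
        by (simp add: mult.commute)
    qed (use iR in auto)
    also have "\<dots> \<le> (LINT x:X|lborel. E x)"
      unfolding set_lebesgue_integral_def using int_E iR(1) R(2) E0
      by (intro integral_mono) (auto simp: set_integrable_def indicator_def)
    finally show ?thesis .
  qed
  have "\<eta> * \<mu> \<le> (LINT x:X|lborel. E x)"
  proof (cases "\<forall>x\<in>R2. \<tau> \<le> w x")
    case True
    then show ?thesis by (intro sub[OF R2]) auto
  next
    case False
    then obtain x where x: "x \<in> R2" "w x < \<tau>" by auto
    show ?thesis
    proof (rule sub[OF R1])
      fix y assume y: "y \<in> R1"
      have yX: "y \<in> X" using y R1(2) by auto
      have "\<tau>\<^sup>2 * w y \<le> w x" unfolding w_def using divide_right_mono[OF \<tau>(2)[OF x(1) y], of t] t by simp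
      then have "\<tau> * (\<tau> * w y) < \<tau> * 1" using x(2) by (simp add: power2_eq_square mult.assoc)
      then have "\<tau> * w y < 1" using \<tau>(1) by (simp only: mult_less_cancel_left_pos[of \<tau>])
      then show "\<tau> \<le> w y \<or> \<tau> \<le> 1 / w y" using w[OF yX] by (simp add: field_simps)
    qed
  qed
  also have "(LINT x:X|lborel. E x) = (?IA / t + t * ?IB) - 2 * ?IS"
    unfolding E_def using int by (subst set_integral_diff set_integral_add; auto intro: set_integral_add)+
  finally have le: "\<eta> * \<mu> \<le> (?IA / t + t * ?IB) - 2 * ?IS" .
  have "?IA / t = sqrt (?IA * ?IB)" "t * ?IB = sqrt (?IA * ?IB)"
    using IA IB unfolding t_def by (simp_all add: real_sqrt_divide real_sqrt_mult field_simps)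
  with le show ?thesis by (simp add: \<eta>_def)
qed

text \<open>The exponent of \<open>s\<^sup>p (1 - s)\<^sup>q\<close> is compared with its maximum at \<open>c = p / (p + q)\<close>.\<close>

lemma binary_entropy_lower:
  fixes N c s :: real
  assumes "0 < s" "s < 1" "0 < c" "c < 1" "0 \<le> N"
  shows "N * c * ln c + N * (1 - c) * ln (1 - c) - N * (s - c)\<^sup>2 / (s * (1 - s))
    \<le> N * c * ln s + N * (1 - c) * ln (1 - s)"
proof -
  have "ln c - ln s \<le> (c - s) / s" "ln (1 - c) - ln (1 - s) \<le> ((1 - c) - (1 - s)) / (1 - s)"
    using ln_diff_le[of c s] ln_diff_le[of "1 - c" "1 - s"] assms by auto
  then have "N * c * (ln c - ln s) + N * (1 - c) * (ln (1 - c) - ln (1 - s))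
    \<le> N * c * ((c - s) / s) + N * (1 - c) * (((1 - c) - (1 - s)) / (1 - s))"
    using assms by (intro add_mono mult_left_mono) auto
  also have "\<dots> = N * (s - c)\<^sup>2 / (s * (1 - s))" using assms by (simp add: field_simps power2_eq_square)
  finally show ?thesis by (simp add: algebra_simps)
qed

text \<open>Bounding ln x by x - 1 would leave 0 as the error term. The sharper bound 2 (sqrt x - 1)
  leaves minus the squared Hellinger distance of the two distributions, and (sqrt x - sqrt y)^2
  \<ge> (x - y)^2 / 4 on the unit interval.\<close>

lemma binary_entropy_upper:
  fixes N c s :: real
  assumes "0 < s" "s < 1" "0 < c" "c < 1" "0 \<le> N"
  shows "N * c * ln s + N * (1 - c) * ln (1 - s)
    \<le> N * c * ln c + N * (1 - c) * ln (1 - c) - N / 2 * (s - c)\<^sup>2"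
proof -
  have ln_le: "ln x - ln y \<le> 2 * (sqrt x / sqrt y - 1)" if "0 < x" "0 < y" for x y :: real
    using ln_le_minus_one[of "sqrt x / sqrt y"] that by (simp add: ln_div ln_sqrt)
  have sq: "2 * sqrt x * sqrt y \<le> x + y - (x - y)\<^sup>2 / 4" if "0 < x" "0 < y" "x \<le> 1" "y \<le> 1" for x y :: real
  proof -
    have "x - y = (sqrt x - sqrt y) * (sqrt x + sqrt y)" using that by (simp add: algebra_simps)
    then have "(x - y)\<^sup>2 = (sqrt x - sqrt y)\<^sup>2 * (sqrt x + sqrt y)\<^sup>2" by (simp add: power_mult_distrib)
    also have "(sqrt x + sqrt y)\<^sup>2 \<le> 2\<^sup>2" using that by (intro power_mono) (auto intro: add_mono[of "sqrt x" 1 "sqrt y" 1, simplified])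
    then have "(sqrt x - sqrt y)\<^sup>2 * (sqrt x + sqrt y)\<^sup>2 \<le> (sqrt x - sqrt y)\<^sup>2 * 2\<^sup>2" by (intro mult_left_mono) auto
    also have "(sqrt x - sqrt y)\<^sup>2 = x + y - 2 * sqrt x * sqrt y" using that by (simp add: power2_diff)
    finally show ?thesis by simp
  qed
  have A: "c * (2 * (sqrt s / sqrt c - 1)) = 2 * sqrt s * sqrt c - 2 * c" if "0 < c" for c s :: real
  proof -
    have "sqrt c * sqrt c = c" using that by simp
    then have "c * (sqrt s / sqrt c) = sqrt c * sqrt s" using that by (simp add: real_div_sqrt field_simps)
    moreover have "c * (2 * (sqrt s / sqrt c - 1)) = 2 * (c * (sqrt s / sqrt c)) - 2 * c" by (simp add: right_diff_distrib)
    ultimately show ?thesis by simp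
  qed
  have "N * c * (ln s - ln c) + N * (1 - c) * (ln (1 - s) - ln (1 - c))
    \<le> N * c * (2 * (sqrt s / sqrt c - 1)) + N * (1 - c) * (2 * (sqrt (1 - s) / sqrt (1 - c) - 1))"
    using assms by (intro add_mono mult_left_mono ln_le) auto
  also have "\<dots> = N * ((2 * sqrt s * sqrt c - 2 * c) + (2 * sqrt (1 - s) * sqrt (1 - c) - 2 * (1 - c)))"
    using A[of c s] A[of "1 - c" "1 - s"] assms by (simp only: mult.assoc distrib_left diff_gt_0_iff_gt simp_thms)
  also have "\<dots> \<le> N * (- ((s - c)\<^sup>2 / 2))"
  proof (rule mult_left_mono)
    have "((1 - s) - (1 - c))\<^sup>2 = (s - c)\<^sup>2" by (simp add: power2_eq_square algebra_simps)
    then show "(2 * sqrt s * sqrt c - 2 * c) + (2 * sqrt (1 - s) * sqrt (1 - c) - 2 * (1 - c)) \<le> - ((s - c)\<^sup>2 / 2)"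
      using sq[of s c] sq[of "1 - s" "1 - c"] assms by simp
  qed fact
  finally show ?thesis by (simp add: algebra_simps)
qed

context reinhardt_measure
begin

section \<open>Lower bound for the defect\<close>

lemma \<kappa>_defect:
  assumes R1: "R1 \<in> sets lborel" "R1 \<subseteq> {0<..<b}" "\<mu>0 \<le> (LINT r:R1|lborel. \<sigma> r ^ n * (1 - \<sigma> r) ^ m * \<sigma>' r)"
    and R2: "R2 \<in> sets lborel" "R2 \<subseteq> {0<..<b}" "\<mu>0 \<le> (LINT r:R2|lborel. \<sigma> r ^ n * (1 - \<sigma> r) ^ m * \<sigma>' r)"
    and \<tau>: "1 < \<tau>" "\<And>x y. x \<in> R2 \<Longrightarrow> y \<in> R1 \<Longrightarrow>
      \<tau>\<^sup>2 * ((y ^ n * \<phi> y ^ m)\<^sup>2 * W y / (\<sigma> y ^ n * (1 - \<sigma> y) ^ m * \<sigma>' y))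
      \<le> (x ^ n * \<phi> x ^ m)\<^sup>2 * W x / (\<sigma> x ^ n * (1 - \<sigma> x) ^ m * \<sigma>' x)"
    and \<mu>0: "0 \<le> \<mu>0"
  shows "1 + (\<tau> - 1)\<^sup>2 / \<tau> * (ck n m * \<mu>0) \<le> \<kappa> (int n, int m)"
proof -
  let ?A = "\<lambda>r. (r ^ n * \<phi> r ^ m)\<^sup>2 * W r" and ?B = "\<lambda>r. (v n m r)\<^sup>2 / W r"
  let ?S = "\<lambda>r. \<sigma> r ^ n * (1 - \<sigma> r) ^ m * \<sigma>' r" and ?X = "{0<..<b}"
  have pos: "0 < ?A r" "0 < ?B r" "0 < ?S r" "?A r * ?B r = (?S r)\<^sup>2" if "r \<in> ?X" for r
  proof -
    have r: "0 < r" "r < b" using that by auto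
    show "0 < ?A r" "0 < ?B r" "0 < ?S r"
      using \<phi>_pos[of r] W_pos[OF r] v_pos[OF r, of n m] \<sigma>_bounds[OF r] \<sigma>'_pos[OF r] r by simp_all
    show "?A r * ?B r = (?S r)\<^sup>2"
      unfolding mon_v[OF r, symmetric] using W_pos[OF r] by (simp add: power_mult_distrib)
  qed
  let ?IA = "LINT r:?X|lborel. ?A r" and ?IB = "LINT r:?X|lborel. ?B r"
  have IA0: "0 \<le> ?IA" unfolding set_lebesgue_integral_def
    by (rule integral_nonneg_AE) (use less_imp_le[OF pos(1)] in \<open>auto simp: indicator_def\<close>)
  \<comment> \<open>Positivity of both integrals comes from \<open>\<kappa> \<ge> 1\<close>, that
    is, from \<open>d_norm\<close>.\<close>
  have "0 \<le> \<kappa> (int n, int m) - 1" unfolding d_norm[symmetric] by simp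
  then have "0 < (ck n m)\<^sup>2 * (?IA * ?IB)" unfolding \<kappa>_integrals(3) by simp
  then have "0 < ?IA * ?IB" using ck_pos[of n m] by (simp add: zero_less_mult_iff)
  then have IA: "0 < ?IA" "0 < ?IB" using IA0 by (auto simp: zero_less_mult_iff)
  define a where "a = (\<tau> - 1)\<^sup>2 / \<tau> * (ck n m * \<mu>0)"
  have a: "0 \<le> a" using \<tau>(1) \<mu>0 ck_pos[of n m] by (simp add: a_def)
  have "2 * (LINT r:?X|lborel. ?S r) + (\<tau> - 1)\<^sup>2 / \<tau> * \<mu>0 \<le> 2 * sqrt (?IA * ?IB)"
    by (rule Cauchy_Schwarz_defect[OF \<kappa>_integrals(1,2) beta_\<sigma>(1) _ pos(1,3,4) IA R1 R2 \<tau>]) simp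
  then have "ck n m * (2 * (1 / ck n m) + (\<tau> - 1)\<^sup>2 / \<tau> * \<mu>0) \<le> ck n m * (2 * sqrt (?IA * ?IB))"
    unfolding beta_\<sigma>(2) using ck_pos[of n m] by (intro mult_left_mono) auto
  then have "1 + a / 2 \<le> ck n m * sqrt (?IA * ?IB)"
    using ck_pos[of n m] by (simp add: a_def algebra_simps)
  then have "(1 + a / 2)\<^sup>2 \<le> (ck n m * sqrt (?IA * ?IB))\<^sup>2" using a by (intro power_mono) auto
  also have "\<dots> = \<kappa> (int n, int m)"
  proof -
    have "(c * sqrt (x * y))\<^sup>2 = c\<^sup>2 * x * y" if "0 < x" "0 < y" for c x y :: real
      using that by (simp add: power_mult_distrib)
    from this[OF IA] show ?thesis unfolding \<kappa>_integrals(3) .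
  qed
  also have "(1 + a / 2)\<^sup>2 = 1 + a + (a / 2)\<^sup>2" by (simp add: power2_eq_square algebra_simps)
  finally show ?thesis using zero_le_power2[of "a / 2"] unfolding a_def by linarith
qed

text \<open>An upper bound of Laplace type. The factor s^(k i) (1 - s)^(k j) lies below its maximum
  \<open>Z\<close> times exp(-\<alpha>^2 (s - c)^2), and exp(x^2) \<ge> 1 + x^2 replaces the
  Gaussian by a function with antiderivative arctan, at the cost of a constant factor.\<close>

lemma beta_upper:
  assumes c: "0 < c" "c < 1" and N: "0 < N" "N * c = real i" "N * (1 - c) = real j" and k: "0 < k"
  shows "1 / ck (k * i) (k * j) \<le> exp (real k * (i * ln c + j * ln (1 - c))) * (pi / sqrt (k * N / 2))"
proof -
  define \<alpha> where "\<alpha> = sqrt (k * N / 2)"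
  define Z where "Z = exp (real k * (i * ln c + j * ln (1 - c)))"
  have \<alpha>: "0 < \<alpha>" "\<alpha>\<^sup>2 = k * N / 2" using N k by (simp_all add: \<alpha>_def)
  let ?f = "\<lambda>s. Z * inverse (1 + (\<alpha> * (s - c))\<^sup>2)"
  have pos: "0 < 1 + (\<alpha> * (s - c))\<^sup>2" for s by (simp add: add_pos_nonneg)
  have F: "((\<lambda>s. Z * (arctan (\<alpha> * (s - c)) / \<alpha>)) has_real_derivative ?f s) (at s)" for s
  proof -
    have "((\<lambda>s. \<alpha> * (s - c)) has_real_derivative \<alpha>) (at s)"
      by (rule DERIV_cong[OF DERIV_cmult[OF DERIV_diff[OF DERIV_ident DERIV_const]]]) simp
    from DERIV_cmult[OF DERIV_cdivide[OF DERIV_chain2[OF DERIV_arctan this], of \<alpha>], of Z]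
    show ?thesis using \<alpha> by simp
  qed
  have fc: "continuous_on UNIV ?f" using pos by (intro continuous_intros ballI) (metis less_irrefl)
  have f0: "0 \<le> ?f s" for s using pos[of s] by (simp add: Z_def)
  note fF = \<sigma>_FTC[OF F fc f0]
  have "1 / ck (k * i) (k * j) = (LINT r:{0<..<b}|lborel. \<sigma> r ^ (k * i) * (1 - \<sigma> r) ^ (k * j) * \<sigma>' r)"
    by (rule beta_\<sigma>(2)[symmetric])
  also have "\<dots> \<le> (LINT r:{0<..<b}|lborel. ?f (\<sigma> r) * \<sigma>' r)"
  proof (rule set_integral_mono[OF beta_\<sigma>(1) fF(1)])
    fix r assume "r \<in> {0<..<b}"
    then have r: "0 < r" "r < b" by auto
    have "\<sigma> r ^ (k * i) * (1 - \<sigma> r) ^ (k * j) = exp (real k * (i * ln (\<sigma> r) + j * ln (1 - \<sigma> r)))"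
      using \<sigma>_bounds[OF r] by (simp add: distrib_left exp_add exp_of_nat_mult power_mult mult.commute[of k])
    also have "\<dots> \<le> exp (real k * ((i * ln c + j * ln (1 - c)) - N / 2 * (\<sigma> r - c)\<^sup>2))"
      using binary_entropy_upper[OF \<sigma>_bounds[OF r] c less_imp_le[OF N(1)]] unfolding N
      by (intro iffD2[OF exp_le_cancel_iff] mult_left_mono) auto
    also have "\<dots> = Z * inverse (exp ((\<alpha> * (\<sigma> r - c))\<^sup>2))"
      unfolding power_mult_distrib \<alpha>(2) Z_def exp_minus[symmetric] exp_add[symmetric] by (simp add: algebra_simps)
    also have "\<dots> \<le> ?f (\<sigma> r)"
      using pos[of "\<sigma> r"] exp_ge_add_one_self[of "(\<alpha> * (\<sigma> r - c))\<^sup>2"]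
      by (intro mult_left_mono le_imp_inverse_le) (auto simp: Z_def)
    finally show "\<sigma> r ^ (k * i) * (1 - \<sigma> r) ^ (k * j) * \<sigma>' r \<le> ?f (\<sigma> r) * \<sigma>' r"
      using \<sigma>'_pos[OF r] by (intro mult_right_mono) auto
  qed
  also have "\<dots> = Z * ((arctan (\<alpha> * (1 - c)) - arctan (\<alpha> * (0 - c))) / \<alpha>)"
    unfolding fF(2) by (simp only: right_diff_distrib diff_divide_distrib)
  also have "\<dots> \<le> Z * (pi / \<alpha>)"
    using \<alpha>(1) arctan_bounded[of "\<alpha> * (1 - c)"] arctan_bounded[of "\<alpha> * (0 - c)"]
    by (intro mult_left_mono divide_right_mono) (auto simp: Z_def)
  finally show ?thesis unfolding Z_def \<alpha>_def .
qed

text \<open>The weights \<open>(r\<^sup>n \<phi>\<^sup>m)\<^sup>2 W\<close> and \<open>v\<^sup>2 / W\<close> concentrate near the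
  same point \<open>r0\<close>, but if \<open>\<sigma>' \<noteq> 2 \<sigma> / r\<close> there, then their widths differ by a factor, and their ratio
  changes by a factor independent of \<open>k\<close> over distances comparable to the width \<open>1 / sqrt k\<close>.\<close>

lemma \<kappa>_lower:
  fixes i j :: nat
  assumes ij: "0 < i" "0 < j" and r0: "0 < r0" "r0 < b" "\<sigma> r0 = real i / (real i + real j)"
    and ne: "r0 * \<sigma>' r0 \<noteq> 2 * \<sigma> r0"
  shows "\<exists>\<epsilon>>0. \<exists>k0. \<forall>k\<ge>k0. 1 + \<epsilon> \<le> \<kappa> (int (k * i), int (k * j))"
proof -
  define N where "N = real i + real j"
  define c where "c = \<sigma> r0"
  have N: "0 < N" "N * c = real i" "N * (1 - c) = real j"
    using ij r0(3) by (auto simp: N_def c_def field_simps)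
  have c: "0 < c" "c < 1" using \<sigma>_bounds[OF r0(1,2)] by (auto simp: c_def)
  \<comment> \<open>2/r - \<sigma>'/\<sigma> is the derivative of ln(r^2/\<sigma>); it vanishes at
    \<open>r0\<close> exactly if the differential equation holds there. \<open>H\<close> is the
    factor of the quotient of the weights that does not change with k.\<close>
  define \<Theta> where "\<Theta> r = 2 / r - \<sigma>' r / \<sigma> r" for r
  define H where "H r = W r / \<sigma>' r" for r
  define \<theta> where "\<theta> = \<Theta> r0"
  have \<theta>: "\<theta> \<noteq> 0"
  proof
    assume "\<theta> = 0"
    then have "2 / r0 = \<sigma>' r0 / \<sigma> r0" by (simp add: \<theta>_def \<Theta>_def)
    then have "r0 * \<sigma>' r0 = 2 * \<sigma> r0" using r0(1) \<sigma>_bounds[OF r0(1,2)] by (simp add: frac_eq_eq mult.commute)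
    with ne show False ..
  qed
  \<comment> \<open>The sign of \<theta> decides whether the quotient of the weights grows or decays
    to the right of \<open>r0\<close>.\<close>
  define sg where "sg = sgn \<theta>"
  \<comment> \<open>Near \<open>r0\<close> the slope of \<sigma> lies between \<open>c1\<close> and
    \<open>L\<close>, and \<open>M\<close> bounds 1/(\<sigma>(1-\<sigma>)). Together with |\<Theta>|
    > |\<theta>|/2 this makes \<open>- sg * P\<close> grow at least like c2/2 (r - r0)^2.\<close>
  define c1 where "c1 = \<sigma>' r0 / 2"
  define L where "L = 2 * \<sigma>' r0"
  define M where "M = 2 / (c * (1 - c))"
  define c2 where "c2 = N * c1 * (\<bar>\<theta>\<bar> / 2)"
  have pos: "0 < c1" "0 < L" "0 < M" "0 < c2"
    using \<sigma>'_pos[OF r0(1,2)] c N(1) \<theta> by (auto simp: c1_def L_def M_def c2_def)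
  have H0: "0 < H r0" using W_pos[OF r0(1,2)] \<sigma>'_pos[OF r0(1,2)] by (simp add: H_def)

  have near: "\<forall>\<^sub>F r in nhds r0. y < f r" if "isCont f r0" "y < f r0" for f and y :: real
    by (rule order_tendstoD(1)[OF iffD1[OF tendsto_at_iff_tendsto_nhds that(1)[unfolded isCont_def]] that(2)])
  have near': "\<forall>\<^sub>F r in nhds r0. f r < y" if "isCont f r0" "f r0 < y" for f and y :: real
    by (rule order_tendstoD(2)[OF iffD1[OF tendsto_at_iff_tendsto_nhds that(1)[unfolded isCont_def]] that(2)])
  have cs: "isCont \<sigma> r0" "isCont \<sigma>' r0" "isCont W r0"
    by (intro \<sigma>_isCont \<sigma>'_isCont W_isCont r0(1,2))+
  have nz: "\<sigma> r0 \<noteq> 0" "1 - \<sigma> r0 \<noteq> 0" "\<sigma>' r0 \<noteq> 0" "r0 \<noteq> 0"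
    using \<sigma>_bounds[OF r0(1,2)] \<sigma>'_pos[OF r0(1,2)] r0(1) by auto
  have cc: "isCont (\<lambda>r. 1 / (\<sigma> r * (1 - \<sigma> r))) r0" "isCont (\<lambda>r. sg * \<Theta> r) r0" "isCont H r0"
    unfolding \<Theta>_def H_def[abs_def] using nz by (intro continuous_intros cs; simp)+
  have "\<forall>\<^sub>F r in nhds r0. (0 < r \<and> r < b) \<and> (c1 < \<sigma>' r \<and> \<sigma>' r < L) \<and> 1 / (\<sigma> r * (1 - \<sigma> r)) < M
      \<and> \<bar>\<theta>\<bar> / 2 < sg * \<Theta> r \<and> H r0 * exp (- c2 / 4) < H r \<and> H r < H r0 * exp (c2 / 4)"
  proof (intro eventually_conj near near' cs cc continuous_ident)
    show "c1 < \<sigma>' r0" "\<sigma>' r0 < L" using \<sigma>'_pos[OF r0(1,2)] by (auto simp: c1_def L_def)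
    show "1 / (\<sigma> r0 * (1 - \<sigma> r0)) < M" unfolding M_def c_def[symmetric] using c by (simp add: divide_strict_right_mono)
    have "sg * \<Theta> r0 = \<bar>\<theta>\<bar>" unfolding sg_def \<theta>_def[symmetric] abs_sgn by (rule mult.commute)
    then show "\<bar>\<theta>\<bar> / 2 < sg * \<Theta> r0" using \<theta> by simp
    show "H r0 * exp (- c2 / 4) < H r0" "H r0 < H r0 * exp (c2 / 4)" using H0 pos(4) by auto
  qed (use r0 in auto)
  then obtain \<delta> where \<delta>: "0 < \<delta>" and dd: "\<forall>r. dist r r0 < \<delta> \<longrightarrow> (0 < r \<and> r < b) \<and> (c1 < \<sigma>' r \<and> \<sigma>' r < L)
      \<and> 1 / (\<sigma> r * (1 - \<sigma> r)) < M \<and> \<bar>\<theta>\<bar> / 2 < sg * \<Theta> r \<and> H r0 * exp (- c2 / 4) < H r \<and> H r < H r0 * exp (c2 / 4)"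
    unfolding eventually_nhds_metric by (elim exE conjE) (rule that)
  have D: "0 < r" "r < b" "c1 < \<sigma>' r" "\<sigma>' r < L" "1 / (\<sigma> r * (1 - \<sigma> r)) < M" "\<bar>\<theta>\<bar> / 2 < sg * \<Theta> r"
      "H r0 * exp (- c2 / 4) < H r" "H r < H r0 * exp (c2 / 4)" if "r0 \<le> r" "r < r0 + \<delta>" for r
    using dd[rule_format, of r] that by (auto simp: dist_real_def)
  have slope: "c1 * (r - r0) \<le> \<sigma> r - c" "\<sigma> r - c \<le> L * (r - r0)" if r: "r0 \<le> r" "r < r0 + \<delta>" for r
  proof -
    have "c1 * (r - r0) \<le> \<sigma> r - c \<and> \<sigma> r - c \<le> L * (r - r0)"
    proof (cases "r = r0")
      case False
      then have "r0 < r" using r by simp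
      then obtain z where z: "r0 < z" "z < r" "\<sigma> r - \<sigma> r0 = (r - r0) * \<sigma>' z"
        using MVT2[of r0 r \<sigma> \<sigma>'] \<sigma>_deriv D(1,2) r by (metis less_le_trans not_less order_less_imp_le less_le_not_le order_le_less_trans)
      have "c1 < \<sigma>' z" "\<sigma>' z < L" using D(3,4)[of z] z r by auto
      then show ?thesis using \<open>r0 < r\<close> unfolding c_def z(3) by (simp add: mult.commute)
    qed (simp add: c_def)
    then show "c1 * (r - r0) \<le> \<sigma> r - c" "\<sigma> r - c \<le> L * (r - r0)" by auto
  qed

  \<comment> \<open>Up to the factor \<open>H\<close>, the quotient of the weights is exp(k P).
    Because \<open>N * c\<close> is \<open>i\<close>, the derivative contains the factor \<sigma> -
    c, so \<open>r0\<close> is a critical point of \<open>P\<close>.\<close>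
  define P where "P r = 2 * (i * ln r + j * ln (\<phi> r)) - (i * ln (\<sigma> r) + j * ln (1 - \<sigma> r))" for r
  have P': "(P has_real_derivative (- N * (\<sigma> r - c) / (1 - \<sigma> r) * \<Theta> r)) (at r)" if r: "0 < r" "r < b" for r
  proof -
    note s = \<sigma>_bounds[OF r] and f = \<phi>_pos[OF less_imp_le[OF r(1)] r(2)]
    have lns: "((\<lambda>r. ln (1 - \<sigma> r)) has_real_derivative - \<sigma>' r / (1 - \<sigma> r)) (at r)"
      using s by (auto intro!: derivative_eq_intros \<sigma>_deriv r)
    have "(P has_real_derivative (2 * (i * (1 / r) + j * (- l r / \<phi> r)) - (i * (\<sigma>' r / \<sigma> r) + j * (- \<sigma>' r / (1 - \<sigma> r))))) (at r)"
      unfolding P_def[abs_def] using s f r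
      by (intro DERIV_diff DERIV_cmult DERIV_add lns) (auto intro!: derivative_eq_intros \<sigma>_deriv \<phi>_deriv)
    \<comment> \<open>The definition of \<sigma> expresses the logarithmic derivative of \<phi>
      through \<sigma> and r.\<close>
    moreover have "l r / \<phi> r = \<sigma> r / (r * (1 - \<sigma> r))"
    proof -
      have "1 - \<sigma> r = \<phi> r / (r * l r + \<phi> r)" using \<sigma>_div(2)[OF r] f by (simp add: nonzero_divide_eq_eq[of "\<phi> r"])
      moreover have "l / f = (r * l / d) / (r * (f / d))" if "d \<noteq> 0" "r \<noteq> 0" for l f d r :: real using that by simp
      ultimately show ?thesis using den_pos[OF r] r(1) by (simp add: \<sigma>_def)
    qed
    then have "- l r / \<phi> r = - (\<sigma> r / (r * (1 - \<sigma> r)))" by (simp only: minus_divide_left[symmetric])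
    moreover have alg: "2 * (x * (1 / r) + y * (- (s / (r * (1 - s))))) - (x * (t / s) + y * (- t / (1 - s)))
        = - ((x + y) * s - x) / (1 - s) * (2 / r - t / s)" if "0 < s" "s < 1" "0 < r" for s r t x y :: real
      using that by (simp add: divide_simps) (simp add: algebra_simps)
    have "- ((real i + real j) * \<sigma> r - real i) = - N * (\<sigma> r - c)"
      using N(2) by (simp add: N_def algebra_simps)
    with alg[OF s r(1), where t = "\<sigma>' r" and x = i and y = j] have "2 * (i * (1 / r) + j * (- (\<sigma> r / (r * (1 - \<sigma> r))))) - (i * (\<sigma>' r / \<sigma> r) + j * (- \<sigma>' r / (1 - \<sigma> r)))
        = - N * (\<sigma> r - c) / (1 - \<sigma> r) * \<Theta> r"
      unfolding \<Theta>_def by simp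
    ultimately show ?thesis by (simp only:)
  qed
  have P_mono: "c2 / 2 * ((x - r0)\<^sup>2 - (y - r0)\<^sup>2) \<le> - sg * (P x - P y)"
    if xy: "r0 \<le> y" "y \<le> x" "x < r0 + \<delta>" for x y
  proof -
    let ?G = "\<lambda>r. - sg * P r - c2 / 2 * (r - r0)\<^sup>2"
    have "?G y \<le> ?G x"
    proof (rule DERIV_nonneg_imp_nondecreasing[OF xy(2)])
      fix r assume "y \<le> r" "r \<le> x"
      then have r: "r0 \<le> r" "r < r0 + \<delta>" using xy by auto
      note Dr = D[OF r] and s = \<sigma>_bounds[OF D(1,2)[OF r]]
      have sl: "0 \<le> c1 * (r - r0)" using pos(1) r by simp
      have "c2 * (r - r0) = N * (c1 * (r - r0)) * (\<bar>\<theta>\<bar> / 2)" by (simp add: c2_def)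
      also have "\<dots> \<le> N * ((\<sigma> r - c) / (1 - \<sigma> r)) * (sg * \<Theta> r)"
      proof (intro mult_mono)
        have "\<sigma> r - c \<le> (\<sigma> r - c) / (1 - \<sigma> r)"
          using s slope(1)[OF r] sl mult_left_le[of "1 - \<sigma> r" "\<sigma> r - c"] by (simp add: pos_le_divide_eq)
        then show "c1 * (r - r0) \<le> (\<sigma> r - c) / (1 - \<sigma> r)" using slope(1)[OF r] by linarith
        then show "0 \<le> N * ((\<sigma> r - c) / (1 - \<sigma> r))" using sl N(1) by (intro mult_nonneg_nonneg) linarith+
      qed (use N(1) Dr sl in auto)
      finally have le: "c2 * (r - r0) \<le> N * ((\<sigma> r - c) / (1 - \<sigma> r)) * (sg * \<Theta> r)" .
      have e1: "c2 / 2 * (2 * (r - r0)) = c2 * (r - r0)" by simp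
      have e2: "- sg * (- N * (\<sigma> r - c) / (1 - \<sigma> r) * \<Theta> r) = N * ((\<sigma> r - c) / (1 - \<sigma> r)) * (sg * \<Theta> r)"
        by simp
      have "0 \<le> - sg * (- N * (\<sigma> r - c) / (1 - \<sigma> r) * \<Theta> r) - c2 / 2 * (2 * (r - r0))"
        using le unfolding e1 e2 by linarith
      moreover have "((\<lambda>r. (r - r0)\<^sup>2) has_real_derivative 2 * (r - r0)) (at r)"
        by (auto intro!: derivative_eq_intros)
      then have "(?G has_real_derivative (- sg * (- N * (\<sigma> r - c) / (1 - \<sigma> r) * \<Theta> r) - c2 / 2 * (2 * (r - r0)))) (at r)"
        by (intro DERIV_diff DERIV_cmult P' Dr(1,2))
      ultimately show "\<exists>y. (?G has_real_derivative y) (at r) \<and> 0 \<le> y" by (intro exI conjI)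
    qed
    then show ?thesis by (simp add: algebra_simps)
  qed

  have ratio: "(r ^ (k * i) * \<phi> r ^ (k * j))\<^sup>2 * W r / (\<sigma> r ^ (k * i) * (1 - \<sigma> r) ^ (k * j) * \<sigma>' r) = exp (k * P r) * H r"
    and weight: "\<sigma> r ^ (k * i) * (1 - \<sigma> r) ^ (k * j) = exp (k * (i * ln (\<sigma> r) + j * ln (1 - \<sigma> r)))"
    if r: "0 < r" "r < b" for r k
  proof -
    note s = \<sigma>_bounds[OF r] and f = \<phi>_pos[OF less_imp_le[OF r(1)] r(2)]
    have e: "x ^ (k * i) = exp (k * (i * ln x))" if "0 < x" for x :: real and i
      using that by (simp add: exp_of_nat_mult power_mult mult.commute[of k])
    show w: "\<sigma> r ^ (k * i) * (1 - \<sigma> r) ^ (k * j) = exp (k * (i * ln (\<sigma> r) + j * ln (1 - \<sigma> r)))"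
      using s by (simp add: e distrib_left exp_add)
    have "(r ^ (k * i) * \<phi> r ^ (k * j))\<^sup>2 = exp (k * (2 * (i * ln r + j * ln (\<phi> r))))"
      unfolding e[OF r(1)] e[OF f] power2_eq_square exp_add[symmetric] by (simp add: algebra_simps)
    then have "(r ^ (k * i) * \<phi> r ^ (k * j))\<^sup>2 / (\<sigma> r ^ (k * i) * (1 - \<sigma> r) ^ (k * j)) = exp (k * P r)"
      unfolding w P_def by (simp only: right_diff_distrib exp_diff)
    then show "(r ^ (k * i) * \<phi> r ^ (k * j))\<^sup>2 * W r / (\<sigma> r ^ (k * i) * (1 - \<sigma> r) ^ (k * j) * \<sigma>' r) = exp (k * P r) * H r"
      unfolding H_def times_divide_times_eq[symmetric] by (rule arg_cong[where f = "\<lambda>x. x * (W r / \<sigma>' r)"])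
  qed

  \<comment> \<open>On [r0, r0 + 3/sqrt k] the beta weight is at least \<open>Z\<close> times exp(-9
    N M L^2) c1, the 9 being 3^2, and the whole integral is at most \<open>Z\<close> times \<pi> /
    sqrt(k N / 2). For an interval of length 1/sqrt k the quotient of these bounds is
    \<omega>.\<close>
  define \<omega> where "\<omega> = sqrt (N / 2) * exp (- (9 * N * M * L\<^sup>2)) * c1 / pi"
  have \<omega>: "0 < \<omega>" using N(1) pos(1) by (simp add: \<omega>_def)
  \<comment> \<open>Between the two intervals \<open>k * P\<close> changes by at least 3/2 c2, and
    the variation of \<open>H\<close> by factors exp(c2/4) costs at most c2/2. What remains is c2 =
    ln(\<tau>^2).\<close>
  define \<tau> where "\<tau> = exp (c2 / 2)"
  have \<tau>: "1 < \<tau>" using pos(4) by (simp add: \<tau>_def)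
  have main: "1 + (\<tau> - 1)\<^sup>2 / \<tau> * \<omega> \<le> \<kappa> (int (k * i), int (k * j))" if k: "0 < k" "9 / \<delta>\<^sup>2 < k" for k :: nat
  proof -
    define g where "g = 1 / sqrt k"
    have g: "0 < g" "k * g\<^sup>2 = 1" using k(1) by (simp_all add: g_def power_divide)
    have "9 * g\<^sup>2 < \<delta>\<^sup>2" using k \<delta> by (simp add: g_def power_divide field_simps)
    then have "(3 * g)\<^sup>2 < \<delta>\<^sup>2" by (simp add: power_mult_distrib)
    then have g3: "3 * g < \<delta>" using \<delta> by (intro power_less_imp_less_base[of "3 * g" 2 \<delta>]) auto
    \<comment> \<open>The gap between the intervals makes the squared distances to \<open>r0\<close>
      differ by at least (2 g)^2 - g^2 = 3 g^2, which is 3/k.\<close>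
    let ?R1 = "{r0..r0 + g}" and ?R2 = "{r0 + 2 * g..r0 + 2 * g + g}"
    let ?S = "\<lambda>r. \<sigma> r ^ (k * i) * (1 - \<sigma> r) ^ (k * j) * \<sigma>' r"
    define Z where "Z = exp (k * (i * ln c + j * ln (1 - c)))"
    define B where "B = Z * exp (- (9 * N * M * L\<^sup>2)) * c1"
    have Bpos: "0 < B" using pos(1) by (simp add: B_def Z_def)
    have S_ge: "B \<le> ?S r" if r: "r0 \<le> r" "r \<le> r0 + 3 * g" for r
    proof -
      have r': "r0 \<le> r" "r < r0 + \<delta>" using r g3 by auto
      note Dr = D[OF r'] and s = \<sigma>_bounds[OF D(1,2)[OF r']]
      have "0 \<le> \<sigma> r - c" using slope(1)[OF r'] pos(1) r mult_nonneg_nonneg[of c1 "r - r0"] by linarith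
      moreover have "\<sigma> r - c \<le> L * (3 * g)" using slope(2)[OF r'] mult_left_mono[of "r - r0" "3 * g" L] r pos(2) by linarith
      ultimately have "(\<sigma> r - c)\<^sup>2 \<le> (L * (3 * g))\<^sup>2" by (intro power_mono)
      then have "N * ((\<sigma> r - c)\<^sup>2 * (1 / (\<sigma> r * (1 - \<sigma> r)))) \<le> N * ((L * (3 * g))\<^sup>2 * M)"
        using N(1) s Dr(5) by (intro mult_left_mono mult_mono) auto
      then have "k * (N * ((\<sigma> r - c)\<^sup>2 * (1 / (\<sigma> r * (1 - \<sigma> r))))) \<le> k * (N * ((L * (3 * g))\<^sup>2 * M))"
        by (rule mult_left_mono) simp
      also have "\<dots> = 9 * N * M * L\<^sup>2 * (k * g\<^sup>2)" by (simp add: power_mult_distrib)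
      finally have "k * (N * (\<sigma> r - c)\<^sup>2 / (\<sigma> r * (1 - \<sigma> r))) \<le> 9 * N * M * L\<^sup>2" using g(2) by simp
      moreover have "k * ((i * ln c + j * ln (1 - c)) - N * (\<sigma> r - c)\<^sup>2 / (\<sigma> r * (1 - \<sigma> r)))
          \<le> k * (i * ln (\<sigma> r) + j * ln (1 - \<sigma> r))"
        using binary_entropy_lower[OF s c less_imp_le[OF N(1)]] unfolding N by (intro mult_left_mono) auto
      ultimately have "k * (i * ln c + j * ln (1 - c)) + (- (9 * N * M * L\<^sup>2)) \<le> k * (i * ln (\<sigma> r) + j * ln (1 - \<sigma> r))"
        unfolding right_diff_distrib by linarith
      then have "Z * exp (- (9 * N * M * L\<^sup>2)) \<le> exp (k * (i * ln (\<sigma> r) + j * ln (1 - \<sigma> r)))"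
        unfolding Z_def exp_add[symmetric] exp_le_cancel_iff .
      then show ?thesis unfolding B_def weight[OF Dr(1,2)] using pos(1) Dr(3) by (intro mult_mono) auto
    qed
    have int_ge: "g * B \<le> (LINT r:{a..a + g}|lborel. ?S r)" if a: "r0 \<le> a" "a + g \<le> r0 + 3 * g" for a
    proof -
      have sub: "{a..a + g} \<subseteq> {0<..<b}" using D(1,2) a g3 by (auto simp: subset_eq)
      have "g * B = (LINT r:{a..a + g}|lborel. B)"
        using g(1) unfolding set_lebesgue_integral_def by (simp add: mult.commute)
      also have "\<dots> \<le> (LINT r:{a..a + g}|lborel. ?S r)"
      proof (rule set_integral_mono)
        show "set_integrable lborel {a..a + g} (\<lambda>r. B)" by (rule borel_integrable_atLeastAtMost'[OF continuous_on_const])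
        show "set_integrable lborel {a..a + g} ?S" by (rule set_integrable_subset[OF beta_\<sigma>(1) _ sub]) simp
      qed (use S_ge a in auto)
      finally show ?thesis .
    qed
    have sub: "?R1 \<subseteq> {0<..<b}" "?R2 \<subseteq> {0<..<b}" using D(1,2) g g3 by (auto simp: subset_eq)
    have P_sep: "c2 * (3 / 2) \<le> - sg * (k * P x - k * P y)" if "x \<in> ?R2" "y \<in> ?R1" for x y
    proof -
      have "(2 * g)\<^sup>2 \<le> (x - r0)\<^sup>2" by (rule power_mono) (use that g in auto)
      moreover have "(y - r0)\<^sup>2 \<le> g\<^sup>2" by (rule power_mono) (use that g in auto)
      ultimately have "(2 * g)\<^sup>2 \<le> (x - r0)\<^sup>2" "(y - r0)\<^sup>2 \<le> g\<^sup>2" .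
      then have "3 * g\<^sup>2 \<le> (x - r0)\<^sup>2 - (y - r0)\<^sup>2" by (simp add: power_mult_distrib)
      then have "c2 / 2 * (3 * g\<^sup>2) \<le> c2 / 2 * ((x - r0)\<^sup>2 - (y - r0)\<^sup>2)" using pos(4) by (intro mult_left_mono) auto
      also have "\<dots> \<le> - sg * (P x - P y)" using that g g3 by (intro P_mono) auto
      finally have "k * (c2 / 2 * (3 * g\<^sup>2)) \<le> k * (- sg * (P x - P y))" by (rule mult_left_mono) simp
      moreover have "k * (c2 / 2 * (3 * g\<^sup>2)) = c2 * (3 / 2) * (k * g\<^sup>2)" by simp
      moreover have "k * (- sg * (P x - P y)) = - sg * (k * P x - k * P y)" by (simp only: right_diff_distrib mult_ac)
      ultimately show ?thesis unfolding g(2) by linarith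
    qed
    have sep: "\<tau>\<^sup>2 * (exp (k * P y) * H y) \<le> exp (k * P x) * H x"
      if le: "c2 * (3 / 2) \<le> k * P x - k * P y" and x: "r0 \<le> x" "x < r0 + \<delta>" and y: "r0 \<le> y" "y < r0 + \<delta>" for x y
    proof -
      have "\<tau>\<^sup>2 * (exp (k * P y) * H y) \<le> \<tau>\<^sup>2 * (exp (k * P y) * (H r0 * exp (c2 / 4)))"
        using D(8)[OF y] by (intro mult_left_mono) auto
      also have "\<dots> = exp (k * P y + c2 * (5 / 4)) * H r0"
        by (simp add: \<tau>_def power2_eq_square exp_add[symmetric] mult_ac)
      also have "\<dots> \<le> exp (k * P x + (- c2 / 4)) * H r0"
        using le H0 by (intro mult_right_mono) auto
      also have "\<dots> = exp (k * P x) * (H r0 * exp (- c2 / 4))" by (simp only: exp_add mult_ac)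
      also have "\<dots> \<le> exp (k * P x) * H x" using D(7)[OF x] by (intro mult_left_mono) auto
      finally show ?thesis .
    qed
    have m1: "g * B \<le> (LINT r:?R1|lborel. ?S r)" and m2: "g * B \<le> (LINT r:?R2|lborel. ?S r)"
      by (rule int_ge; use g in simp)+
    have gB: "0 \<le> g * B" using g Bpos by simp
    have "1 + (\<tau> - 1)\<^sup>2 / \<tau> * (ck (k * i) (k * j) * (g * B)) \<le> \<kappa> (int (k * i), int (k * j))"
    \<comment> \<open>For negative \<theta> the function \<open>P\<close> increases away from
      \<open>r0\<close> and the outer interval carries the larger quotient; for positive \<theta>
      the two intervals exchange roles.\<close>
    proof (cases "\<theta> < 0")
      case True
      then have "sg = - 1" by (simp add: sg_def)
      show ?thesis
      proof (rule \<kappa>_defect[OF _ sub(1) m1 _ sub(2) m2 \<tau> _ gB])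
        fix x y assume xy: "x \<in> ?R2" "y \<in> ?R1"
        have rx: "r0 \<le> x" "x < r0 + \<delta>" and ry: "r0 \<le> y" "y < r0 + \<delta>" using xy g g3 by auto
        have "c2 * (3 / 2) \<le> k * P x - k * P y" using P_sep[OF xy] \<open>sg = - 1\<close> by simp
        from sep[OF this rx ry]
        show "\<tau>\<^sup>2 * ((y ^ (k * i) * \<phi> y ^ (k * j))\<^sup>2 * W y / (\<sigma> y ^ (k * i) * (1 - \<sigma> y) ^ (k * j) * \<sigma>' y))
          \<le> (x ^ (k * i) * \<phi> x ^ (k * j))\<^sup>2 * W x / (\<sigma> x ^ (k * i) * (1 - \<sigma> x) ^ (k * j) * \<sigma>' x)"
          unfolding ratio[OF D(1,2)[OF rx]] ratio[OF D(1,2)[OF ry]] .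
      qed auto
    next
      case False
      then have "sg = 1" using \<theta> by (simp add: sg_def)
      show ?thesis
      proof (rule \<kappa>_defect[OF _ sub(2) m2 _ sub(1) m1 \<tau> _ gB])
        fix x y assume xy: "x \<in> ?R1" "y \<in> ?R2"
        have rx: "r0 \<le> x" "x < r0 + \<delta>" and ry: "r0 \<le> y" "y < r0 + \<delta>" using xy g g3 by auto
        have "c2 * (3 / 2) \<le> k * P x - k * P y" using P_sep[OF xy(2,1)] \<open>sg = 1\<close> by simp
        from sep[OF this rx ry]
        show "\<tau>\<^sup>2 * ((y ^ (k * i) * \<phi> y ^ (k * j))\<^sup>2 * W y / (\<sigma> y ^ (k * i) * (1 - \<sigma> y) ^ (k * j) * \<sigma>' y))
          \<le> (x ^ (k * i) * \<phi> x ^ (k * j))\<^sup>2 * W x / (\<sigma> x ^ (k * i) * (1 - \<sigma> x) ^ (k * j) * \<sigma>' x)"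
          unfolding ratio[OF D(1,2)[OF rx]] ratio[OF D(1,2)[OF ry]] .
      qed auto
    qed
    moreover have "\<omega> \<le> ck (k * i) (k * j) * (g * B)"
    proof -
      have "1 / ck (k * i) (k * j) * \<omega> \<le> Z * (pi / sqrt (k * N / 2)) * \<omega>"
        unfolding Z_def using \<omega> by (intro mult_right_mono beta_upper[OF c N k(1)]) auto
      also have "sqrt (k * N / 2) = sqrt k * sqrt (N / 2)" by (simp add: real_sqrt_mult[symmetric])
      also have "Z * (pi / (sqrt k * sqrt (N / 2))) * \<omega> = g * B"
        unfolding \<omega>_def B_def g_def using N(1) k(1) by (simp add: field_simps)
      finally show ?thesis using ck_pos[of "k * i" "k * j"] by (simp add: field_simps)
    qed
    then have "(\<tau> - 1)\<^sup>2 / \<tau> * \<omega> \<le> (\<tau> - 1)\<^sup>2 / \<tau> * (ck (k * i) (k * j) * (g * B))"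
      using \<tau> by (intro mult_left_mono) auto
    ultimately show ?thesis by linarith
  qed
  have "0 < (\<tau> - 1)\<^sup>2 / \<tau> * \<omega>" using \<tau> \<omega> by simp
  moreover have "\<forall>k\<ge>Suc (nat \<lceil>9 / \<delta>\<^sup>2\<rceil>). 1 + (\<tau> - 1)\<^sup>2 / \<tau> * \<omega> \<le> \<kappa> (int (k * i), int (k * j))"
  proof (intro allI impI main)
    fix k assume k: "Suc (nat \<lceil>9 / \<delta>\<^sup>2\<rceil>) \<le> k"
    then show "0 < k" by simp
    show "9 / \<delta>\<^sup>2 < k" using k real_nat_ceiling_ge[of "9 / \<delta>\<^sup>2"] by linarith
  qed
  ultimately show ?thesis by (intro exI conjI)
qed

section \<open>The differential equation and its solution\<close>

lemma compact_imp_ode_rational: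
  assumes comp: "L2_compact_operator \<mu> (leray_antisymmetric_part D \<rho> \<mu>)"
    and ij: "0 < i" "0 < j" and r0: "0 < r0" "r0 < b" "\<sigma> r0 = real i / (real i + real j)"
  shows "r0 * \<sigma>' r0 = 2 * \<sigma> r0"
proof (rule ccontr)
  assume "r0 * \<sigma>' r0 \<noteq> 2 * \<sigma> r0"
  from \<kappa>_lower[OF ij r0 this] obtain \<epsilon> k0 where \<epsilon>: "0 < \<epsilon>" "\<forall>k\<ge>k0. 1 + \<epsilon> \<le> \<kappa> (int (k * i), int (k * j))"
    by (elim exE conjE)
  \<comment> \<open>Starting at \<open>k0\<close> puts every degree in the range where the lower
    bound holds; positivity of \<open>i\<close> and \<open>j\<close> makes the degrees
    distinct.\<close>
  define s where "s k = (int ((k0 + k) * i), int ((k0 + k) * j))" for k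
  have s: "inj s" "range s \<subseteq> quadrant" using ij by (auto simp: s_def inj_on_def)
  have "L2_compact_operator \<mu> (\<lambda>f x. L2_adjoint \<mu> (leray_op D \<rho> \<mu>) f x - leray_op D \<rho> \<mu> f x)"
    using comp unfolding leray_antisymmetric_part_def[abs_def] .
  from leray.compact_imp_small[OF this s, of "sqrt \<epsilon>"] \<epsilon>(1) obtain k where k: "L2_norm \<mu> (d (s k)) < sqrt \<epsilon>" by auto
  have "(L2_norm \<mu> (d (s k)))\<^sup>2 < (sqrt \<epsilon>)\<^sup>2" by (rule power_strict_mono[OF k L2_norm_nonneg]) simp
  moreover have "1 + \<epsilon> \<le> \<kappa> (s k)" unfolding s_def using \<epsilon>(2)[rule_format, of "k0 + k"] by (simp only: le_add1)
  ultimately show False unfolding d_norm using \<epsilon>(1) by simp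
qed

text \<open>If the equation failed at \<open>r0\<close>, it would fail on an interval to the right
  of \<open>r0\<close>, where the strictly increasing \<sigma> takes a rational value, contrary to
  the rational case.\<close>

lemma compact_imp_ode:
  assumes comp: "L2_compact_operator \<mu> (leray_antisymmetric_part D \<rho> \<mu>)" and r0: "0 < r0" "r0 < b"
  shows "r0 * \<sigma>' r0 = 2 * \<sigma> r0"
proof (rule ccontr)
  let ?f = "\<lambda>r. \<bar>r * \<sigma>' r - 2 * \<sigma> r\<bar>"
  assume "r0 * \<sigma>' r0 \<noteq> 2 * \<sigma> r0"
  then have f0: "0 < ?f r0" by simp
  have "isCont ?f r0" by (intro continuous_intros \<sigma>_isCont \<sigma>'_isCont r0)
  then have "(?f \<longlongrightarrow> ?f r0) (nhds r0)"
    unfolding isCont_def by (rule iffD1[OF tendsto_at_iff_tendsto_nhds])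
  from order_tendstoD(1)[OF this f0] obtain \<delta> where \<delta>: "0 < \<delta>" "\<forall>r. dist r r0 < \<delta> \<longrightarrow> 0 < ?f r"
    unfolding eventually_nhds_metric by (elim exE conjE)
  define r1 where "r1 = min ((r0 + b) / 2) (r0 + \<delta> / 2)"
  have r1: "r0 < r1" "r1 < b" "r1 < r0 + \<delta>" using r0 \<delta>(1) by (auto simp: r1_def min_def)
  have "\<sigma> r0 < \<sigma> r1"
    by (rule DERIV_pos_imp_increasing[OF r1(1)]) (use \<sigma>_deriv \<sigma>'_pos r0 r1 in \<open>force intro!: exI conjI\<close>)
  from Rats_dense_in_real[OF this] obtain q where q: "q \<in> \<rat>" "\<sigma> r0 < q" "q < \<sigma> r1" by blast
  have q01: "0 < q" "q < 1" using q \<sigma>_bounds[of r0] \<sigma>_bounds[of r1] r0 r1 by auto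
  obtain m n :: nat where mn: "n \<noteq> 0" "\<bar>q\<bar> = m / n" using q(1) by (rule Rats_abs_nat_div_natE)
  have "q * n = m" using mn q01(1) by (simp add: field_simps)
  moreover have "0 < q * n" "q * n < 1 * n" using q01 mn(1) by (auto intro!: mult_strict_right_mono)
  ultimately have m: "0 < m" "m < n" by auto
  have "\<exists>r\<ge>r0. r \<le> r1 \<and> \<sigma> r = q"
    by (rule IVT) (use q r0 r1 in \<open>auto intro!: \<sigma>_isCont\<close>)
  then obtain r where r: "r0 \<le> r" "r \<le> r1" "\<sigma> r = q" by blast
  have rb: "0 < r" "r < b" using r r0 r1 by auto
  have "\<sigma> r = real m / (real m + real (n - m))" using m mn(2) q01(1) r(3) by (simp add: of_nat_diff)
  then have "r * \<sigma>' r = 2 * \<sigma> r"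
    using m by (intro compact_imp_ode_rational[OF comp, of m "n - m"] rb) auto
  moreover have "0 < ?f r" using \<delta>(2)[rule_format, of r] r r1 by (simp add: dist_real_def)
  ultimately show False by simp
qed

text \<open>The equation says that \<sigma>/r^2 is constant, and the limit 1 of \<sigma> at
  \<open>b\<close> gives the constant 1/b^2. The definition of \<sigma> then becomes a first order
  equation for \<phi>, with the first integral \<phi>^2 / (1 - C r^2).\<close>

lemma ode_imp_ellipsoid:
  assumes ode: "\<And>r. 0 < r \<Longrightarrow> r < b \<Longrightarrow> r * \<sigma>' r = 2 * \<sigma> r"
  shows "\<exists>a1 a2 :: real. a1 > 0 \<and> a2 > 0 \<and> D = {z. a1 * (cmod (fst z))\<^sup>2 + a2 * (cmod (snd z))\<^sup>2 < 1}"
proof -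
  have b2: "0 < b / 2" "b / 2 < b" using b_pos by auto
  have const: "f r = f (b / 2)" if "\<And>r. 0 < r \<Longrightarrow> r < b \<Longrightarrow> (f has_real_derivative 0) (at r)" "0 < r" "r < b" for f r
    by (rule DERIV_isconst3[of 0 b]) (use that b_pos in auto)
  define C where "C = \<sigma> (b / 2) / (b / 2)\<^sup>2"
  have \<sigma>C: "\<sigma> r = C * r\<^sup>2" if r: "0 < r" "r < b" for r
  proof -
    have "\<sigma> r / r\<^sup>2 = C" unfolding C_def
    proof (rule const[OF _ r])
      fix r assume r: "0 < r" "r < b"
      have "((\<lambda>r. \<sigma> r / r\<^sup>2) has_real_derivative (\<sigma>' r * r\<^sup>2 - \<sigma> r * (2 * r)) / (r\<^sup>2 * r\<^sup>2)) (at r)"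
        using DERIV_pow[of 2 r UNIV] r by (intro DERIV_divide \<sigma>_deriv) auto
      moreover have "\<sigma>' r * r\<^sup>2 - \<sigma> r * (2 * r) = r * (r * \<sigma>' r - 2 * \<sigma> r)" by (simp add: algebra_simps power2_eq_square)
      ultimately show "((\<lambda>r. \<sigma> r / r\<^sup>2) has_real_derivative 0) (at r)" unfolding ode[OF r] by simp
    qed
    then show ?thesis using r by (simp add: field_simps)
  qed
  have nt: "at_left b \<noteq> bot" "at_right (0::real) \<noteq> bot" by simp_all
  have "C * b\<^sup>2 = 1"
  proof (rule tendsto_unique[OF nt(1) _ \<sigma>_tendsto_1])
    have "((\<lambda>r. C * r\<^sup>2) \<longlongrightarrow> C * b\<^sup>2) (at_left b)" by (intro tendsto_intros)
    moreover have "\<forall>\<^sub>F r in at_left b. C * r\<^sup>2 = \<sigma> r"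
      using eventually_at_left_real[OF b_pos] by eventually_elim (simp add: \<sigma>C)
    ultimately show "(\<sigma> \<longlongrightarrow> C * b\<^sup>2) (at_left b)" by (rule Lim_transform_eventually)
  qed
  then have C: "C = 1 / b\<^sup>2" using b_pos by (simp add: field_simps)
  then have Cpos: "0 < C" using b_pos by simp
  have w: "0 < 1 - C * r\<^sup>2" if "0 \<le> r" "r < b" for r
    using power_strict_mono[of r b 2] that b_pos by (simp add: C)
  define K where "K = (\<phi> (b / 2))\<^sup>2 / (1 - C * (b / 2)\<^sup>2)"
  have Kpos: "0 < K" using \<phi>_pos[of "b / 2"] w[of "b / 2"] b2 by (simp add: K_def)
  have \<phi>K: "(\<phi> r)\<^sup>2 = K * (1 - C * r\<^sup>2)" if r: "0 < r" "r < b" for r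
  proof -
    have "(\<phi> r)\<^sup>2 / (1 - C * r\<^sup>2) = K" unfolding K_def
    proof (rule const[OF _ r])
      fix r assume r: "0 < r" "r < b"
      have wr: "0 < 1 - C * r\<^sup>2" using w[of r] r by simp
      have d1: "((\<lambda>r. (\<phi> r)\<^sup>2) has_real_derivative 2 * \<phi> r * (- l r)) (at r)"
        by (auto intro!: derivative_eq_intros \<phi>_deriv r)
      have d2: "((\<lambda>r. 1 - C * r\<^sup>2) has_real_derivative - (2 * C * r)) (at r)"
        by (auto intro!: derivative_eq_intros)
      have "r * l r = \<sigma> r * (r * l r + \<phi> r)" using den_pos[OF r] by (simp add: \<sigma>_def)
      then have "r * (l r * (1 - C * r\<^sup>2)) = r * (C * r * \<phi> r)" unfolding \<sigma>C[OF r] by (simp add: algebra_simps power2_eq_square)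
      then have l: "l r * (1 - C * r\<^sup>2) = C * r * \<phi> r" using r by simp
      have "2 * \<phi> r * (- l r) * (1 - C * r\<^sup>2) - (\<phi> r)\<^sup>2 * (- (2 * C * r)) = - 2 * \<phi> r * (l r * (1 - C * r\<^sup>2) - C * r * \<phi> r)"
        by (simp add: algebra_simps power2_eq_square)
      also have "\<dots> = 0" unfolding l by simp
      finally have n0: "2 * \<phi> r * (- l r) * (1 - C * r\<^sup>2) - (\<phi> r)\<^sup>2 * (- (2 * C * r)) = 0" .
      have wn: "1 - C * r\<^sup>2 \<noteq> 0" using wr by simp
      show "((\<lambda>r. (\<phi> r)\<^sup>2 / (1 - C * r\<^sup>2)) has_real_derivative 0) (at r)"
        using DERIV_divide[OF d1 d2 wn] unfolding n0 div_0 .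
    qed
    then show ?thesis using w[of r] r by (simp add: field_simps)
  qed
  \<comment> \<open>The formula for \<phi> is known on the open interval only; right continuity of
    \<phi> at 0 extends it to the points with z1 = 0.\<close>
  have "(\<phi> 0)\<^sup>2 = K"
  proof (rule tendsto_unique[OF nt(2)])
    have "(\<phi> \<longlongrightarrow> \<phi> 0) (at 0 within {0..b / 2})"
      using \<phi>_continuous_on[OF b2(2)] b2 by (auto simp: continuous_on_def)
    then have "(\<phi> \<longlongrightarrow> \<phi> 0) (at_right 0)" using b2(1) by (simp add: at_within_Icc_at_right)
    then show "((\<lambda>r. (\<phi> r)\<^sup>2) \<longlongrightarrow> (\<phi> 0)\<^sup>2) (at_right 0)" by (intro tendsto_intros)
    have "((\<lambda>r. K * (1 - C * r\<^sup>2)) \<longlongrightarrow> K * (1 - C * 0\<^sup>2)) (at_right 0)" by (intro tendsto_intros)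
    moreover have "\<forall>\<^sub>F r in at_right 0. K * (1 - C * r\<^sup>2) = (\<phi> r)\<^sup>2"
      using eventually_at_right_real[OF b_pos] by eventually_elim (simp add: \<phi>K)
    ultimately have "((\<lambda>r. (\<phi> r)\<^sup>2) \<longlongrightarrow> K * (1 - C * 0\<^sup>2)) (at_right 0)" by (rule Lim_transform_eventually)
    then show "((\<lambda>r. (\<phi> r)\<^sup>2) \<longlongrightarrow> K) (at_right 0)" by simp
  qed
  then have \<phi>K': "(\<phi> r)\<^sup>2 = K * (1 - C * r\<^sup>2)" if "0 \<le> r" "r < b" for r
    using \<phi>K[of r] that by (cases "r = 0") auto
  have "z \<in> D \<longleftrightarrow> C * (cmod (fst z))\<^sup>2 + 1 / K * (cmod (snd z))\<^sup>2 < 1" for z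
  proof (cases "cmod (fst z) < b")
    case True
    let ?r = "cmod (fst z)" and ?t = "cmod (snd z)"
    have "z \<in> D \<longleftrightarrow> ?t < \<phi> ?r" using True by (simp add: mem_D_iff)
    also have "\<dots> \<longleftrightarrow> ?t\<^sup>2 < (\<phi> ?r)\<^sup>2"
      using \<phi>_pos[of ?r] True by (metis norm_ge_zero power_less_imp_less_base power_strict_mono pos2 less_imp_le)
    also have "\<dots> \<longleftrightarrow> C * ?r\<^sup>2 + 1 / K * ?t\<^sup>2 < 1" unfolding \<phi>K'[OF norm_ge_zero True] using Kpos by (simp add: field_simps)
    finally show ?thesis .
  next
    case False
    then have "b\<^sup>2 \<le> (cmod (fst z))\<^sup>2" using b_pos by (intro power_mono) auto
    then have "1 \<le> C * (cmod (fst z))\<^sup>2" using b_pos by (simp add: C)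
    moreover have "0 \<le> 1 / K * (cmod (snd z))\<^sup>2" using Kpos by simp
    ultimately show ?thesis using False by (simp add: mem_D_iff)
  qed
  then show ?thesis using Cpos Kpos by (intro exI[of _ C] exI[of _ "1 / K"]) auto
qed

end

subsection \<open>Concentration for ellipsoids\<close>

lemma ck_Suc: "ck (Suc n) m = ck n m * (real (n + m + 2) / real (n + 1))"
proof -
  have "Suc n + m + 1 = Suc (n + m + 1)" by simp
  then have e: "(fact (Suc n + m + 1) :: real) = real (n + m + 2) * fact (n + m + 1)" by (simp only: fact_Suc) simp
  have alg: "x * F / (y * G * H) = F / (G * H) * (x / y)" for x y F G H :: real by (simp only: times_divide_times_eq mult_ac)
  show ?thesis unfolding ck_def e fact_Suc[of n] alg unfolding Suc_eq_plus1 ..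
qed

text \<open>As in Bernstein's proof of the Weierstrass theorem: uniform continuity handles |x - y| <
  \<delta>, and otherwise (x - y)^2 / \<delta>^2 \<ge> 1 multiplies a bound for the
  oscillation.\<close>

lemma continuous_quadratic_bound:
  fixes g :: "real \<Rightarrow> real"
  assumes g: "continuous_on {0..1} g" and \<eta>: "0 < \<eta>"
  shows "\<exists>K\<ge>0. \<forall>x\<in>{0..1}. \<forall>y\<in>{0..1}. g x \<le> g y + \<eta> + K * (x - y)\<^sup>2"
proof -
  have "uniformly_continuous_on {0..1} g" by (rule compact_uniformly_continuous[OF g]) simp
  then obtain \<delta> where \<delta>: "0 < \<delta>" "\<forall>x\<in>{0..1}. \<forall>y\<in>{0..1}. dist y x < \<delta> \<longrightarrow> dist (g y) (g x) < \<eta>"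
    unfolding uniformly_continuous_on_def using \<eta> by blast
  have "bounded (g ` {0..1})" by (rule compact_imp_bounded[OF compact_continuous_image[OF g]]) simp
  then obtain B where B: "\<forall>x\<in>{0..1}. \<bar>g x\<bar> \<le> B" unfolding bounded_iff by auto
  have B0: "0 \<le> B" using B[rule_format, of 0] by simp
  have "g x \<le> g y + \<eta> + 2 * B / \<delta>\<^sup>2 * (x - y)\<^sup>2" if xy: "x \<in> {0..1}" "y \<in> {0..1}" for x y
  proof (cases "\<bar>x - y\<bar> < \<delta>")
    case True
    then have "dist (g x) (g y) < \<eta>" using \<delta>(2) xy by (simp add: dist_real_def)
    moreover have "0 \<le> 2 * B / \<delta>\<^sup>2 * (x - y)\<^sup>2" using B0 by simp
    ultimately show ?thesis by (simp add: dist_real_def)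
  next
    case False
    then have "\<delta>\<^sup>2 \<le> (x - y)\<^sup>2" using \<delta>(1) power_mono[of \<delta> "\<bar>x - y\<bar>" 2] by simp
    then have "2 * B / \<delta>\<^sup>2 * \<delta>\<^sup>2 \<le> 2 * B / \<delta>\<^sup>2 * (x - y)\<^sup>2" using B0 by (intro mult_left_mono) auto
    then have "2 * B \<le> 2 * B / \<delta>\<^sup>2 * (x - y)\<^sup>2" using \<delta>(1) by simp
    moreover have "\<bar>g x\<bar> \<le> B" "\<bar>g y\<bar> \<le> B" using B xy by auto
    ultimately show ?thesis using \<eta> by linarith
  qed
  moreover have "0 \<le> 2 * B / \<delta>\<^sup>2" using B0 by simp
  ultimately show ?thesis by (intro exI[of _ "2 * B / \<delta>\<^sup>2"]) auto
qed

context reinhardt_measure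
begin

text \<open>Chebyshev's estimate: \<open>x0 n m\<close> is the mean of the probability density ck
  s^n (1 - s)^m, and the variance is at most 1 / (n + m + 3), which tends to 0 uniformly as the
  total degree grows.\<close>

lemma beta_average_le:
  defines "x0 n m \<equiv> real (n + 1) / real (n + m + 2)"
  assumes g: "set_integrable lborel {0<..<b} (\<lambda>r. g (\<sigma> r) * (\<sigma> r ^ n * (1 - \<sigma> r) ^ m * \<sigma>' r))"
    and le: "\<And>x. 0 < x \<Longrightarrow> x < 1 \<Longrightarrow> g x \<le> \<alpha> + K * (x - x0 n m)\<^sup>2" and K: "0 \<le> K"
  shows "ck n m * (LINT r:{0<..<b}|lborel. g (\<sigma> r) * (\<sigma> r ^ n * (1 - \<sigma> r) ^ m * \<sigma>' r)) \<le> \<alpha> + K / real (n + m + 3)"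
proof -
  let ?X = "{0<..<b}" and ?x = "x0 n m"
  let ?S = "\<lambda>n r. \<sigma> r ^ n * (1 - \<sigma> r) ^ m * \<sigma>' r"
  let ?Q = "\<lambda>r. K * ?S (n + 2) r + (\<alpha> + K * ?x\<^sup>2) * ?S n r - 2 * K * ?x * ?S (n + 1) r"
  \<comment> \<open>Powers of \<sigma> are absorbed into the exponent \<open>n\<close>, so the
    quadratic bound integrates to three beta integrals.\<close>
  have Q: "(\<alpha> + K * (\<sigma> r - ?x)\<^sup>2) * ?S n r = ?Q r" for r
    by (simp add: power2_eq_square algebra_simps)
  have i: "set_integrable lborel ?X (\<lambda>r. K * ?S (n + 2) r)"
    "set_integrable lborel ?X (\<lambda>r. (\<alpha> + K * ?x\<^sup>2) * ?S n r)" "set_integrable lborel ?X (\<lambda>r. 2 * K * ?x * ?S (n + 1) r)"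
    by (intro set_integrable_mult_right impI beta_\<sigma>(1))+
  have iQ: "set_integrable lborel ?X ?Q" by (rule set_integral_diff(1)[OF set_integral_add(1)[OF i(1,2)] i(3)])
  have "(LINT r:?X|lborel. ?Q r) = K * (1 / ck (n + 2) m) + (\<alpha> + K * ?x\<^sup>2) * (1 / ck n m) - 2 * K * ?x * (1 / ck (n + 1) m)"
    unfolding set_integral_diff(2)[OF set_integral_add(1)[OF i(1,2)] i(3)] set_integral_add(2)[OF i(1,2)]
      set_integral_mult_right beta_\<sigma>(2) ..
  also have "ck n m * \<dots> = K * (real (n + 1) / real (n + m + 2) * (real (n + 2) / real (n + m + 3))) + (\<alpha> + K * ?x\<^sup>2) - 2 * K * ?x * ?x"
  proof -
    have 1: "ck n m * (1 / ck (n + 1) m) = ?x"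
      unfolding x0_def Suc_eq_plus1[symmetric] ck_Suc using ck_pos[of n m] by simp
    have 2: "ck n m * (1 / ck (n + 2) m) = real (n + 1) / real (n + m + 2) * (real (n + 2) / real (n + m + 3))"
    proof -
      have "ck (n + 2) m = ck n m * (real (n + m + 2) / real (n + 1)) * (real (n + m + 3) / real (n + 2))"
        using ck_Suc[of "Suc n" m] unfolding ck_Suc[of n] by simp
      moreover have "c * (1 / (c * (p / q) * (s / t))) = q / p * (t / s)" if "c \<noteq> 0" for c p q s t :: real using that by simp
      ultimately show ?thesis using ck_pos[of n m] by simp
    qed
    have "c * (K * x + A * (1 / c) - B * y) = K * (c * x) + A - B * (c * y)" if "c \<noteq> 0" for c x y A B :: real
      using that by (simp add: algebra_simps)
    from this[of "ck n m"] show ?thesis unfolding 1 2 using ck_pos[of n m] by (metis 1 2 less_irrefl)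
  qed
  also have "\<dots> = \<alpha> + K * (real (n + 1) / real (n + m + 2) * (real (n + 2) / real (n + m + 3)) - ?x\<^sup>2)"
    by (simp add: power2_eq_square algebra_simps)
  also have "\<dots> \<le> \<alpha> + K * (1 / real (n + m + 3))"
  proof (intro add_left_mono mult_left_mono K)
    have "p / q * ((p + 1) / (q + 1)) - (p / q)\<^sup>2 = p * (q - p) / (q * q) * (1 / (q + 1))" if "0 < q" for p q :: real
      using that by (simp add: divide_simps power2_eq_square) (simp add: algebra_simps)
    from this[of "real (n + m + 2)" "real (n + 1)"]
    have "real (n + 1) / real (n + m + 2) * (real (n + 2) / real (n + m + 3)) - ?x\<^sup>2
      = real (n + 1) * (real (n + m + 2) - real (n + 1)) / (real (n + m + 2) * real (n + m + 2)) * (1 / real (n + m + 3))"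
      by (simp add: x0_def add_ac)
    also have "\<dots> \<le> 1 * (1 / real (n + m + 3))"
    proof (rule mult_right_mono)
      have "real (n + 1) * (real (n + m + 2) - real (n + 1)) \<le> real (n + m + 2) * real (n + m + 2)"
        by (intro mult_mono) auto
      then show "real (n + 1) * (real (n + m + 2) - real (n + 1)) / (real (n + m + 2) * real (n + m + 2)) \<le> 1"
        by (subst divide_le_eq_1_pos) auto
    qed simp
    finally show "real (n + 1) / real (n + m + 2) * (real (n + 2) / real (n + m + 3)) - ?x\<^sup>2 \<le> 1 / real (n + m + 3)" by simp
  qed
  finally have up: "ck n m * (LINT r:?X|lborel. ?Q r) \<le> \<alpha> + K / real (n + m + 3)" by simp
  have "(LINT r:?X|lborel. g (\<sigma> r) * ?S n r) \<le> (LINT r:?X|lborel. ?Q r)"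
  proof (rule set_integral_mono[OF g iQ])
    fix r assume "r \<in> ?X"
    then have r: "0 < r" "r < b" by auto
    show "g (\<sigma> r) * ?S n r \<le> ?Q r" unfolding Q[symmetric]
      using le[OF \<sigma>_bounds[OF r]] \<sigma>_bounds[OF r] \<sigma>'_pos[OF r] by (intro mult_right_mono) auto
  qed
  then have "ck n m * (LINT r:?X|lborel. g (\<sigma> r) * ?S n r) \<le> ck n m * (LINT r:?X|lborel. ?Q r)"
    using ck_pos[of n m] by (intro mult_left_mono) auto
  with up show ?thesis by linarith
qed

section \<open>Explicit formulas and concentration on an ellipsoid\<close>

lemma ellipsoid_profile:
  assumes a: "0 < a1" "0 < a2" and Deq: "D = {z. a1 * (cmod (fst z))\<^sup>2 + a2 * (cmod (snd z))\<^sup>2 < 1}"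
  shows "a1 * b\<^sup>2 = 1" "0 \<le> r \<Longrightarrow> r < b \<Longrightarrow> a1 * r\<^sup>2 + a2 * (\<phi> r)\<^sup>2 = 1"
proof -
  have mem: "pt x y \<in> D \<longleftrightarrow> a1 * x\<^sup>2 + a2 * y\<^sup>2 < 1" for x y by (simp add: Deq pt_def)
  have lt: "a1 * x\<^sup>2 < 1 \<longleftrightarrow> x < b" if "0 \<le> x" for x
    using mem[of x 0] mem_less_b[of x 0] less_b_mem[of x] that by auto
  show b: "a1 * b\<^sup>2 = 1"
  proof (rule antisym)
    show "1 \<le> a1 * b\<^sup>2" using lt[of b] b_pos by auto
    have "\<not> sqrt (1 / a1) < b" using lt[of "sqrt (1 / a1)"] a by simp
    then have "b\<^sup>2 \<le> (sqrt (1 / a1))\<^sup>2" using b_pos by (intro power_mono) auto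
    then show "a1 * b\<^sup>2 \<le> 1" using a by (simp add: field_simps)
  qed
  assume r: "0 \<le> r" "r < b"
  note m = mem_iff_profile[OF r]
  show "a1 * r\<^sup>2 + a2 * (\<phi> r)\<^sup>2 = 1"
  proof (rule antisym)
    have "\<not> pt r (\<phi> r) \<in> D" unfolding m using \<phi>_pos[OF r] by simp
    then show "1 \<le> a1 * r\<^sup>2 + a2 * (\<phi> r)\<^sup>2" unfolding mem by simp
    let ?t = "sqrt ((1 - a1 * r\<^sup>2) / a2)"
    have w: "0 < 1 - a1 * r\<^sup>2" using lt[of r] r by simp
    have "a1 * r\<^sup>2 + a2 * ?t\<^sup>2 = 1" using w a by simp
    then have "\<not> pt r ?t \<in> D" unfolding mem by simp
    then have "\<phi> r \<le> ?t" unfolding m using w a by simp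
    then have "(\<phi> r)\<^sup>2 \<le> ?t\<^sup>2" using \<phi>_pos[OF r] by (intro power_mono) auto
    then show "a1 * r\<^sup>2 + a2 * (\<phi> r)\<^sup>2 \<le> 1" using w a by (simp add: field_simps)
  qed
qed

lemma ellipsoid_\<sigma>:
  assumes a: "0 < a1" "0 < a2" and Deq: "D = {z. a1 * (cmod (fst z))\<^sup>2 + a2 * (cmod (snd z))\<^sup>2 < 1}"
    and r: "0 < r" "r < b"
  shows "a2 * (\<phi> r * l r) = a1 * r" "\<sigma> r = a1 * r\<^sup>2" "1 - \<sigma> r = a2 * (\<phi> r)\<^sup>2" "\<sigma>' r = 2 * a1 * r"
proof -
  have eq: "a1 * r\<^sup>2 + a2 * (\<phi> r)\<^sup>2 = 1" if "0 < r" "r < b" for r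
    using ellipsoid_profile(2)[OF a Deq, of r] that by simp
  have l: "a2 * (\<phi> r * l r) = a1 * r" if r: "0 < r" "r < b" for r
  proof -
    have "((\<lambda>r. a1 * r\<^sup>2 + a2 * (\<phi> r)\<^sup>2) has_real_derivative a1 * (2 * r) + a2 * (2 * \<phi> r * (- l r))) (at r)"
      by (auto intro!: derivative_eq_intros \<phi>_deriv r)
    moreover have "((\<lambda>r. a1 * r\<^sup>2 + a2 * (\<phi> r)\<^sup>2) has_real_derivative 0) (at r)"
      by (rule has_field_derivative_transform_within_open[of "\<lambda>r. 1" 0 r "{0<..<b}"]) (use eq r in auto)
    ultimately have "a1 * (2 * r) + a2 * (2 * \<phi> r * (- l r)) = 0" by (rule DERIV_unique)
    then show ?thesis by simp
  qed
  have s: "\<sigma> r = a1 * r\<^sup>2" if r: "0 < r" "r < b" for r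
  proof -
    have f: "\<phi> r \<noteq> 0" using \<phi>_pos[of r] r by simp
    have "\<sigma> r = (a2 * \<phi> r * (r * l r)) / (a2 * \<phi> r * (r * l r + \<phi> r))" unfolding \<sigma>_def using a f by simp
    also have "a2 * \<phi> r * (r * l r) = a1 * r\<^sup>2" using l[OF r] by (simp add: power2_eq_square algebra_simps)
    also have "a2 * \<phi> r * (r * l r + \<phi> r) = 1"
      using l[OF r] eq[OF r] by (simp add: power2_eq_square algebra_simps)
    finally show ?thesis by simp
  qed
  show "a2 * (\<phi> r * l r) = a1 * r" "\<sigma> r = a1 * r\<^sup>2" using l s r by auto
  then show "1 - \<sigma> r = a2 * (\<phi> r)\<^sup>2" using eq[OF r] by simp
  have "((\<lambda>r. a1 * r\<^sup>2) has_real_derivative \<sigma>' r) (at r)"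
    by (rule has_field_derivative_transform_within_open[OF \<sigma>_deriv[OF r], of "{0<..<b}"]) (use s r in auto)
  moreover have "((\<lambda>r. a1 * r\<^sup>2) has_real_derivative a1 * (2 * r)) (at r)"
    by (auto intro!: derivative_eq_intros)
  ultimately have "\<sigma>' r = a1 * (2 * r)" by (rule DERIV_unique)
  then show "\<sigma>' r = 2 * a1 * r" by simp
qed

text \<open>Here \<phi> sqrt(1 + l^2) equals sqrt(\<phi>^2 + (\<phi> l)^2), and \<phi> l = a1 r / a2
  stays bounded although \<open>l\<close> does not. So W/\<sigma>', written as a function of
  \<sigma>, is continuous and positive up to both endpoints.\<close>

lemma ellipsoid_density:
  assumes a: "0 < a1" "0 < a2" and Deq: "D = {z. a1 * (cmod (fst z))\<^sup>2 + a2 * (cmod (snd z))\<^sup>2 < 1}"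
  obtains V where "continuous_on {0..1} V" "\<And>x. x \<in> {0..1} \<Longrightarrow> 0 < V x"
    "\<And>r. 0 < r \<Longrightarrow> r < b \<Longrightarrow> W r = V (\<sigma> r) * \<sigma>' r"
proof -
  \<comment> \<open>As \<sigma> = a1 r^2 and 1 - \<sigma> = a2 \<phi>^2 on an ellipsoid,
    \<open>g\<close> is the curve \<gamma> parametrized by \<sigma> and extended to the endpoint x =
    1.\<close>
  define g where "g x = pt (sqrt (x / a1)) (sqrt ((1 - x) / a2))" for x
  define V where "V x = h (g x) * sqrt ((1 - x) / a2 + a1 * x / a2\<^sup>2) / (2 * a1)" for x
  note E = ellipsoid_profile[OF a Deq]
  have gc: "continuous_on {0..1} g" unfolding g_def[abs_def] pt_def using a by (intro continuous_intros) auto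
  have g\<gamma>: "g (a1 * r\<^sup>2) = \<gamma> r" if "0 \<le> r" "r < b" for r
  proof -
    have "(1 - a1 * r\<^sup>2) / a2 = (\<phi> r)\<^sup>2" using E(2)[OF that] a by (simp add: field_simps)
    then show ?thesis using a that \<phi>_pos[OF that] by (simp add: g_def \<gamma>_def)
  qed
  have gF: "g x \<in> frontier D" if x: "0 \<le> x" "x < 1" for x
  proof -
    define r where "r = sqrt (x / a1)"
    have "r\<^sup>2 = x / a1" using x a by (simp add: r_def)
    then have r: "0 \<le> r" "a1 * r\<^sup>2 = x" using x a by (auto simp: r_def)
    have "r < b"
    proof (rule ccontr)
      assume "\<not> r < b"
      then have "b\<^sup>2 \<le> r\<^sup>2" using b_pos by (intro power_mono) auto
      then have "a1 * b\<^sup>2 \<le> a1 * r\<^sup>2" using a by simp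
      then show False using E(1) r x by simp
    qed
    from g\<gamma>[OF r(1) this] \<gamma>_frontier[OF r(1) this] show ?thesis unfolding r(2) by simp
  qed
  have g1: "g 1 \<in> frontier D"
  proof (rule Lim_in_closed_set[OF frontier_closed, of g _ "at_left 1"])
    show "\<forall>\<^sub>F x in at_left 1. g x \<in> frontier D"
      using eventually_at_left_real[of 0 "1::real"] by (auto elim!: eventually_mono intro: gF)
    have "(g \<longlongrightarrow> g 1) (at 1 within {0..1})" using gc by (auto simp: continuous_on_def)
    then show "(g \<longlongrightarrow> g 1) (at_left 1)" by (simp add: at_within_Icc_at_left)
  qed simp
  have gF': "g x \<in> frontier D" if "x \<in> {0..1}" for x using gF[of x] g1 that by (cases "x = 1") auto
  have hg: "continuous_on {0..1} (\<lambda>x. h (g x))"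
    by (rule continuous_on_compose2[OF h_cont gc]) (rule image_subsetI, rule gF')
  show ?thesis
  proof (rule that)
    show "continuous_on {0..1} V" unfolding V_def[abs_def] using a
      by (intro continuous_intros hg) auto
    show "0 < V x" if x: "x \<in> {0..1}" for x
    proof -
      have "0 < (1 - x) / a2 + a1 * x / a2\<^sup>2"
        using x a by (cases "x = 1") (auto intro!: add_pos_nonneg)
      then show ?thesis using h_pos[OF gF'[OF x]] a by (simp add: V_def)
    qed
    show "W r = V (\<sigma> r) * \<sigma>' r" if r: "0 < r" "r < b" for r
    proof -
      note S = ellipsoid_\<sigma>[OF a Deq r] and f = \<phi>_pos[OF less_imp_le[OF r(1)] r(2)]
      have "(1 - \<sigma> r) / a2 = (\<phi> r)\<^sup>2" unfolding S(3) using a by simp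
      moreover have "a1 * \<sigma> r / a2\<^sup>2 = (\<phi> r * l r)\<^sup>2"
      proof -
        have "\<phi> r * l r = a1 * r / a2" using S(1) a by (simp add: field_simps)
        then show ?thesis unfolding S(2) by (simp add: power2_eq_square)
      qed
      ultimately have "sqrt ((1 - \<sigma> r) / a2 + a1 * \<sigma> r / a2\<^sup>2) = sqrt ((\<phi> r)\<^sup>2 * (1 + (l r)\<^sup>2))"
        by (simp add: algebra_simps power_mult_distrib)
      also have "\<dots> = \<phi> r * sqrt (1 + (l r)\<^sup>2)" using f by (simp add: real_sqrt_mult)
      finally have "V (\<sigma> r) * \<sigma>' r = h (\<gamma> r) * (\<phi> r * sqrt (1 + (l r)\<^sup>2)) / (2 * a1) * (2 * a1 * r)"
        unfolding V_def S(4) using g\<gamma>[of r] r by (simp add: S(2))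
      also have "\<dots> = W r" unfolding W_def using a by simp
      finally show ?thesis ..
    qed
  qed
qed

text \<open>On an ellipsoid \<sigma>/r = a1 r and (1-\<sigma>)/\<phi> = a2 \<phi>, so
  \<open>v n m\<close> is a constant times r^n \<phi>^m \<sigma>'. The two weights become the beta
  weight times V and 1/V, and the constants a1^n a2^m cancel in the product.\<close>

lemma ellipsoid_\<kappa>:
  assumes a: "0 < a1" "0 < a2" and Deq: "D = {z. a1 * (cmod (fst z))\<^sup>2 + a2 * (cmod (snd z))\<^sup>2 < 1}"
    and V: "\<And>x. x \<in> {0..1} \<Longrightarrow> 0 < V x" "\<And>r. 0 < r \<Longrightarrow> r < b \<Longrightarrow> W r = V (\<sigma> r) * \<sigma>' r"
  shows "set_integrable lborel {0<..<b} (\<lambda>r. V (\<sigma> r) * (\<sigma> r ^ n * (1 - \<sigma> r) ^ m * \<sigma>' r))"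
    "set_integrable lborel {0<..<b} (\<lambda>r. 1 / V (\<sigma> r) * (\<sigma> r ^ n * (1 - \<sigma> r) ^ m * \<sigma>' r))"
    "\<kappa> (int n, int m) = (ck n m * (LINT r:{0<..<b}|lborel. V (\<sigma> r) * (\<sigma> r ^ n * (1 - \<sigma> r) ^ m * \<sigma>' r)))
      * (ck n m * (LINT r:{0<..<b}|lborel. 1 / V (\<sigma> r) * (\<sigma> r ^ n * (1 - \<sigma> r) ^ m * \<sigma>' r)))"
proof -
  let ?X = "{0<..<b}" and ?c = "a1 ^ n * a2 ^ m"
  let ?S = "\<lambda>r. \<sigma> r ^ n * (1 - \<sigma> r) ^ m * \<sigma>' r"
  have c: "0 < ?c" using a by simp
  have eA: "V (\<sigma> r) * ?S r = ?c * ((r ^ n * \<phi> r ^ m)\<^sup>2 * W r)"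
    and eB: "1 / V (\<sigma> r) * ?S r = 1 / ?c * ((v n m r)\<^sup>2 / W r)" if "r \<in> ?X" for r
  proof -
    have r: "0 < r" "r < b" using that by auto
    note S = ellipsoid_\<sigma>[OF a Deq r] and f = \<phi>_pos[OF less_imp_le[OF r(1)] r(2)] and s = \<sigma>_bounds[OF r] and s' = \<sigma>'_pos[OF r]
    have V0: "0 < V (\<sigma> r)" using V(1)[of "\<sigma> r"] s by simp
    have sn: "\<sigma> r ^ n = a1 ^ n * (r ^ n)\<^sup>2" unfolding S(2) by (simp add: power_mult_distrib power_mult[symmetric] mult.commute)
    have sm: "(1 - \<sigma> r) ^ m = a2 ^ m * (\<phi> r ^ m)\<^sup>2" unfolding S(3) by (simp add: power_mult_distrib power_mult[symmetric] mult.commute)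
    show "V (\<sigma> r) * ?S r = ?c * ((r ^ n * \<phi> r ^ m)\<^sup>2 * W r)"
      unfolding V(2)[OF r] sn sm by (simp add: power_mult_distrib)
    have q1: "\<sigma> r / r = a1 * r" unfolding S(2) using r by (simp add: power2_eq_square)
    have q2: "(1 - \<sigma> r) / \<phi> r = a2 * \<phi> r" unfolding S(3) using f by (simp add: power2_eq_square)
    have "(v n m r)\<^sup>2 = ?c * (\<sigma> r ^ n * (1 - \<sigma> r) ^ m) * (\<sigma>' r)\<^sup>2"
      unfolding v_def q1 q2 sn sm by (simp add: power_mult_distrib power2_eq_square)
    then show "1 / V (\<sigma> r) * ?S r = 1 / ?c * ((v n m r)\<^sup>2 / W r)"
      unfolding V(2)[OF r] using c V0 s' a by (simp add: power2_eq_square)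
  qed
  have iA: "set_integrable lborel ?X (\<lambda>r. ?c * ((r ^ n * \<phi> r ^ m)\<^sup>2 * W r))"
    by (intro set_integrable_mult_right impI \<kappa>_integrals(1))
  have iB: "set_integrable lborel ?X (\<lambda>r. 1 / ?c * ((v n m r)\<^sup>2 / W r))"
    by (intro set_integrable_mult_right impI \<kappa>_integrals(2))
  show "set_integrable lborel ?X (\<lambda>r. V (\<sigma> r) * ?S r)"
    by (rule iffD2[OF set_integrable_cong[OF refl refl eA] iA])
  show "set_integrable lborel ?X (\<lambda>r. 1 / V (\<sigma> r) * ?S r)"
    by (rule iffD2[OF set_integrable_cong[OF refl refl eB] iB])
  have A: "(LINT r:?X|lborel. V (\<sigma> r) * ?S r) = ?c * (LINT r:?X|lborel. (r ^ n * \<phi> r ^ m)\<^sup>2 * W r)"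
    unfolding set_integral_mult_right[symmetric] by (rule set_lebesgue_integral_cong) (simp, use eA in blast)
  have B: "(LINT r:?X|lborel. 1 / V (\<sigma> r) * ?S r) = 1 / ?c * (LINT r:?X|lborel. (v n m r)\<^sup>2 / W r)"
    unfolding set_integral_mult_right[symmetric] by (rule set_lebesgue_integral_cong) (simp, use eB in blast)
  have alg: "k\<^sup>2 * x * y = (k * (c * x)) * (k * (1 / c * y))" if "c \<noteq> 0" for k x y c :: real
    using that by (simp add: power2_eq_square)
  show "\<kappa> (int n, int m) = (ck n m * (LINT r:?X|lborel. V (\<sigma> r) * ?S r)) * (ck n m * (LINT r:?X|lborel. 1 / V (\<sigma> r) * ?S r))"
    unfolding A B \<kappa>_integrals(3) by (rule alg[OF less_imp_neq[OF c, symmetric]])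
qed

text \<open>For large total degree the beta averages of V and 1/V exceed the values of these
  functions at the mean \<open>y\<close> by at most 2 \<eta>, and those two values have product
  1.\<close>

lemma ellipsoid_\<kappa>_le:
  assumes a: "0 < a1" "0 < a2" and Deq: "D = {z. a1 * (cmod (fst z))\<^sup>2 + a2 * (cmod (snd z))\<^sup>2 < 1}"
    and \<epsilon>: "0 < \<epsilon>"
  shows "\<exists>N0. \<forall>n m. N0 \<le> n + m \<longrightarrow> \<kappa> (int n, int m) \<le> 1 + \<epsilon>"
proof -
  obtain V where V: "continuous_on {0..1} V" "\<And>x. x \<in> {0..1} \<Longrightarrow> 0 < V x"
    "\<And>r. 0 < r \<Longrightarrow> r < b \<Longrightarrow> W r = V (\<sigma> r) * \<sigma>' r"
    by (rule ellipsoid_density[OF a Deq]) (rule that)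
  have Vne: "\<forall>x\<in>{0..1}. V x \<noteq> 0" using V(2) by (metis less_irrefl)
  have V': "continuous_on {0..1} (\<lambda>x. 1 / V x)"
    by (rule continuous_on_divide[OF continuous_on_const V(1) Vne])
  have bdd: "\<exists>B. \<forall>x\<in>{0..1}. \<bar>g x\<bar> \<le> B" if "continuous_on {0..1} g" for g :: "real \<Rightarrow> real"
  proof -
    have "bounded (g ` {0..1})" by (rule compact_imp_bounded[OF compact_continuous_image[OF that]]) simp
    then show ?thesis unfolding bounded_iff by auto
  qed
  obtain B1 B2 where B: "\<forall>x\<in>{0..1}. \<bar>V x\<bar> \<le> B1" "\<forall>x\<in>{0..1}. \<bar>1 / V x\<bar> \<le> B2" using bdd[OF V(1)] bdd[OF V'] by (elim exE)
  have B0: "0 \<le> B1" "0 \<le> B2"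
    by (rule order_trans[OF abs_ge_zero bspec[OF B(1), of 0]], simp) (rule order_trans[OF abs_ge_zero bspec[OF B(2), of 0]], simp)
  \<comment> \<open>Made for (V + 2\<eta>)(1/V + 2\<eta>) = 1 + 2\<eta> V + 2\<eta>/V + 4\<eta>^2,
    with V \<le> B1, 1/V \<le> B2 and \<eta> \<le> 1.\<close>
  define \<eta> where "\<eta> = min 1 (\<epsilon> / (2 * B1 + 2 * B2 + 4))"
  have \<eta>: "0 < \<eta>" "\<eta> \<le> 1" "\<eta> * (2 * B1 + 2 * B2 + 4) \<le> \<epsilon>"
  proof -
    have "0 < 2 * B1 + 2 * B2 + 4" using B0 by simp
    moreover from this have "\<eta> * (2 * B1 + 2 * B2 + 4) \<le> \<epsilon> / (2 * B1 + 2 * B2 + 4) * (2 * B1 + 2 * B2 + 4)"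
      unfolding \<eta>_def by (intro mult_right_mono) auto
    ultimately show "0 < \<eta>" "\<eta> \<le> 1" "\<eta> * (2 * B1 + 2 * B2 + 4) \<le> \<epsilon>" using \<epsilon> by (auto simp: \<eta>_def)
  qed
  obtain K1 where K1: "0 \<le> K1" "\<forall>x\<in>{0..1}. \<forall>y\<in>{0..1}. V x \<le> V y + \<eta> + K1 * (x - y)\<^sup>2"
    using continuous_quadratic_bound[OF V(1) \<eta>(1)] by (elim exE conjE)
  obtain K2 where K2: "0 \<le> K2" "\<forall>x\<in>{0..1}. \<forall>y\<in>{0..1}. 1 / V x \<le> 1 / V y + \<eta> + K2 * (x - y)\<^sup>2"
    using continuous_quadratic_bound[OF V' \<eta>(1)] by (elim exE conjE)
  have "\<kappa> (int n, int m) \<le> 1 + \<epsilon>" if nm: "nat \<lceil>(K1 + K2) / \<eta>\<rceil> \<le> n + m" for n m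
  proof -
    define y where "y = real (n + 1) / real (n + m + 2)"
    have y: "y \<in> {0..1}" by (simp add: y_def)
    note E = ellipsoid_\<kappa>[OF a Deq V(2,3), of n m]
    have "(K1 + K2) / \<eta> \<le> real (n + m + 3)" using nm real_nat_ceiling_ge[of "(K1 + K2) / \<eta>"] by linarith
    then have "(K1 + K2) / real (n + m + 3) \<le> \<eta>" using \<eta>(1) by (simp add: field_simps)
    then have K\<eta>: "K1 / real (n + m + 3) \<le> \<eta>" "K2 / real (n + m + 3) \<le> \<eta>"
      using K1(1) K2(1) divide_nonneg_nonneg[of K1 "real (n + m + 3)"] divide_nonneg_nonneg[of K2 "real (n + m + 3)"]
      unfolding add_divide_distrib by linarith+
    have 1: "ck n m * (LINT r:{0<..<b}|lborel. V (\<sigma> r) * (\<sigma> r ^ n * (1 - \<sigma> r) ^ m * \<sigma>' r)) \<le> V y + \<eta> + K1 / real (n + m + 3)"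
      by (rule beta_average_le[OF E(1) _ K1(1)]; (assumption | (unfold y_def[symmetric], rule K1(2)[rule_format, OF _ y], simp)))
    have 2: "ck n m * (LINT r:{0<..<b}|lborel. 1 / V (\<sigma> r) * (\<sigma> r ^ n * (1 - \<sigma> r) ^ m * \<sigma>' r)) \<le> 1 / V y + \<eta> + K2 / real (n + m + 3)"
      by (rule beta_average_le[OF E(2) _ K2(1)]; (assumption | (unfold y_def[symmetric], rule K2(2)[rule_format, OF _ y], simp)))
    have Vy: "0 < V y" "V y \<le> B1" "1 / V y \<le> B2"
      using V(2)[OF y] order_trans[OF abs_ge_self bspec[OF B(1) y]] order_trans[OF abs_ge_self bspec[OF B(2) y]] .
    have E3: "\<kappa> (int n, int m) = (ck n m * (LINT r:{0<..<b}|lborel. V (\<sigma> r) * (\<sigma> r ^ n * (1 - \<sigma> r) ^ m * \<sigma>' r)))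
        * (ck n m * (LINT r:{0<..<b}|lborel. 1 / V (\<sigma> r) * (\<sigma> r ^ n * (1 - \<sigma> r) ^ m * \<sigma>' r)))"
      by (rule E(3))
    have "\<kappa> (int n, int m) \<le> (V y + 2 * \<eta>) * (1 / V y + 2 * \<eta>)"
      unfolding E3
    proof (rule mult_mono)
      show "0 \<le> ck n m * (LINT r:{0<..<b}|lborel. 1 / V (\<sigma> r) * (\<sigma> r ^ n * (1 - \<sigma> r) ^ m * \<sigma>' r))"
      proof (rule mult_nonneg_nonneg[OF less_imp_le[OF ck_pos]], unfold set_lebesgue_integral_def, rule integral_nonneg_AE, rule AE_I2)
        fix r
        show "0 \<le> indicator {0<..<b} r *\<^sub>R (1 / V (\<sigma> r) * (\<sigma> r ^ n * (1 - \<sigma> r) ^ m * \<sigma>' r))"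
          using V(2)[of "\<sigma> r"] \<sigma>_bounds[of r] \<sigma>'_pos[of r] by (auto simp: indicator_def less_imp_le)
      qed
    qed ((use 1 2 K\<eta> Vy \<eta> in linarith)+)
    also have "\<dots> = 1 + 2 * \<eta> * V y + 2 * \<eta> * (1 / V y) + 4 * \<eta> * \<eta>" using Vy(1) by (simp add: algebra_simps)
    also have "\<dots> \<le> 1 + 2 * \<eta> * B1 + 2 * \<eta> * B2 + 4 * \<eta> * 1"
      using \<eta> Vy by (intro add_mono mult_left_mono) auto
    also have "\<dots> \<le> 1 + \<epsilon>" using \<eta>(3) by (simp add: algebra_simps)
    finally show ?thesis .
  qed
  then show ?thesis by (intro exI[of _ "nat \<lceil>(K1 + K2) / \<eta>\<rceil>"] allI impI)
qed

lemma ellipsoid_imp_compact: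
  assumes a: "0 < a1" "0 < a2" and Deq: "D = {z. a1 * (cmod (fst z))\<^sup>2 + a2 * (cmod (snd z))\<^sup>2 < 1}"
  shows "L2_compact_operator \<mu> (leray_antisymmetric_part D \<rho> \<mu>)"
  unfolding leray_antisymmetric_part_def[abs_def]
proof (rule leray.small_imp_compact)
  show "countable quadrant" by (rule countableI_type)
  fix \<epsilon> :: real assume \<epsilon>: "0 < \<epsilon>"
  \<comment> \<open>\<open>\<epsilon> \<le> L2_norm \<mu> (d k)\<close> means \<kappa> - 1 \<ge>
    \<epsilon>^2, strictly above the bound \<epsilon>^2 / 2 that holds for all but finitely many
    degrees.\<close>
  then have "0 < \<epsilon>\<^sup>2 / 2" by simp
  from ellipsoid_\<kappa>_le[OF a Deq this] obtain N0 where N0: "\<forall>n m. N0 \<le> n + m \<longrightarrow> \<kappa> (int n, int m) \<le> 1 + \<epsilon>\<^sup>2 / 2"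
    by (elim exE)
  have "{k \<in> quadrant. \<epsilon> \<le> L2_norm \<mu> (d k)} \<subseteq> {0..int N0} \<times> {0..int N0}"
  proof
    fix k assume "k \<in> {k \<in> quadrant. \<epsilon> \<le> L2_norm \<mu> (d k)}"
    then have k: "0 \<le> fst k" "0 \<le> snd k" "\<epsilon> \<le> L2_norm \<mu> (d k)" by auto
    then have "\<epsilon>\<^sup>2 \<le> \<kappa> k - 1" unfolding d_norm[symmetric] using \<epsilon> by (intro power_mono) auto
    then have "\<not> \<kappa> k \<le> 1 + \<epsilon>\<^sup>2 / 2" using zero_less_power[OF \<epsilon>, of 2] by linarith
    then have "\<not> \<kappa> (int (nat (fst k)), int (nat (snd k))) \<le> 1 + \<epsilon>\<^sup>2 / 2" using k by simp
    then have "\<not> N0 \<le> nat (fst k) + nat (snd k)" using N0 by blast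
    then show "k \<in> {0..int N0} \<times> {0..int N0}" using k by (auto simp: mem_Times_iff)
  qed
  then show "finite {k \<in> quadrant. \<epsilon> \<le> L2_norm \<mu> (d k)}" by (rule finite_subset) simp
qed

end

section \<open>From the definitions to the theorem\<close>

lemma smooth_reinhardtI:
  assumes "smooth_strongly_convex_Reinhardt_domain D \<rho>"
  shows "\<exists>U \<rho>' \<rho>''. smooth_reinhardt D U \<rho> \<rho>' \<rho>''"
proof -
  have D: "open D" "D \<noteq> {}" "bounded D" "Reinhardt D" "C2_defining_function D \<rho>" "strongly_convex D \<rho>"
    using assms by (auto simp: smooth_strongly_convex_Reinhardt_domain_def)
  from D(5) obtain U where U: "open U" "frontier D \<subseteq> U" "C2_smooth_on U \<rho>" "D \<inter> U = {z \<in> U. \<rho> z < 0}"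
    and nd: "\<forall>z\<in>frontier D. \<exists>v. frechet_derivative \<rho> (at z) v \<noteq> 0"
    unfolding C2_defining_function_def by (elim conjE exE)
  from U(3) obtain \<rho>' \<rho>'' where R: "\<forall>z\<in>U. (\<rho> has_derivative blinfun_apply (\<rho>' z)) (at z)"
    "\<forall>z\<in>U. (\<rho>' has_derivative blinfun_apply (\<rho>'' z)) (at z)" "continuous_on U \<rho>''"
    unfolding C2_smooth_on_def by (elim conjE exE)
  have f1: "frechet_derivative \<rho> (at z) = blinfun_apply (\<rho>' z)" if "z \<in> U" for z
    using frechet_derivative_at[OF bspec[OF R(1) that]] by simp
  \<comment> \<open>The iterated derivative may be computed from \<open>\<rho>'\<close> because the
    inner derivative agrees with \<open>\<rho>'\<close> on the whole open set
    \<open>U\<close>.\<close>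
  have f2: "frechet_derivative (\<lambda>x. frechet_derivative \<rho> (at x) v) (at z) = (\<lambda>w. \<rho>'' z w v)" if z: "z \<in> U" for z v
  proof -
    have "((\<lambda>x. blinfun_apply (\<rho>' x) v) has_derivative (\<lambda>w. \<rho>'' z w v)) (at z)"
      by (rule bounded_linear.has_derivative[OF blinfun.bounded_linear_left bspec[OF R(2) z]])
    then have "((\<lambda>x. frechet_derivative \<rho> (at x) v) has_derivative (\<lambda>w. \<rho>'' z w v)) (at z)"
      by (rule has_derivative_transform_within_open[OF _ U(1) z]) (simp add: f1)
    then show ?thesis by (rule frechet_derivative_at[symmetric])
  qed
  have "smooth_reinhardt D U \<rho> \<rho>' \<rho>''"
  proof (unfold_locales)
    show "convex D" using D(6) by (simp add: strongly_convex_def)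
    fix z assume z: "z \<in> frontier D"
    then have zU: "z \<in> U" using U(2) by auto
    show "\<exists>v. \<rho>' z v \<noteq> 0" using bspec[OF nd z] unfolding f1[OF zU] .
    fix v :: C2 assume v: "v \<noteq> 0" "\<rho>' z v = 0"
    then have "v \<noteq> 0 \<and> frechet_derivative \<rho> (at z) v = 0" unfolding f1[OF zU] by (rule conjI)
    from D(6)[unfolded strongly_convex_def, THEN conjunct2, rule_format, OF z this]
    show "\<rho>'' z v v > 0" unfolding f2[OF zU] .
  qed (use D U R in auto)
  then show ?thesis by (intro exI)
qed

theorem corollary5:
  fixes D :: "C2 set" and \<rho> :: "C2 \<Rightarrow> real" and \<mu> :: "C2 measure"
  assumes "smooth_strongly_convex_Reinhardt_domain D \<rho>"
    and "invariant_surface_multiple D \<mu>"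
  shows "L2_compact_operator \<mu> (leray_antisymmetric_part D \<rho> \<mu>) \<longleftrightarrow>
    (\<exists>a\<^sub>1 a\<^sub>2 :: real. a\<^sub>1 > 0 \<and> a\<^sub>2 > 0 \<and>
       D = {z. a\<^sub>1 * (cmod (fst z))\<^sup>2 + a\<^sub>2 * (cmod (snd z))\<^sup>2 < 1})"
proof -
  from smooth_reinhardtI[OF assms(1)] obtain U \<rho>' \<rho>'' where R: "smooth_reinhardt D U \<rho> \<rho>' \<rho>''" by (elim exE)
  from assms(2) obtain h where h: "continuous_on (frontier D) h"
    "\<forall>\<zeta>\<in>frontier D. h \<zeta> > 0 \<and> (\<forall>\<alpha> \<beta>. h (rot \<alpha> \<beta> \<zeta>) = h \<zeta>)" "\<mu> = density (surface_measure D) (\<lambda>\<zeta>. ennreal (h \<zeta>))"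
    unfolding invariant_surface_multiple_def by (elim exE conjE)
  interpret reinhardt_measure D U \<rho> \<rho>' \<rho>'' \<mu> h
    using R by (rule reinhardt_measure.intro) (unfold_locales, use h in auto)
  show ?thesis
  proof
    assume "L2_compact_operator \<mu> (leray_antisymmetric_part D \<rho> \<mu>)"
    from ode_imp_ellipsoid[OF compact_imp_ode[OF this]]
    show "\<exists>a\<^sub>1 a\<^sub>2 :: real. a\<^sub>1 > 0 \<and> a\<^sub>2 > 0 \<and> D = {z. a\<^sub>1 * (cmod (fst z))\<^sup>2 + a\<^sub>2 * (cmod (snd z))\<^sup>2 < 1}" .
  next
    assume "\<exists>a\<^sub>1 a\<^sub>2 :: real. a\<^sub>1 > 0 \<and> a\<^sub>2 > 0 \<and> D = {z. a\<^sub>1 * (cmod (fst z))\<^sup>2 + a\<^sub>2 * (cmod (snd z))\<^sup>2 < 1}"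
    then show "L2_compact_operator \<mu> (leray_antisymmetric_part D \<rho> \<mu>)"
      by (elim exE conjE) (rule ellipsoid_imp_compact)
  qed
qed

end
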